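(* Let $\mathcal{A}=(A=\bigoplus_{i\in\mathbb{Z}}A^i,d)$ be a dg $k$-algebra such that (P1) $A^i=0$ for $i<0$; (P2) $A^0$ is a semisimple ring; (P3) $d(A^0)=0$. Then: (1) The subcategory $\mathrm{dgPrae}(\mathcal{A})$ of $\mathrm{dgDer}(\mathcal{A})$ is closed under taking direct summands, i.e. $\mathrm{dgPrae}(\mathcal{A})=\mathrm{dgPer}(\mathcal{A})$. (2) The inclusion $\mathrm{dgFilt}(\mathcal{A})\subset\mathrm{dgPer}(\mathcal{A})$ is an equivalence of categories.
   Context: $k$ is a commutative ring; algebras are associative and unital. Dg modules over $\mathcal{A}$ are right dg modules. $\mathrm{dgMod}(\mathcal{A})$ is the abelian category of dg modules (morphisms: degree $0$, $A$-linear, commuting with differentials) and $\mathrm{dgDer}(\mathcal{A})$ is the derived category of dg modules, a triangulated category. The shift is $(\{1\}M)^i=M^{i+1}$, $d_{\{1\}M}=-d_M$, and $\{n\}=\{1\}^n$. $(L_x)_{x\in W}$ is a (finite) set of representatives of the isomorphism classes of simple right $A^0$-modules. $A^0$ is regarded as a dg subalgebra $\mathcal{A}^0$ of $\mathcal{A}$ and each $L_x$ as a dg $\mathcal{A}^0$-module concentrated in degree $0$; put $\hat L_x:=L_x\otimes_{\mathcal{A}^0}\mathcal{A}$, a dg $\mathcal{A}$-module. $\mathrm{dgPer}(\mathcal{A})$ (the perfect derived category) is the smallest strict (= closed under isomorphism) full triangulated subcategory of $\mathrm{dgDer}(\mathcal{A})$ containing $\mathcal{A}$ and closed under forming direct summands.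 $\mathrm{dgPrae}(\mathcal{A})$ is the smallest strict full triangulated subcategory of $\mathrm{dgDer}(\mathcal{A})$ containing all $\hat L_x$, $x\in W$. $\mathrm{dgFilt}(\mathcal{A})$ is the full subcategory of $\mathrm{dgDer}(\mathcal{A})$ whose objects are the dg modules $M$ admitting a finite filtration $0=F_0(M)\subset F_1(M)\subset\dots\subset F_n(M)=M$ by dg submodules with $F_i(M)/F_{i-1}(M)\cong\{l_i\}\hat L_{x_i}$ in $\mathrm{dgMod}(\mathcal{A})$ for suitable integers $l_1\ge l_2\ge\dots\ge l_n$ and $x_i\in W$. *)

theory Defs
  imports "HOL-Algebra.Module" "HOL-Algebra.AbelCoset" "HOL-Algebra.Free_Abelian_Groups" "HOL-Library.Equipollence"
begin

section \<open>Categories, functors, equivalences\<close>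

record ('o, 'r) cat =
  Ob :: "'o set"
  Hom :: "'o \<Rightarrow> 'o \<Rightarrow> 'r set"
  Id :: "'o \<Rightarrow> 'r"
  Comp :: "'r \<Rightarrow> 'r \<Rightarrow> 'r"

text \<open>\<open>Comp C g f\<close> is \<open>g\<close> after \<open>f\<close>.\<close>

locale category =
  fixes C :: "('o, 'r) cat"
  assumes Id_in: "X \<in> Ob C \<Longrightarrow> Id C X \<in> Hom C X X"
    and Comp_in: "\<lbrakk>X \<in> Ob C; Y \<in> Ob C; Z \<in> Ob C; f \<in> Hom C X Y; g \<in> Hom C Y Z\<rbrakk>
      \<Longrightarrow> Comp C g f \<in> Hom C X Z"
    and Comp_Id_left: "\<lbrakk>X \<in> Ob C; Y \<in> Ob C; f \<in> Hom C X Y\<rbrakk> \<Longrightarrow> Comp C (Id C Y) f = f"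
    and Comp_Id_right: "\<lbrakk>X \<in> Ob C; Y \<in> Ob C; f \<in> Hom C X Y\<rbrakk> \<Longrightarrow> Comp C f (Id C X) = f"
    and Comp_assoc: "\<lbrakk>X \<in> Ob C; Y \<in> Ob C; Z \<in> Ob C; V \<in> Ob C;
        f \<in> Hom C X Y; g \<in> Hom C Y Z; h \<in> Hom C Z V\<rbrakk>
      \<Longrightarrow> Comp C h (Comp C g f) = Comp C (Comp C h g) f"

definition iso_in :: "('o, 'r) cat \<Rightarrow> 'o \<Rightarrow> 'o \<Rightarrow> 'r \<Rightarrow> bool" where
  "iso_in C X Y f \<longleftrightarrow> f \<in> Hom C X Y \<and>
     (\<exists>g\<in>Hom C Y X. Comp C g f = Id C X \<and> Comp C f g = Id C Y)"

definition isomorphic_in :: "('o, 'r) cat \<Rightarrow> 'o \<Rightarrow> 'o \<Rightarrow> bool" where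
  "isomorphic_in C X Y \<longleftrightarrow> X \<in> Ob C \<and> Y \<in> Ob C \<and> (\<exists>f. iso_in C X Y f)"

definition full_subcat :: "('o, 'r) cat \<Rightarrow> 'o set \<Rightarrow> ('o, 'r) cat" where
  "full_subcat C S = C\<lparr>Ob := S\<rparr>"

locale cat_functor = C: category C + D: category D
  for C :: "('o, 'r) cat" and D :: "('p, 's) cat" +
  fixes Fo :: "'o \<Rightarrow> 'p" and Fm :: "'r \<Rightarrow> 's"
  assumes map_Ob: "X \<in> Ob C \<Longrightarrow> Fo X \<in> Ob D"
    and map_Hom: "\<lbrakk>X \<in> Ob C; Y \<in> Ob C; f \<in> Hom C X Y\<rbrakk> \<Longrightarrow> Fm f \<in> Hom D (Fo X) (Fo Y)"
    and map_Id: "X \<in> Ob C \<Longrightarrow> Fm (Id C X) = Id D (Fo X)"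
    and map_Comp: "\<lbrakk>X \<in> Ob C; Y \<in> Ob C; Z \<in> Ob C; f \<in> Hom C X Y; g \<in> Hom C Y Z\<rbrakk>
      \<Longrightarrow> Fm (Comp C g f) = Comp D (Fm g) (Fm f)"

definition nat_iso ::
  "('o, 'r) cat \<Rightarrow> ('p, 's) cat \<Rightarrow> ('o \<Rightarrow> 'p) \<Rightarrow> ('r \<Rightarrow> 's) \<Rightarrow> ('o \<Rightarrow> 'p) \<Rightarrow> ('r \<Rightarrow> 's) \<Rightarrow> ('o \<Rightarrow> 's) \<Rightarrow> bool"
  where "nat_iso C D Fo Fm Go Gm \<eta> \<longleftrightarrow>
    (\<forall>X\<in>Ob C. iso_in D (Fo X) (Go X) (\<eta> X)) \<and>
    (\<forall>X\<in>Ob C. \<forall>Y\<in>Ob C. \<forall>f\<in>Hom C X Y. Comp D (\<eta> Y) (Fm f) = Comp D (Gm f) (\<eta> X))"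

definition equivalence_functor ::
  "('o, 'r) cat \<Rightarrow> ('p, 's) cat \<Rightarrow> ('o \<Rightarrow> 'p) \<Rightarrow> ('r \<Rightarrow> 's) \<Rightarrow> bool" where
  "equivalence_functor C D Fo Fm \<longleftrightarrow> cat_functor C D Fo Fm \<and>
     (\<exists>Go Gm \<eta> \<epsilon>. cat_functor D C Go Gm \<and>
        nat_iso C C (\<lambda>X. X) (\<lambda>f. f) (Go \<circ> Fo) (Gm \<circ> Fm) \<eta> \<and>
        nat_iso D D (Fo \<circ> Go) (Fm \<circ> Gm) (\<lambda>X. X) (\<lambda>f. f) \<epsilon>)"


section \<open>Right modules and semisimple rings\<close>

text \<open>As for modules in HOL-Algebra, the underlying abelian group is the additive part of a
  ring record; its fields \<open>mult\<close> and \<open>one\<close> are irrelevant.\<close>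

record ('a, 'm) rmod = "'m ring" +
  ract :: "'m \<Rightarrow> 'a \<Rightarrow> 'm"

locale right_module =
  fixes R :: "('a, 'e) ring_scheme" and M :: "('a, 'm, 'f) rmod_scheme"
  assumes ring: "ring R" and abelian_group: "abelian_group M"
    and act_closed: "\<lbrakk>x \<in> carrier M; a \<in> carrier R\<rbrakk> \<Longrightarrow> ract M x a \<in> carrier M"
    and act_add_left: "\<lbrakk>x \<in> carrier M; y \<in> carrier M; a \<in> carrier R\<rbrakk>
      \<Longrightarrow> ract M (x \<oplus>\<^bsub>M\<^esub> y) a = ract M x a \<oplus>\<^bsub>M\<^esub> ract M y a"
    and act_add_right: "\<lbrakk>x \<in> carrier M; a \<in> carrier R; b \<in> carrier R\<rbrakk>
      \<Longrightarrow> ract M x (a \<oplus>\<^bsub>R\<^esub> b) = ract M x a \<oplus>\<^bsub>M\<^esub> ract M x b"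
    and act_assoc: "\<lbrakk>x \<in> carrier M; a \<in> carrier R; b \<in> carrier R\<rbrakk>
      \<Longrightarrow> ract M x (a \<otimes>\<^bsub>R\<^esub> b) = ract M (ract M x a) b"
    and act_one: "x \<in> carrier M \<Longrightarrow> ract M x \<one>\<^bsub>R\<^esub> = x"

definition rsubmodule ::
  "('a, 'e) ring_scheme \<Rightarrow> ('a, 'm, 'f) rmod_scheme \<Rightarrow> 'm set \<Rightarrow> bool" where
  "rsubmodule R M N \<longleftrightarrow> N \<subseteq> carrier M \<and> right_module R (M\<lparr>carrier := N\<rparr>)"

definition simple_rmodule :: "('a, 'e) ring_scheme \<Rightarrow> ('a, 'm, 'f) rmod_scheme \<Rightarrow> bool" where
  "simple_rmodule R M \<longleftrightarrow> right_module R M \<and> carrier M \<noteq> {\<zero>\<^bsub>M\<^esub>} \<and>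
     (\<forall>N. rsubmodule R M N \<longrightarrow> N = {\<zero>\<^bsub>M\<^esub>} \<or> N = carrier M)"

definition rmod_hom ::
  "('a, 'e) ring_scheme \<Rightarrow> ('a, 'm, 'f) rmod_scheme \<Rightarrow> ('a, 'n, 'g) rmod_scheme \<Rightarrow> ('m \<Rightarrow> 'n) set" where
  "rmod_hom R M N = {f. f \<in> carrier M \<rightarrow> carrier N \<and>
     (\<forall>x\<in>carrier M. \<forall>y\<in>carrier M. f (x \<oplus>\<^bsub>M\<^esub> y) = f x \<oplus>\<^bsub>N\<^esub> f y) \<and>
     (\<forall>x\<in>carrier M. \<forall>a\<in>carrier R. f (ract M x a) = ract N (f x) a)}"

definition rmod_iso ::
  "('a, 'e) ring_scheme \<Rightarrow> ('a, 'm, 'f) rmod_scheme \<Rightarrow> ('a, 'n, 'g) rmod_scheme \<Rightarrow> bool" where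
  "rmod_iso R M N \<longleftrightarrow> (\<exists>f\<in>rmod_hom R M N. bij_betw f (carrier M) (carrier N))"

definition internal_direct_sum :: "('m, 'e) ring_scheme \<Rightarrow> 'i set \<Rightarrow> ('i \<Rightarrow> 'm set) \<Rightarrow> bool" where
  "internal_direct_sum M I F \<longleftrightarrow>
     (\<forall>i\<in>I. subgroup (F i) (add_monoid M)) \<and>
     (\<forall>x\<in>carrier M. \<exists>!f. f \<in> (\<Pi>\<^sub>E i\<in>I. F i) \<and> finite {i\<in>I. f i \<noteq> \<zero>\<^bsub>M\<^esub>} \<and>
        x = finsum M f {i\<in>I. f i \<noteq> \<zero>\<^bsub>M\<^esub>})"

definition semisimple_rmodule :: "('a, 'e) ring_scheme \<Rightarrow> ('a, 'm, 'f) rmod_scheme \<Rightarrow> bool" where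
  "semisimple_rmodule R M \<longleftrightarrow> right_module R M \<and>
     (\<exists>S. (\<forall>N\<in>S. rsubmodule R M N \<and> simple_rmodule R (M\<lparr>carrier := N\<rparr>)) \<and>
          internal_direct_sum M S (\<lambda>N. N))"

definition regular_rmod :: "('a, 'e) ring_scheme \<Rightarrow> ('a, 'a) rmod" where
  "regular_rmod R = \<lparr>carrier = carrier R, monoid.mult = monoid.mult R, monoid.one = \<one>\<^bsub>R\<^esub>,
     ring.zero = \<zero>\<^bsub>R\<^esub>, ring.add = ring.add R, ract = monoid.mult R\<rparr>"

definition semisimple_ring :: "('a, 'e) ring_scheme \<Rightarrow> bool" where
  "semisimple_ring R \<longleftrightarrow> ring R \<and> semisimple_rmodule R (regular_rmod R)"

text \<open>Completeness of the family only refers to simple modules on the same type \<open>'m\<close>; this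
  covers all isomorphism classes as soon as \<open>R\<close> embeds into \<open>'m\<close>, since simple modules are
  quotients of \<open>R\<close>.\<close>

definition simple_representatives ::
  "('a, 'e) ring_scheme \<Rightarrow> 'x set \<Rightarrow> ('x \<Rightarrow> ('a, 'm) rmod) \<Rightarrow> bool" where
  "simple_representatives R W L \<longleftrightarrow>
     (\<forall>x\<in>W. simple_rmodule R (L x)) \<and>
     (\<forall>x\<in>W. \<forall>y\<in>W. rmod_iso R (L x) (L y) \<longrightarrow> x = y) \<and>
     (\<forall>M :: ('a, 'm) rmod. simple_rmodule R M \<longrightarrow> (\<exists>x\<in>W. rmod_iso R M (L x)))"


section \<open>Dg algebras and dg modules\<close>

record ('k, 'a) dga = "('k, 'a) module" +
  agr :: "int \<Rightarrow> 'a set"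
  adiff :: "'a \<Rightarrow> 'a"

definition koszul :: "('m, 'e) ring_scheme \<Rightarrow> int \<Rightarrow> 'm \<Rightarrow> 'm" where
  "koszul M i x = (if even i then x else \<ominus>\<^bsub>M\<^esub> x)"

locale dg_algebra =
  fixes k :: "('k, 'e) ring_scheme" and A :: "('k, 'a, 'f) dga_scheme" (structure)
  assumes module: "module k A" and ring: "ring A"
    and smult_mult_left: "\<lbrakk>c \<in> carrier k; a \<in> carrier A; b \<in> carrier A\<rbrakk>
      \<Longrightarrow> (c \<odot> a) \<otimes> b = c \<odot> (a \<otimes> b)"
    and smult_mult_right: "\<lbrakk>c \<in> carrier k; a \<in> carrier A; b \<in> carrier A\<rbrakk>
      \<Longrightarrow> a \<otimes> (c \<odot> b) = c \<odot> (a \<otimes> b)"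
    and grading: "internal_direct_sum A UNIV (agr A)"
    and smult_gr: "\<lbrakk>c \<in> carrier k; a \<in> agr A i\<rbrakk> \<Longrightarrow> c \<odot> a \<in> agr A i"
    and one_gr: "\<one> \<in> agr A 0"
    and mult_gr: "\<lbrakk>a \<in> agr A i; b \<in> agr A j\<rbrakk> \<Longrightarrow> a \<otimes> b \<in> agr A (i + j)"
    and diff_closed: "a \<in> carrier A \<Longrightarrow> adiff A a \<in> carrier A"
    and diff_add: "\<lbrakk>a \<in> carrier A; b \<in> carrier A\<rbrakk>
      \<Longrightarrow> adiff A (a \<oplus> b) = adiff A a \<oplus> adiff A b"
    and diff_smult: "\<lbrakk>c \<in> carrier k; a \<in> carrier A\<rbrakk> \<Longrightarrow> adiff A (c \<odot> a) = c \<odot> adiff A a"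
    and diff_gr: "a \<in> agr A i \<Longrightarrow> adiff A a \<in> agr A (i + 1)"
    and diff_diff: "a \<in> carrier A \<Longrightarrow> adiff A (adiff A a) = \<zero>"
    and leibniz: "\<lbrakk>a \<in> agr A i; b \<in> carrier A\<rbrakk>
      \<Longrightarrow> adiff A (a \<otimes> b) = adiff A a \<otimes> b \<oplus> koszul A i (a \<otimes> adiff A b)"

definition degree_zero_ring :: "('k, 'a, 'f) dga_scheme \<Rightarrow> 'a ring" where
  "degree_zero_ring A = \<lparr>carrier = agr A 0, monoid.mult = monoid.mult A, monoid.one = \<one>\<^bsub>A\<^esub>,
     ring.zero = \<zero>\<^bsub>A\<^esub>, ring.add = ring.add A\<rparr>"

record ('a, 'm) dgmod = "('a, 'm) rmod" +
  gr :: "int \<Rightarrow> 'm set"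
  diff :: "'m \<Rightarrow> 'm"

text \<open>The action of the base ring \<open>k\<close> on a dg module is the one induced by the unit map
  \<open>k \<rightarrow> A\<close>; all structure maps below are then automatically \<open>k\<close>-linear, so it is not recorded.\<close>

locale dg_module =
  fixes A :: "('k, 'a, 'f) dga_scheme" and M :: "('a, 'm, 'g) dgmod_scheme"
  assumes right_module: "right_module A M"
    and grading: "internal_direct_sum M UNIV (gr M)"
    and act_gr: "\<lbrakk>x \<in> gr M i; a \<in> agr A j\<rbrakk> \<Longrightarrow> ract M x a \<in> gr M (i + j)"
    and diff_closed: "x \<in> carrier M \<Longrightarrow> diff M x \<in> carrier M"
    and diff_add: "\<lbrakk>x \<in> carrier M; y \<in> carrier M\<rbrakk>
      \<Longrightarrow> diff M (x \<oplus>\<^bsub>M\<^esub> y) = diff M x \<oplus>\<^bsub>M\<^esub> diff M y"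
    and diff_gr: "x \<in> gr M i \<Longrightarrow> diff M x \<in> gr M (i + 1)"
    and diff_diff: "x \<in> carrier M \<Longrightarrow> diff M (diff M x) = \<zero>\<^bsub>M\<^esub>"
    and leibniz: "\<lbrakk>x \<in> gr M i; a \<in> carrier A\<rbrakk>
      \<Longrightarrow> diff M (ract M x a) = ract M (diff M x) a \<oplus>\<^bsub>M\<^esub> koszul M i (ract M x (adiff A a))"

definition mk_dgmod ::
  "'m set \<Rightarrow> 'm \<Rightarrow> ('m \<Rightarrow> 'm \<Rightarrow> 'm) \<Rightarrow> ('m \<Rightarrow> 'a \<Rightarrow> 'm) \<Rightarrow> (int \<Rightarrow> 'm set) \<Rightarrow> ('m \<Rightarrow> 'm) \<Rightarrow> ('a, 'm) dgmod"
  where "mk_dgmod C z p r g d = \<lparr>carrier = C, monoid.mult = undefined, monoid.one = undefined,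
     ring.zero = z, ring.add = p, ract = r, gr = g, diff = d\<rparr>"

definition dg_hom ::
  "('k, 'a, 'f) dga_scheme \<Rightarrow> ('a, 'm) dgmod \<Rightarrow> ('a, 'n) dgmod \<Rightarrow> ('m \<Rightarrow> 'n) set" where
  "dg_hom A M N = {f. dg_module A M \<and> dg_module A N \<and> f \<in> rmod_hom A M N \<and>
     (\<forall>i. \<forall>x\<in>gr M i. f x \<in> gr N i) \<and> (\<forall>x\<in>carrier M. f (diff M x) = diff N (f x))}"

definition dg_isos ::
  "('k, 'a, 'f) dga_scheme \<Rightarrow> ('a, 'm) dgmod \<Rightarrow> ('a, 'n) dgmod \<Rightarrow> ('m \<Rightarrow> 'n) set" where
  "dg_isos A M N = {f\<in>dg_hom A M N. bij_betw f (carrier M) (carrier N)}"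

definition dg_iso ::
  "('k, 'a, 'f) dga_scheme \<Rightarrow> ('a, 'm) dgmod \<Rightarrow> ('a, 'n) dgmod \<Rightarrow> bool" where
  "dg_iso A M N \<longleftrightarrow> dg_isos A M N \<noteq> {}"

definition regular_dgmod :: "('k, 'a, 'f) dga_scheme \<Rightarrow> ('a, 'a) dgmod" where
  "regular_dgmod A = mk_dgmod (carrier A) \<zero>\<^bsub>A\<^esub> (ring.add A) (monoid.mult A) (agr A) (adiff A)"

definition dg_shift :: "int \<Rightarrow> ('a, 'm) dgmod \<Rightarrow> ('a, 'm) dgmod" where
  "dg_shift n M = M\<lparr>gr := \<lambda>i. gr M (i + n), diff := \<lambda>x. koszul M n (diff M x)\<rparr>"

definition dg_sum :: "('a, 'm) dgmod \<Rightarrow> ('a, 'n) dgmod \<Rightarrow> ('a, 'm \<times> 'n) dgmod" where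
  "dg_sum M N = mk_dgmod (carrier M \<times> carrier N) (\<zero>\<^bsub>M\<^esub>, \<zero>\<^bsub>N\<^esub>)
     (\<lambda>(x, y) (x', y'). (x \<oplus>\<^bsub>M\<^esub> x', y \<oplus>\<^bsub>N\<^esub> y'))
     (\<lambda>(x, y) a. (ract M x a, ract N y a))
     (\<lambda>i. gr M i \<times> gr N i)
     (\<lambda>(x, y). (diff M x, diff N y))"

text \<open>The mapping cone of \<open>f : M \<rightarrow> N\<close>: the graded module \<open>N \<oplus> {1}M\<close> with differential
  \<open>(y, x) \<mapsto> (dy + f x, -dx)\<close>.\<close>

definition dg_cone :: "('a, 'm) dgmod \<Rightarrow> ('m \<Rightarrow> 'n) \<Rightarrow> ('a, 'n) dgmod \<Rightarrow> ('a, 'n \<times> 'm) dgmod" where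
  "dg_cone M f N = (dg_sum N (dg_shift 1 M))
     \<lparr>diff := \<lambda>(y, x). (diff N y \<oplus>\<^bsub>N\<^esub> f x, \<ominus>\<^bsub>M\<^esub> diff M x)\<rparr>"

definition dg_restrict :: "('a, 'm) dgmod \<Rightarrow> 'm set \<Rightarrow> ('a, 'm) dgmod" where
  "dg_restrict M N = M\<lparr>carrier := N, gr := \<lambda>i. gr M i \<inter> N\<rparr>"

definition dg_submodule :: "('k, 'a, 'f) dga_scheme \<Rightarrow> ('a, 'm) dgmod \<Rightarrow> 'm set \<Rightarrow> bool" where
  "dg_submodule A M N \<longleftrightarrow> N \<subseteq> carrier M \<and> dg_module A (dg_restrict M N)"

text \<open>In \<open>ract\<close> and \<open>diff\<close>, adding \<open>N\<close> turns the image of a coset into a full coset.\<close>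

definition dg_quotient :: "('a, 'm) dgmod \<Rightarrow> 'm set \<Rightarrow> ('a, 'm set) dgmod" where
  "dg_quotient M N = mk_dgmod (a_rcosets\<^bsub>M\<^esub> N) N (set_add M)
     (\<lambda>X a. N <+>\<^bsub>M\<^esub> (\<lambda>x. ract M x a) ` X)
     (\<lambda>i. {N +>\<^bsub>M\<^esub> x |x. x \<in> gr M i})
     (\<lambda>X. N <+>\<^bsub>M\<^esub> diff M ` X)"


subsection \<open>Induction from the degree zero part\<close>

text \<open>\<open>L \<otimes>\<^bsub>A\<^sup>0\<^esub> A\<close> is the free abelian group on pairs \<open>(l, a)\<close> modulo the subgroup
  \<open>tensor_rel\<close>, with \<open>(l \<otimes> a) b = l \<otimes> a b\<close>, with \<open>l \<otimes> a\<close> in degree \<open>n\<close> for \<open>a \<in> A\<^sup>n\<close> and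
  with \<open>d (l \<otimes> a) = l \<otimes> d a\<close> (\<open>L\<close> sits in degree \<open>0\<close> and has zero differential).\<close>

definition tensor_free ::
  "('k, 'a, 'f) dga_scheme \<Rightarrow> ('a, 'l) rmod \<Rightarrow> ('l \<times> 'a \<Rightarrow>\<^sub>0 int) monoid" where
  "tensor_free A L = free_Abelian_group (carrier L \<times> carrier A)"

definition tensor_rel ::
  "('k, 'a, 'f) dga_scheme \<Rightarrow> ('a, 'l) rmod \<Rightarrow> ('l \<times> 'a \<Rightarrow>\<^sub>0 int) set" where
  "tensor_rel A L = generate (tensor_free A L)
     ({frag_of (l \<oplus>\<^bsub>L\<^esub> l', a) - frag_of (l, a) - frag_of (l', a) |l l' a.
         l \<in> carrier L \<and> l' \<in> carrier L \<and> a \<in> carrier A} \<union>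
      {frag_of (l, a \<oplus>\<^bsub>A\<^esub> a') - frag_of (l, a) - frag_of (l, a') |l a a'.
         l \<in> carrier L \<and> a \<in> carrier A \<and> a' \<in> carrier A} \<union>
      {frag_of (ract L l r, a) - frag_of (l, r \<otimes>\<^bsub>A\<^esub> a) |l r a.
         l \<in> carrier L \<and> r \<in> agr A 0 \<and> a \<in> carrier A})"

definition induced_dgmod ::
  "('k, 'a, 'f) dga_scheme \<Rightarrow> ('a, 'l) rmod \<Rightarrow> ('a, ('l \<times> 'a \<Rightarrow>\<^sub>0 int) set) dgmod" where
  "induced_dgmod A L = (let G = tensor_free A L; H = tensor_rel A L in
     mk_dgmod (rcosets\<^bsub>G\<^esub> H) H (set_mult G)
       (\<lambda>X b. H <#>\<^bsub>G\<^esub> frag_extend (\<lambda>(l, a). frag_of (l, a \<otimes>\<^bsub>A\<^esub> b)) ` X)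
       (\<lambda>n. {H #>\<^bsub>G\<^esub> t |t. t \<in> carrier (free_Abelian_group (carrier L \<times> agr A n))})
       (\<lambda>X. H <#>\<^bsub>G\<^esub> frag_extend (\<lambda>(l, a). frag_of (l, adiff A a)) ` X))"


section \<open>The derived category of dg modules\<close>

subsection \<open>Homotopies and quasi-isomorphisms\<close>

definition homotopic ::
  "('k, 'a, 'f) dga_scheme \<Rightarrow> ('a, 'm) dgmod \<Rightarrow> ('a, 'm) dgmod \<Rightarrow> ('m \<Rightarrow> 'm) \<Rightarrow> ('m \<Rightarrow> 'm) \<Rightarrow> bool" where
  "homotopic A M N f g \<longleftrightarrow> (\<exists>h\<in>rmod_hom A M N. (\<forall>i. \<forall>x\<in>gr M i. h x \<in> gr N (i - 1)) \<and>
     (\<forall>x\<in>carrier M. f x = g x \<oplus>\<^bsub>N\<^esub> (diff N (h x) \<oplus>\<^bsub>N\<^esub> h (diff M x))))"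

definition cycles :: "('a, 'm) dgmod \<Rightarrow> int \<Rightarrow> 'm set" where
  "cycles M i = {x\<in>gr M i. diff M x = \<zero>\<^bsub>M\<^esub>}"

definition boundaries :: "('a, 'm) dgmod \<Rightarrow> int \<Rightarrow> 'm set" where
  "boundaries M i = diff M ` gr M (i - 1)"

definition cohomology :: "('a, 'm) dgmod \<Rightarrow> int \<Rightarrow> 'm set set" where
  "cohomology M i = {boundaries M i +>\<^bsub>M\<^esub> z |z. z \<in> cycles M i}"

definition cohomology_map :: "('a, 'm) dgmod \<Rightarrow> int \<Rightarrow> ('m \<Rightarrow> 'm) \<Rightarrow> 'm set \<Rightarrow> 'm set" where
  "cohomology_map N i f X = boundaries N i <+>\<^bsub>N\<^esub> f ` X"

definition quasi_isos ::
  "('k, 'a, 'f) dga_scheme \<Rightarrow> ('a, 'm) dgmod \<Rightarrow> ('a, 'm) dgmod \<Rightarrow> ('m \<Rightarrow> 'm) set" where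
  "quasi_isos A M N = {f\<in>dg_hom A M N.
     \<forall>i. bij_betw (cohomology_map N i f) (cohomology M i) (cohomology N i)}"


subsection \<open>Localization of the homotopy category at the quasi-isomorphisms\<close>

text \<open>The derived category is the localization (in the sense of Gabriel and Zisman) of the
  homotopy category at the quasi-isomorphisms: morphisms are zigzags of morphisms \<open>Fwd M f N\<close>
  and formal inverses \<open>Bwd N s M : N \<rightarrow> M\<close> of quasi-isomorphisms \<open>s : M \<rightarrow> N\<close>, modulo the
  congruence generated by homotopy, by identities and composition of dg modules, and by the
  inversion of quasi-isomorphisms. Steps are listed in the order in which they are traversed.

  All dg modules live on a fixed type \<open>'m\<close>, which plays the role of a universe: the objects
  are the dg modules whose underlying set is a subset of \<open>'m\<close>. When \<open>'m\<close> is infinite and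
  \<open>A\<close> embeds into \<open>'m\<close>, this universe is closed, up to isomorphism, under shifts, finite and
  countable direct sums, cones, sub- and quotient modules and K-projective resolutions, and it
  contains copies of \<open>A\<close> and of the induced modules.\<close>

datatype ('a, 'm) step =
  Fwd "('a, 'm) dgmod" "'m \<Rightarrow> 'm" "('a, 'm) dgmod"
| Bwd "('a, 'm) dgmod" "'m \<Rightarrow> 'm" "('a, 'm) dgmod"

type_synonym ('a, 'm) zigzag = "('a, 'm) step list"

fun zigzag ::
  "('k, 'a, 'f) dga_scheme \<Rightarrow> ('a, 'm) dgmod \<Rightarrow> ('a, 'm) zigzag \<Rightarrow> ('a, 'm) dgmod \<Rightarrow> bool" where
  "zigzag A X [] Y \<longleftrightarrow> dg_module A X \<and> X = Y"
| "zigzag A X (Fwd M f N # p) Y \<longleftrightarrow> X = M \<and> f \<in> dg_hom A M N \<and> zigzag A N p Y"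
| "zigzag A X (Bwd N s M # p) Y \<longleftrightarrow> X = N \<and> s \<in> quasi_isos A M N \<and> zigzag A M p Y"

inductive zz_equiv ::
  "('k, 'a, 'f) dga_scheme \<Rightarrow> ('a, 'm) dgmod \<Rightarrow> ('a, 'm) dgmod \<Rightarrow>
     ('a, 'm) zigzag \<Rightarrow> ('a, 'm) zigzag \<Rightarrow> bool" for A where
  zz_refl: "zigzag A X p Y \<Longrightarrow> zz_equiv A X Y p p"
| zz_sym: "zz_equiv A X Y p q \<Longrightarrow> zz_equiv A X Y q p"
| zz_trans: "\<lbrakk>zz_equiv A X Y p q; zz_equiv A X Y q r\<rbrakk> \<Longrightarrow> zz_equiv A X Y p r"
| zz_cong: "\<lbrakk>zigzag A X p M; zz_equiv A M N q q'; zigzag A N r Y\<rbrakk>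
    \<Longrightarrow> zz_equiv A X Y (p @ q @ r) (p @ q' @ r)"
| zz_homotopy: "\<lbrakk>f \<in> dg_hom A M N; g \<in> dg_hom A M N; homotopic A M N f g\<rbrakk>
    \<Longrightarrow> zz_equiv A M N [Fwd M f N] [Fwd M g N]"
| zz_ident: "dg_module A M \<Longrightarrow> zz_equiv A M M [Fwd M (\<lambda>x. x) M] []"
| zz_comp: "\<lbrakk>f \<in> dg_hom A M N; g \<in> dg_hom A N P\<rbrakk>
    \<Longrightarrow> zz_equiv A M P [Fwd M f N, Fwd N g P] [Fwd M (g \<circ> f) P]"
| zz_inv_right: "s \<in> quasi_isos A M N \<Longrightarrow> zz_equiv A M M [Fwd M s N, Bwd N s M] []"
| zz_inv_left: "s \<in> quasi_isos A M N \<Longrightarrow> zz_equiv A N N [Bwd N s M, Fwd M s N] []"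

type_synonym ('a, 'm) dmor = "('a, 'm) dgmod \<times> ('a, 'm) dgmod \<times> ('a, 'm) zigzag set"

definition zz_class ::
  "('k, 'a, 'f) dga_scheme \<Rightarrow> ('a, 'm) dgmod \<Rightarrow> ('a, 'm) zigzag \<Rightarrow> ('a, 'm) dgmod \<Rightarrow> ('a, 'm) dmor" where
  "zz_class A X p Y = (X, Y, {q. zz_equiv A X Y p q})"

definition dgDer :: "('k, 'a, 'f) dga_scheme \<Rightarrow> (('a, 'm) dgmod, ('a, 'm) dmor) cat" where
  "dgDer A = \<lparr>Ob = {M. dg_module A M},
     Hom = (\<lambda>X Y. {zz_class A X p Y |p. zigzag A X p Y}),
     Id = (\<lambda>X. zz_class A X [] X),
     Comp = (\<lambda>(_, Z, \<beta>) (X, _, \<alpha>). (X, Z, {r. \<exists>p\<in>\<alpha>. \<exists>q\<in>\<beta>. zz_equiv A X Z (p @ q) r}))\<rparr>"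

definition der_of ::
  "('k, 'a, 'f) dga_scheme \<Rightarrow> ('a, 'm) dgmod \<Rightarrow> ('m \<Rightarrow> 'm) \<Rightarrow> ('a, 'm) dgmod \<Rightarrow> ('a, 'm) dmor" where
  "der_of A M f N = zz_class A M [Fwd M f N] N"


subsection \<open>The triangulated structure\<close>

fun step_shift :: "('a, 'm) step \<Rightarrow> ('a, 'm) step" where
  "step_shift (Fwd M f N) = Fwd (dg_shift 1 M) f (dg_shift 1 N)"
| "step_shift (Bwd N s M) = Bwd (dg_shift 1 N) s (dg_shift 1 M)"

fun der_shift :: "('k, 'a, 'f) dga_scheme \<Rightarrow> ('a, 'm) dmor \<Rightarrow> ('a, 'm) dmor" where
  "der_shift A (X, Y, \<alpha>) = (dg_shift 1 X, dg_shift 1 Y,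
     {r. \<exists>p\<in>\<alpha>. zz_equiv A (dg_shift 1 X) (dg_shift 1 Y) (map step_shift p) r})"

text \<open>A triangle \<open>X \<rightarrow> Y \<rightarrow> Z \<rightarrow> {1}X\<close> is distinguished if it is isomorphic in \<open>dgDer A\<close> to the
  standard triangle \<open>X' \<rightarrow> Y' \<rightarrow> C \<rightarrow> {1}X'\<close> of a morphism \<open>f : X' \<rightarrow> Y'\<close> of dg modules. Here
  \<open>C\<close> is a copy on the type \<open>'m\<close> of the mapping cone, transported along \<open>\<phi>\<close>.\<close>

definition distinguished ::
  "('k, 'a, 'f) dga_scheme \<Rightarrow> ('a, 'm) dgmod \<Rightarrow> ('a, 'm) dgmod \<Rightarrow> ('a, 'm) dgmod \<Rightarrow>
     ('a, 'm) dmor \<Rightarrow> ('a, 'm) dmor \<Rightarrow> ('a, 'm) dmor \<Rightarrow> bool" where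
  "distinguished A X Y Z u v w \<longleftrightarrow>
     u \<in> Hom (dgDer A) X Y \<and> v \<in> Hom (dgDer A) Y Z \<and> w \<in> Hom (dgDer A) Z (dg_shift 1 X) \<and>
     (\<exists>X' Y' C f \<phi> a b c.
        f \<in> dg_hom A X' Y' \<and> \<phi> \<in> dg_isos A C (dg_cone X' f Y') \<and>
        iso_in (dgDer A) X X' a \<and> iso_in (dgDer A) Y Y' b \<and> iso_in (dgDer A) Z C c \<and>
        Comp (dgDer A) b u = Comp (dgDer A) (der_of A X' f Y') a \<and>
        Comp (dgDer A) c v =
          Comp (dgDer A) (der_of A Y' (\<lambda>y. inv_into (carrier C) \<phi> (y, \<zero>\<^bsub>X'\<^esub>)) C) b \<and>
        Comp (dgDer A) (der_shift A a) w =
          Comp (dgDer A) (der_of A C (\<lambda>z. snd (\<phi> z)) (dg_shift 1 X')) c)"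

text \<open>Full subcategories are given by their sets of objects.\<close>

definition strict_triangulated :: "('k, 'a, 'f) dga_scheme \<Rightarrow> ('a, 'm) dgmod set \<Rightarrow> bool" where
  "strict_triangulated A S \<longleftrightarrow> S \<subseteq> Ob (dgDer A) \<and>
     (\<forall>X\<in>Ob (dgDer A). carrier X = {\<zero>\<^bsub>X\<^esub>} \<longrightarrow> X \<in> S) \<and>
     (\<forall>X\<in>S. \<forall>Y. isomorphic_in (dgDer A) X Y \<longrightarrow> Y \<in> S) \<and>
     (\<forall>X\<in>S. \<forall>n. dg_shift n X \<in> S) \<and>
     (\<forall>X Y Z u v w. distinguished A X Y Z u v w \<longrightarrow> X \<in> S \<longrightarrow> Y \<in> S \<longrightarrow> Z \<in> S)"

text \<open>\<open>X\<close> is a direct summand of \<open>M\<close>: some copy \<open>D\<close> on the type \<open>'m\<close> of a direct sum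
  \<open>X \<oplus> Y\<close> is isomorphic to \<open>M\<close> in \<open>dgDer A\<close>.\<close>

definition direct_summand ::
  "('k, 'a, 'f) dga_scheme \<Rightarrow> ('a, 'm) dgmod \<Rightarrow> ('a, 'm) dgmod \<Rightarrow> bool" where
  "direct_summand A X M \<longleftrightarrow>
     (\<exists>(Y :: ('a, 'm) dgmod) D. dg_iso A D (dg_sum X Y) \<and> isomorphic_in (dgDer A) M D)"

definition summand_closed :: "('k, 'a, 'f) dga_scheme \<Rightarrow> ('a, 'm) dgmod set \<Rightarrow> bool" where
  "summand_closed A S \<longleftrightarrow> (\<forall>M\<in>S. \<forall>X\<in>Ob (dgDer A). direct_summand A X M \<longrightarrow> X \<in> S)"


subsection \<open>The subcategories dgPer, dgPrae and dgFilt\<close>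

definition dgPer :: "('k, 'a, 'f) dga_scheme \<Rightarrow> ('a, 'm) dgmod set" where
  "dgPer A = \<Inter>{S. strict_triangulated A S \<and> summand_closed A S \<and>
     (\<forall>M. dg_iso A M (regular_dgmod A) \<longrightarrow> M \<in> S)}"

definition dgPrae ::
  "('k, 'a, 'f) dga_scheme \<Rightarrow> 'x set \<Rightarrow> ('x \<Rightarrow> ('a, 'm) rmod) \<Rightarrow> ('a, 'm) dgmod set" where
  "dgPrae A W L = \<Inter>{S. strict_triangulated A S \<and>
     (\<forall>x\<in>W. \<forall>M. dg_iso A M (induced_dgmod A (L x)) \<longrightarrow> M \<in> S)}"

definition dgFilt ::
  "('k, 'a, 'f) dga_scheme \<Rightarrow> 'x set \<Rightarrow> ('x \<Rightarrow> ('a, 'm) rmod) \<Rightarrow> ('a, 'm) dgmod set" where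
  "dgFilt A W L = {M. dg_module A M \<and>
     (\<exists>(n :: nat) F l x. F 0 = {\<zero>\<^bsub>M\<^esub>} \<and> F n = carrier M \<and>
        (\<forall>i\<le>n. dg_submodule A M (F i)) \<and>
        (\<forall>i\<in>{1..n}. F (i - 1) \<subseteq> F i \<and> x i \<in> W \<and>
           dg_iso A (dg_quotient (dg_restrict M (F i)) (F (i - 1)))
                    (dg_shift (l i) (induced_dgmod A (L (x i))))) \<and>
        (\<forall>i\<in>{1..n}. \<forall>j\<in>{1..n}. i \<le> j \<longrightarrow> l j \<le> l i))}"

end

theory Submission
  imports Defs
begin

text \<open>A dg module is built by attaching cells: a cell of \<open>M\<close> over \<open>N\<close> is a homogeneous \<open>s\<close> with
  \<open>s e = s\<close> for a primitive idempotent \<open>e\<close> of \<open>A\<^sup>0\<close> and \<open>d s \<in> N\<close>, and it enlarges \<open>N\<close> to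
  \<open>N \<oplus> s e A\<close>. As \<open>\<lbrace>l\<rbrace>L\<^sub>x \<otimes> A\<close> is a shifted \<open>e A\<close>, the objects of dgFilt are the modules with
  finitely many cells, attached in ascending degree. Cellular modules lift through
  quasi-isomorphisms up to homotopy, so that isomorphisms out of them in the derived category are
  represented by quasi-isomorphisms.

  Any further cell can be sorted into such a model. Its boundary, taken at a top cell of too
  high degree, has a coefficient in \<open>A\<^sup>i\<close> with \<open>i \<le> 0\<close>. By positivity and Schur's lemma this
  coefficient is zero, and then the cells can be exchanged, or invertible, and then they cancel.
  So the modules with a sorted model are closed under cones and make up dgPrae.

  For direct summands let \<open>Q \<rightarrow> X \<oplus> Y\<close> be a quasi-isomorphism from a minimal cellular \<open>Q\<close>. A
  cell of lowest degree gives a nonzero class in \<open>X\<close> or in \<open>Y\<close>. Killing this class there removes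
  the cell from \<open>Q\<close>; induction applies, and \<open>X\<close> is recovered as a fibre.\<close>

section \<open>Abelian groups and gradings\<close>

text \<open>All three subcategories are compared through one predicate, \<open>filtered\<close>:
  there is a quasi-isomorphism from a cellular module whose cell degrees are sorted. dgFilt need not
  be closed under isomorphism in the derived category, so cones and summands are studied for
  \<open>filtered\<close>, and dgFilt re-enters only as the supply of models. Morphisms of the
  derived category are bare zigzags, and no calculus of fractions is set up. Two facts replace it: a
  zigzag out of a cellular module collapses to one morphism, and every zigzag acts on cohomology by
  a relation that respects the congruence, so that an invertible morphism is a quasi-isomorphism.
  Cones and sums live on product types while objects live on \<open>'m\<close>; hence
  quasi-isomorphisms between different types, and copies wherever a module must return to the
  universe. Idempotents enter twice: a simple module is some e A^0, so its induced module is eA, and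
  A splits as eA plus (1 - e)A, which puts the induced modules into dgPer; conversely A is built
  from finitely many cells of degree 0.\<close>

lemmas (in abelian_group) ag_simprules
  [algebra abgroup "ring.zero G" "ring.add G" "a_inv G" "a_minus G"] =
  a_closed zero_closed a_inv_closed minus_closed a_assoc l_zero l_neg a_comm minus_eq
  r_zero r_neg r_neg2 r_neg1 minus_add minus_minus add.inv_one a_lcomm

context abelian_group begin

lemma koszul_closed [simp]: "x \<in> carrier G \<Longrightarrow> koszul G i x \<in> carrier G"
  by (simp add: koszul_def)

lemma koszul_zero [simp]: "koszul G i \<zero> = \<zero>"
  by (simp add: koszul_def)

lemma koszul_koszul: "x \<in> carrier G \<Longrightarrow> koszul G i (koszul G j x) = koszul G (i + j) x"
  by (auto simp: koszul_def)

lemma koszul_add: "x \<in> carrier G \<Longrightarrow> y \<in> carrier G \<Longrightarrow> koszul G i (x \<oplus> y) = koszul G i x \<oplus> koszul G i y"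
  by (auto simp: koszul_def minus_add)

lemma koszul_eq_zero [simp]: "x \<in> carrier G \<Longrightarrow> koszul G i x = \<zero> \<longleftrightarrow> x = \<zero>"
  by (auto simp: koszul_def)

lemma koszul_plus_one: "x \<in> carrier G \<Longrightarrow> koszul G (i + 1) x = \<ominus> koszul G i x"
  by (auto simp: koszul_def)

lemma eq_minusI: "x \<in> carrier G \<Longrightarrow> y \<in> carrier G \<Longrightarrow> x \<oplus> y = \<zero> \<Longrightarrow> x = \<ominus> y"
  using minus_equality by (metis a_comm)

lemma diff_eq_zero: "x \<in> carrier G \<Longrightarrow> y \<in> carrier G \<Longrightarrow> x \<ominus> y = \<zero> \<longleftrightarrow> x = y"
  by (metis add.inv_solve_right' add.one_closed l_zero minus_eq r_neg)

lemma hom_zero: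
  assumes "f \<in> carrier G \<rightarrow> carrier H" "abelian_group H"
    "\<And>x y. x \<in> carrier G \<Longrightarrow> y \<in> carrier G \<Longrightarrow> f (x \<oplus> y) = f x \<oplus>\<^bsub>H\<^esub> f y"
  shows "f \<zero> = \<zero>\<^bsub>H\<^esub>"
proof -
  interpret H: abelian_group H by fact
  have "f \<zero> \<oplus>\<^bsub>H\<^esub> f \<zero> = f \<zero>" using assms(3)[of \<zero> \<zero>] by simp
  moreover have "f \<zero> \<in> carrier H" using assms(1) by auto
  ultimately show ?thesis by (metis H.add.l_cancel_one')
qed

lemma hom_inv:
  assumes "f \<in> carrier G \<rightarrow> carrier H" "abelian_group H"
    "\<And>x y. x \<in> carrier G \<Longrightarrow> y \<in> carrier G \<Longrightarrow> f (x \<oplus> y) = f x \<oplus>\<^bsub>H\<^esub> f y"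
    and x: "x \<in> carrier G"
  shows "f (\<ominus> x) = \<ominus>\<^bsub>H\<^esub> f x"
proof -
  interpret H: abelian_group H by fact
  have "f (\<ominus> x) \<oplus>\<^bsub>H\<^esub> f x = \<zero>\<^bsub>H\<^esub>" using assms(3)[of "\<ominus> x" x] hom_zero[OF assms(1-3)] x by (simp add: l_neg)
  moreover have "f x \<in> carrier H" "f (\<ominus> x) \<in> carrier H" using assms(1) x by auto
  ultimately show ?thesis by (metis H.minus_equality)
qed

end

text \<open>An equational form of a direct sum decomposition: additive projections of finite support
  that jointly detect zero. Submodules, shifts, sums and cones inherit it componentwise, which is
  easier than re-proving unique finite decompositions.\<close>

definition projections :: "('m, 'e) ring_scheme \<Rightarrow> (int \<Rightarrow> 'm set) \<Rightarrow> (int \<Rightarrow> 'm \<Rightarrow> 'm) \<Rightarrow> bool" where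
  "projections M F c \<longleftrightarrow>
     (\<forall>i. F i \<subseteq> carrier M) \<and> (\<forall>i. \<forall>x\<in>carrier M. c i x \<in> F i) \<and>
     (\<forall>i. \<forall>x\<in>carrier M. \<forall>y\<in>carrier M. c i (x \<oplus>\<^bsub>M\<^esub> y) = c i x \<oplus>\<^bsub>M\<^esub> c i y) \<and>
     (\<forall>i j. \<forall>x\<in>F i. c j x = (if j = i then x else \<zero>\<^bsub>M\<^esub>)) \<and>
     (\<forall>x\<in>carrier M. finite {i. c i x \<noteq> \<zero>\<^bsub>M\<^esub>}) \<and>
     (\<forall>x\<in>carrier M. (\<forall>i. c i x = \<zero>\<^bsub>M\<^esub>) \<longrightarrow> x = \<zero>\<^bsub>M\<^esub>)"

context abelian_group begin

lemma finsum_superset: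
  assumes "finite T" "{i. f i \<noteq> \<zero>} \<subseteq> T" "f \<in> UNIV \<rightarrow> carrier G"
  shows "finsum G f {i. f i \<noteq> \<zero>} = finsum G f T"
  by (rule add.finprod_mono_neutral_cong_left) (use assms in auto)

text \<open>The terms of the unique decomposition are the projections. Uniqueness makes them
  additive: the decompositions of \<open>x\<close> and \<open>y\<close>, added over the union of
  their supports, decompose \<open>x \<oplus> y\<close>.\<close>

lemma projections_if_direct_sum:
  assumes ds: "internal_direct_sum G UNIV F"
  obtains c where "projections G F c"
proof -
  define D where "D x f \<longleftrightarrow> f \<in> (\<Pi>\<^sub>E i\<in>(UNIV::int set). F i) \<and> finite {i. f i \<noteq> \<zero>} \<and> x = finsum G f {i. f i \<noteq> \<zero>}" for x f
  define c where "c i x = (THE f. D x f) i" for i x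
  have sg: "subgroup (F i) (add_monoid G)" for i
    using ds by (auto simp: internal_direct_sum_def)
  have sub: "x \<in> carrier G" if "x \<in> F i" for i x
    using subgroup.mem_carrier[OF sg that] by simp
  have ex1: "\<exists>!f. D x f" if "x \<in> carrier G" for x
    using ds that by (simp add: internal_direct_sum_def D_def)
  have cD: "D x (\<lambda>i. c i x)" if "x \<in> carrier G" for x
    unfolding c_def using theI'[OF ex1[OF that]] by (simp add: eta_contract_eq)
  have ceq: "c i x = f i" if "D x f" "x \<in> carrier G" for i x f
    unfolding c_def using the1_equality[of "D x" f, OF ex1[OF that(2)] that(1)] by (rule arg_cong[of _ _ "\<lambda>f. f i"])
  have cF: "c i x \<in> F i" if "x \<in> carrier G" for i x
    using cD[OF that] by (auto simp: D_def)
  have fin: "finite {i. c i x \<noteq> \<zero>}" if "x \<in> carrier G" for x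
    using cD[OF that] by (auto simp: D_def)
  have sum: "x = finsum G (\<lambda>i. c i x) {i. c i x \<noteq> \<zero>}" if "x \<in> carrier G" for x
    using cD[OF that] by (auto simp: D_def)
  have add: "c i (x \<oplus> y) = c i x \<oplus> c i y" if xy: "x \<in> carrier G" "y \<in> carrier G" for i x y
  proof (rule ceq)
    let ?f = "\<lambda>i. c i x \<oplus> c i y"
    let ?T = "{i. c i x \<noteq> \<zero>} \<union> {i. c i y \<noteq> \<zero>}"
    have T: "finite ?T" using fin xy by auto
    have car: "c i x \<in> carrier G" "c i y \<in> carrier G" for i using cF xy sub by blast+
    have supp: "{i. ?f i \<noteq> \<zero>} \<subseteq> ?T" by auto
    have "x \<oplus> y = finsum G (\<lambda>i. c i x) ?T \<oplus> finsum G (\<lambda>i. c i y) ?T"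
      using sum[OF xy(1)] sum[OF xy(2)] finsum_superset[of ?T "\<lambda>i. c i x"] finsum_superset[of ?T "\<lambda>i. c i y"] T car
      by auto
    also have "\<dots> = finsum G ?f ?T" using car by (simp add: finsum_addf)
    also have "\<dots> = finsum G ?f {i. ?f i \<noteq> \<zero>}"
      by (rule finsum_superset[symmetric]) (use T supp car in auto)
    finally have "x \<oplus> y = finsum G ?f {i. ?f i \<noteq> \<zero>}" .
    moreover have "?f i \<in> F i" for i
      using subgroup.m_closed[OF sg, of "c i x" i "c i y"] cF xy by simp
    ultimately show "D (x \<oplus> y) ?f"
      unfolding D_def using finite_subset[OF supp T] by (auto simp: PiE_def)
  qed (use xy in auto)
  have pure: "c j x = (if j = i then x else \<zero>)" if x: "x \<in> F i" for i j x
  proof (rule ceq)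
    show xc: "x \<in> carrier G" using sub x .
    let ?f = "\<lambda>j. if j = i then x else \<zero>"
    have "finsum G ?f {j. ?f j \<noteq> \<zero>} = finsum G ?f {i}"
      by (rule finsum_superset) (use xc in auto)
    also have "\<dots> = x" using xc by simp
    finally have "x = finsum G ?f {j. ?f j \<noteq> \<zero>}" by simp
    moreover have "finite {j. ?f j \<noteq> \<zero>}" by (rule finite_subset[of _ "{i}"]) auto
    moreover have "?f j \<in> F j" for j using x subgroup.one_closed[OF sg, of j] by simp
    ultimately show "D x ?f" unfolding D_def by auto
  qed
  have "x = \<zero>" if "x \<in> carrier G" "\<forall>i. c i x = \<zero>" for x
    using sum[OF that(1)] that(2) by simp
  note z = this
  have "projections G F c"
    unfolding projections_def
    apply (intro conjI allI ballI subsetI impI)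
    subgoal by (erule sub)
    subgoal by (erule cF)
    subgoal by (rule add)
    subgoal by (erule pure)
    subgoal by (erule fin)
    subgoal by (erule z)
    done
  then show ?thesis by (rule that)
qed

context
  fixes F c assumes p: "projections G F c"
begin

lemma pj_sub: "x \<in> F i \<Longrightarrow> x \<in> carrier G" using p by (auto simp: projections_def)
lemma pj_mem: "x \<in> carrier G \<Longrightarrow> c i x \<in> F i" using p by (auto simp: projections_def)
lemma pj_car: "x \<in> carrier G \<Longrightarrow> c i x \<in> carrier G" using pj_mem pj_sub by blast
lemma pj_add: "x \<in> carrier G \<Longrightarrow> y \<in> carrier G \<Longrightarrow> c i (x \<oplus> y) = c i x \<oplus> c i y"
  using p by (auto simp: projections_def)
lemma pj_pure: "x \<in> F i \<Longrightarrow> c j x = (if j = i then x else \<zero>)" using p unfolding projections_def by blast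
lemma pj_fin: "x \<in> carrier G \<Longrightarrow> finite {i. c i x \<noteq> \<zero>}" using p by (auto simp: projections_def)
lemma pj_zeroD: "x \<in> carrier G \<Longrightarrow> (\<And>i. c i x = \<zero>) \<Longrightarrow> x = \<zero>" using p unfolding projections_def by blast
lemma pj_zero: "c i \<zero> = \<zero>"
  by (rule hom_zero) (auto simp: pj_car pj_add abelian_group_axioms)
lemma pj_inv: "x \<in> carrier G \<Longrightarrow> c i (\<ominus> x) = \<ominus> c i x"
  by (rule hom_inv) (auto simp: pj_car pj_add abelian_group_axioms)
lemma pj_memI: "x \<in> carrier G \<Longrightarrow> c i x = x \<Longrightarrow> x \<in> F i" using pj_mem by metis
lemma pj_F_add: "x \<in> F i \<Longrightarrow> y \<in> F i \<Longrightarrow> x \<oplus> y \<in> F i"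
  by (rule pj_memI) (auto simp: pj_sub pj_add pj_pure)
lemma pj_F_zero: "\<zero> \<in> F i"
  by (rule pj_memI) (auto simp: pj_zero)
lemma pj_F_inv: "x \<in> F i \<Longrightarrow> \<ominus> x \<in> F i"
  by (rule pj_memI) (auto simp: pj_sub pj_inv pj_pure)
lemma pj_subgroup: "subgroup (F i) (add_monoid G)"
  proof (rule add.subgroupI)
  show "F i \<noteq> {}" using pj_F_zero by blast
qed (auto simp: pj_sub pj_F_add pj_F_inv)

lemma pj_finsum:
  assumes "finite T" "f \<in> T \<rightarrow> carrier G"
  shows "c i (finsum G f T) = finsum G (\<lambda>t. c i (f t)) T"
  using assms
proof (induction T)
  case empty then show ?case by (simp add: pj_zero)
next
  case (insert t T)
  then have "finsum G f T \<in> carrier G" "f t \<in> carrier G" "f \<in> T \<rightarrow> carrier G"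
    by auto
  moreover have "(\<lambda>t. c i (f t)) \<in> T \<rightarrow> carrier G" using insert.prems by (intro Pi_I pj_car) auto
  ultimately show ?case using insert.hyps insert.IH by (simp add: pj_add pj_car)
qed

text \<open>Both sides have the same components, and only zero has all components zero.\<close>

lemma pj_sum: assumes x: "x \<in> carrier G" "finite T" "{i. c i x \<noteq> \<zero>} \<subseteq> T" shows "x = finsum G (\<lambda>i. c i x) T"
proof -
  let ?s = "finsum G (\<lambda>i. c i x) T"
  have s: "?s \<in> carrier G" using x by (simp add: pj_car)
  have "c j (x \<ominus> ?s) = \<zero>" for j
  proof -
    have "c j ?s = finsum G (\<lambda>i. if j = i then c i x else \<zero>) T"
    proof -
      have "c j ?s = finsum G (\<lambda>i. c j (c i x)) T" using x by (intro pj_finsum) (auto simp: pj_car)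
      then show ?thesis using x(1) by (simp add: pj_pure[OF pj_mem])
    qed
    also have "\<dots> = c j x"
    proof (cases "j \<in> T")
      case True then show ?thesis using add.finprod_singleton[of j T "\<lambda>i. c i x"] x(1,2) by (simp add: pj_car)
    next
      case False then have "c j x = \<zero>" using x by auto
      moreover have "finsum G (\<lambda>i. if j = i then c i x else \<zero>) T = finsum G (\<lambda>i. \<zero>) T"
        by (rule finsum_cong') (use False in auto)
      ultimately show ?thesis using x by simp
    qed
    finally have "c j ?s = c j x" .
    moreover have "c j (x \<ominus> ?s) = c j x \<oplus> \<ominus> c j ?s"
      unfolding minus_eq using x(1) s by (subst pj_add) (simp_all only: a_inv_closed pj_inv)
    ultimately show ?thesis using pj_car[OF x(1)] by (simp add: r_neg)
  qed
  then have "x \<ominus> ?s = \<zero>" by (rule pj_zeroD[OF minus_closed[OF x(1) s]])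
  then show ?thesis using diff_eq_zero[OF x(1) s] by blast
qed

text \<open>Uniqueness holds because \<open>c j\<close>, applied to any decomposition of
  \<open>x\<close>, returns its term of index \<open>j\<close>.\<close>

lemma direct_sum_if_projections: "internal_direct_sum G UNIV F"
  unfolding internal_direct_sum_def
proof (intro conjI ballI)
  show "subgroup (F i) (add_monoid G)" for i by (rule pj_subgroup)
  fix x assume x: "x \<in> carrier G"
  show "\<exists>!f. f \<in> (\<Pi>\<^sub>E i\<in>UNIV. F i) \<and> finite {i \<in> UNIV. f i \<noteq> \<zero>} \<and> x = finsum G f {i \<in> UNIV. f i \<noteq> \<zero>}"
  proof (rule ex1I[of _ "\<lambda>i. c i x"])
    show "(\<lambda>i. c i x) \<in> (\<Pi>\<^sub>E i\<in>UNIV. F i) \<and> finite {i \<in> UNIV. c i x \<noteq> \<zero>} \<and> x = finsum G (\<lambda>i. c i x) {i \<in> UNIV. c i x \<noteq> \<zero>}"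
      using pj_sum[OF x pj_fin[OF x]] pj_fin[OF x] by (auto simp: pj_mem x)
  next
    fix f assume f: "f \<in> (\<Pi>\<^sub>E i\<in>UNIV. F i) \<and> finite {i \<in> UNIV. f i \<noteq> \<zero>} \<and> x = finsum G f {i \<in> UNIV. f i \<noteq> \<zero>}"
    then have fF: "f i \<in> F i" for i by auto
    have fc: "f i \<in> carrier G" for i using pj_sub[OF fF] .
    let ?T = "{i. f i \<noteq> \<zero>}"
    have "c j x = f j" for j
    proof -
      have "c j x = finsum G (\<lambda>i. c j (f i)) ?T" using f pj_finsum[of ?T f j] fc by (simp add: Pi_def)
      also have "\<dots> = finsum G (\<lambda>i. if j = i then f i else \<zero>) ?T"
        by (rule finsum_cong') (auto simp: pj_pure[OF fF] fc)
      also have "\<dots> = f j"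
      proof (cases "j \<in> ?T")
        case True then show ?thesis using f by (subst add.finprod_singleton) (auto simp: fc)
      next
        case False
        have "finsum G (\<lambda>i. if j = i then f i else \<zero>) ?T = finsum G (\<lambda>i. \<zero>) ?T"
          by (rule finsum_cong') (use False in auto)
        then show ?thesis using False by simp
      qed
      finally show ?thesis .
    qed
    then show "f = (\<lambda>i. c i x)" by auto
  qed
qed

end

lemma grading_iff: "internal_direct_sum G UNIV F \<longleftrightarrow> (\<exists>c. projections G F c)"
  using projections_if_direct_sum direct_sum_if_projections by metis

end

section \<open>Dg modules\<close>

sublocale dg_module \<subseteq> abelian_group M
  by (rule right_module.abelian_group[OF right_module])

context dg_module begin

lemma act_closed [simp]: "x \<in> carrier M \<Longrightarrow> a \<in> carrier A \<Longrightarrow> ract M x a \<in> carrier M"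
  by (rule right_module.act_closed[OF right_module])

lemma act_add_left: "x \<in> carrier M \<Longrightarrow> y \<in> carrier M \<Longrightarrow> a \<in> carrier A \<Longrightarrow>
    ract M (x \<oplus>\<^bsub>M\<^esub> y) a = ract M x a \<oplus>\<^bsub>M\<^esub> ract M y a"
  by (rule right_module.act_add_left[OF right_module])

lemma act_add_right: "x \<in> carrier M \<Longrightarrow> a \<in> carrier A \<Longrightarrow> b \<in> carrier A \<Longrightarrow>
    ract M x (a \<oplus>\<^bsub>A\<^esub> b) = ract M x a \<oplus>\<^bsub>M\<^esub> ract M x b"
  by (rule right_module.act_add_right[OF right_module])

lemma act_assoc: "x \<in> carrier M \<Longrightarrow> a \<in> carrier A \<Longrightarrow> b \<in> carrier A \<Longrightarrow>
    ract M (ract M x a) b = ract M x (a \<otimes>\<^bsub>A\<^esub> b)"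
  by (rule right_module.act_assoc[OF right_module, symmetric])

lemma act_one [simp]: "x \<in> carrier M \<Longrightarrow> ract M x \<one>\<^bsub>A\<^esub> = x"
  by (rule right_module.act_one[OF right_module])

lemma ring_A: "ring A"
  by (rule right_module.ring[OF right_module])

lemma act_zero_left [simp]: "a \<in> carrier A \<Longrightarrow> ract M \<zero>\<^bsub>M\<^esub> a = \<zero>\<^bsub>M\<^esub>"
  by (rule hom_zero[of "\<lambda>x. ract M x a"]) (auto simp: act_add_left abelian_group_axioms)

lemma act_inv_left: "x \<in> carrier M \<Longrightarrow> a \<in> carrier A \<Longrightarrow> ract M (\<ominus>\<^bsub>M\<^esub> x) a = \<ominus>\<^bsub>M\<^esub> ract M x a"
  by (rule hom_inv[of "\<lambda>x. ract M x a"]) (auto simp: act_add_left abelian_group_axioms)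

lemma act_zero_right [simp]: "x \<in> carrier M \<Longrightarrow> ract M x \<zero>\<^bsub>A\<^esub> = \<zero>\<^bsub>M\<^esub>"
  by (rule abelian_group.hom_zero[OF ring.is_abelian_group[OF ring_A]])
    (auto simp: act_add_right abelian_group_axioms)

lemma act_inv_right: "x \<in> carrier M \<Longrightarrow> a \<in> carrier A \<Longrightarrow> ract M x (\<ominus>\<^bsub>A\<^esub> a) = \<ominus>\<^bsub>M\<^esub> ract M x a"
  by (rule abelian_group.hom_inv[OF ring.is_abelian_group[OF ring_A]])
    (auto simp: act_add_right abelian_group_axioms)

lemma act_koszul_left: "x \<in> carrier M \<Longrightarrow> a \<in> carrier A \<Longrightarrow> ract M (koszul M i x) a = koszul M i (ract M x a)"
  by (simp add: koszul_def act_inv_left)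

lemma act_koszul_right: "x \<in> carrier M \<Longrightarrow> a \<in> carrier A \<Longrightarrow> ract M x (koszul A i a) = koszul M i (ract M x a)"
  by (simp add: koszul_def act_inv_right)

declare diff_closed [simp]

lemma diff_zero [simp]: "diff M \<zero>\<^bsub>M\<^esub> = \<zero>\<^bsub>M\<^esub>"
  by (rule hom_zero) (auto simp: diff_add abelian_group_axioms)

lemma diff_inv: "x \<in> carrier M \<Longrightarrow> diff M (\<ominus>\<^bsub>M\<^esub> x) = \<ominus>\<^bsub>M\<^esub> diff M x"
  by (rule hom_inv) (auto simp: diff_add abelian_group_axioms)

lemma diff_koszul: "x \<in> carrier M \<Longrightarrow> diff M (koszul M i x) = koszul M i (diff M x)"
  by (simp add: koszul_def diff_inv)

text \<open>On the carrier the projections are determined by the grading; the choice only gives them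
  a name without an extra parameter.\<close>

definition pr :: "int \<Rightarrow> 'm \<Rightarrow> 'm" where
  "pr = (SOME c. projections M (gr M) c)"

lemma pr: "projections M (gr M) pr"
  using grading unfolding grading_iff pr_def by (rule someI_ex)

lemma gr_closed: "x \<in> gr M i \<Longrightarrow> x \<in> carrier M"
  by (rule pj_sub[OF pr])

lemma pr_gr: "x \<in> carrier M \<Longrightarrow> pr i x \<in> gr M i"
  by (rule pj_mem[OF pr])

lemma pr_closed [simp]: "x \<in> carrier M \<Longrightarrow> pr i x \<in> carrier M"
  by (rule pj_car[OF pr])

lemma pr_add: "x \<in> carrier M \<Longrightarrow> y \<in> carrier M \<Longrightarrow> pr i (x \<oplus>\<^bsub>M\<^esub> y) = pr i x \<oplus>\<^bsub>M\<^esub> pr i y"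
  by (rule pj_add[OF pr])

lemma pr_pure: "x \<in> gr M i \<Longrightarrow> pr j x = (if j = i then x else \<zero>\<^bsub>M\<^esub>)"
  by (rule pj_pure[OF pr])

lemma pr_zero [simp]: "pr i \<zero>\<^bsub>M\<^esub> = \<zero>\<^bsub>M\<^esub>"
  by (rule pj_zero[OF pr])

lemma pr_inv: "x \<in> carrier M \<Longrightarrow> pr i (\<ominus>\<^bsub>M\<^esub> x) = \<ominus>\<^bsub>M\<^esub> pr i x"
  by (rule pj_inv[OF pr])

lemma pr_zeroD: "x \<in> carrier M \<Longrightarrow> (\<And>i. pr i x = \<zero>\<^bsub>M\<^esub>) \<Longrightarrow> x = \<zero>\<^bsub>M\<^esub>"
  by (rule pj_zeroD[OF pr])

lemma gr_add: "x \<in> gr M i \<Longrightarrow> y \<in> gr M i \<Longrightarrow> x \<oplus>\<^bsub>M\<^esub> y \<in> gr M i"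
  by (rule pj_F_add[OF pr])

lemma gr_zero [simp]: "\<zero>\<^bsub>M\<^esub> \<in> gr M i"
  by (rule pj_F_zero[OF pr])

lemma gr_inv: "x \<in> gr M i \<Longrightarrow> \<ominus>\<^bsub>M\<^esub> x \<in> gr M i"
  by (rule pj_F_inv[OF pr])

lemma gr_minus: "x \<in> gr M i \<Longrightarrow> y \<in> gr M i \<Longrightarrow> x \<ominus>\<^bsub>M\<^esub> y \<in> gr M i"
  by (simp add: minus_eq gr_add gr_inv)

lemma gr_koszul: "x \<in> gr M i \<Longrightarrow> koszul M j x \<in> gr M i"
  by (simp add: koszul_def gr_inv)

lemma pr_eqI: assumes "x \<in> carrier M" "y \<in> carrier M" "\<And>i. pr i x = pr i y" shows "x = y"
proof -
  have "x \<ominus>\<^bsub>M\<^esub> y = \<zero>\<^bsub>M\<^esub>" by (rule pr_zeroD) (use assms in \<open>simp_all add: minus_eq pr_add pr_inv r_neg\<close>)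
  then show ?thesis using diff_eq_zero assms(1,2) by blast
qed

text \<open>Degrees and Koszul signs make sense for homogeneous elements only; additive statements
  are reduced to these.\<close>

lemma gr_induct [consumes 1, case_names gr add]:
  assumes x: "x \<in> carrier M"
    and gr: "\<And>i y. y \<in> gr M i \<Longrightarrow> P y"
    and add: "\<And>y z. y \<in> carrier M \<Longrightarrow> z \<in> carrier M \<Longrightarrow> P y \<Longrightarrow> P z \<Longrightarrow> P (y \<oplus>\<^bsub>M\<^esub> z)"
  shows "P x"
proof -
  let ?T = "{i. pr i x \<noteq> \<zero>\<^bsub>M\<^esub>}"
  have "finite T \<Longrightarrow> P (finsum M (\<lambda>i. pr i x) T)" for T :: "int set"
  proof (induction T rule: finite_induct)
    case empty then show ?case using gr[OF gr_zero] by simp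
  next
    case (insert i T)
    have "P (pr i x \<oplus>\<^bsub>M\<^esub> finsum M (\<lambda>i. pr i x) T)"
      by (rule add) (use x insert.IH in \<open>auto intro: gr[OF pr_gr]\<close>)
    then show ?case using insert.hyps x by simp
  qed
  from this[OF pj_fin[OF pr x]] show ?thesis
    using pj_sum[OF pr x pj_fin[OF pr x] order_refl] by simp
qed

lemma pr_diff: "x \<in> carrier M \<Longrightarrow> pr (i + 1) (diff M x) = diff M (pr i x)"
  by (induction rule: gr_induct)
    (auto simp: pr_pure[OF diff_gr] pr_pure pr_add diff_add)

end

lemma dg_moduleI:
  fixes M :: "('a, 'm, 'g) dgmod_scheme"
  assumes "ring A" and M: "abelian_group M"
    and "\<And>x a. x \<in> carrier M \<Longrightarrow> a \<in> carrier A \<Longrightarrow> ract M x a \<in> carrier M"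
    and "\<And>x y a. x \<in> carrier M \<Longrightarrow> y \<in> carrier M \<Longrightarrow> a \<in> carrier A \<Longrightarrow>
      ract M (x \<oplus>\<^bsub>M\<^esub> y) a = ract M x a \<oplus>\<^bsub>M\<^esub> ract M y a"
    and "\<And>x a b. x \<in> carrier M \<Longrightarrow> a \<in> carrier A \<Longrightarrow> b \<in> carrier A \<Longrightarrow>
      ract M x (a \<oplus>\<^bsub>A\<^esub> b) = ract M x a \<oplus>\<^bsub>M\<^esub> ract M x b"
    and "\<And>x a b. x \<in> carrier M \<Longrightarrow> a \<in> carrier A \<Longrightarrow> b \<in> carrier A \<Longrightarrow>
      ract M x (a \<otimes>\<^bsub>A\<^esub> b) = ract M (ract M x a) b"
    and "\<And>x. x \<in> carrier M \<Longrightarrow> ract M x \<one>\<^bsub>A\<^esub> = x"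
    and c: "projections M (gr M) c"
    and "\<And>x a i j. x \<in> gr M i \<Longrightarrow> a \<in> agr A j \<Longrightarrow> ract M x a \<in> gr M (i + j)"
    and "\<And>x. x \<in> carrier M \<Longrightarrow> diff M x \<in> carrier M"
    and "\<And>x y. x \<in> carrier M \<Longrightarrow> y \<in> carrier M \<Longrightarrow> diff M (x \<oplus>\<^bsub>M\<^esub> y) = diff M x \<oplus>\<^bsub>M\<^esub> diff M y"
    and "\<And>x i. x \<in> gr M i \<Longrightarrow> diff M x \<in> gr M (i + 1)"
    and "\<And>x. x \<in> carrier M \<Longrightarrow> diff M (diff M x) = \<zero>\<^bsub>M\<^esub>"
    and "\<And>x a i. x \<in> gr M i \<Longrightarrow> a \<in> carrier A \<Longrightarrow>
      diff M (ract M x a) = ract M (diff M x) a \<oplus>\<^bsub>M\<^esub> koszul M i (ract M x (adiff A a))"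
  shows "dg_module A M"
proof (rule dg_module.intro)
  show "right_module A M" using assms(1-7) by (rule right_module.intro)
  show "internal_direct_sum M UNIV (gr M)" using abelian_group.direct_sum_if_projections[OF M c] .
qed fact+

section \<open>Morphisms of dg modules, transport of structure, copies inside the universe\<close>

sublocale dg_algebra \<subseteq> ring A
  by (rule ring)

context dg_algebra begin

definition "apr = (SOME c. projections A (agr A) c)"

lemma apr: "projections A (agr A) apr"
  using grading unfolding grading_iff apr_def by (rule someI_ex)

lemma agr_closed: "a \<in> agr A i \<Longrightarrow> a \<in> carrier A"
  by (rule pj_sub[OF apr])

declare diff_closed [simp]

text \<open>Only \<open>M\<close> is known to be a dg module; \<open>N\<close> merely carries
  operations that correspond to those of \<open>M\<close> under the bijection, so every axiom is
  pulled back by injectivity. Copies, quotients, tensor products and complements of summands are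
  recognised as dg modules in this way.\<close>

lemma transport_dg_module:
  fixes M :: "('a, 'm) dgmod" and N :: "('a, 'n) dgmod"
  assumes M: "dg_module A M" and bij: "bij_betw \<phi> (carrier N) (carrier M)"
    and zero: "\<zero>\<^bsub>N\<^esub> \<in> carrier N" "\<phi> \<zero>\<^bsub>N\<^esub> = \<zero>\<^bsub>M\<^esub>"
    and add: "\<And>x y. x \<in> carrier N \<Longrightarrow> y \<in> carrier N \<Longrightarrow> x \<oplus>\<^bsub>N\<^esub> y \<in> carrier N"
      "\<And>x y. x \<in> carrier N \<Longrightarrow> y \<in> carrier N \<Longrightarrow> \<phi> (x \<oplus>\<^bsub>N\<^esub> y) = \<phi> x \<oplus>\<^bsub>M\<^esub> \<phi> y"
    and act: "\<And>x a. x \<in> carrier N \<Longrightarrow> a \<in> carrier A \<Longrightarrow> ract N x a \<in> carrier N"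
      "\<And>x a. x \<in> carrier N \<Longrightarrow> a \<in> carrier A \<Longrightarrow> \<phi> (ract N x a) = ract M (\<phi> x) a"
    and gr: "\<And>i x. x \<in> gr N i \<longleftrightarrow> x \<in> carrier N \<and> \<phi> x \<in> gr M i"
    and diff: "\<And>x. x \<in> carrier N \<Longrightarrow> diff N x \<in> carrier N"
      "\<And>x. x \<in> carrier N \<Longrightarrow> \<phi> (diff N x) = diff M (\<phi> x)"
  shows "\<phi> \<in> dg_isos A N M"
proof -
  interpret M: dg_module A M by fact
  have eqI: "x = y" if "\<phi> x = \<phi> y" "x \<in> carrier N" "y \<in> carrier N" for x y
    using bij that by (auto simp: bij_betw_def dest: inj_onD)
  have \<phi> [simp]: "\<phi> x \<in> carrier M" if "x \<in> carrier N" for x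
    using bij that by (auto simp: bij_betw_def)
  define \<psi> where "\<psi> = inv_into (carrier N) \<phi>"
  have \<psi> [simp]: "\<psi> y \<in> carrier N" "\<phi> (\<psi> y) = y" if "y \<in> carrier M" for y
    using bij that bij_betw_inv_into_right[OF bij] inv_into_into[of y \<phi> "carrier N"]
    by (auto simp: \<psi>_def bij_betw_def)
  note [simp] = zero add act diff
  interpret N: abelian_group N
  proof (rule abelian_groupI)
    fix x assume x: "x \<in> carrier N"
    show "\<exists>y\<in>carrier N. y \<oplus>\<^bsub>N\<^esub> x = \<zero>\<^bsub>N\<^esub>"
      by (rule bexI[of _ "\<psi> (\<ominus>\<^bsub>M\<^esub> \<phi> x)"]) (rule eqI, use x in \<open>simp_all add: M.l_neg\<close>)
  qed (auto intro!: eqI simp: M.a_assoc M.a_comm M.a_lcomm)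
  have inv: "\<phi> (\<ominus>\<^bsub>N\<^esub> x) = \<ominus>\<^bsub>M\<^esub> \<phi> x" if "x \<in> carrier N" for x
    by (rule N.hom_inv) (use that M.abelian_group_axioms in auto)
  have kos: "\<phi> (koszul N i x) = koszul M i (\<phi> x)" if "x \<in> carrier N" for x i
    using that inv by (simp add: koszul_def)
  have z0: "\<phi> x = \<zero>\<^bsub>M\<^esub> \<longleftrightarrow> x = \<zero>\<^bsub>N\<^esub>" if "x \<in> carrier N" for x
    using eqI[of x "\<zero>\<^bsub>N\<^esub>"] that by auto
  have "projections N (gr N) (\<lambda>i x. \<psi> (M.pr i (\<phi> x)))"
    unfolding projections_def
  proof (intro conjI allI ballI impI)
    show "gr N i \<subseteq> carrier N" for i using gr by auto
    show "\<psi> (M.pr i (\<phi> x)) \<in> gr N i" if "x \<in> carrier N" for i x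
      using that by (simp add: gr M.pr_gr)
    show "\<psi> (M.pr i (\<phi> (x \<oplus>\<^bsub>N\<^esub> y))) = \<psi> (M.pr i (\<phi> x)) \<oplus>\<^bsub>N\<^esub> \<psi> (M.pr i (\<phi> y))"
      if "x \<in> carrier N" "y \<in> carrier N" for i x y
      by (rule eqI) (use that in \<open>simp_all add: M.pr_add\<close>)
    show "\<psi> (M.pr j (\<phi> x)) = (if j = i then x else \<zero>\<^bsub>N\<^esub>)" if "x \<in> gr N i" for i j x
      by (rule eqI) (use that in \<open>auto simp: gr M.pr_pure\<close>)
    show "finite {i. \<psi> (M.pr i (\<phi> x)) \<noteq> \<zero>\<^bsub>N\<^esub>}" if x: "x \<in> carrier N" for x
    proof -
      have "{i. \<psi> (M.pr i (\<phi> x)) \<noteq> \<zero>\<^bsub>N\<^esub>} = {i. M.pr i (\<phi> x) \<noteq> \<zero>\<^bsub>M\<^esub>}"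
        using x z0[of "\<psi> (M.pr _ (\<phi> x))"] by auto
      then show ?thesis using M.pj_fin[OF M.pr, of "\<phi> x"] x by simp
    qed
    show "x = \<zero>\<^bsub>N\<^esub>" if x: "x \<in> carrier N" and *: "\<forall>i. \<psi> (M.pr i (\<phi> x)) = \<zero>\<^bsub>N\<^esub>" for x
    proof -
      have "M.pr i (\<phi> x) = \<zero>\<^bsub>M\<^esub>" for i
      proof -
        have "\<phi> (\<psi> (M.pr i (\<phi> x))) = \<phi> \<zero>\<^bsub>N\<^esub>" using * by metis
        then show ?thesis unfolding \<psi>(2)[OF M.pr_closed[OF \<phi>[OF x]]] zero(2) .
      qed
      then have "\<phi> x = \<zero>\<^bsub>M\<^esub>" by (rule M.pr_zeroD[OF \<phi>[OF x]])
      then show ?thesis using z0[OF x] by blast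
    qed
  qed
  then have N': "dg_module A N"
  proof (rule dg_moduleI[OF ring_axioms N.abelian_group_axioms, rotated 5])
    fix x a i assume x: "x \<in> gr N i" and a: "a \<in> carrier A"
    then have xc: "x \<in> carrier N" and g: "\<phi> x \<in> gr M i" using gr by auto
    show "diff N (ract N x a) = ract N (diff N x) a \<oplus>\<^bsub>N\<^esub> koszul N i (ract N x (adiff A a))"
      by (rule eqI) (use xc a g diff_closed[OF a] in \<open>simp_all add: kos M.leibniz\<close>)
  next
    fix x a i j assume "x \<in> gr N i" "a \<in> agr A j"
    then show "ract N x a \<in> gr N (i + j)" using agr_closed M.act_gr by (simp add: gr)
  next
    fix x i assume "x \<in> gr N i" then show "diff N x \<in> gr N (i + 1)" by (simp add: gr M.diff_gr)
  next
    fix x y assume "x \<in> carrier N" "y \<in> carrier N"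
    then show "diff N (x \<oplus>\<^bsub>N\<^esub> y) = diff N x \<oplus>\<^bsub>N\<^esub> diff N y"
      by (intro eqI) (simp_all add: M.diff_add)
  next
    fix x assume "x \<in> carrier N"
    then show "diff N (diff N x) = \<zero>\<^bsub>N\<^esub>" by (intro eqI) (simp_all add: M.diff_diff)
  next
    fix x a b assume "x \<in> carrier N" "a \<in> carrier A" "b \<in> carrier A"
    then show "ract N x (a \<otimes> b) = ract N (ract N x a) b" by (intro eqI) (simp_all add: M.act_assoc)
  next
    fix x assume "x \<in> carrier N"
    then show "ract N x \<one> = x" by (intro eqI) simp_all
  next
    fix x a b assume "x \<in> carrier N" "a \<in> carrier A" "b \<in> carrier A"
    then show "ract N x (a \<oplus> b) = ract N x a \<oplus>\<^bsub>N\<^esub> ract N x b" by (intro eqI) (simp_all add: M.act_add_right)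
  next
    fix x y a assume "x \<in> carrier N" "y \<in> carrier N" "a \<in> carrier A"
    then show "ract N (x \<oplus>\<^bsub>N\<^esub> y) a = ract N x a \<oplus>\<^bsub>N\<^esub> ract N y a" by (intro eqI) (simp_all add: M.act_add_left)
  qed (use act diff in auto)
  show ?thesis unfolding dg_isos_def dg_hom_def rmod_hom_def using M N' bij by (auto simp: gr)
qed

lemma dg_homI:
  assumes "dg_module A M" "dg_module A N" "\<And>x. x \<in> carrier M \<Longrightarrow> f x \<in> carrier N"
    and "\<And>x y. x \<in> carrier M \<Longrightarrow> y \<in> carrier M \<Longrightarrow> f (x \<oplus>\<^bsub>M\<^esub> y) = f x \<oplus>\<^bsub>N\<^esub> f y"
    and "\<And>x a. x \<in> carrier M \<Longrightarrow> a \<in> carrier A \<Longrightarrow> f (ract M x a) = ract N (f x) a"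
    and "\<And>i x. x \<in> gr M i \<Longrightarrow> f x \<in> gr N i"
    and "\<And>x. x \<in> carrier M \<Longrightarrow> f (diff M x) = diff N (f x)"
  shows "f \<in> dg_hom A M N"
  using assms by (simp add: dg_hom_def rmod_hom_def)

lemma dg_homD:
  assumes "f \<in> dg_hom A M N"
  shows "dg_module A M" "dg_module A N" "x \<in> carrier M \<Longrightarrow> f x \<in> carrier N"
    and "x \<in> carrier M \<Longrightarrow> y \<in> carrier M \<Longrightarrow> f (x \<oplus>\<^bsub>M\<^esub> y) = f x \<oplus>\<^bsub>N\<^esub> f y"
    and "x \<in> carrier M \<Longrightarrow> a \<in> carrier A \<Longrightarrow> f (ract M x a) = ract N (f x) a"
    and "x \<in> gr M i \<Longrightarrow> f x \<in> gr N i"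
    and "x \<in> carrier M \<Longrightarrow> f (diff M x) = diff N (f x)"
  using assms by (auto simp: dg_hom_def rmod_hom_def)

lemma rmod_homD:
  assumes "f \<in> rmod_hom A M N"
  shows "x \<in> carrier M \<Longrightarrow> f x \<in> carrier N"
    and "x \<in> carrier M \<Longrightarrow> y \<in> carrier M \<Longrightarrow> f (x \<oplus>\<^bsub>M\<^esub> y) = f x \<oplus>\<^bsub>N\<^esub> f y"
    and "x \<in> carrier M \<Longrightarrow> a \<in> carrier A \<Longrightarrow> f (ract M x a) = ract N (f x) a"
  using assms by (auto simp: rmod_hom_def)

lemma rmod_hom_zero:
  assumes "f \<in> rmod_hom A M N" "dg_module A M" "dg_module A N"
  shows "f \<zero>\<^bsub>M\<^esub> = \<zero>\<^bsub>N\<^esub>"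
proof -
  interpret M: dg_module A M by fact
  interpret N: dg_module A N by fact
  show ?thesis by (rule M.hom_zero) (use rmod_homD[OF assms(1)] N.abelian_group_axioms in auto)
qed

lemma rmod_hom_inv:
  assumes "f \<in> rmod_hom A M N" "dg_module A M" "dg_module A N" "x \<in> carrier M"
  shows "f (\<ominus>\<^bsub>M\<^esub> x) = \<ominus>\<^bsub>N\<^esub> f x"
proof -
  interpret M: dg_module A M by fact
  interpret N: dg_module A N by fact
  show ?thesis by (rule M.hom_inv) (use rmod_homD[OF assms(1)] N.abelian_group_axioms assms(4) in auto)
qed

lemma dg_hom_rmod: "f \<in> dg_hom A M N \<Longrightarrow> f \<in> rmod_hom A M N"
  by (simp add: dg_hom_def)

lemma dg_hom_zero: "f \<in> dg_hom A M N \<Longrightarrow> f \<zero>\<^bsub>M\<^esub> = \<zero>\<^bsub>N\<^esub>"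
  using rmod_hom_zero by (auto simp: dg_hom_def)

lemma dg_hom_inv: "f \<in> dg_hom A M N \<Longrightarrow> x \<in> carrier M \<Longrightarrow> f (\<ominus>\<^bsub>M\<^esub> x) = \<ominus>\<^bsub>N\<^esub> f x"
  using rmod_hom_inv by (auto simp: dg_hom_def)

lemma dg_hom_minus:
  assumes f: "f \<in> dg_hom A M N" and xy: "x \<in> carrier M" "y \<in> carrier M"
  shows "f (x \<ominus>\<^bsub>M\<^esub> y) = f x \<ominus>\<^bsub>N\<^esub> f y"
proof -
  interpret M: dg_module A M using dg_homD(1)[OF f] .
  show ?thesis using xy by (simp add: a_minus_def dg_homD(4)[OF f] dg_hom_inv[OF f])
qed

lemma dg_hom_koszul: "f \<in> dg_hom A M N \<Longrightarrow> x \<in> carrier M \<Longrightarrow> f (koszul M i x) = koszul N i (f x)"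
  by (simp add: koszul_def dg_hom_inv)

lemma dg_hom_comp: "f \<in> dg_hom A M N \<Longrightarrow> g \<in> dg_hom A N P \<Longrightarrow> g \<circ> f \<in> dg_hom A M P"
  by (rule dg_homI) (simp_all add: dg_homD dg_homD(1)[of f M N] dg_homD(2)[of g N P])

lemma dg_hom_id: "dg_module A M \<Longrightarrow> (\<lambda>x. x) \<in> dg_hom A M M"
  by (rule dg_homI) auto

lemma dg_isosD: "\<phi> \<in> dg_isos A M N \<Longrightarrow> \<phi> \<in> dg_hom A M N" "\<phi> \<in> dg_isos A M N \<Longrightarrow> bij_betw \<phi> (carrier M) (carrier N)"
  by (auto simp: dg_isos_def)

lemma dg_isos_comp: "f \<in> dg_isos A M N \<Longrightarrow> g \<in> dg_isos A N P \<Longrightarrow> g \<circ> f \<in> dg_isos A M P"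
  by (auto simp: dg_isos_def intro: dg_hom_comp bij_betw_trans)

lemma dg_isos_inv:
  assumes "\<phi> \<in> dg_isos A M N"
  shows "inv_into (carrier M) \<phi> \<in> dg_isos A N M"
proof -
  note hom = dg_isosD(1)[OF assms] and bij = dg_isosD(2)[OF assms]
  interpret M: dg_module A M using dg_homD(1)[OF hom] .
  interpret N: dg_module A N using dg_homD(2)[OF hom] .
  let ?g = "inv_into (carrier M) \<phi>"
  have g [simp]: "?g y \<in> carrier M" "\<phi> (?g y) = y" if "y \<in> carrier N" for y
    using bij that bij_betw_inv_into_right[OF bij] inv_into_into[of y \<phi> "carrier M"]
    by (auto simp: bij_betw_def)
  have eqI: "x = y" if "\<phi> x = \<phi> y" "x \<in> carrier M" "y \<in> carrier M" for x y
    using bij that by (auto simp: bij_betw_def dest: inj_onD)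
  have "?g \<in> dg_hom A N M"
  proof (rule dg_homI)
    fix y i assume y: "y \<in> gr N i"
    then have yc: "y \<in> carrier N" by (rule N.gr_closed)
    \<comment> \<open>Morphisms preserve degrees in one direction only; the inverse does so because
      \<phi> commutes with the projections and is injective.\<close>
    have "?g y = M.pr i (?g y)"
    proof (rule M.pr_eqI)
      fix j show "M.pr j (?g y) = M.pr j (M.pr i (?g y))"
      proof (rule eqI)
        have *: "\<phi> (M.pr i x) = N.pr i (\<phi> x)" if "x \<in> carrier M" for x i
          using that by (induction rule: M.gr_induct)
            (auto simp: M.pr_pure N.pr_pure[OF dg_homD(6)[OF hom]] M.pr_add N.pr_add dg_homD(3,4)[OF hom] dg_hom_zero[OF hom])
        show "\<phi> (M.pr j (?g y)) = \<phi> (M.pr j (M.pr i (?g y)))"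
          using yc y by (simp add: * N.pr_pure)
      qed (use yc in auto)
    qed (use yc in auto)
    then show "?g y \<in> gr M i" using M.pr_gr[of "?g y" i] yc by simp
  qed (use M.dg_module_axioms N.dg_module_axioms in \<open>auto intro!: eqI simp: dg_homD[OF hom]\<close>)
  moreover have "bij_betw ?g (carrier N) (carrier M)" using bij_betw_inv_into[OF bij] .
  ultimately show ?thesis by (simp add: dg_isos_def)
qed

lemma dg_iso_sym: "dg_iso A M N \<Longrightarrow> dg_iso A N M"
  using dg_isos_inv by (fastforce simp: dg_iso_def)

lemma dg_iso_trans: "dg_iso A M N \<Longrightarrow> dg_iso A N P \<Longrightarrow> dg_iso A M P"
  using dg_isos_comp by (fastforce simp: dg_iso_def)

text \<open>Returns a construction on some other type to the universe, given that its carrier is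
  small enough; the structure is carried along an injection into \<open>'m\<close>.\<close>

lemma copy_exists:
  fixes M :: "('a, 'n) dgmod"
  assumes M: "dg_module A M" and le: "carrier M \<lesssim> (UNIV :: 'm set)"
  obtains C :: "('a, 'm) dgmod" and \<phi> where "\<phi> \<in> dg_isos A C M"
proof -
  interpret M: dg_module A M by fact
  obtain \<kappa> :: "'n \<Rightarrow> 'm" where \<kappa>: "inj_on \<kappa> (carrier M)" using le by (auto simp: lepoll_def)
  define \<phi> where "\<phi> = inv_into (carrier M) \<kappa>"
  have \<phi> [simp]: "\<phi> (\<kappa> x) = x" if "x \<in> carrier M" for x using \<kappa> that by (simp add: \<phi>_def)
  define C where "C = mk_dgmod (\<kappa> ` carrier M) (\<kappa> \<zero>\<^bsub>M\<^esub>) (\<lambda>x y. \<kappa> (\<phi> x \<oplus>\<^bsub>M\<^esub> \<phi> y))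
     (\<lambda>x a. \<kappa> (ract M (\<phi> x) a)) (\<lambda>i. \<kappa> ` gr M i) (\<lambda>x. \<kappa> (diff M (\<phi> x)))"
  have "\<phi> \<in> dg_isos A C M"
  proof (rule transport_dg_module[OF M])
    show "bij_betw \<phi> (carrier C) (carrier M)"
      by (rule bij_betw_byWitness[of _ \<kappa>]) (auto simp: C_def mk_dgmod_def)
    show "x \<in> gr C i \<longleftrightarrow> x \<in> carrier C \<and> \<phi> x \<in> gr M i" for i x
      by (auto simp: C_def mk_dgmod_def dest: M.gr_closed intro!: imageI) (use M.gr_closed \<phi> in \<open>metis imageI\<close>)+
  qed (auto simp: C_def mk_dgmod_def)
  then show ?thesis by (rule that)
qed

end

section \<open>Submodules, shifts, sums and cones\<close>

lemma dg_restrict_sel [simp]: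
  "carrier (dg_restrict M N) = N" "\<zero>\<^bsub>(dg_restrict M N)\<^esub> = \<zero>\<^bsub>M\<^esub>"
  "x \<oplus>\<^bsub>(dg_restrict M N)\<^esub> y = x \<oplus>\<^bsub>M\<^esub> y"
  "ract (dg_restrict M N) = ract M" "diff (dg_restrict M N) = diff M"
  "gr (dg_restrict M N) i = gr M i \<inter> N"
  by (simp_all add: dg_restrict_def)

lemma dg_restrict_restrict: "N \<subseteq> N' \<Longrightarrow> dg_restrict (dg_restrict M N') N = dg_restrict M N"
proof -
  assume "N \<subseteq> N'"
  then have "gr M i \<inter> N' \<inter> N = gr M i \<inter> N" for i by auto
  then show ?thesis by (simp add: dg_restrict_def)
qed

lemma dg_shift_sel [simp]:
  "carrier (dg_shift n M) = carrier M" "\<zero>\<^bsub>(dg_shift n M)\<^esub> = \<zero>\<^bsub>M\<^esub>"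
  "x \<oplus>\<^bsub>(dg_shift n M)\<^esub> y = x \<oplus>\<^bsub>M\<^esub> y"
  "ract (dg_shift n M) = ract M" "diff (dg_shift n M) x = koszul M n (diff M x)"
  "gr (dg_shift n M) i = gr M (i + n)" "\<ominus>\<^bsub>(dg_shift n M)\<^esub> x = \<ominus>\<^bsub>M\<^esub> x"
  by (simp_all add: dg_shift_def a_inv_def)

lemma koszul_shift [simp]: "koszul (dg_shift n M) = koszul M"
  by (simp add: koszul_def fun_eq_iff)

lemma dg_sum_sel [simp]:
  "carrier (dg_sum M N) = carrier M \<times> carrier N" "\<zero>\<^bsub>(dg_sum M N)\<^esub> = (\<zero>\<^bsub>M\<^esub>, \<zero>\<^bsub>N\<^esub>)"
  "(x, y) \<oplus>\<^bsub>(dg_sum M N)\<^esub> (x', y') = (x \<oplus>\<^bsub>M\<^esub> x', y \<oplus>\<^bsub>N\<^esub> y')"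
  "ract (dg_sum M N) (x, y) a = (ract M x a, ract N y a)" "diff (dg_sum M N) (x, y) = (diff M x, diff N y)"
  "gr (dg_sum M N) i = gr M i \<times> gr N i"
  by (simp_all add: dg_sum_def mk_dgmod_def)

lemma dg_cone_sel [simp]:
  "carrier (dg_cone M f N) = carrier N \<times> carrier M" "\<zero>\<^bsub>(dg_cone M f N)\<^esub> = (\<zero>\<^bsub>N\<^esub>, \<zero>\<^bsub>M\<^esub>)"
  "(x, y) \<oplus>\<^bsub>(dg_cone M f N)\<^esub> (x', y') = (x \<oplus>\<^bsub>N\<^esub> x', y \<oplus>\<^bsub>M\<^esub> y')"
  "ract (dg_cone M f N) (x, y) a = (ract N x a, ract M y a)"
  "diff (dg_cone M f N) (x, y) = (diff N x \<oplus>\<^bsub>N\<^esub> f y, \<ominus>\<^bsub>M\<^esub> diff M y)"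
  "gr (dg_cone M f N) i = gr N i \<times> gr M (i + 1)"
  by (simp_all add: dg_cone_def dg_sum_def mk_dgmod_def dg_shift_def)

lemma regular_sel [simp]:
  "carrier (regular_dgmod A) = carrier A" "\<zero>\<^bsub>(regular_dgmod A)\<^esub> = \<zero>\<^bsub>A\<^esub>"
  "x \<oplus>\<^bsub>(regular_dgmod A)\<^esub> y = x \<oplus>\<^bsub>A\<^esub> y"
  "ract (regular_dgmod A) x a = x \<otimes>\<^bsub>A\<^esub> a" "diff (regular_dgmod A) = adiff A"
  "gr (regular_dgmod A) i = agr A i" "\<ominus>\<^bsub>(regular_dgmod A)\<^esub> x = \<ominus>\<^bsub>A\<^esub> x"
  by (simp_all add: regular_dgmod_def mk_dgmod_def a_inv_def m_inv_def)

lemma koszul_regular [simp]: "koszul (regular_dgmod A) = koszul A"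
  by (simp add: koszul_def fun_eq_iff)

context dg_algebra begin

lemma regular_dg_module: "dg_module A (regular_dgmod A)"
proof (rule dg_moduleI[OF ring_axioms])
  show R: "abelian_group (regular_dgmod A)"
  proof (rule abelian_groupI)
    fix x assume "x \<in> carrier (regular_dgmod A)"
    then show "\<exists>y\<in>carrier (regular_dgmod A). y \<oplus>\<^bsub>(regular_dgmod A)\<^esub> x = \<zero>\<^bsub>(regular_dgmod A)\<^esub>"
      by (intro bexI[of _ "\<ominus> x"]) (auto simp: l_neg)
  qed (auto simp: a_ac)
  show "projections (regular_dgmod A) (gr (regular_dgmod A)) apr"
    using apr by (simp add: projections_def)
qed (simp_all add: l_distr r_distr m_assoc mult_gr diff_add diff_gr diff_diff leibniz)

sublocale regular: dg_module A "regular_dgmod A"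
  by (rule regular_dg_module)

text \<open>Closure under the projections makes the subset graded: the homogeneous components of its
  elements stay inside.\<close>

lemma dg_submoduleI:
  assumes M: "dg_module A M" and sub: "N \<subseteq> carrier M" "\<zero>\<^bsub>M\<^esub> \<in> N"
    and add: "\<And>x y. x \<in> N \<Longrightarrow> y \<in> N \<Longrightarrow> x \<oplus>\<^bsub>M\<^esub> y \<in> N"
    and inv: "\<And>x. x \<in> N \<Longrightarrow> \<ominus>\<^bsub>M\<^esub> x \<in> N"
    and act: "\<And>x a. x \<in> N \<Longrightarrow> a \<in> carrier A \<Longrightarrow> ract M x a \<in> N"
    and diff: "\<And>x. x \<in> N \<Longrightarrow> diff M x \<in> N"
    and pr: "\<And>i x. x \<in> N \<Longrightarrow> dg_module.pr M i x \<in> N"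
  shows "dg_submodule A M N"
proof -
  interpret M: dg_module A M by fact
  let ?R = "dg_restrict M N"
  have car: "x \<in> carrier M" if "x \<in> N" for x using that sub by blast
  interpret R: abelian_group ?R
  proof (rule abelian_groupI)
    fix x assume x: "x \<in> carrier ?R"
    show "\<exists>y\<in>carrier ?R. y \<oplus>\<^bsub>(?R)\<^esub> x = \<zero>\<^bsub>(?R)\<^esub>"
      by (rule bexI[of _ "\<ominus>\<^bsub>M\<^esub> x"]) (use x inv car in \<open>auto simp: M.l_neg\<close>)
  qed (use sub add in \<open>auto simp: M.a_ac car\<close>)
  \<comment> \<open>\<open>a_inv\<close> is a definite description over the carrier of the record,
    so the negatives of the restricted record have to be identified with those of
    \<open>M\<close>.\<close>
  have i: "\<ominus>\<^bsub>(?R)\<^esub> x = \<ominus>\<^bsub>M\<^esub> x" if "x \<in> N" for x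
    using R.minus_equality[of "\<ominus>\<^bsub>M\<^esub> x" x] that inv by (simp add: car M.l_neg)
  have kos: "koszul ?R n x = koszul M n x" if "x \<in> N" for n x
    using that by (simp add: koszul_def i)
  have "dg_module A ?R"
  proof (rule dg_moduleI[OF ring_axioms R.abelian_group_axioms])
    show "projections ?R (gr ?R) M.pr"
      unfolding projections_def
    proof (intro conjI allI ballI impI)
      fix x assume x: "x \<in> carrier ?R"
      show "finite {i. M.pr i x \<noteq> \<zero>\<^bsub>(?R)\<^esub>}" using M.pj_fin[OF M.pr, of x] x by (simp add: car)
      show "x = \<zero>\<^bsub>(?R)\<^esub>" if "\<forall>i. M.pr i x = \<zero>\<^bsub>(?R)\<^esub>" using M.pr_zeroD[of x] x that by (simp add: car)
    qed (auto simp: M.pr_gr car pr M.pr_add M.pr_pure)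
  qed (auto simp: act diff diff_closed car M.act_add_left M.act_add_right M.act_assoc M.act_gr M.diff_add M.diff_gr
      M.diff_diff M.leibniz agr_closed kos)
  then show ?thesis using sub by (simp add: dg_submodule_def)
qed

lemma dg_submoduleD:
  assumes M: "dg_module A M" and N: "dg_submodule A M N"
  shows "N \<subseteq> carrier M" "\<zero>\<^bsub>M\<^esub> \<in> N" "x \<in> N \<Longrightarrow> x \<in> carrier M"
    "x \<in> N \<Longrightarrow> y \<in> N \<Longrightarrow> x \<oplus>\<^bsub>M\<^esub> y \<in> N" "x \<in> N \<Longrightarrow> \<ominus>\<^bsub>M\<^esub> x \<in> N" "x \<in> N \<Longrightarrow> y \<in> N \<Longrightarrow> x \<ominus>\<^bsub>M\<^esub> y \<in> N"
    "x \<in> N \<Longrightarrow> a \<in> carrier A \<Longrightarrow> ract M x a \<in> N" "x \<in> N \<Longrightarrow> diff M x \<in> N" "x \<in> N \<Longrightarrow> dg_module.pr M i x \<in> N"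
    "dg_module A (dg_restrict M N)" "x \<in> N \<Longrightarrow> \<ominus>\<^bsub>(dg_restrict M N)\<^esub> x = \<ominus>\<^bsub>M\<^esub> x"
    "x \<in> N \<Longrightarrow> koszul M i x \<in> N" "x \<in> N \<Longrightarrow> koszul (dg_restrict M N) i x = koszul M i x"
proof -
  interpret M: dg_module A M by fact
  show sub: "N \<subseteq> carrier M" and R: "dg_module A (dg_restrict M N)" using N by (auto simp: dg_submodule_def)
  interpret R: dg_module A "dg_restrict M N" by fact
  show "\<zero>\<^bsub>M\<^esub> \<in> N" using R.zero_closed by simp
  show car: "x \<in> N \<Longrightarrow> x \<in> carrier M" for x using sub by blast
  show add: "x \<in> N \<Longrightarrow> y \<in> N \<Longrightarrow> x \<oplus>\<^bsub>M\<^esub> y \<in> N" for x y using R.a_closed by simp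
  show ri: "\<ominus>\<^bsub>(dg_restrict M N)\<^esub> x = \<ominus>\<^bsub>M\<^esub> x" if "x \<in> N" for x
    using M.minus_equality[of "\<ominus>\<^bsub>(dg_restrict M N)\<^esub> x" x] R.l_neg[of x] R.a_inv_closed[of x] that by (simp add: car)
  show inv: "\<ominus>\<^bsub>M\<^esub> x \<in> N" if "x \<in> N" for x using ri that R.a_inv_closed[of x] by simp
  show "x \<in> N \<Longrightarrow> y \<in> N \<Longrightarrow> x \<ominus>\<^bsub>M\<^esub> y \<in> N" by (simp add: M.minus_eq add inv)
  show "x \<in> N \<Longrightarrow> a \<in> carrier A \<Longrightarrow> ract M x a \<in> N" using R.act_closed by simp
  show "x \<in> N \<Longrightarrow> diff M x \<in> N" using R.diff_closed by simp
  show "x \<in> N \<Longrightarrow> koszul M i x \<in> N" by (simp add: koszul_def inv)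
  show "x \<in> N \<Longrightarrow> koszul (dg_restrict M N) i x = koszul M i x" by (simp add: koszul_def ri)
  have "x \<in> carrier (dg_restrict M N) \<Longrightarrow> M.pr i x \<in> N"
  proof (induction rule: R.gr_induct)
    case (gr j y) then show ?case using R.zero_closed by (auto simp: M.pr_pure)
  next
    case (add y z) then show ?case using R.a_closed by (simp add: M.pr_add car)
  qed
  then show "x \<in> N \<Longrightarrow> M.pr i x \<in> N" by simp
qed

lemma dg_submodule_zero:
  assumes "dg_module A M" shows "dg_submodule A M {\<zero>\<^bsub>M\<^esub>}"
proof -
  interpret M: dg_module A M by fact
  show ?thesis by (rule dg_submoduleI[OF assms]) auto
qed

lemma dg_restrict_carrier: "dg_module A M \<Longrightarrow> dg_restrict M (carrier M) = M"
proof -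
  assume "dg_module A M"
  then interpret M: dg_module A M .
  have "gr M i \<inter> carrier M = gr M i" for i using M.gr_closed by auto
  then show ?thesis by (simp add: dg_restrict_def)
qed

lemma dg_submodule_carrier: "dg_module A M \<Longrightarrow> dg_submodule A M (carrier M)"
  by (simp add: dg_submodule_def dg_restrict_carrier)

lemma dg_submodule_restrict:
  "N \<subseteq> N' \<Longrightarrow> N' \<subseteq> carrier M \<Longrightarrow> dg_submodule A (dg_restrict M N') N \<longleftrightarrow> dg_submodule A M N"
  by (auto simp: dg_submodule_def dg_restrict_restrict)

lemma dg_hom_restrict:
  assumes "f \<in> dg_hom A M N" "dg_submodule A M S"
  shows "f \<in> dg_hom A (dg_restrict M S) N"
proof -
  note S = dg_submoduleD[OF dg_homD(1)[OF assms(1)] assms(2)]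
  show ?thesis by (rule dg_homI) (use S(3,10) in \<open>simp_all add: dg_homD[OF assms(1)]\<close>)
qed

lemma dg_hom_codomain:
  assumes "f \<in> dg_hom A M N" "dg_submodule A N S" "\<And>x. x \<in> carrier M \<Longrightarrow> f x \<in> S"
  shows "f \<in> dg_hom A M (dg_restrict N S)"
proof -
  note S = dg_submoduleD[OF dg_homD(2)[OF assms(1)] assms(2)]
  interpret M: dg_module A M using dg_homD(1)[OF assms(1)] .
  show ?thesis by (rule dg_homI) (use S(10) M.dg_module_axioms assms(3) in \<open>simp_all add: dg_homD[OF assms(1)] M.gr_closed\<close>)
qed

lemma dg_hom_extend:
  assumes "f \<in> dg_hom A M (dg_restrict N S)" "dg_submodule A N S" "dg_module A N"
  shows "f \<in> dg_hom A M N"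
proof -
  note S = dg_submoduleD[OF assms(3,2)]
  show ?thesis by (rule dg_homI) (use dg_homD[OF assms(1)] assms(3) S(3) in auto)
qed

lemma inclusion_dg_hom:
  "dg_module A M \<Longrightarrow> dg_submodule A M S \<Longrightarrow> (\<lambda>x. x) \<in> dg_hom A (dg_restrict M S) M"
  by (rule dg_hom_restrict[OF dg_hom_id])

lemma inclusion_dg_hom':
  "dg_module A M \<Longrightarrow> dg_submodule A M S \<Longrightarrow> dg_submodule A M S' \<Longrightarrow> S \<subseteq> S' \<Longrightarrow>
    (\<lambda>x. x) \<in> dg_hom A (dg_restrict M S) (dg_restrict M S')"
  by (rule dg_hom_codomain[OF inclusion_dg_hom]) auto

lemma dg_hom_pr:
  assumes f: "f \<in> dg_hom A M N" and x: "x \<in> carrier M"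
  shows "f (dg_module.pr M i x) = dg_module.pr N i (f x)"
proof -
  interpret M: dg_module A M using dg_homD(1)[OF f] .
  interpret N: dg_module A N using dg_homD(2)[OF f] .
  show ?thesis using x
    by (induction rule: M.gr_induct)
      (auto simp: M.pr_pure N.pr_pure[OF dg_homD(6)[OF f]] M.pr_add N.pr_add dg_homD(3,4)[OF f] dg_hom_zero[OF f])
qed

lemma image_submodule:
  assumes f: "f \<in> dg_hom A M N" and S: "dg_submodule A M S"
  shows "dg_submodule A N (f ` S)"
proof (rule dg_submoduleI[OF dg_homD(2)[OF f]])
  note S = dg_submoduleD[OF dg_homD(1)[OF f] S]
  show "f ` S \<subseteq> carrier N" using S(3) dg_homD(3)[OF f] by blast
  show "\<zero>\<^bsub>N\<^esub> \<in> f ` S" using S(2) dg_hom_zero[OF f] by (metis imageI)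
  fix x assume "x \<in> f ` S"
  then obtain u where u: "u \<in> S" "x = f u" by blast
  show "x \<oplus>\<^bsub>N\<^esub> y \<in> f ` S" if y: "y \<in> f ` S" for y
  proof -
    obtain v where v: "v \<in> S" "y = f v" using y by blast
    then have "x \<oplus>\<^bsub>N\<^esub> y = f (u \<oplus>\<^bsub>M\<^esub> v)" using u by (simp add: S(3) dg_homD(4)[OF f])
    then show ?thesis using S(4) u v by blast
  qed
  have "\<ominus>\<^bsub>N\<^esub> x = f (\<ominus>\<^bsub>M\<^esub> u)" "diff N x = f (diff M u)"
    "dg_module.pr N i x = f (dg_module.pr M i u)" for i
    using u by (simp_all add: S(3) dg_hom_inv[OF f] dg_homD(7)[OF f] dg_hom_pr[OF f])
  then show "\<ominus>\<^bsub>N\<^esub> x \<in> f ` S" "diff N x \<in> f ` S" "dg_module.pr N i x \<in> f ` S" for i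
    using S(5,8,9) u by blast+
  show "ract N x a \<in> f ` S" if "a \<in> carrier A" for a
  proof -
    have "ract N x a = f (ract M u a)" using u that by (simp add: S(3) dg_homD(5)[OF f])
    then show ?thesis using S(7) u that by blast
  qed
qed

lemma shift_dg_module:
  assumes "dg_module A M" shows "dg_module A (dg_shift n M)"
proof -
  interpret M: dg_module A M by fact
  show ?thesis
  proof (rule dg_moduleI[OF ring_axioms])
    show "abelian_group (dg_shift n M)"
    proof (rule abelian_groupI)
      fix x assume "x \<in> carrier (dg_shift n M)"
      then show "\<exists>y\<in>carrier (dg_shift n M). y \<oplus>\<^bsub>(dg_shift n M)\<^esub> x = \<zero>\<^bsub>(dg_shift n M)\<^esub>"
        by (intro bexI[of _ "\<ominus>\<^bsub>M\<^esub> x"]) (auto simp: M.l_neg)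
    qed (auto simp: M.a_ac)
    show "projections (dg_shift n M) (gr (dg_shift n M)) (\<lambda>i. M.pr (i + n))"
      unfolding projections_def
    proof (intro conjI allI ballI impI)
      fix x assume x: "x \<in> carrier (dg_shift n M)"
      have "{i. M.pr (i + n) x \<noteq> \<zero>\<^bsub>M\<^esub>} = (\<lambda>i. i - n) ` {i. M.pr i x \<noteq> \<zero>\<^bsub>M\<^esub>}"
        by (auto intro!: image_eqI[of _ _ "_ + n"])
      then show "finite {i. M.pr (i + n) x \<noteq> \<zero>\<^bsub>(dg_shift n M)\<^esub>}"
        using M.pj_fin[OF M.pr, of x] x by simp
      show "x = \<zero>\<^bsub>(dg_shift n M)\<^esub>" if "\<forall>i. M.pr (i + n) x = \<zero>\<^bsub>(dg_shift n M)\<^esub>"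
      proof -
        have "M.pr i x = \<zero>\<^bsub>M\<^esub>" for i using that[rule_format, of "i - n"] by simp
        then show ?thesis using x M.pr_zeroD by simp
      qed
    qed (auto simp: M.gr_closed M.pr_gr M.pr_add M.pr_pure)
    show "ract (dg_shift n M) x a \<in> gr (dg_shift n M) (i + j)"
      if "x \<in> gr (dg_shift n M) i" "a \<in> agr A j" for x a i j
      using M.act_gr[of x "i + n" a j] that by (simp add: ac_simps)
    show "diff (dg_shift n M) x \<in> gr (dg_shift n M) (i + 1)"
      if "x \<in> gr (dg_shift n M) i" for x i
      using M.diff_gr[of x "i + n"] that by (simp add: ac_simps M.gr_koszul)
    \<comment> \<open>Degree i of the shift is degree i + n of \<open>M\<close>: the sign (-1)^n of
      the new differential and (-1)^(i+n) from the Leibniz rule of \<open>M\<close> combine to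
      (-1)^i.\<close>
    show "diff (dg_shift n M) (ract (dg_shift n M) x a) = ract (dg_shift n M) (diff (dg_shift n M) x) a
        \<oplus>\<^bsub>(dg_shift n M)\<^esub> koszul (dg_shift n M) i (ract (dg_shift n M) x (adiff A a))"
      if "x \<in> gr (dg_shift n M) i" "a \<in> carrier A" for x a i
      using that M.gr_closed[of x "i + n"]
      by (simp add: M.leibniz M.koszul_add M.act_koszul_left M.koszul_koszul) (simp add: koszul_def)
  qed (auto simp: M.act_add_left M.act_add_right M.act_assoc M.diff_add M.koszul_add
      M.diff_koszul M.diff_diff M.koszul_koszul)
qed

lemma koszul_pair:
  assumes "abelian_group M" "abelian_group N" "abelian_group P" "carrier P = carrier M \<times> carrier N"
    "\<zero>\<^bsub>P\<^esub> = (\<zero>\<^bsub>M\<^esub>, \<zero>\<^bsub>N\<^esub>)" "\<And>x y x' y'. (x, y) \<oplus>\<^bsub>P\<^esub> (x', y') = (x \<oplus>\<^bsub>M\<^esub> x', y \<oplus>\<^bsub>N\<^esub> y')"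
    "x \<in> carrier M" "y \<in> carrier N"
  shows "\<ominus>\<^bsub>P\<^esub> (x, y) = (\<ominus>\<^bsub>M\<^esub> x, \<ominus>\<^bsub>N\<^esub> y)" "koszul P i (x, y) = (koszul M i x, koszul N i y)"
proof -
  interpret M: abelian_group M by fact
  interpret N: abelian_group N by fact
  interpret P: abelian_group P by fact
  show "\<ominus>\<^bsub>P\<^esub> (x, y) = (\<ominus>\<^bsub>M\<^esub> x, \<ominus>\<^bsub>N\<^esub> y)"
    by (rule P.minus_equality) (use assms(4-) in \<open>auto simp: M.l_neg N.l_neg\<close>)
  then show "koszul P i (x, y) = (koszul M i x, koszul N i y)" by (simp add: koszul_def)
qed

lemma cone_dg_module:
  assumes f: "f \<in> dg_hom A M N"
  shows "dg_module A (dg_cone M f N)"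
proof -
  interpret M: dg_module A M using dg_homD(1)[OF f] .
  interpret N: dg_module A N using dg_homD(2)[OF f] .
  note [simp] = dg_homD(3)[OF f]
  let ?C = "dg_cone M f N"
  have C: "abelian_group ?C"
  proof (rule abelian_groupI)
    fix z assume "z \<in> carrier ?C"
    then obtain x y where z: "z = (x, y)" "x \<in> carrier N" "y \<in> carrier M" by auto
    then show "\<exists>w\<in>carrier ?C. w \<oplus>\<^bsub>(?C)\<^esub> z = \<zero>\<^bsub>(?C)\<^esub>"
      by (intro bexI[of _ "(\<ominus>\<^bsub>N\<^esub> x, \<ominus>\<^bsub>M\<^esub> y)"]) (auto simp: M.l_neg N.l_neg)
  qed (auto simp: M.a_ac N.a_ac)
  note kos = koszul_pair[OF N.abelian_group_axioms M.abelian_group_axioms C, simplified]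
  show ?thesis
  proof (rule dg_moduleI[OF ring_axioms C])
    show "projections ?C (gr ?C) (\<lambda>i (x, y). (N.pr i x, M.pr (i + 1) y))"
      unfolding projections_def
    proof (intro conjI allI ballI impI)
      fix z assume z: "z \<in> carrier ?C"
      then obtain x y where z: "z = (x, y)" "x \<in> carrier N" "y \<in> carrier M" by auto
      have "{i. (case z of (x, y) \<Rightarrow> (N.pr i x, M.pr (i + 1) y)) \<noteq> \<zero>\<^bsub>(?C)\<^esub>}
          \<subseteq> {i. N.pr i x \<noteq> \<zero>\<^bsub>N\<^esub>} \<union> (\<lambda>i. i - 1) ` {i. M.pr i y \<noteq> \<zero>\<^bsub>M\<^esub>}"
        by (auto simp: z intro!: image_eqI[of _ _ "_ + 1"])
      then show "finite {i. (case z of (x, y) \<Rightarrow> (N.pr i x, M.pr (i + 1) y)) \<noteq> \<zero>\<^bsub>(?C)\<^esub>}"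
        by (rule finite_subset) (use M.pj_fin[OF M.pr] N.pj_fin[OF N.pr] z in auto)
      show "z = \<zero>\<^bsub>(?C)\<^esub>" if "\<forall>i. (case z of (x, y) \<Rightarrow> (N.pr i x, M.pr (i + 1) y)) = \<zero>\<^bsub>(?C)\<^esub>"
      proof -
        have "M.pr i y = \<zero>\<^bsub>M\<^esub>" for i using that[rule_format, of "i - 1"] z by simp
        moreover have "N.pr i x = \<zero>\<^bsub>N\<^esub>" for i using that[rule_format, of "i"] z by simp
        ultimately show ?thesis using z M.pr_zeroD N.pr_zeroD by simp
      qed
    qed (auto simp: M.gr_closed M.pr_gr M.pr_add M.pr_pure N.gr_closed N.pr_gr N.pr_add N.pr_pure)
    show "ract ?C x a \<in> gr ?C (i + j)" if "x \<in> gr ?C i" "a \<in> agr A j" for x a i j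
      using that M.act_gr[of "snd x" "i + 1" a j] N.act_gr[of "fst x" i a j] by (auto simp: ac_simps)
    show "diff ?C x \<in> gr ?C (i + 1)" if "x \<in> gr ?C i" for x i
      using that M.diff_gr[of "snd x" "i + 1"] N.diff_gr[of "fst x" i]
      by (auto simp: ac_simps M.gr_inv intro!: N.gr_add dg_homD(6)[OF f])
    show "diff ?C (ract ?C x a) = ract ?C (diff ?C x) a \<oplus>\<^bsub>(?C)\<^esub> koszul ?C i (ract ?C x (adiff A a))"
      if x: "x \<in> gr ?C i" and a: "a \<in> carrier A" for x a i
    proof -
      obtain y z where x: "x = (y, z)" "y \<in> gr N i" "z \<in> gr M (i + 1)" using x by auto
      have c: "y \<in> carrier N" "z \<in> carrier M" using x M.gr_closed N.gr_closed by auto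
      have "ract N (diff N y) a \<oplus>\<^bsub>N\<^esub> koszul N i (ract N y (adiff A a)) \<oplus>\<^bsub>N\<^esub> ract N (f z) a
        = ract N (diff N y) a \<oplus>\<^bsub>N\<^esub> ract N (f z) a \<oplus>\<^bsub>N\<^esub> koszul N i (ract N y (adiff A a))"
        using c a by (simp add: N.a_ac)
      \<comment> \<open>In degree i of the cone the second component has degree i + 1 in
        \<open>M\<close>; the minus sign of its differential turns (-1)^(i+1) into the required
        (-1)^i.\<close>
      moreover have "\<ominus>\<^bsub>M\<^esub> (ract M (diff M z) a \<oplus>\<^bsub>M\<^esub> koszul M (i + 1) (ract M z (adiff A a)))
        = \<ominus>\<^bsub>M\<^esub> ract M (diff M z) a \<oplus>\<^bsub>M\<^esub> koszul M i (ract M z (adiff A a))"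
        using c a by (simp add: M.koszul_plus_one M.minus_add)
      ultimately show ?thesis using x c a
        by (simp add: M.leibniz N.leibniz kos dg_homD(5)[OF f] N.act_add_left M.act_inv_left)
    qed
    \<comment> \<open>The cross terms are d (f y) and f (- d y), which cancel because
      \<open>f\<close> is a chain map.\<close>
    show "diff ?C (diff ?C x) = \<zero>\<^bsub>(?C)\<^esub>" if "x \<in> carrier ?C" for x
      using that dg_homD(7)[OF f]
      by (auto simp: N.diff_add M.diff_inv M.diff_diff N.diff_diff dg_hom_inv[OF f] N.r_neg)
    show "diff ?C (x \<oplus>\<^bsub>(?C)\<^esub> y) = diff ?C x \<oplus>\<^bsub>(?C)\<^esub> diff ?C y" if "x \<in> carrier ?C" "y \<in> carrier ?C" for x y
      using that by (auto simp: M.diff_add N.diff_add M.minus_add N.a_ac dg_homD(4)[OF f])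
  qed (auto simp: M.act_add_left M.act_add_right M.act_assoc N.act_add_left N.act_add_right N.act_assoc)
qed

lemma sum_dg_module:
  assumes "dg_module A M" "dg_module A N"
  shows "dg_module A (dg_sum M N)"
proof -
  interpret M: dg_module A M by fact
  interpret N: dg_module A N by fact
  let ?C = "dg_sum M N"
  have C: "abelian_group ?C"
  proof (rule abelian_groupI)
    fix z assume "z \<in> carrier ?C"
    then obtain x y where z: "z = (x, y)" "x \<in> carrier M" "y \<in> carrier N" by auto
    then show "\<exists>w\<in>carrier ?C. w \<oplus>\<^bsub>(?C)\<^esub> z = \<zero>\<^bsub>(?C)\<^esub>"
      by (intro bexI[of _ "(\<ominus>\<^bsub>M\<^esub> x, \<ominus>\<^bsub>N\<^esub> y)"]) (auto simp: M.l_neg N.l_neg)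
  qed (auto simp: M.a_ac N.a_ac)
  note kos = koszul_pair[OF M.abelian_group_axioms N.abelian_group_axioms C, simplified]
  show ?thesis
  proof (rule dg_moduleI[OF ring_axioms C])
    show "projections ?C (gr ?C) (\<lambda>i (x, y). (M.pr i x, N.pr i y))"
      unfolding projections_def
    proof (intro conjI allI ballI impI)
      fix z assume z: "z \<in> carrier ?C"
      then obtain x y where z: "z = (x, y)" "x \<in> carrier M" "y \<in> carrier N" by auto
      have "{i. (case z of (x, y) \<Rightarrow> (M.pr i x, N.pr i y)) \<noteq> \<zero>\<^bsub>(?C)\<^esub>}
          \<subseteq> {i. M.pr i x \<noteq> \<zero>\<^bsub>M\<^esub>} \<union> {i. N.pr i y \<noteq> \<zero>\<^bsub>N\<^esub>}"
        by (auto simp: z)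
      then show "finite {i. (case z of (x, y) \<Rightarrow> (M.pr i x, N.pr i y)) \<noteq> \<zero>\<^bsub>(?C)\<^esub>}"
        by (rule finite_subset) (use M.pj_fin[OF M.pr] N.pj_fin[OF N.pr] z in auto)
      show "z = \<zero>\<^bsub>(?C)\<^esub>" if "\<forall>i. (case z of (x, y) \<Rightarrow> (M.pr i x, N.pr i y)) = \<zero>\<^bsub>(?C)\<^esub>"
        using that z M.pr_zeroD N.pr_zeroD by simp
    qed (auto simp: M.gr_closed M.pr_gr M.pr_add M.pr_pure N.gr_closed N.pr_gr N.pr_add N.pr_pure)
    show "diff ?C (ract ?C x a) = ract ?C (diff ?C x) a \<oplus>\<^bsub>(?C)\<^esub> koszul ?C i (ract ?C x (adiff A a))"
      if x: "x \<in> gr ?C i" and a: "a \<in> carrier A" for x a i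
      using x a by (auto simp: M.leibniz N.leibniz kos M.gr_closed N.gr_closed)
  qed (auto simp: M.act_add_left M.act_add_right M.act_assoc N.act_add_left N.act_add_right N.act_assoc
      M.diff_add N.diff_add M.diff_diff N.diff_diff M.act_gr N.act_gr M.diff_gr N.diff_gr)
qed

end

lemma (in abelian_group) inv_zero [simp]: "\<ominus> \<zero> = \<zero>"
  by (rule minus_equality) simp_all

section \<open>Quasi-isomorphisms\<close>

text \<open>A bijection on cohomology, spelled out on representatives. The two modules may have
  different types, unlike in \<open>quasi_isos\<close>; this admits cones and sums as targets of
  models. The agreement for equal types is \<open>quasi_isos_iff\<close>.\<close>

definition qis ::
  "('k, 'a, 'f) dga_scheme \<Rightarrow> ('m \<Rightarrow> 'n) \<Rightarrow> ('a, 'm) dgmod \<Rightarrow> ('a, 'n) dgmod \<Rightarrow> bool" where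
  "qis A f M N \<longleftrightarrow> f \<in> dg_hom A M N \<and>
     (\<forall>i. \<forall>z\<in>cycles N i. \<exists>x\<in>cycles M i. \<exists>w\<in>gr N (i - 1). z = f x \<oplus>\<^bsub>N\<^esub> diff N w) \<and>
     (\<forall>i. \<forall>x\<in>cycles M i. f x \<in> boundaries N i \<longrightarrow> x \<in> boundaries M i)"

lemma cycles_iff: "z \<in> cycles M i \<longleftrightarrow> z \<in> gr M i \<and> diff M z = \<zero>\<^bsub>M\<^esub>"
  by (simp add: cycles_def)

lemma boundariesI: "w \<in> gr M (i - 1) \<Longrightarrow> x = diff M w \<Longrightarrow> x \<in> boundaries M i"
  by (auto simp: boundaries_def)

lemma boundariesE: assumes "x \<in> boundaries M i" obtains w where "w \<in> gr M (i - 1)" "x = diff M w"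
  using assms by (auto simp: boundaries_def)

lemma qis_surjE:
  assumes "qis A f M N" "z \<in> gr N i" "diff N z = \<zero>\<^bsub>N\<^esub>"
  obtains x w where "x \<in> gr M i" "diff M x = \<zero>\<^bsub>M\<^esub>" "w \<in> gr N (i - 1)" "z = f x \<oplus>\<^bsub>N\<^esub> diff N w"
  using assms unfolding qis_def Ball_def Bex_def cycles_iff by metis

lemma qis_injE:
  assumes "qis A f M N" "x \<in> gr M i" "diff M x = \<zero>\<^bsub>M\<^esub>" "w \<in> gr N (i - 1)" "f x = diff N w"
  obtains v where "v \<in> gr M (i - 1)" "x = diff M v"
  using assms unfolding qis_def Ball_def cycles_iff by (metis boundariesI boundariesE)

lemma qisI:
  assumes "f \<in> dg_hom A M N"
    and "\<And>i z. z \<in> gr N i \<Longrightarrow> diff N z = \<zero>\<^bsub>N\<^esub> \<Longrightarrow> \<exists>x\<in>gr M i. diff M x = \<zero>\<^bsub>M\<^esub> \<and> (\<exists>w\<in>gr N (i - 1). z = f x \<oplus>\<^bsub>N\<^esub> diff N w)"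
    and "\<And>i x w. x \<in> gr M i \<Longrightarrow> diff M x = \<zero>\<^bsub>M\<^esub> \<Longrightarrow> w \<in> gr N (i - 1) \<Longrightarrow> f x = diff N w \<Longrightarrow>
      \<exists>v\<in>gr M (i - 1). x = diff M v"
  shows "qis A f M N"
  unfolding qis_def
proof (intro conjI allI ballI impI)
  show "\<exists>x\<in>cycles M i. \<exists>w\<in>gr N (i - 1). z = f x \<oplus>\<^bsub>N\<^esub> diff N w" if "z \<in> cycles N i" for i z
    using assms(2)[of z i] that unfolding Bex_def cycles_iff by blast
  show "x \<in> boundaries M i" if "x \<in> cycles M i" "f x \<in> boundaries N i" for i x
    using that assms(3)[of x i] unfolding cycles_iff by (metis boundariesI boundariesE)
qed fact

lemma qis_hom: "qis A f M N \<Longrightarrow> f \<in> dg_hom A M N"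
  by (simp add: qis_def)

context dg_module begin
lemma diff_gr': "w \<in> gr M (i - 1) \<Longrightarrow> diff M w \<in> gr M i"
  using diff_gr[of w "i - 1"] by simp
end

section \<open>Two out of three, composition and the five lemma for quasi-isomorphisms\<close>

context dg_algebra begin

text \<open>On cohomology \<open>s\<close> after \<open>g\<close> equals \<open>f\<close>, so
  \<open>g\<close> is bijective together with \<open>f\<close> and \<open>s\<close>. Agreement is
  asked for on cycles and up to boundaries only, which is what a homotopy delivers.\<close>

lemma qis_lift:
  assumes f: "qis A f P N" and s: "qis A s M N" and g: "g \<in> dg_hom A P M"
    and h: "\<And>i x. x \<in> gr P i \<Longrightarrow> diff P x = \<zero>\<^bsub>P\<^esub> \<Longrightarrow> \<exists>w\<in>gr N (i - 1). s (g x) = f x \<oplus>\<^bsub>N\<^esub> diff N w"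
  shows "qis A g P M"
proof -
  note fh = qis_hom[OF f] and sh = qis_hom[OF s]
  interpret P: dg_module A P using dg_homD(1)[OF fh] .
  interpret M: dg_module A M using dg_homD(1)[OF sh] .
  interpret N: dg_module A N using dg_homD(2)[OF sh] .
  show ?thesis
  proof (rule qisI[OF g])
    fix i z assume z: "z \<in> gr M i" "diff M z = \<zero>\<^bsub>M\<^esub>"
    have zc: "z \<in> carrier M" using M.gr_closed[OF z(1)] .
    have "s z \<in> gr N i" "diff N (s z) = \<zero>\<^bsub>N\<^esub>"
      using dg_homD(6)[OF sh z(1)] dg_homD(7)[OF sh zc] z dg_hom_zero[OF sh] by simp_all
    then obtain x w where x: "x \<in> gr P i" "diff P x = \<zero>\<^bsub>P\<^esub>" "w \<in> gr N (i - 1)" "s z = f x \<oplus>\<^bsub>N\<^esub> diff N w"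
      by (rule qis_surjE[OF f])
    obtain w' where w': "w' \<in> gr N (i - 1)" "s (g x) = f x \<oplus>\<^bsub>N\<^esub> diff N w'" using h[OF x(1,2)] by blast
    have gx: "g x \<in> gr M i" using dg_homD(6)[OF g x(1)] .
    have c: "g x \<in> carrier M" "w \<in> carrier N" "w' \<in> carrier N" "f x \<in> carrier N"
      using M.gr_closed[OF gx] N.gr_closed[OF x(3)] N.gr_closed[OF w'(1)]
        N.gr_closed[OF dg_homD(6)[OF fh x(1)]] by simp_all
    \<comment> \<open>Both \<open>s z\<close> and \<open>s (g x)\<close> are cohomologous to
      \<open>f x\<close>; injectivity of \<open>s\<close> on cohomology then makes the difference of
      \<open>z\<close> and \<open>g x\<close> a boundary.\<close>
    have "s (z \<ominus>\<^bsub>M\<^esub> g x) = s z \<ominus>\<^bsub>N\<^esub> s (g x)" using zc c by (simp add: dg_hom_minus[OF sh])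
    also have "\<dots> = diff N w \<ominus>\<^bsub>N\<^esub> diff N w'" unfolding x(4) w'(2)
      using c N.diff_closed[of w] N.diff_closed[of w'] by algebra
    also have "\<dots> = diff N (w \<ominus>\<^bsub>N\<^esub> w')" using c by (simp add: N.minus_eq N.diff_add N.diff_inv)
    finally have "s (z \<ominus>\<^bsub>M\<^esub> g x) = diff N (w \<ominus>\<^bsub>N\<^esub> w')" .
    moreover have "w \<ominus>\<^bsub>N\<^esub> w' \<in> gr N (i - 1)" using x w' N.gr_minus by simp
    moreover have "z \<ominus>\<^bsub>M\<^esub> g x \<in> gr M i" using z gx M.gr_minus by simp
    moreover have "diff M (g x) = \<zero>\<^bsub>M\<^esub>"
      using dg_homD(7)[OF g, of x] x dg_hom_zero[OF g] by (simp add: P.gr_closed)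
    then have "diff M (z \<ominus>\<^bsub>M\<^esub> g x) = \<zero>\<^bsub>M\<^esub>" using zc c z
      by (simp add: M.minus_eq M.diff_add M.diff_inv)
    ultimately obtain v where v: "v \<in> gr M (i - 1)" "z \<ominus>\<^bsub>M\<^esub> g x = diff M v"
      using qis_injE[OF s] by metis
    have "z = g x \<oplus>\<^bsub>M\<^esub> (z \<ominus>\<^bsub>M\<^esub> g x)" using zc c by algebra
    then show "\<exists>x\<in>gr P i. diff P x = \<zero>\<^bsub>P\<^esub> \<and> (\<exists>w\<in>gr M (i - 1). z = g x \<oplus>\<^bsub>M\<^esub> diff M w)"
      using x v by metis
  next
    fix i x v assume x: "x \<in> gr P i" "diff P x = \<zero>\<^bsub>P\<^esub>" "v \<in> gr M (i - 1)" "g x = diff M v"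
    obtain w where w: "w \<in> gr N (i - 1)" "s (g x) = f x \<oplus>\<^bsub>N\<^esub> diff N w" using h[OF x(1,2)] by blast
    have c: "v \<in> carrier M" "w \<in> carrier N" "f x \<in> carrier N" "s v \<in> carrier N"
      using M.gr_closed[OF x(3)] N.gr_closed[OF w(1)] N.gr_closed[OF dg_homD(6)[OF fh x(1)]]
      dg_homD(3)[OF sh] by simp_all
    have "diff N (s v) = f x \<oplus>\<^bsub>N\<^esub> diff N w" using w(2) x(4) dg_homD(7)[OF sh c(1)] by simp
    then have "f x = diff N (s v) \<ominus>\<^bsub>N\<^esub> diff N w"
      using c N.diff_closed[of w] by (simp add: N.minus_eq N.a_assoc N.r_neg)
    also have "\<dots> = diff N (s v \<ominus>\<^bsub>N\<^esub> w)" using c by (simp add: N.minus_eq N.diff_add N.diff_inv)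
    finally have "f x = diff N (s v \<ominus>\<^bsub>N\<^esub> w)" .
    moreover have "s v \<ominus>\<^bsub>N\<^esub> w \<in> gr N (i - 1)" using dg_homD(6)[OF sh x(3)] w N.gr_minus by simp
    ultimately show "\<exists>v\<in>gr P (i - 1). x = diff P v" using qis_injE[OF f x(1,2)] by metis
  qed
qed

lemma qis_comp:
  assumes f: "qis A f M N" and g: "qis A g N P"
  shows "qis A (g \<circ> f) M P"
proof -
  note fh = qis_hom[OF f] and gh = qis_hom[OF g]
  interpret M: dg_module A M using dg_homD(1)[OF fh] .
  interpret N: dg_module A N using dg_homD(1)[OF gh] .
  interpret P: dg_module A P using dg_homD(2)[OF gh] .
  show ?thesis
  proof (rule qisI[OF dg_hom_comp[OF fh gh]])
    fix i z assume z: "z \<in> gr P i" "diff P z = \<zero>\<^bsub>P\<^esub>"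
    obtain y w where y: "y \<in> gr N i" "diff N y = \<zero>\<^bsub>N\<^esub>" "w \<in> gr P (i - 1)" "z = g y \<oplus>\<^bsub>P\<^esub> diff P w"
      using qis_surjE[OF g z] .
    obtain x v where x: "x \<in> gr M i" "diff M x = \<zero>\<^bsub>M\<^esub>" "v \<in> gr N (i - 1)" "y = f x \<oplus>\<^bsub>N\<^esub> diff N v"
      using qis_surjE[OF f y(1,2)] .
    have c: "f x \<in> carrier N" "v \<in> carrier N" "w \<in> carrier P" "g (f x) \<in> carrier P" "g v \<in> carrier P"
      using M.gr_closed[OF x(1)] N.gr_closed[OF x(3)] P.gr_closed[OF y(3)]
      by (simp_all add: dg_homD(3)[OF fh] dg_homD(3)[OF gh])
    have "z = g (f x) \<oplus>\<^bsub>P\<^esub> diff P (g v \<oplus>\<^bsub>P\<^esub> w)"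
      using c y(4) x(4) by (simp add: dg_homD(4)[OF gh] P.diff_add dg_homD(7)[OF gh] P.a_assoc)
    moreover have "g v \<oplus>\<^bsub>P\<^esub> w \<in> gr P (i - 1)" using y(3) dg_homD(6)[OF gh x(3)] P.gr_add by simp
    ultimately show "\<exists>x\<in>gr M i. diff M x = \<zero>\<^bsub>M\<^esub> \<and> (\<exists>w\<in>gr P (i - 1). z = (g \<circ> f) x \<oplus>\<^bsub>P\<^esub> diff P w)"
      using x(1,2) by (metis comp_apply)
  next
    fix i x w assume x: "x \<in> gr M i" "diff M x = \<zero>\<^bsub>M\<^esub>" "w \<in> gr P (i - 1)" "(g \<circ> f) x = diff P w"
    have "f x \<in> gr N i" "diff N (f x) = \<zero>\<^bsub>N\<^esub>"
      using dg_homD(6)[OF fh x(1)] dg_homD(7)[OF fh M.gr_closed[OF x(1)]] x(2) dg_hom_zero[OF fh] by simp_all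
    then obtain v where "v \<in> gr N (i - 1)" "f x = diff N v" using x(3,4) qis_injE[OF g] by (metis comp_apply)
    then show "\<exists>v\<in>gr M (i - 1). x = diff M v" using qis_injE[OF f x(1,2)] by metis
  qed
qed

lemma qis_if_isos:
  assumes \<phi>: "\<phi> \<in> dg_isos A M N"
  shows "qis A \<phi> M N"
proof -
  note h = dg_isosD(1)[OF \<phi>] and h' = dg_isosD(1)[OF dg_isos_inv[OF \<phi>]]
  interpret M: dg_module A M using dg_homD(1)[OF h] .
  interpret N: dg_module A N using dg_homD(2)[OF h] .
  let ?g = "inv_into (carrier M) \<phi>"
  have g\<phi>: "?g (\<phi> x) = x" if "x \<in> carrier M" for x
    using bij_betw_inv_into_left[OF dg_isosD(2)[OF \<phi>] that] .
  have \<phi>g: "\<phi> (?g x) = x" if "x \<in> carrier N" for x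
    using bij_betw_inv_into_right[OF dg_isosD(2)[OF \<phi>] that] .
  show ?thesis
  proof (rule qisI[OF h])
    fix i z assume z: "z \<in> gr N i" "diff N z = \<zero>\<^bsub>N\<^esub>"
    have "z \<in> carrier N" using N.gr_closed[OF z(1)] .
    then show "\<exists>x\<in>gr M i. diff M x = \<zero>\<^bsub>M\<^esub> \<and> (\<exists>w\<in>gr N (i - 1). z = \<phi> x \<oplus>\<^bsub>N\<^esub> diff N w)"
      using z by (intro bexI[of _ "?g z"] bexI[of _ "\<zero>\<^bsub>N\<^esub>"] conjI)
        (simp_all add: \<phi>g dg_homD(6)[OF h'] dg_hom_zero[OF h'] flip: dg_homD(7)[OF h'])
  next
    fix i x w assume x: "x \<in> gr M i" "diff M x = \<zero>\<^bsub>M\<^esub>" "w \<in> gr N (i - 1)" "\<phi> x = diff N w"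
    then have "x = ?g (diff N w)" using g\<phi> M.gr_closed by metis
    then show "\<exists>v\<in>gr M (i - 1). x = diff M v"
      using dg_homD(6)[OF h' x(3)] dg_homD(7)[OF h' N.gr_closed[OF x(3)]] by blast
  qed
qed

lemma qis_id: "dg_module A M \<Longrightarrow> qis A (\<lambda>x. x) M M"
  by (rule qis_if_isos) (auto simp: dg_isos_def dg_hom_id bij_betw_def)

text \<open>The five lemma for \<open>0 \<rightarrow> N \<rightarrow> M \<rightarrow> M/N \<rightarrow> 0\<close>, with the hypothesis on the quotients
  spelled out for representatives.\<close>

lemma qis_five:
  assumes f: "f \<in> dg_hom A M M'" and N: "dg_submodule A M N" and N': "dg_submodule A M' N'"
    and fN: "\<And>x. x \<in> N \<Longrightarrow> f x \<in> N'"
    and q: "qis A f (dg_restrict M N) (dg_restrict M' N')"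
    and surj: "\<And>i z. z \<in> gr M' i \<Longrightarrow> diff M' z \<in> N' \<Longrightarrow>
      \<exists>y\<in>gr M i. diff M y \<in> N \<and> (\<exists>w\<in>gr M' (i - 1). z \<ominus>\<^bsub>M'\<^esub> f y \<ominus>\<^bsub>M'\<^esub> diff M' w \<in> N')"
    and inj: "\<And>i z w'. z \<in> gr M i \<Longrightarrow> diff M z \<in> N \<Longrightarrow> w' \<in> gr M' (i - 1) \<Longrightarrow>
      f z \<ominus>\<^bsub>M'\<^esub> diff M' w' \<in> N' \<Longrightarrow> \<exists>w\<in>gr M (i - 1). z \<ominus>\<^bsub>M\<^esub> diff M w \<in> N"
  shows "qis A f M M'"
proof -
  interpret M: dg_module A M using dg_homD(1)[OF f] .
  interpret M': dg_module A M' using dg_homD(2)[OF f] .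
  note S = dg_submoduleD[OF M.dg_module_axioms N] and S' = dg_submoduleD[OF M'.dg_module_axioms N']
  note fc = dg_homD(3)[OF f] and fa = dg_homD(4)[OF f] and fd = dg_homD(7)[OF f] and fg = dg_homD(6)[OF f]
    and fm = dg_hom_minus[OF f] and f0 = dg_hom_zero[OF f]
  note dm = M.minus_eq M.diff_add M.diff_inv and dm' = M'.minus_eq M'.diff_add M'.diff_inv
  show ?thesis
  proof (rule qisI[OF f])
    fix i z assume z: "z \<in> gr M' i" "diff M' z = \<zero>\<^bsub>M'\<^esub>"
    then obtain y w where y: "y \<in> gr M i" "diff M y \<in> N" "w \<in> gr M' (i - 1)"
      and u: "z \<ominus>\<^bsub>M'\<^esub> f y \<ominus>\<^bsub>M'\<^esub> diff M' w \<in> N'" using surj[OF z(1)] S'(2) by auto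
    define u where "u = z \<ominus>\<^bsub>M'\<^esub> f y \<ominus>\<^bsub>M'\<^esub> diff M' w"
    have c: "z \<in> carrier M'" "y \<in> carrier M" "w \<in> carrier M'" "f y \<in> carrier M'" "u \<in> carrier M'" "u \<in> N'"
      using M'.gr_closed[OF z(1)] M.gr_closed[OF y(1)] M'.gr_closed[OF y(3)] u S'(3)[OF u] fc by (simp_all add: u_def)
    have ug: "u \<in> gr M' i" using z y M'.gr_minus M'.diff_gr' fg by (simp add: u_def)
    have du: "diff M' u = \<ominus>\<^bsub>M'\<^esub> f (diff M y)"
      using c z by (simp add: u_def dm' M'.diff_diff fd)
    have "diff M y \<in> gr (dg_restrict M N) (i + 1)" using y M.diff_gr by simp
    moreover have "diff (dg_restrict M N) (diff M y) = \<zero>\<^bsub>(dg_restrict M N)\<^esub>" using c M.diff_diff by simp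
    moreover have "\<ominus>\<^bsub>M'\<^esub> u \<in> gr (dg_restrict M' N') (i + 1 - 1)" using ug c S'(5) M'.gr_inv by simp
    moreover have "f (diff M y) = diff (dg_restrict M' N') (\<ominus>\<^bsub>M'\<^esub> u)"
      using du c fc[of "diff M y"] by (simp add: M'.diff_inv)
    \<comment> \<open>The boundary of \<open>y\<close> is a cycle of \<open>N\<close> whose image
      bounds in \<open>N'\<close>; hence it bounds some \<open>v\<close> in \<open>N\<close>, and
      \<open>y - v\<close> is a cycle.\<close>
    ultimately obtain v where "v \<in> gr (dg_restrict M N) (i + 1 - 1)" "diff M y = diff (dg_restrict M N) v"
      using qis_injE[OF q] by metis
    then have v: "v \<in> gr M i" "v \<in> N" "diff M y = diff M v" by simp_all
    have vc: "v \<in> carrier M" "f v \<in> carrier M'" "f v \<in> N'" using S(3)[OF v(2)] fc fN[OF v(2)] by simp_all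
    \<comment> \<open>\<open>u + f v\<close> is the defect between \<open>z\<close> and
      \<open>f (y - v)\<close> up to a boundary. It is a cycle of \<open>N'\<close> and is matched
      by a cycle \<open>x0\<close> of \<open>N\<close>.\<close>
    have "diff M' (u \<oplus>\<^bsub>M'\<^esub> f v) = \<zero>\<^bsub>M'\<^esub>"
      using vc c du fd[OF vc(1)] fc[of "diff M v"] by (simp add: M'.diff_add v(3) M'.l_neg)
    moreover have "u \<oplus>\<^bsub>M'\<^esub> f v \<in> gr (dg_restrict M' N') i" using ug c vc fg[OF v(1)] S'(4) M'.gr_add by simp
    ultimately obtain x0 w0 where x0: "x0 \<in> gr (dg_restrict M N) i" "diff (dg_restrict M N) x0 = \<zero>\<^bsub>(dg_restrict M N)\<^esub>"
      "w0 \<in> gr (dg_restrict M' N') (i - 1)" "u \<oplus>\<^bsub>M'\<^esub> f v = f x0 \<oplus>\<^bsub>(dg_restrict M' N')\<^esub> diff (dg_restrict M' N') w0"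
      using qis_surjE[OF q, of "u \<oplus>\<^bsub>M'\<^esub> f v" i] by auto
    then have x0: "x0 \<in> gr M i" "x0 \<in> N" "diff M x0 = \<zero>\<^bsub>M\<^esub>" "w0 \<in> gr M' (i - 1)" "w0 \<in> N'"
      "u \<oplus>\<^bsub>M'\<^esub> f v = f x0 \<oplus>\<^bsub>M'\<^esub> diff M' w0" by simp_all
    have x0c: "x0 \<in> carrier M" "w0 \<in> carrier M'" "f x0 \<in> carrier M'" using S(3)[OF x0(2)] S'(3)[OF x0(5)] fc by simp_all
    let ?x = "y \<ominus>\<^bsub>M\<^esub> v \<oplus>\<^bsub>M\<^esub> x0" and ?w = "w \<oplus>\<^bsub>M'\<^esub> w0"
    have "?x \<in> gr M i" using y v x0 M.gr_minus M.gr_add by simp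
    moreover have "diff M ?x = \<zero>\<^bsub>M\<^esub>" using c vc x0c x0 by (simp add: dm v(3) M.r_neg)
    moreover have "?w \<in> gr M' (i - 1)" using y x0 M'.gr_add by simp
    moreover have "z = f ?x \<oplus>\<^bsub>M'\<^esub> diff M' ?w"
    proof -
      have "f ?x \<oplus>\<^bsub>M'\<^esub> diff M' ?w = f y \<ominus>\<^bsub>M'\<^esub> f v \<oplus>\<^bsub>M'\<^esub> (f x0 \<oplus>\<^bsub>M'\<^esub> diff M' w0) \<oplus>\<^bsub>M'\<^esub> diff M' w"
        using c vc x0c M'.diff_closed[of w] M'.diff_closed[of w0]
        by (simp add: fa fm M'.diff_add M'.a_ac)
      also have "\<dots> = f y \<ominus>\<^bsub>M'\<^esub> f v \<oplus>\<^bsub>M'\<^esub> (u \<oplus>\<^bsub>M'\<^esub> f v) \<oplus>\<^bsub>M'\<^esub> diff M' w" using x0(6) by simp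
      also have "\<dots> = z" unfolding u_def using c vc M'.diff_closed[of w] by algebra
      finally show ?thesis by simp
    qed
    ultimately show "\<exists>x\<in>gr M i. diff M x = \<zero>\<^bsub>M\<^esub> \<and> (\<exists>w\<in>gr M' (i - 1). z = f x \<oplus>\<^bsub>M'\<^esub> diff M' w)" by blast
  next
    fix i x w' assume x: "x \<in> gr M i" "diff M x = \<zero>\<^bsub>M\<^esub>" "w' \<in> gr M' (i - 1)" "f x = diff M' w'"
    have c: "x \<in> carrier M" "w' \<in> carrier M'" using M.gr_closed[OF x(1)] M'.gr_closed[OF x(3)] .
    obtain w where w: "w \<in> gr M (i - 1)" "x \<ominus>\<^bsub>M\<^esub> diff M w \<in> N"
      using inj[OF x(1) _ x(3)] x S(2) S'(2) c by (auto simp: M'.r_neg M'.minus_eq)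
    have wc: "w \<in> carrier M" "f w \<in> carrier M'" using M.gr_closed[OF w(1)] fc by simp_all
    \<comment> \<open>\<open>w\<close> bounds \<open>x\<close> only modulo \<open>N\<close>. Since d
      u = f (x - d w) lies in \<open>N'\<close>, surjectivity on the quotients one degree lower
      supplies \<open>y\<close>, and x - d w - d y is a cycle of \<open>N\<close> whose image bounds
      in \<open>N'\<close>.\<close>
    define u where "u = w' \<ominus>\<^bsub>M'\<^esub> f w"
    have u: "u \<in> gr M' (i - 1)" "u \<in> carrier M'" using x w fg M'.gr_minus c wc by (simp_all add: u_def)
    have du: "diff M' u = f (x \<ominus>\<^bsub>M\<^esub> diff M w)" using c wc x(4) by (simp add: u_def dm' fm fd)
    then have "diff M' u \<in> N'" using fN[OF w(2)] by simp
    then obtain y w2 where y: "y \<in> gr M (i - 1)" "diff M y \<in> N" "w2 \<in> gr M' (i - 1 - 1)"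
      and t: "u \<ominus>\<^bsub>M'\<^esub> f y \<ominus>\<^bsub>M'\<^esub> diff M' w2 \<in> N'" using surj[OF u(1)] by blast
    have yc: "y \<in> carrier M" "w2 \<in> carrier M'" "f y \<in> carrier M'" using M.gr_closed[OF y(1)] M'.gr_closed[OF y(3)] fc by simp_all
    let ?t = "u \<ominus>\<^bsub>M'\<^esub> f y \<ominus>\<^bsub>M'\<^esub> diff M' w2" and ?r = "x \<ominus>\<^bsub>M\<^esub> diff M w \<ominus>\<^bsub>M\<^esub> diff M y"
    have "?r \<in> gr (dg_restrict M N) i" using x w y S(6) M.gr_minus M.diff_gr' by simp
    moreover have "diff (dg_restrict M N) ?r = \<zero>\<^bsub>(dg_restrict M N)\<^esub>"
      using c wc yc x by (simp add: dm M.diff_diff)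
    moreover have "?t \<in> gr (dg_restrict M' N') (i - 1)" using u y t fg M'.gr_minus M'.diff_gr' by simp
    moreover have "f ?r = diff (dg_restrict M' N') ?t"
      using c wc yc u du fc by (simp add: dm' fm fd M'.diff_diff)
    ultimately obtain v where "v \<in> gr (dg_restrict M N) (i - 1)" "?r = diff (dg_restrict M N) v"
      using qis_injE[OF q] by metis
    then have v: "v \<in> gr M (i - 1)" "v \<in> carrier M" "?r = diff M v" by (auto simp: M.gr_closed)
    have "x = ?r \<oplus>\<^bsub>M\<^esub> diff M w \<oplus>\<^bsub>M\<^esub> diff M y" using c wc yc M.diff_closed[of w] M.diff_closed[of y] by algebra
    also have "\<dots> = diff M (v \<oplus>\<^bsub>M\<^esub> w \<oplus>\<^bsub>M\<^esub> y)" using v wc yc by (simp add: M.diff_add)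
    finally show "\<exists>v\<in>gr M (i - 1). x = diff M v" using v w y M.gr_add by blast
  qed
qed

end

section \<open>Idempotents of degree zero\<close>

text \<open>For an idempotent \<open>e\<close> this is the right ideal eA; in the fixed point form
  no factorisation has to be carried along.\<close>

definition peirce :: "('k, 'a, 'f) dga_scheme \<Rightarrow> 'a \<Rightarrow> 'a set" where
  "peirce A e = {a \<in> carrier A. e \<otimes>\<^bsub>A\<^esub> a = a}"

text \<open>The last clause says that e A^0 is a simple right A^0-module: each nonzero element
  generates \<open>e\<close>. For semisimple A^0 these are the primitive idempotents.\<close>

definition prim_idem :: "('k, 'a, 'f) dga_scheme \<Rightarrow> 'a \<Rightarrow> bool" where
  "prim_idem A e \<longleftrightarrow> e \<in> agr A 0 \<and> e \<otimes>\<^bsub>A\<^esub> e = e \<and> e \<noteq> \<zero>\<^bsub>A\<^esub> \<and>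
     (\<forall>x\<in>agr A 0. e \<otimes>\<^bsub>A\<^esub> x = x \<longrightarrow> x \<noteq> \<zero>\<^bsub>A\<^esub> \<longrightarrow> (\<exists>c\<in>agr A 0. x \<otimes>\<^bsub>A\<^esub> c = e))"

locale pos_dga = dg_algebra k A
  for k :: "('k, 'e) ring_scheme" and A :: "('k, 'a, 'f) dga_scheme" (structure) +
  assumes neg: "i < 0 \<Longrightarrow> agr A i = {\<zero>}"
    and diff_agr0: "a \<in> agr A 0 \<Longrightarrow> adiff A a = \<zero>"
begin

lemma agr0_closed [simp]: "a \<in> agr A 0 \<Longrightarrow> a \<in> carrier A"
  by (rule agr_closed)

lemma agr0_mult: "a \<in> agr A 0 \<Longrightarrow> b \<in> agr A 0 \<Longrightarrow> a \<otimes> b \<in> agr A 0"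
  using mult_gr[of a 0 b 0] by simp

lemma prim_idemD:
  assumes "prim_idem A e"
  shows "e \<in> agr A 0" "e \<in> carrier A" "e \<otimes> e = e" "e \<noteq> \<zero>"
  using assms by (auto simp: prim_idem_def)

text \<open>Schur's lemma for left multiplication by \<open>b\<close>, a nonzero map from e A^0 to
  e' A^0 between simple modules; \<open>c\<close> is the inverse map.\<close>

lemma prim_idem_schur:
  assumes e: "prim_idem A e" and e': "prim_idem A e'"
    and b: "b \<in> agr A 0" "e' \<otimes> b = b" "b \<otimes> e = b" "b \<noteq> \<zero>"
  obtains c where "c \<in> agr A 0" "c \<otimes> e' = c" "b \<otimes> c = e'" "c \<otimes> b = e"
proof -
  note E = prim_idemD[OF e] and E' = prim_idemD[OF e']
  obtain c0 where c0: "c0 \<in> agr A 0" "b \<otimes> c0 = e'" using e' b unfolding prim_idem_def by blast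
  \<comment> \<open>A right inverse \<open>c0\<close> exists by simplicity of e' A^0; it is cut down
    to e A^0 e'.\<close>
  define c where "c = e \<otimes> (c0 \<otimes> e')"
  have c: "c \<in> agr A 0" "e \<otimes> c = c" "c \<otimes> e' = c"
    using c0 E E' by (simp_all add: c_def agr0_mult m_assoc) (simp flip: m_assoc add: E)
  have bc: "b \<otimes> c = e'"
  proof -
    have "b \<otimes> c = b \<otimes> e \<otimes> (c0 \<otimes> e')" unfolding c_def using b(1) c0(1) E(2) E'(2) by (subst m_assoc) simp_all
    also have "\<dots> = b \<otimes> c0 \<otimes> e'" unfolding b(3) using b(1) c0(1) E'(2) by (subst m_assoc) simp_all
    finally show ?thesis using c0 E' by simp
  qed
  \<comment> \<open>\<open>c\<close> is nonzero, hence has a right inverse \<open>d\<close> in turn.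
    Associating b c d in both ways gives b = e' d, and then c b = c d = e.\<close>
  have "c \<noteq> \<zero>" using bc E' b by auto
  then obtain d where d: "d \<in> agr A 0" "c \<otimes> d = e" using e c unfolding prim_idem_def by blast
  have "b = b \<otimes> (c \<otimes> d)" using b d by simp
  also have "\<dots> = b \<otimes> c \<otimes> d" using b(1) c(1) d(1) by (simp add: m_assoc)
  also have "\<dots> = e' \<otimes> d" unfolding bc ..
  finally have "c \<otimes> b = c \<otimes> (e' \<otimes> d)" by simp
  also have "\<dots> = c \<otimes> e' \<otimes> d" using c(1) d(1) E'(2) by (simp only: m_assoc agr0_closed)
  finally have "c \<otimes> b = e" using c d by simp
  with c bc show ?thesis using that by blast
qed

lemma peirce_closed:
  assumes "e \<in> agr A 0" "e \<otimes> e = e"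
  shows "\<zero> \<in> peirce A e" "e \<in> peirce A e" "a \<in> peirce A e \<Longrightarrow> a \<in> carrier A" "a \<in> peirce A e \<Longrightarrow> e \<otimes> a = a"
    "a \<in> carrier A \<Longrightarrow> e \<otimes> a \<in> peirce A e"
    "a \<in> peirce A e \<Longrightarrow> b \<in> peirce A e \<Longrightarrow> a \<oplus> b \<in> peirce A e"
    "a \<in> peirce A e \<Longrightarrow> \<ominus> a \<in> peirce A e"
    "a \<in> peirce A e \<Longrightarrow> b \<in> carrier A \<Longrightarrow> a \<otimes> b \<in> peirce A e"
    "a \<in> peirce A e \<Longrightarrow> adiff A a \<in> peirce A e"
    "a \<in> peirce A e \<Longrightarrow> regular.pr i a \<in> peirce A e"
    "a \<in> peirce A e \<Longrightarrow> koszul A j a \<in> peirce A e"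
proof -
  have ec: "e \<in> carrier A" using assms by simp
  show "\<zero> \<in> peirce A e" "e \<in> peirce A e" "a \<in> peirce A e \<Longrightarrow> a \<in> carrier A" "a \<in> peirce A e \<Longrightarrow> e \<otimes> a = a"
    "a \<in> carrier A \<Longrightarrow> e \<otimes> a \<in> peirce A e"
    "a \<in> peirce A e \<Longrightarrow> b \<in> peirce A e \<Longrightarrow> a \<oplus> b \<in> peirce A e"
    "a \<in> peirce A e \<Longrightarrow> b \<in> carrier A \<Longrightarrow> a \<otimes> b \<in> peirce A e" for a b
    using assms by (auto simp: peirce_def r_distr r_minus m_assoc[symmetric])
  show inv: "\<ominus> a \<in> peirce A e" if "a \<in> peirce A e" for a
    using that ec by (auto simp: peirce_def r_minus)
  then show "a \<in> peirce A e \<Longrightarrow> koszul A j a \<in> peirce A e"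
    by (simp add: koszul_def)
  \<comment> \<open>Since d e = 0 and \<open>e\<close> has degree 0, d (e a) = e (d a) without a
    sign; this is where (P3) makes eA a dg submodule of A.\<close>
  show "adiff A a \<in> peirce A e" if "a \<in> peirce A e"
    using that leibniz[OF assms(1), of a] ec by (auto simp: peirce_def diff_agr0[OF assms(1)] koszul_def)
  have "regular.pr i (e \<otimes> a) = e \<otimes> regular.pr i a" if "a \<in> carrier A" for a
  proof -
    have "a \<in> carrier (regular_dgmod A)" using that by simp
    then show ?thesis
    proof (induction rule: regular.gr_induct)
      case (gr j y)
      then have "y \<in> agr A j" "e \<otimes> y \<in> agr A j" using mult_gr[OF assms(1), of y j] by simp_all
      then show ?case using regular.pr_pure[of y j i] regular.pr_pure[of "e \<otimes> y" j i] ec by simp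
    next
      case (add y z)
      then show ?case using ec regular.pr_add[of y z i] regular.pr_add[of "e \<otimes> y" "e \<otimes> z" i]
          regular.pr_closed[of y i] regular.pr_closed[of z i] by (simp add: r_distr)
    qed
  qed
  then show "a \<in> peirce A e \<Longrightarrow> regular.pr i a \<in> peirce A e"
    using regular.pr_closed[of a i] by (simp add: peirce_def) metis
qed

lemma peirce_submodule:
  assumes "e \<in> agr A 0" "e \<otimes> e = e"
  shows "dg_submodule A (regular_dgmod A) (peirce A e)"
  by (rule dg_submoduleI[OF regular_dg_module]) (simp_all add: subset_eq peirce_closed[OF assms])

lemma agr_neg: "a \<in> agr A i \<Longrightarrow> i < 0 \<Longrightarrow> a = \<zero>"
  using neg by blast

end

section \<open>Cells\<close>

text \<open>The quotient of \<open>N'\<close> by \<open>N\<close> is eA with its generator moved to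
  degree \<open>n\<close>. Freeness is demanded modulo \<open>N\<close>, which yields directness of
  the sum and injectivity of b \<mapsto> s b on eA together.\<close>

definition cell ::
  "('k, 'a, 'f) dga_scheme \<Rightarrow> ('a, 'm) dgmod \<Rightarrow> 'm set \<Rightarrow> 'm \<Rightarrow> 'a \<Rightarrow> int \<Rightarrow> 'm set \<Rightarrow> bool" where
  "cell A M N s e n N' \<longleftrightarrow> dg_submodule A M N \<and> dg_submodule A M N' \<and> N \<subseteq> N' \<and> prim_idem A e \<and>
     s \<in> gr M n \<and> s \<in> N' \<and> ract M s e = s \<and> diff M s \<in> N \<and>
     (\<forall>y\<in>N'. \<exists>x\<in>N. \<exists>b\<in>peirce A e. y = x \<oplus>\<^bsub>M\<^esub> ract M s b) \<and>
     (\<forall>b\<in>peirce A e. ract M s b \<in> N \<longrightarrow> b = \<zero>\<^bsub>A\<^esub>)"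

context pos_dga begin

lemma ract_peirce_diff:
  assumes M: "dg_module A M" and s: "s \<in> gr M n" and b: "b \<in> carrier A"
  shows "diff M (ract M s b) = ract M (diff M s) b \<oplus>\<^bsub>M\<^esub> ract M s (koszul A n (adiff A b))"
proof -
  interpret M: dg_module A M by fact
  show ?thesis using s b by (simp add: M.leibniz M.act_koszul_right M.gr_closed)
qed

lemma ract_pr:
  assumes M: "dg_module A M" and s: "s \<in> gr M n" and b: "b \<in> carrier A"
  shows "dg_module.pr M i (ract M s b) = ract M s (regular.pr (i - n) b)"
proof -
  interpret M: dg_module A M by fact
  have sc: "s \<in> carrier M" using M.gr_closed[OF s] .
  have "b \<in> carrier (regular_dgmod A)" using b by simp
  then show ?thesis
  proof (induction rule: regular.gr_induct)
    case (gr j y)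
    then show ?case using M.act_gr[OF s, of y j] sc
      by (auto simp: M.pr_pure regular.pr_pure[of y j])
  next
    case (add y z)
    then show ?case using sc regular.pr_add[of y z "i - n"] regular.pr_closed[of y "i - n"] regular.pr_closed[of z "i - n"]
      by (simp add: M.act_add_right M.pr_add)
  qed
qed

text \<open>Since \<open>d s\<close> lies in \<open>N\<close>, the Leibniz rule keeps d (s b) inside
  N + s eA, so the sum is closed under the differential.\<close>

lemma cell_sum:
  assumes M: "dg_module A M" and N: "dg_submodule A M N" and e: "prim_idem A e"
    and s: "s \<in> gr M n" "ract M s e = s" "diff M s \<in> N"
    and free: "\<And>b. b \<in> peirce A e \<Longrightarrow> ract M s b \<in> N \<Longrightarrow> b = \<zero>"
  shows "cell A M N s e n {x \<oplus>\<^bsub>M\<^esub> ract M s b |x b. x \<in> N \<and> b \<in> peirce A e}" (is "cell A M N s e n ?S")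
proof -
  interpret M: dg_module A M by fact
  note E = prim_idemD[OF e] and p = peirce_closed[OF prim_idemD(1,3)[OF e]]
  note S = dg_submoduleD[OF M N]
  have sc: "s \<in> carrier M" using M.gr_closed[OF s(1)] .
  have inS: "x \<oplus>\<^bsub>M\<^esub> ract M s b \<in> ?S" if "x \<in> N" "b \<in> peirce A e" for x b using that by blast
  have sub: "dg_submodule A M ?S"
  proof (rule dg_submoduleI[OF M])
    show "?S \<subseteq> carrier M" using S(3) p(3) sc by auto
    show "\<zero>\<^bsub>M\<^esub> \<in> ?S" using inS[OF S(2) p(1)] sc by simp
    fix y assume "y \<in> ?S"
    then obtain x b where y: "y = x \<oplus>\<^bsub>M\<^esub> ract M s b" "x \<in> N" "b \<in> peirce A e" by blast
    have c: "x \<in> carrier M" "b \<in> carrier A" using S(3) p(3) y by simp_all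
    show "y \<oplus>\<^bsub>M\<^esub> z \<in> ?S" if z: "z \<in> ?S" for z
    proof -
      obtain x' b' where z: "z = x' \<oplus>\<^bsub>M\<^esub> ract M s b'" "x' \<in> N" "b' \<in> peirce A e" using z by blast
      have c': "x' \<in> carrier M" "b' \<in> carrier A" using S(3) p(3) z by simp_all
      have "y \<oplus>\<^bsub>M\<^esub> z = (x \<oplus>\<^bsub>M\<^esub> x') \<oplus>\<^bsub>M\<^esub> ract M s (b \<oplus> b')"
        using y z c c' sc by (simp add: M.act_add_right M.a_ac)
      then show ?thesis using inS[OF S(4)[OF y(2) z(2)] p(6)[OF y(3) z(3)]] by (simp only:)
    qed
    have "\<ominus>\<^bsub>M\<^esub> y = \<ominus>\<^bsub>M\<^esub> x \<oplus>\<^bsub>M\<^esub> ract M s (\<ominus> b)" using y c sc by (simp add: M.minus_add M.act_inv_right)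
    then show "\<ominus>\<^bsub>M\<^esub> y \<in> ?S" using inS[OF S(5)[OF y(2)] p(7)[OF y(3)]] by (simp only:)
    show "ract M y a \<in> ?S" if a: "a \<in> carrier A" for a
    proof -
      have "ract M y a = ract M x a \<oplus>\<^bsub>M\<^esub> ract M s (b \<otimes> a)" using y c sc a by (simp add: M.act_add_left M.act_assoc)
      then show ?thesis using inS[OF S(7)[OF y(2) a] p(8)[OF y(3) a]] by (simp only:)
    qed
    have "diff M y = diff M x \<oplus>\<^bsub>M\<^esub> ract M (diff M s) b \<oplus>\<^bsub>M\<^esub> ract M s (koszul A n (adiff A b))"
      using y c sc by (simp add: M.diff_add ract_peirce_diff[OF M s(1)] M.a_assoc)
    then show "diff M y \<in> ?S" using inS[OF S(4)[OF S(8)[OF y(2)] S(7)[OF s(3) c(2)]] p(11)[OF p(9)[OF y(3)]]] by (simp only:)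
    have "M.pr i y = M.pr i x \<oplus>\<^bsub>M\<^esub> ract M s (regular.pr (i - n) b)" for i
      using y c sc by (simp add: M.pr_add ract_pr[OF M s(1)])
    then show "M.pr i y \<in> ?S" for i using inS[OF S(9)[OF y(2)] p(10)[OF y(3)]] by (simp only:)
  qed
  have "N \<subseteq> ?S"
  proof
    fix x assume "x \<in> N"
    then show "x \<in> ?S" using inS[OF _ p(1), of x] S(3) sc by simp
  qed
  moreover have "s \<in> ?S" using inS[OF S(2) p(2)] s sc by simp
  ultimately show ?thesis unfolding cell_def using N sub e s free by blast
qed

end

locale dg_cell = pos_dga k A + M: dg_module A M
  for k :: "('k, 'e) ring_scheme" and A :: "('k, 'a, 'f) dga_scheme" (structure)
    and M :: "('a, 'm) dgmod" +
  fixes N s e n N'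
  assumes cell: "cell A M N s e n N'"
begin

lemma N: "dg_submodule A M N" and N': "dg_submodule A M N'" and sub: "N \<subseteq> N'" and e: "prim_idem A e"
  and s: "s \<in> gr M n" "s \<in> N'" "ract M s e = s" "diff M s \<in> N"
  and gen: "y \<in> N' \<Longrightarrow> \<exists>x\<in>N. \<exists>b\<in>peirce A e. y = x \<oplus>\<^bsub>M\<^esub> ract M s b"
  and free: "b \<in> peirce A e \<Longrightarrow> ract M s b \<in> N \<Longrightarrow> b = \<zero>"
  using cell by (auto simp: cell_def)

lemma sc [simp]: "s \<in> carrier M"
  by (rule M.gr_closed[OF s(1)])

lemmas E = prim_idemD[OF e]
lemmas P = peirce_closed[OF E(1,3)]
lemmas S = dg_submoduleD[OF M.dg_module_axioms N]
lemmas S' = dg_submoduleD[OF M.dg_module_axioms N']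

text \<open>The coordinates of the splitting of \<open>N'\<close> into \<open>N\<close> and s eA.
  \<open>coef\<close> has kernel \<open>N\<close> and is a chain map up to the sign of the shift;
  \<open>base\<close> is linear but fails to be a chain map by
  \<open>ract M (diff M s) (coef y)\<close>.\<close>

definition "coef y = (SOME b. b \<in> peirce A e \<and> (\<exists>x\<in>N. y = x \<oplus>\<^bsub>M\<^esub> ract M s b))"
definition "base y = y \<ominus>\<^bsub>M\<^esub> ract M s (coef y)"

lemma coef_base:
  assumes "y \<in> N'" shows "coef y \<in> peirce A e" "base y \<in> N" "y = base y \<oplus>\<^bsub>M\<^esub> ract M s (coef y)"
proof -
  have "\<exists>b. b \<in> peirce A e \<and> (\<exists>x\<in>N. y = x \<oplus>\<^bsub>M\<^esub> ract M s b)" using gen[OF assms] by blast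
  from someI_ex[OF this] obtain x where x: "coef y \<in> peirce A e" "x \<in> N" "y = x \<oplus>\<^bsub>M\<^esub> ract M s (coef y)"
    unfolding coef_def by blast
  have "base y = (x \<oplus>\<^bsub>M\<^esub> ract M s (coef y)) \<ominus>\<^bsub>M\<^esub> ract M s (coef y)"
    unfolding base_def by (rule arg_cong[OF x(3)])
  also have "\<dots> = x" using S(3)[OF x(2)] M.act_closed[OF sc P(3)[OF x(1)]] by algebra
  finally have "base y = x" .
  with x show "coef y \<in> peirce A e" "base y \<in> N" "y = base y \<oplus>\<^bsub>M\<^esub> ract M s (coef y)" by simp_all
qed

lemma coef_closed: "y \<in> N' \<Longrightarrow> coef y \<in> carrier A"
  using P(3) coef_base by blast

text \<open>The difference of two candidates for the coefficient sends \<open>s\<close> into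
  \<open>N\<close>, so it vanishes by freeness.\<close>

lemma coef_eqI:
  assumes x: "x \<in> N" and b: "b \<in> peirce A e"
  shows "coef (x \<oplus>\<^bsub>M\<^esub> ract M s b) = b" "base (x \<oplus>\<^bsub>M\<^esub> ract M s b) = x"
proof -
  let ?y = "x \<oplus>\<^bsub>M\<^esub> ract M s b"
  have bc: "b \<in> carrier A" "x \<in> carrier M" using P(3) S(3) x b by blast+
  have y: "?y \<in> N'" using x sub S'(4,7) s(2) bc by blast
  note cb = coef_base[OF y]
  have c: "coef ?y \<in> carrier A" "base ?y \<in> carrier M" using P(3) S(3) cb by blast+
  have "ract M s (coef ?y \<ominus> b) = ract M s (coef ?y) \<ominus>\<^bsub>M\<^esub> ract M s b"
    using c bc by (simp add: a_minus_def M.act_add_right M.act_inv_right)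
  also have "\<dots> = x \<ominus>\<^bsub>M\<^esub> base ?y"
  proof -
    have "x \<ominus>\<^bsub>M\<^esub> base ?y = (x \<oplus>\<^bsub>M\<^esub> ract M s b) \<ominus>\<^bsub>M\<^esub> base ?y \<ominus>\<^bsub>M\<^esub> ract M s b"
      using bc c M.act_closed[OF sc bc(1)] by algebra
    also have "\<dots> = (base ?y \<oplus>\<^bsub>M\<^esub> ract M s (coef ?y)) \<ominus>\<^bsub>M\<^esub> base ?y \<ominus>\<^bsub>M\<^esub> ract M s b"
      by (rule arg_cong[OF cb(3)])
    also have "\<dots> = ract M s (coef ?y) \<ominus>\<^bsub>M\<^esub> ract M s b"
      using bc c M.act_closed[OF sc bc(1)] M.act_closed[OF sc c(1)] by algebra
    finally show ?thesis by simp
  qed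
  finally have eq: "ract M s (coef ?y \<ominus> b) = x \<ominus>\<^bsub>M\<^esub> base ?y" .
  moreover have "x \<ominus>\<^bsub>M\<^esub> base ?y \<in> N" using S(6) x cb by blast
  moreover have "coef ?y \<ominus> b \<in> peirce A e" unfolding a_minus_def using P(6,7) b cb by blast
  ultimately have "coef ?y \<ominus> b = \<zero>" using free by simp
  then show 1: "coef ?y = b" using c bc diff_eq_zero by blast
  show "base ?y = x" using eq unfolding 1 using bc c M.diff_eq_zero[of x "base ?y"] by (simp add: a_minus_def r_neg)
qed

lemma coef_N: assumes x: "x \<in> N" shows "coef x = \<zero>" "base x = x"
  using coef_eqI[OF x P(1)] S(3)[OF x] by simp_all

lemma coef_s: "coef s = e" "base s = \<zero>\<^bsub>M\<^esub>"
  using coef_eqI[OF S(2) P(2)] s(3) by simp_all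

lemma mem_N_iff: "y \<in> N' \<Longrightarrow> y \<in> N \<longleftrightarrow> coef y = \<zero>"
  using coef_N coef_base by (metis M.act_zero_right M.r_zero S(3) sc)

lemma coef_add:
  assumes "y \<in> N'" "z \<in> N'"
  shows "coef (y \<oplus>\<^bsub>M\<^esub> z) = coef y \<oplus> coef z" "base (y \<oplus>\<^bsub>M\<^esub> z) = base y \<oplus>\<^bsub>M\<^esub> base z"
proof -
  note cy = coef_base[OF assms(1)] and cz = coef_base[OF assms(2)]
  have "y \<oplus>\<^bsub>M\<^esub> z = (base y \<oplus>\<^bsub>M\<^esub> base z) \<oplus>\<^bsub>M\<^esub> ract M s (coef y \<oplus> coef z)"
  proof -
    have "y \<oplus>\<^bsub>M\<^esub> z = (base y \<oplus>\<^bsub>M\<^esub> ract M s (coef y)) \<oplus>\<^bsub>M\<^esub> (base z \<oplus>\<^bsub>M\<^esub> ract M s (coef z))"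
      by (rule arg_cong2[OF cy(3) cz(3)])
    also have "\<dots> = (base y \<oplus>\<^bsub>M\<^esub> base z) \<oplus>\<^bsub>M\<^esub> ract M s (coef y \<oplus> coef z)"
      using S(3)[OF cy(2)] S(3)[OF cz(2)] P(3)[OF cy(1)] P(3)[OF cz(1)] by (simp add: M.act_add_right M.a_ac)
    finally show ?thesis .
  qed
  then show "coef (y \<oplus>\<^bsub>M\<^esub> z) = coef y \<oplus> coef z" "base (y \<oplus>\<^bsub>M\<^esub> z) = base y \<oplus>\<^bsub>M\<^esub> base z"
    using coef_eqI[OF S(4)[OF cy(2) cz(2)] P(6)[OF cy(1) cz(1)]] by (simp_all only:)
qed

lemma coef_act:
  assumes "y \<in> N'" "a \<in> carrier A"
  shows "coef (ract M y a) = coef y \<otimes> a" "base (ract M y a) = ract M (base y) a"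
proof -
  note cy = coef_base[OF assms(1)]
  have "ract M y a = ract M (base y \<oplus>\<^bsub>M\<^esub> ract M s (coef y)) a" by (rule arg_cong[OF cy(3)])
  also have "\<dots> = ract M (base y) a \<oplus>\<^bsub>M\<^esub> ract M s (coef y \<otimes> a)"
    using assms(2) S(3)[OF cy(2)] P(3)[OF cy(1)] by (simp add: M.act_add_left M.act_assoc)
  finally show "coef (ract M y a) = coef y \<otimes> a" "base (ract M y a) = ract M (base y) a"
    using coef_eqI[OF S(7)[OF cy(2) assms(2)] P(8)[OF cy(1) assms(2)]] by (simp_all only:)
qed

lemma coef_diff:
  assumes "y \<in> N'"
  shows "coef (diff M y) = koszul A n (adiff A (coef y))"
    "base (diff M y) = diff M (base y) \<oplus>\<^bsub>M\<^esub> ract M (diff M s) (coef y)"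
proof -
  note cy = coef_base[OF assms(1)]
  note c = S(3)[OF cy(2)] P(3)[OF cy(1)]
  have "diff M y = diff M (base y \<oplus>\<^bsub>M\<^esub> ract M s (coef y))" by (rule arg_cong[OF cy(3)])
  also have "\<dots> = (diff M (base y) \<oplus>\<^bsub>M\<^esub> ract M (diff M s) (coef y)) \<oplus>\<^bsub>M\<^esub> ract M s (koszul A n (adiff A (coef y)))"
    using c by (simp add: M.diff_add ract_peirce_diff[OF M.dg_module_axioms s(1)] M.a_assoc)
  finally show "coef (diff M y) = koszul A n (adiff A (coef y))"
    "base (diff M y) = diff M (base y) \<oplus>\<^bsub>M\<^esub> ract M (diff M s) (coef y)"
    using coef_eqI[OF S(4)[OF S(8)[OF cy(2)] S(7)[OF s(4) c(2)]] P(11)[OF P(9)[OF cy(1)]]] by (simp_all only:)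
qed

text \<open>The coordinates of \<open>y\<close> and of its projection to degree \<open>i\<close>
  coincide. With (P1) this kills the coefficient of every element of degree below
  \<open>n\<close>.\<close>

lemma coef_gr:
  assumes "y \<in> N'" "y \<in> gr M i"
  shows "coef y \<in> agr A (i - n)" "base y \<in> gr M i"
proof -
  note cy = coef_base[OF assms(1)]
  note c = S(3)[OF cy(2)] P(3)[OF cy(1)]
  have "y = M.pr i y" using assms by (simp add: M.pr_pure)
  also have "\<dots> = M.pr i (base y \<oplus>\<^bsub>M\<^esub> ract M s (coef y))" by (rule arg_cong[OF cy(3)])
  also have "\<dots> = M.pr i (base y) \<oplus>\<^bsub>M\<^esub> ract M s (regular.pr (i - n) (coef y))"
    using c by (simp add: M.pr_add ract_pr[OF M.dg_module_axioms s(1)])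
  finally have "coef y = regular.pr (i - n) (coef y)" "base y = M.pr i (base y)"
    using coef_eqI[OF S(9)[OF cy(2)] P(10)[OF cy(1)], of i "i - n"] by simp_all
  then show "coef y \<in> agr A (i - n)" "base y \<in> gr M i"
    using regular.pr_gr[of "coef y" "i - n"] c M.pr_gr by (simp_all, metis+)
qed

lemma coef_inv: "y \<in> N' \<Longrightarrow> coef (\<ominus>\<^bsub>M\<^esub> y) = \<ominus> coef y"
proof -
  assume y: "y \<in> N'"
  have "coef (\<ominus>\<^bsub>M\<^esub> y) \<oplus> coef y = \<zero>"
    using coef_add(1)[OF S'(5)[OF y] y] S'(3)[OF y] coef_N(1)[OF S(2)] by (simp add: M.l_neg)
  then show ?thesis using minus_equality coef_closed y S'(5) by metis
qed

lemma ract_s_mem: "b \<in> carrier A \<Longrightarrow> ract M s b \<in> N'"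
  using S'(7) s(2) by blast

text \<open>The linear extension of \<open>g\<close> from \<open>N\<close> to \<open>N'\<close> that
  sends the generator \<open>s\<close> to \<open>t\<close>; it restricts correctly once
  \<open>t e = t\<close>.\<close>

definition "ext g T t y = g (base y) \<oplus>\<^bsub>T\<^esub> ract T t (coef y)"

lemma ext_N: assumes "x \<in> N" "t \<in> carrier T" "dg_module A T" "g x \<in> carrier T" shows "ext g T t x = g x"
proof -
  interpret T: dg_module A T by fact
  show ?thesis using assms by (simp add: ext_def coef_N)
qed

context
  fixes T :: "('a, 't) dgmod" and g t
  assumes T: "dg_module A T" and g: "g \<in> rmod_hom A (dg_restrict M N) T"
    and t: "t \<in> carrier T" "ract T t e = t"
begin

interpretation T: dg_module A T by (rule T)

lemma ext_g: "x \<in> N \<Longrightarrow> g x \<in> carrier T" "x \<in> N \<Longrightarrow> y \<in> N \<Longrightarrow> g (x \<oplus>\<^bsub>M\<^esub> y) = g x \<oplus>\<^bsub>T\<^esub> g y"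
  "x \<in> N \<Longrightarrow> a \<in> carrier A \<Longrightarrow> g (ract M x a) = ract T (g x) a"
  using rmod_homD[OF g] by simp_all

lemma ext_s: "ext g T t s = t"
  using rmod_hom_zero[OF g S(10) T] t by (simp add: ext_def coef_s)

lemma ext_rmod_hom: "ext g T t \<in> rmod_hom A (dg_restrict M N') T"
proof -
  have "ext g T t y \<in> carrier T" if y: "y \<in> N'" for y
    using coef_base(2)[OF y] coef_closed[OF y] t ext_g by (simp add: ext_def)
  moreover have "ext g T t (y \<oplus>\<^bsub>M\<^esub> z) = ext g T t y \<oplus>\<^bsub>T\<^esub> ext g T t z" if yz: "y \<in> N'" "z \<in> N'" for y z
    using coef_base(2)[OF yz(1)] coef_base(2)[OF yz(2)] coef_closed yz t
    by (simp add: ext_def coef_add ext_g T.act_add_right T.a_ac)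
  moreover have "ext g T t (ract M y a) = ract T (ext g T t y) a" if ya: "y \<in> N'" "a \<in> carrier A" for y a
    using coef_base(2)[OF ya(1)] coef_closed[OF ya(1)] ya t
    by (simp add: ext_def coef_act ext_g T.act_add_left T.act_assoc)
  ultimately show ?thesis by (auto simp: rmod_hom_def)
qed

text \<open>The offset \<open>j\<close> serves chain maps with j = 0 and homotopies with j =
  -1.\<close>

lemma ext_gr:
  assumes "\<And>i x. x \<in> gr M i \<Longrightarrow> x \<in> N \<Longrightarrow> g x \<in> gr T (i + j)" "t \<in> gr T (n + j)"
    and y: "y \<in> gr M i" "y \<in> N'"
  shows "ext g T t y \<in> gr T (i + j)"
  unfolding ext_def
  using T.gr_add[OF assms(1)[OF coef_gr(2)[OF y(2,1)] coef_base(2)[OF y(2)]], of "ract T t (coef y)"]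
    T.act_gr[OF assms(2) coef_gr(1)[OF y(2,1)]] by (simp add: algebra_simps)

end

text \<open>Cells are free generators subject only to \<open>t e = t\<close>: to extend a chain map
  it suffices that the boundary of the proposed image \<open>t\<close> is the image of the boundary
  of \<open>s\<close>.\<close>

lemma ext_dg_hom:
  assumes g: "g \<in> dg_hom A (dg_restrict M N) T" and t: "t \<in> gr T n" "ract T t e = t" "diff T t = g (diff M s)"
  shows "ext g T t \<in> dg_hom A (dg_restrict M N') T"
proof -
  have T: "dg_module A T" using dg_homD(2)[OF g] .
  interpret T: dg_module A T by fact
  have tc: "t \<in> carrier T" using T.gr_closed[OF t(1)] .
  note gr = dg_hom_rmod[OF g]
  note ext = rmod_homD[OF ext_rmod_hom[OF T gr tc t(2)], simplified]
  show ?thesis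
  proof (rule dg_homI[OF S'(10) T], simp_all add: ext)
    show "ext g T t y \<in> gr T i" if "y \<in> gr M i \<and> y \<in> N'" for i y
      using ext_gr[OF T gr tc t(2), of 0 y i] t(1) dg_homD(6)[OF g] that by simp
    show "ext g T t (diff M y) = diff T (ext g T t y)" if y: "y \<in> N'" for y
    proof -
      note b = coef_base(2)[OF y] and c = coef_closed[OF y]
      have "g (diff M (base y)) = diff T (g (base y))" "g (base y) \<in> carrier T" "g (diff M s) \<in> carrier T"
        "g (diff M (base y)) \<in> carrier T"
        using dg_homD(3,7)[OF g] b S(8)[OF b] s(4) by simp_all
      moreover have "g (diff M (base y) \<oplus>\<^bsub>M\<^esub> ract M (diff M s) (coef y)) = g (diff M (base y)) \<oplus>\<^bsub>T\<^esub> ract T (g (diff M s)) (coef y)"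
        using dg_homD(4,5)[OF g] b S(7,8) s(4) c by simp
      ultimately show ?thesis using tc c
        by (simp add: ext_def coef_diff[OF y] T.diff_add ract_peirce_diff[OF T t(1)] t(3) T.a_assoc)
    qed
  qed
qed

end

section \<open>Chains of cells\<close>

text \<open>The list records only the degrees of the cells, the last attached cell first. Thus
  \<open>sorted_wrt (\<ge>)\<close> expresses that degrees ascend from the bottom to the
  top.\<close>

inductive chain ::
  "('k, 'a, 'f) dga_scheme \<Rightarrow> ('a, 'm) dgmod \<Rightarrow> 'm set \<Rightarrow> int list \<Rightarrow> 'm set \<Rightarrow> bool" for A M N0 where
  chain_nil: "dg_submodule A M N0 \<Longrightarrow> chain A M N0 [] N0"
| chain_cons: "\<lbrakk>chain A M N0 ns N; cell A M N s e n N'\<rbrakk> \<Longrightarrow> chain A M N0 (n # ns) N'"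

definition cellular :: "('k, 'a, 'f) dga_scheme \<Rightarrow> ('a, 'm) dgmod \<Rightarrow> int list \<Rightarrow> bool" where
  "cellular A M ns \<longleftrightarrow> dg_module A M \<and> chain A M {\<zero>\<^bsub>M\<^esub>} ns (carrier M)"

lemma koszul_minus [simp]: "koszul M (- i) x = koszul M i x"
  by (simp add: koszul_def)

context dg_algebra begin

lemma cell_restrict:
  assumes "dg_submodule A M S" "N' \<subseteq> S"
  shows "cell A (dg_restrict M S) N s e n N' \<longleftrightarrow> cell A M N s e n N'"
proof -
  have "S \<subseteq> carrier M" using assms(1) by (simp add: dg_submodule_def)
  then show ?thesis using assms(2) dg_submodule_restrict[of _ S M] unfolding cell_def by auto
qed

lemma cell_image:
  assumes j: "j \<in> dg_hom A Q M" and inj: "inj_on j (carrier Q)" and c: "cell A Q N s e n N'"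
  shows "cell A M (j ` N) (j s) e n (j ` N')"
proof -
  have Q: "dg_module A Q" using dg_homD(1)[OF j] .
  interpret Q: dg_module A Q by fact
  have N: "dg_submodule A Q N" and N': "dg_submodule A Q N'" and e: "prim_idem A e"
    and s: "s \<in> gr Q n" "s \<in> N'" "ract Q s e = s" "diff Q s \<in> N" "N \<subseteq> N'"
    and gen: "\<And>y. y \<in> N' \<Longrightarrow> \<exists>x\<in>N. \<exists>b\<in>peirce A e. y = x \<oplus>\<^bsub>Q\<^esub> ract Q s b"
    and free: "\<And>b. b \<in> peirce A e \<Longrightarrow> ract Q s b \<in> N \<Longrightarrow> b = \<zero>"
    using c by (auto simp: cell_def)
  note S = dg_submoduleD[OF Q N]
  have sc: "s \<in> carrier Q" using Q.gr_closed[OF s(1)] .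
  have pc: "b \<in> carrier A" if "b \<in> peirce A e" for b using that by (simp add: peirce_def)
  have ec: "e \<in> carrier A" using e agr_closed by (auto simp: prim_idem_def)
  show ?thesis unfolding cell_def
  proof (intro conjI ballI impI)
    show "dg_submodule A M (j ` N)" "dg_submodule A M (j ` N')"
      using image_submodule[OF j] N N' by blast+
    show "j ` N \<subseteq> j ` N'" "prim_idem A e" "j s \<in> gr M n" "j s \<in> j ` N'"
      using s e dg_homD(6)[OF j] by auto
    show "ract M (j s) e = j s" using dg_homD(5)[OF j sc ec] s by simp
    show "diff M (j s) \<in> j ` N" using dg_homD(7)[OF j sc] s by (metis imageI)
    show "\<exists>x\<in>j ` N. \<exists>b\<in>peirce A e. y = x \<oplus>\<^bsub>M\<^esub> ract M (j s) b" if y: "y \<in> j ` N'" for y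
    proof -
      obtain x b where x: "x \<in> N" "b \<in> peirce A e" "y = j (x \<oplus>\<^bsub>Q\<^esub> ract Q s b)" using y gen by blast
      then have "y = j x \<oplus>\<^bsub>M\<^esub> ract M (j s) b" using S(3) pc sc by (simp add: dg_homD(4,5)[OF j])
      then show ?thesis using x by blast
    qed
    show "b = \<zero>" if b: "b \<in> peirce A e" "ract M (j s) b \<in> j ` N" for b
    proof -
      have "j (ract Q s b) \<in> j ` N" using b pc sc by (simp add: dg_homD(5)[OF j])
      then have "ract Q s b \<in> N" using inj_on_image_mem_iff[OF inj] S(1) sc pc[OF b(1)] by simp
      then show ?thesis using free b by blast
    qed
  qed
qed

lemma chain_image:
  assumes "chain A Q N0 ns N" and j: "j \<in> dg_hom A Q M" "inj_on j (carrier Q)"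
  shows "chain A M (j ` N0) ns (j ` N)"
  using assms(1)
  by (induction rule: chain.induct)
    (auto intro: chain.intros image_submodule[OF j(1)] cell_image[OF j])

lemma qis_cong:
  assumes q: "qis A f M N" and eq: "\<And>x. x \<in> carrier M \<Longrightarrow> g x = f x"
  shows "qis A g M N"
proof -
  note f = qis_hom[OF q]
  interpret M: dg_module A M using dg_homD(1)[OF f] .
  have g: "g \<in> dg_hom A M N"
    by (rule dg_homI) (use dg_homD(1,2)[OF f] in \<open>simp_all add: eq dg_homD[OF f] M.gr_closed\<close>)
  show ?thesis
  proof (rule qisI[OF g])
    fix i z assume "z \<in> gr N i" "diff N z = \<zero>\<^bsub>N\<^esub>"
    then obtain x w where "x \<in> gr M i" "diff M x = \<zero>\<^bsub>M\<^esub>" "w \<in> gr N (i - 1)" "z = f x \<oplus>\<^bsub>N\<^esub> diff N w"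
      by (rule qis_surjE[OF q])
    then show "\<exists>x\<in>gr M i. diff M x = \<zero>\<^bsub>M\<^esub> \<and> (\<exists>w\<in>gr N (i - 1). z = g x \<oplus>\<^bsub>N\<^esub> diff N w)"
      using eq M.gr_closed by metis
  next
    fix i x w assume x: "x \<in> gr M i" "diff M x = \<zero>\<^bsub>M\<^esub>" "w \<in> gr N (i - 1)" "g x = diff N w"
    then show "\<exists>v\<in>gr M (i - 1). x = diff M v" using qis_injE[OF q x(1,2,3)] eq[OF M.gr_closed[OF x(1)]] by metis
  qed
qed

lemma dg_isos_image:
  assumes j: "j \<in> dg_hom A Q M" and inj: "inj_on j (carrier Q)"
  shows "j \<in> dg_isos A Q (dg_restrict M (j ` carrier Q))"
  using dg_hom_codomain[OF j image_submodule[OF j dg_submodule_carrier]] dg_homD(1)[OF j] inj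
  by (auto simp: dg_isos_def bij_betw_def)

end

section \<open>Attaching cells and lifting through quasi-isomorphisms\<close>

context pos_dga begin

lemma agr_zero [simp]: "\<zero> \<in> agr A i"
  by (rule pj_F_zero[OF apr])

lemma adiff_zero [simp]: "adiff A \<zero> = \<zero>"
  by (rule diff_agr0[OF agr_zero])

lemma dg_cellI: "cell A M N s e n N' \<Longrightarrow> dg_module A M \<Longrightarrow> dg_cell k A M N s e n N'"
  by (intro dg_cell.intro dg_cell_axioms.intro pos_dga_axioms)

text \<open>Because \<open>f s1\<close> is \<open>s2\<close> modulo \<open>N2\<close>, the map
  preserves \<open>coef\<close> and induces the identity of eA on the quotients; the five lemma then
  reduces everything to the submodules.\<close>

lemma cell_qis:
  assumes c1: "cell A M1 N1 s1 e n (carrier M1)" and c2: "cell A M2 N2 s2 e n (carrier M2)"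
    and f: "f \<in> dg_hom A M1 M2" and fN: "\<And>x. x \<in> N1 \<Longrightarrow> f x \<in> N2"
    and v: "v \<in> N2" "f s1 = s2 \<oplus>\<^bsub>M2\<^esub> v"
    and q: "qis A f (dg_restrict M1 N1) (dg_restrict M2 N2)"
  shows "qis A f M1 M2"
proof -
  interpret C: dg_cell k A M1 N1 s1 e n "carrier M1" using dg_cellI[OF c1 dg_homD(1)[OF f]] .
  interpret D: dg_cell k A M2 N2 s2 e n "carrier M2" using dg_cellI[OF c2 dg_homD(2)[OF f]] .
  note fc = dg_homD(3)[OF f]
  have vc: "v \<in> carrier M2" using D.S(3) v by blast
  have coef: "D.coef (f y) = C.coef y" if y: "y \<in> carrier M1" for y
  proof -
    note cb = C.coef_base[OF y] and cc = C.coef_closed[OF y]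
    have bc: "C.base y \<in> carrier M1" "f (C.base y) \<in> carrier M2" using C.S(3)[OF cb(2)] fc by simp_all
    have "f y = f (C.base y \<oplus>\<^bsub>M1\<^esub> ract M1 s1 (C.coef y))" by (rule arg_cong[OF cb(3)])
    also have "\<dots> = f (C.base y) \<oplus>\<^bsub>M2\<^esub> ract M2 (s2 \<oplus>\<^bsub>M2\<^esub> v) (C.coef y)"
      using bc cc by (simp add: dg_homD(4,5)[OF f] v(2))
    also have "\<dots> = (f (C.base y) \<oplus>\<^bsub>M2\<^esub> ract M2 v (C.coef y)) \<oplus>\<^bsub>M2\<^esub> ract M2 s2 (C.coef y)"
      using bc cc vc by (simp add: D.M.act_add_left D.M.a_ac)
    finally show ?thesis
      using D.coef_eqI(1)[OF D.S(4)[OF fN[OF cb(2)] D.S(7)[OF v(1) cc]] cb(1)] by simp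
  qed
  show ?thesis
  proof (rule qis_five[OF f C.N D.N fN q])
    fix i z assume z: "z \<in> gr M2 i" "diff M2 z \<in> N2"
    have zc: "z \<in> carrier M2" using D.M.gr_closed[OF z(1)] .
    let ?c = "D.coef z"
    note cb = D.coef_base[OF zc] and cc = D.coef_closed[OF zc]
    have g: "?c \<in> agr A (i - n)" using D.coef_gr zc z by blast
    let ?y = "ract M1 s1 ?c"
    have "C.coef ?y = ?c" using C.coef_eqI(1)[OF C.S(2) cb(1)] cc by simp
    \<comment> \<open>The boundary of \<open>z\<close> lies in \<open>N2\<close>, so the coefficient
      of \<open>z\<close> is a cycle of eA, and multiplying \<open>s1\<close> by it lifts
      \<open>z\<close> modulo \<open>N2\<close>.\<close>
    have d0: "adiff A ?c = \<zero>"
      using D.coef_diff(1)[OF zc] D.coef_N(1)[OF z(2)] cc by (metis koszul_eq_zero diff_closed)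
    have yc: "?y \<in> carrier M1" using cc by simp
    have "?y \<in> gr M1 i" using C.M.act_gr[OF C.s(1) g] by simp
    moreover have "diff M1 ?y \<in> N1"
      using C.mem_N_iff[of "diff M1 ?y"] C.coef_diff(1)[OF yc] \<open>C.coef ?y = ?c\<close> yc d0 by simp
    moreover have "z \<ominus>\<^bsub>M2\<^esub> f ?y \<in> N2"
    proof -
      have "D.coef (z \<ominus>\<^bsub>M2\<^esub> f ?y) = \<zero>"
        using zc yc fc cc \<open>C.coef ?y = ?c\<close> by (simp add: a_minus_def D.coef_add D.coef_inv coef r_neg)
      then show ?thesis using D.mem_N_iff[of "z \<ominus>\<^bsub>M2\<^esub> f ?y"] zc yc fc by simp
    qed
    ultimately show "\<exists>y\<in>gr M1 i. diff M1 y \<in> N1 \<and> (\<exists>w\<in>gr M2 (i - 1). z \<ominus>\<^bsub>M2\<^esub> f y \<ominus>\<^bsub>M2\<^esub> diff M2 w \<in> N2)"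
      using D.S(3) by (intro bexI[of _ ?y] conjI bexI[of _ "\<zero>\<^bsub>M2\<^esub>"]) (simp_all add: D.M.minus_eq)
  next
    fix i z w assume z: "z \<in> gr M1 i" "diff M1 z \<in> N1" "w \<in> gr M2 (i - 1)" "f z \<ominus>\<^bsub>M2\<^esub> diff M2 w \<in> N2"
    have zc: "z \<in> carrier M1" "w \<in> carrier M2" using C.M.gr_closed[OF z(1)] D.M.gr_closed[OF z(3)] .
    let ?c = "D.coef w"
    note cb = D.coef_base[OF zc(2)] and cc = D.coef_closed[OF zc(2)]
    have "D.coef (f z \<ominus>\<^bsub>M2\<^esub> diff M2 w) = \<zero>" using D.coef_N(1)[OF z(4)] .
    then have "C.coef z \<ominus> koszul A n (adiff A ?c) = \<zero>"
      using zc fc by (simp add: a_minus_def D.coef_add D.coef_inv D.coef_diff coef)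
    then have eq: "C.coef z = koszul A n (adiff A ?c)"
      using C.coef_closed[OF zc(1)] cc diff_eq_zero by simp
    let ?y = "ract M1 s1 ?c"
    have yc: "?y \<in> carrier M1" using cc by simp
    have cy: "C.coef ?y = ?c" using C.coef_eqI(1)[OF C.S(2) cb(1)] cc by simp
    have "?y \<in> gr M1 (i - 1)" using C.M.act_gr[OF C.s(1) D.coef_gr(1)[OF zc(2) z(3)]] by simp
    moreover have "C.coef (z \<ominus>\<^bsub>M1\<^esub> diff M1 ?y) = \<zero>"
      using zc yc cy cc eq by (simp add: a_minus_def C.coef_add C.coef_inv C.coef_diff r_neg)
    then have "z \<ominus>\<^bsub>M1\<^esub> diff M1 ?y \<in> N1" using C.mem_N_iff[of "z \<ominus>\<^bsub>M1\<^esub> diff M1 ?y"] zc yc by simp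
    ultimately show "\<exists>w\<in>gr M1 (i - 1). z \<ominus>\<^bsub>M1\<^esub> diff M1 w \<in> N1" by blast
  qed
qed

text \<open>The shift by \<open>- n\<close> puts the generator \<open>e\<close> in degree \<open>n\<close>.\<close>

definition cell_mod :: "'a \<Rightarrow> int \<Rightarrow> ('a, 'a) dgmod" where
  "cell_mod e n = dg_shift (- n) (dg_restrict (regular_dgmod A) (peirce A e))"

lemma cell_mod_sel [simp]:
  "carrier (cell_mod e n) = peirce A e" "\<zero>\<^bsub>(cell_mod e n)\<^esub> = \<zero>"
  "x \<oplus>\<^bsub>(cell_mod e n)\<^esub> y = x \<oplus> y" "ract (cell_mod e n) x a = x \<otimes> a"
  "gr (cell_mod e n) i = agr A (i - n) \<inter> peirce A e"
  by (simp_all add: cell_mod_def)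

context
  fixes e assumes e: "e \<in> agr A 0" "e \<otimes> e = e"
begin

lemma cell_mod_dg_module: "dg_module A (cell_mod e n)"
  unfolding cell_mod_def
  by (intro shift_dg_module dg_submoduleD(10)[OF regular_dg_module peirce_submodule[OF e]])

lemma cell_mod_inv: "x \<in> peirce A e \<Longrightarrow> \<ominus>\<^bsub>(cell_mod e n)\<^esub> x = \<ominus> x"
  unfolding cell_mod_def
  using dg_submoduleD(11)[OF regular_dg_module peirce_submodule[OF e]] by simp

lemma cell_mod_diff: "x \<in> peirce A e \<Longrightarrow> diff (cell_mod e n) x = koszul A n (adiff A x)"
  unfolding cell_mod_def
  using dg_submoduleD(13)[OF regular_dg_module peirce_submodule[OF e] peirce_closed(9)[OF e], of x] by simp

lemma cell_mod_hom:
  assumes M: "dg_module A M" and z: "z \<in> gr M n" "diff M z = \<zero>\<^bsub>M\<^esub>"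
  shows "(\<lambda>b. ract M z b) \<in> dg_hom A (cell_mod e n) M"
proof -
  interpret M: dg_module A M by fact
  note P = peirce_closed[OF e]
  have zc: "z \<in> carrier M" using M.gr_closed[OF z(1)] .
  show ?thesis
  proof (rule dg_homI[OF cell_mod_dg_module M])
    fix i x assume "x \<in> gr (cell_mod e n) i"
    then show "ract M z x \<in> gr M i" using M.act_gr[OF z(1), of x "i - n"] by simp
  next
    fix x assume "x \<in> carrier (cell_mod e n)"
    then have x: "x \<in> peirce A e" by simp
    then show "ract M z (diff (cell_mod e n) x) = diff M (ract M z x)"
      using ract_peirce_diff[OF M z(1) P(3)[OF x]] z(2) zc P(3)[OF x] by (simp add: cell_mod_diff)
  qed (use zc P(3) in \<open>simp_all add: M.act_add_right M.act_assoc\<close>)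
qed

end

text \<open>The cone of the map from a shifted eA to \<open>Q\<close> that sends the generator
  \<open>e\<close> to \<open>z\<close>. A cone lowers the degrees of the source by one: the source
  is generated in degree n + 1 and the new cell has degree n.\<close>

lemma attach_cone:
  fixes Q :: "('a, 'q) dgmod"
  assumes Q: "dg_module A Q" and e: "prim_idem A e"
    and z: "z \<in> gr Q (n + 1)" "diff Q z = \<zero>\<^bsub>Q\<^esub>" "ract Q z e = z"
  defines "C \<equiv> dg_cone (cell_mod e (n + 1)) (\<lambda>b. ract Q z b) Q"
  shows "dg_module A C" "(\<lambda>x. (x, \<zero>)) \<in> dg_hom A Q C"
    "cell A C ((\<lambda>x. (x, \<zero>)) ` carrier Q) (\<zero>\<^bsub>Q\<^esub>, e) e n (carrier C)"
    "diff C (\<zero>\<^bsub>Q\<^esub>, e) = (z, \<zero>)"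
proof -
  interpret Q: dg_module A Q by fact
  note E = prim_idemD[OF e]
  note P = peirce_closed[OF E(1,3)]
  have zc: "z \<in> carrier Q" using Q.gr_closed[OF z(1)] .
  show C: "dg_module A C" unfolding C_def
    by (rule cone_dg_module[OF cell_mod_hom[OF E(1,3) Q z(1,2)]])
  interpret C: dg_module A C by fact
  let ?j = "\<lambda>x. (x, \<zero>)"
  show j: "?j \<in> dg_hom A Q C"
    by (rule dg_homI[OF Q C])
      (simp_all add: C_def P cell_mod_diff[OF E(1,3)] cell_mod_inv[OF E(1,3)] zc)
  have de: "adiff A e = \<zero>" using diff_agr0[OF E(1)] .
  show ds: "diff C (\<zero>\<^bsub>Q\<^esub>, e) = (z, \<zero>)"
    using zc z(3) by (simp add: C_def P(1,2) cell_mod_diff[OF E(1,3)] cell_mod_inv[OF E(1,3)] de)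
  have N: "dg_submodule A C (?j ` carrier Q)" by (rule image_submodule[OF j dg_submodule_carrier[OF Q]])
  show "cell A C (?j ` carrier Q) (\<zero>\<^bsub>Q\<^esub>, e) e n (carrier C)"
    unfolding cell_def
  proof (intro conjI ballI impI)
    show "(\<zero>\<^bsub>Q\<^esub>, e) \<in> gr C n" using E P by (simp add: C_def)
    show "(\<zero>\<^bsub>Q\<^esub>, e) \<in> carrier C" using P by (simp add: C_def)
    show "ract C (\<zero>\<^bsub>Q\<^esub>, e) e = (\<zero>\<^bsub>Q\<^esub>, e)" using E by (simp add: C_def)
    show "diff C (\<zero>\<^bsub>Q\<^esub>, e) \<in> ?j ` carrier Q" using ds zc by simp
    show "\<exists>x\<in>?j ` carrier Q. \<exists>b\<in>peirce A e. y = x \<oplus>\<^bsub>C\<^esub> ract C (\<zero>\<^bsub>Q\<^esub>, e) b" if y: "y \<in> carrier C" for y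
    proof -
      obtain x b where y: "y = (x, b)" "x \<in> carrier Q" "b \<in> peirce A e" using y by (auto simp: C_def)
      then have "y = (x, \<zero>) \<oplus>\<^bsub>C\<^esub> ract C (\<zero>\<^bsub>Q\<^esub>, e) b" using P by (simp add: C_def)
      then show ?thesis using y by blast
    qed
    show "b = \<zero>" if "b \<in> peirce A e" "ract C (\<zero>\<^bsub>Q\<^esub>, e) b \<in> ?j ` carrier Q" for b
      using that P(4) by (auto simp: C_def)
  qed (use N dg_submodule_carrier[OF C] e C.dg_module_axioms dg_submoduleD(1)[OF C N] in auto)
qed

text \<open>Lifts \<open>f\<close> through \<open>s\<close> one cell at a time, up to a homotopy
  \<open>h\<close> that is built along with it. Injectivity of \<open>s\<close> on cohomology
  removes the obstruction to extending the lift over a cell; surjectivity then adjusts the extension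
  by a cycle so that the homotopy extends too.\<close>

lemma chain_lift:
  fixes P :: "('a, 'p) dgmod" and M :: "('a, 'm) dgmod" and T :: "('a, 't) dgmod"
  assumes P: "dg_module A P" and s: "qis A s M T"
    and "chain A P {\<zero>\<^bsub>P\<^esub>} ns N" "f \<in> dg_hom A (dg_restrict P N) T"
  shows "\<exists>g h. g \<in> dg_hom A (dg_restrict P N) M \<and> h \<in> rmod_hom A (dg_restrict P N) T \<and>
    (\<forall>i. \<forall>x\<in>gr P i \<inter> N. h x \<in> gr T (i - 1)) \<and>
    (\<forall>x\<in>N. s (g x) = f x \<oplus>\<^bsub>T\<^esub> (diff T (h x) \<oplus>\<^bsub>T\<^esub> h (diff P x)))"
  using assms(3,4)
proof (induction arbitrary: f rule: chain.induct)
  case chain_nil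
  interpret P: dg_module A P by fact
  note sh = qis_hom[OF s]
  interpret M: dg_module A M using dg_homD(1)[OF sh] .
  interpret T: dg_module A T using dg_homD(2)[OF sh] .
  have "(\<lambda>x. \<zero>\<^bsub>M\<^esub>) \<in> dg_hom A (dg_restrict P {\<zero>\<^bsub>P\<^esub>}) M"
    by (rule dg_homI[OF dg_submoduleD(10)[OF P dg_submodule_zero[OF P]] M.dg_module_axioms]) auto
  moreover have "(\<lambda>x. \<zero>\<^bsub>T\<^esub>) \<in> rmod_hom A (dg_restrict P {\<zero>\<^bsub>P\<^esub>}) T" by (simp add: rmod_hom_def)
  ultimately show ?case
    using dg_hom_zero[OF sh] dg_hom_zero[OF chain_nil(2)]
    by (intro exI[of _ "\<lambda>x. \<zero>\<^bsub>M\<^esub>"] exI[of _ "\<lambda>x. \<zero>\<^bsub>T\<^esub>"]) simp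
next
  case (chain_cons ns N t e n N')
  note sh = qis_hom[OF s] and f = chain_cons.prems
  interpret C: dg_cell k A P N t e n N' using dg_cellI[OF chain_cons.hyps(2) P] .
  have M: "dg_module A M" and T: "dg_module A T" using dg_homD[OF sh] by auto
  interpret M: dg_module A M by fact
  interpret T: dg_module A T by fact
  have fN: "f \<in> dg_hom A (dg_restrict P N) T"
    using dg_hom_restrict[OF f, of N] dg_submodule_restrict[OF C.sub C.S'(1)] dg_restrict_restrict[OF C.sub, of P] C.N
    by simp
  obtain g h where g: "g \<in> dg_hom A (dg_restrict P N) M" and h: "h \<in> rmod_hom A (dg_restrict P N) T"
    and hgr: "\<And>i x. x \<in> gr P i \<Longrightarrow> x \<in> N \<Longrightarrow> h x \<in> gr T (i - 1)"
    and sg: "\<And>x. x \<in> N \<Longrightarrow> s (g x) = f x \<oplus>\<^bsub>T\<^esub> (diff T (h x) \<oplus>\<^bsub>T\<^esub> h (diff P x))"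
    using chain_cons.IH[OF fN] by auto
  have gN: "g x \<in> carrier M" "h x \<in> carrier T" "f x \<in> carrier T" if "x \<in> N" for x
    using dg_homD(3)[OF g, of x] rmod_homD(1)[OF h, of x] dg_homD(3)[OF fN, of x] that by simp_all
  have fN': "f x \<in> carrier T" if "x \<in> N'" for x using dg_homD(3)[OF f, of x] that by simp
  \<comment> \<open>\<open>u\<close> is the attaching cycle of the new cell; the cell can be lifted
    exactly if \<open>g u\<close> bounds in \<open>M\<close>.\<close>
  define u where "u = diff P t"
  have u: "u \<in> N" "u \<in> gr P (n + 1)" "diff P u = \<zero>\<^bsub>P\<^esub>" "u \<in> carrier P" "u \<in> N'"
    using C.s C.M.diff_gr C.M.diff_diff C.S(3) C.sub by (auto simp: u_def)
  have ue: "ract P u e = u"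
    using ract_peirce_diff[OF P C.s(1) C.E(2)] C.s(3) diff_agr0[OF C.E(1)] u C.E(2) by (simp add: u_def)
  have act0: "diff M (ract M y e) = ract M (diff M y) e" if "y \<in> gr M i" for y i
    using ract_peirce_diff[OF M that C.E(2)] that M.gr_closed[OF that] diff_agr0[OF C.E(1)] C.E(2) by simp
  have act0T: "diff T (ract T y e) = ract T (diff T y) e" if "y \<in> gr T i" for y i
    using ract_peirce_diff[OF T that C.E(2)] that T.gr_closed[OF that] diff_agr0[OF C.E(1)] C.E(2) by simp
  have gu: "g u \<in> gr M (n + 1)" "diff M (g u) = \<zero>\<^bsub>M\<^esub>" "ract M (g u) e = g u"
    using dg_homD(6)[OF g, of u "n + 1"] dg_homD(7)[OF g, of u] dg_homD(5)[OF g, of u e] dg_hom_zero[OF g] u C.E(2) ue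
    by simp_all
  have hu: "h u \<in> gr T n" "ract T (h u) e = h u" "h u \<in> carrier T"
    using hgr[OF u(2,1)] rmod_homD(3)[OF h, of u e] u ue C.E(2) gN by simp_all
  have ft: "f t \<in> gr T n" "ract T (f t) e = f t" "diff T (f t) = f u" "f t \<in> carrier T" "f u \<in> carrier T"
    using dg_homD(6)[OF f, of t n] dg_homD(5)[OF f, of t e] dg_homD(7)[OF f, of t] C.s C.E(2) fN' gN u by (simp_all add: u_def)
  \<comment> \<open>By the homotopy on \<open>N\<close> and d u = 0, the image of the obstruction is
    a boundary in \<open>T\<close>, so the obstruction itself bounds some \<open>y\<close>.\<close>
  have "s (g u) = diff T (f t \<oplus>\<^bsub>T\<^esub> h u)"
    using sg[OF u(1)] ft hu rmod_hom_zero[OF h C.S(10) T] u by (simp add: T.diff_add)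
  moreover have "f t \<oplus>\<^bsub>T\<^esub> h u \<in> gr T (n + 1 - 1)" using ft hu T.gr_add by simp
  ultimately obtain y where y: "y \<in> gr M (n + 1 - 1)" "g u = diff M y"
    using qis_injE[OF s gu(1,2)] by metis
  then have y: "y \<in> gr M n" "g u = diff M y" "y \<in> carrier M" "s y \<in> carrier T"
    using M.gr_closed dg_homD(3)[OF sh] by auto
  \<comment> \<open>\<open>r\<close> measures how far \<open>y\<close> is from lifting f t + h u. It
    is a cycle, hence s x + d w for a cycle \<open>x\<close>: the corrected lift is y - x, and
    \<open>w\<close> becomes the value of the homotopy on the new generator.\<close>
  define r where "r = s y \<ominus>\<^bsub>T\<^esub> (f t \<oplus>\<^bsub>T\<^esub> h u)"
  have "r \<in> gr T n" using dg_homD(6)[OF sh y(1)] ft hu by (simp add: r_def T.gr_add T.gr_minus)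
  then have r: "r \<in> gr T n" "diff T r = \<zero>\<^bsub>T\<^esub>"
    using dg_homD(6)[OF sh y(1)] ft hu y dg_homD(7)[OF sh y(3)] \<open>s (g u) = diff T (f t \<oplus>\<^bsub>T\<^esub> h u)\<close>
    by (simp_all add: r_def T.minus_eq T.diff_add T.diff_inv T.r_neg)
  obtain x w where x: "x \<in> gr M n" "diff M x = \<zero>\<^bsub>M\<^esub>" "w \<in> gr T (n - 1)" "r = s x \<oplus>\<^bsub>T\<^esub> diff T w"
    using qis_surjE[OF s r] .
  have xc: "x \<in> carrier M" "w \<in> carrier T" "s x \<in> carrier T"
    using M.gr_closed[OF x(1)] T.gr_closed[OF x(3)] dg_homD(3)[OF sh] by auto
  \<comment> \<open>Images of \<open>t\<close> have to be fixed by \<open>e\<close>. Multiplying by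
    \<open>e\<close> achieves this and commutes with the differential, because d e = 0.\<close>
  define m where "m = ract M (y \<ominus>\<^bsub>M\<^esub> x) e"
  define w' where "w' = ract T w e"
  have yx: "y \<ominus>\<^bsub>M\<^esub> x \<in> gr M n" using y x M.gr_minus by simp
  have "diff M (y \<ominus>\<^bsub>M\<^esub> x) = g u" using y xc x by (simp add: M.minus_eq M.diff_add M.diff_inv)
  then have m: "m \<in> gr M n" "m \<in> carrier M" "ract M m e = m" "diff M m = g u"
    using M.act_gr[OF yx C.E(1)] M.gr_closed[OF yx] C.E gu
    by (simp_all add: m_def M.act_assoc act0[OF yx])
  have w': "w' \<in> gr T (n - 1)" "w' \<in> carrier T" "ract T w' e = w'" "diff T w' = ract T (diff T w) e"
    using T.act_gr[OF x(3) C.E(1)] xc C.E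
    by (simp_all add: w'_def T.act_assoc act0T[OF x(3)])
  have sm: "s m = f t \<oplus>\<^bsub>T\<^esub> (diff T w' \<oplus>\<^bsub>T\<^esub> h u)"
  proof -
    have "s (y \<ominus>\<^bsub>M\<^esub> x) = s y \<ominus>\<^bsub>T\<^esub> s x" using y xc by (simp add: dg_hom_minus[OF sh])
    also have "\<dots> = r \<oplus>\<^bsub>T\<^esub> (f t \<oplus>\<^bsub>T\<^esub> h u) \<ominus>\<^bsub>T\<^esub> s x" unfolding r_def using y ft hu xc by algebra
    also have "\<dots> = f t \<oplus>\<^bsub>T\<^esub> (diff T w \<oplus>\<^bsub>T\<^esub> h u)" unfolding x(4) using ft hu xc T.diff_closed[OF xc(2)] by algebra
    finally have "s m = ract T (f t \<oplus>\<^bsub>T\<^esub> (diff T w \<oplus>\<^bsub>T\<^esub> h u)) e"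
      using y xc C.E(2) by (simp add: m_def dg_homD(5)[OF sh])
    then show ?thesis using ft hu xc C.E(2) w' by (simp add: T.act_add_left)
  qed
  let ?g = "C.ext g M m" and ?h = "C.ext h T w'"
  have 1: "?g \<in> dg_hom A (dg_restrict P N') M" using C.ext_dg_hom[OF g m(1,3)] m(4) by (simp add: u_def)
  have 2: "?h \<in> rmod_hom A (dg_restrict P N') T" using C.ext_rmod_hom[OF T h w'(2,3)] .
  have 3: "?h x \<in> gr T (i - 1)" if "x \<in> gr P i \<inter> N'" for i x
    using C.ext_gr[OF T h w'(2,3), of "-1" x i] hgr w'(1) that by simp
  have 4: "s (?g x) = f x \<oplus>\<^bsub>T\<^esub> (diff T (?h x) \<oplus>\<^bsub>T\<^esub> ?h (diff P x))" if x: "x \<in> N'" for x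
  proof -
    let ?b = "C.base x" and ?c = "C.coef x"
    note cb = C.coef_base[OF x] and c = C.coef_closed[OF x]
    have bN: "?b \<in> N" "diff P ?b \<in> N" "?b \<in> carrier P" "?b \<in> N'" using cb C.S(3,8) C.sub by auto
    note bT = gN[OF bN(1)] gN(2)[OF bN(2)]
    have "s (?g x) = s (g ?b) \<oplus>\<^bsub>T\<^esub> ract T (s m) ?c"
      using bT m c by (simp add: C.ext_def dg_homD(4,5)[OF sh])
    also have "\<dots> = (f ?b \<oplus>\<^bsub>T\<^esub> (diff T (h ?b) \<oplus>\<^bsub>T\<^esub> h (diff P ?b))) \<oplus>\<^bsub>T\<^esub>
       (ract T (f t) ?c \<oplus>\<^bsub>T\<^esub> (ract T (diff T w') ?c \<oplus>\<^bsub>T\<^esub> ract T (h u) ?c))"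
      unfolding sm sg[OF bN(1)] using ft hu w'(2) c by (simp add: T.act_add_left)
    finally have L: "s (?g x) = \<dots>" .
    have "f x = f (?b \<oplus>\<^bsub>P\<^esub> ract P t ?c)" by (rule arg_cong[OF cb(3)])
    also have "\<dots> = f ?b \<oplus>\<^bsub>T\<^esub> ract T (f t) ?c"
      using dg_homD(4)[OF f, of ?b "ract P t ?c"] dg_homD(5)[OF f, of t ?c] bN C.s C.ract_s_mem c by simp
    finally have F: "f x = \<dots>" .
    let ?k = "koszul T n (ract T w' (adiff A ?c))"
    have "diff T (?h x) = diff T (h ?b) \<oplus>\<^bsub>T\<^esub> (ract T (diff T w') ?c \<oplus>\<^bsub>T\<^esub> koszul T (n - 1) (ract T w' (adiff A ?c)))"
      using bT w' c by (simp add: C.ext_def T.diff_add T.leibniz)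
    \<comment> \<open>The homotopy value has degree n - 1, so its Leibniz sign is opposite to the
      one that \<open>coef_diff\<close> contributes to \<open>?h (diff P x)\<close>; the two terms
      \<open>?k\<close> cancel.\<close>
    also have "koszul T (n - 1) (ract T w' (adiff A ?c)) = \<ominus>\<^bsub>T\<^esub> ?k"
      using w'(2) c T.koszul_plus_one[of "ract T w' (adiff A ?c)" "n - 1"] by simp
    finally have H1: "diff T (?h x) = diff T (h ?b) \<oplus>\<^bsub>T\<^esub> (ract T (diff T w') ?c \<oplus>\<^bsub>T\<^esub> \<ominus>\<^bsub>T\<^esub> ?k)" .
    have "h (diff P ?b \<oplus>\<^bsub>P\<^esub> ract P u ?c) = h (diff P ?b) \<oplus>\<^bsub>T\<^esub> ract T (h u) ?c"
      using rmod_homD(2)[OF h, of "diff P ?b" "ract P u ?c"] rmod_homD(3)[OF h, of u ?c] bN u C.S(7) c by simp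
    then have H2: "?h (diff P x) = h (diff P ?b) \<oplus>\<^bsub>T\<^esub> ract T (h u) ?c \<oplus>\<^bsub>T\<^esub> ?k"
      using w' c by (simp add: C.ext_def C.coef_diff[OF x] T.act_koszul_right flip: u_def)
    note * = bT ft(4) hu(3) w'(2) c T.diff_closed[OF bT(2)] T.act_closed[OF ft(4) c] T.act_closed[OF hu(3) c]
       T.act_closed[OF T.diff_closed[OF w'(2)] c] T.koszul_closed[OF T.act_closed[OF w'(2) diff_closed[OF c]], of n]
    show ?thesis unfolding L F H1 H2 using * by algebra
  qed
  show ?case using 1 2 3 4 by blast
qed

end

section \<open>Minimal models\<close>

text \<open>The type token \<open>U\<close> fixes where the cellular module lives, while
  \<open>X\<close> may have any type; cones and sums thus have models without being copied
  first.\<close>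

definition model ::
  "('k, 'a, 'f) dga_scheme \<Rightarrow> 'm itself \<Rightarrow> ('a, 'x) dgmod \<Rightarrow> int list \<Rightarrow> bool" where
  "model A U X ns \<longleftrightarrow> sorted_wrt (\<ge>) ns \<and>
     (\<exists>(Q :: ('a, 'm) dgmod) q. cellular A Q ns \<and> qis A q Q X)"

locale dg_universe = pos_dga k A
  for k :: "('k, 'e) ring_scheme" and A :: "('k, 'a, 'f) dga_scheme" (structure) +
  fixes U :: "'m itself"
  assumes infinite_universe: "infinite (UNIV :: 'm set)"
    and algebra_lepoll: "carrier A \<lesssim> (UNIV :: 'm set)"
begin

text \<open>The square of an infinite cardinal is the cardinal itself; this keeps cones inside the
  universe.\<close>

lemma times_lepoll_universe:
  assumes "X \<lesssim> (UNIV :: 'm set)" "Y \<lesssim> (UNIV :: 'm set)"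
  shows "X \<times> Y \<lesssim> (UNIV :: 'm set)"
proof -
  have "(UNIV :: 'm set) \<times> (UNIV :: 'm set) \<lesssim> (UNIV :: 'm set)"
  proof -
    have "|(UNIV :: 'm set) \<times> (UNIV :: 'm set)| =o |UNIV :: 'm set|"
      using card_of_Times_same_infinite[OF infinite_universe] .
    then have "\<exists>f. bij_betw f ((UNIV :: 'm set) \<times> (UNIV :: 'm set)) (UNIV :: 'm set)"
      by (simp add: card_of_ordIso)
    then show ?thesis using eqpoll_imp_lepoll unfolding eqpoll_def by blast
  qed
  then show ?thesis using times_lepoll_mono[OF assms] lepoll_trans by blast
qed

text \<open>The cone that attaches the cell lives on a product type, but its carrier is bounded by
  the product of \<open>Q\<close> and A, so it is replaced by a copy on \<open>'m\<close>; the
  inclusion of \<open>Q\<close> turns into the injection \<open>j\<close>.\<close>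

lemma attach:
  fixes Q :: "('a, 'm) dgmod"
  assumes Q: "dg_module A Q" and e: "prim_idem A e"
    and z: "z \<in> gr Q (n + 1)" "diff Q z = \<zero>\<^bsub>Q\<^esub>" "ract Q z e = z"
  obtains Q' :: "('a, 'm) dgmod" and j s where
    "j \<in> dg_hom A Q Q'" "inj_on j (carrier Q)" "cell A Q' (j ` carrier Q) s e n (carrier Q')" "diff Q' s = j z"
proof -
  let ?C = "dg_cone (cell_mod e (n + 1)) (\<lambda>b. ract Q z b) Q" and ?i = "\<lambda>x. (x, \<zero>)"
  note C = attach_cone[OF Q e z]
  have "carrier ?C \<subseteq> carrier Q \<times> carrier A" by (auto simp: peirce_def)
  then have "carrier ?C \<lesssim> (UNIV :: 'm set)"
    using times_lepoll_universe[OF subset_imp_lepoll[OF subset_UNIV] algebra_lepoll] subset_imp_lepoll lepoll_trans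
    by blast
  then obtain Q' :: "('a, 'm) dgmod" and \<phi> where \<phi>: "\<phi> \<in> dg_isos A Q' ?C"
    using copy_exists[OF C(1)] by blast
  define \<psi> where "\<psi> = inv_into (carrier Q') \<phi>"
  have \<psi>: "\<psi> \<in> dg_isos A ?C Q'" using dg_isos_inv[OF \<phi>] by (simp add: \<psi>_def)
  note \<psi>h = dg_isosD(1)[OF \<psi>]
  have \<psi>i: "inj_on \<psi> (carrier ?C)" and \<psi>c: "\<psi> ` carrier ?C = carrier Q'"
    using dg_isosD(2)[OF \<psi>] by (auto simp: bij_betw_def)
  have "\<zero> \<in> peirce A e" "e \<in> peirce A e" using peirce_closed[OF prim_idemD(1,3)[OF e]] by auto
  then have ic: "?i ` carrier Q \<subseteq> carrier ?C" "(\<zero>\<^bsub>Q\<^esub>, e) \<in> carrier ?C"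
    using abelian_group.axioms(1) dg_homD(3)[OF C(2)]
      abelian_monoid.zero_closed[OF abelian_group.axioms(1)[OF right_module.abelian_group[OF dg_module.right_module[OF Q]]]]
    by auto
  have "\<psi> \<circ> ?i \<in> dg_hom A Q Q'" using dg_hom_comp[OF C(2) \<psi>h] .
  moreover have "inj_on (\<psi> \<circ> ?i) (carrier Q)"
    by (rule comp_inj_on) (use inj_on_subset[OF \<psi>i ic(1)] in \<open>auto simp: inj_on_def\<close>)
  moreover have "cell A Q' ((\<psi> \<circ> ?i) ` carrier Q) (\<psi> (\<zero>\<^bsub>Q\<^esub>, e)) e n (carrier Q')"
    using cell_image[OF \<psi>h \<psi>i C(3)] by (simp only: \<psi>c image_comp)
  moreover have "diff Q' (\<psi> (\<zero>\<^bsub>Q\<^esub>, e)) = (\<psi> \<circ> ?i) z"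
    using dg_homD(7)[OF \<psi>h ic(2)] C(4) by simp
  ultimately show ?thesis by (rule that)
qed

text \<open>Attaching a cell to the source and to the target of a quasi-isomorphism; \<open>z\<close> is the
  boundary of the new cell of \<open>Q\<close> and \<open>w\<close> corrects the image of that cell.\<close>

lemma attach_qis:
  fixes Q :: "('a, 'm) dgmod" and M :: "('a, 'x) dgmod"
  assumes q: "qis A q Q (dg_restrict M N)" and c: "cell A M N s e n (carrier M)" and M: "dg_module A M"
  obtains Q' :: "('a, 'm) dgmod" and j t q' z w where
    "j \<in> dg_hom A Q Q'" "inj_on j (carrier Q)" "cell A Q' (j ` carrier Q) t e n (carrier Q')" "diff Q' t = j z"
    "qis A q' Q' M" "\<And>x. x \<in> carrier Q \<Longrightarrow> q' (j x) = q x"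
    "z \<in> carrier Q" "w \<in> N" "diff M s = q z \<oplus>\<^bsub>M\<^esub> diff M w"
proof -
  interpret D: dg_cell k A M N s e n "carrier M" using dg_cellI[OF c M] .
  note qh = qis_hom[OF q]
  have Q: "dg_module A Q" using dg_homD(1)[OF qh] .
  interpret Q: dg_module A Q by fact
  have ds: "diff M s \<in> gr (dg_restrict M N) (n + 1)" "diff (dg_restrict M N) (diff M s) = \<zero>\<^bsub>(dg_restrict M N)\<^esub>"
    using D.s D.M.diff_gr D.M.diff_diff by simp_all
  obtain z0 w0 where z0: "z0 \<in> gr Q (n + 1)" "diff Q z0 = \<zero>\<^bsub>Q\<^esub>" "w0 \<in> gr (dg_restrict M N) (n + 1 - 1)"
    "diff M s = q z0 \<oplus>\<^bsub>(dg_restrict M N)\<^esub> diff (dg_restrict M N) w0"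
    using qis_surjE[OF q ds] .
  have w0: "w0 \<in> gr M n" "w0 \<in> N" "w0 \<in> carrier M" using z0(3) D.S(3) by auto
  have z0c: "z0 \<in> carrier Q" "q z0 \<in> N" "q z0 \<in> carrier M"
    using Q.gr_closed[OF z0(1)] dg_homD(3)[OF qh, of z0] D.S(3) by auto
  have de: "adiff A e = \<zero>" using diff_agr0[OF D.E(1)] .
  \<comment> \<open>The cycle given by surjectivity need not be fixed by \<open>e\<close>;
    multiplying the whole equation for \<open>d s\<close> by \<open>e\<close> repairs this, as
    \<open>s e = s\<close>.\<close>
  define z where "z = ract Q z0 e"
  define w where "w = ract M w0 e"
  have z: "z \<in> gr Q (n + 1)" "diff Q z = \<zero>\<^bsub>Q\<^esub>" "ract Q z e = z" "z \<in> carrier Q"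
    using Q.act_gr[OF z0(1) D.E(1)] ract_peirce_diff[OF Q z0(1) D.E(2)] z0c z0(2) D.E de
    by (simp_all add: z_def Q.act_assoc)
  have w: "w \<in> gr M n" "w \<in> N" "ract M w e = w" "w \<in> carrier M" "diff M w = ract M (diff M w0) e"
    using D.M.act_gr[OF w0(1) D.E(1)] ract_peirce_diff[OF M w0(1) D.E(2)] w0 D.E de D.S(7)
    by (simp_all add: w_def D.M.act_assoc)
  have "diff M s = ract M (diff M s) e"
    using ract_peirce_diff[OF M D.s(1) D.E(2)] D.s D.E de by simp
  also have "\<dots> = ract M (q z0 \<oplus>\<^bsub>M\<^esub> diff M w0) e" using z0(4) by simp
  also have "\<dots> = q z \<oplus>\<^bsub>M\<^esub> diff M w"
    using z0c w0 D.E dg_homD(5)[OF qh, of z0 e] w(5) by (simp add: D.M.act_add_left z_def)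
  finally have dsz: "diff M s = q z \<oplus>\<^bsub>M\<^esub> diff M w" .
  have qz: "q z \<in> N" "q z \<in> carrier M" using dg_homD(3)[OF qh z(4)] D.S(3) by auto
  obtain Q' :: "('a, 'm) dgmod" and j t where j: "j \<in> dg_hom A Q Q'" "inj_on j (carrier Q)"
    and c': "cell A Q' (j ` carrier Q) t e n (carrier Q')" and dt: "diff Q' t = j z"
    using attach[OF Q D.e z(1-3)] .
  have Q': "dg_module A Q'" using dg_homD(2)[OF j(1)] .
  interpret C: dg_cell k A Q' "j ` carrier Q" t e n "carrier Q'" using dg_cellI[OF c' Q'] .
  note ji = dg_isos_image[OF j]
  define g where "g = q \<circ> inv_into (carrier Q) j"
  have g: "qis A g (dg_restrict Q' (j ` carrier Q)) (dg_restrict M N)"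
    unfolding g_def by (rule qis_comp[OF qis_if_isos[OF dg_isos_inv[OF ji]] q])
  have gj: "g (j x) = q x" if "x \<in> carrier Q" for x using that j(2) by (simp add: g_def)
  have gh: "g \<in> dg_hom A (dg_restrict Q' (j ` carrier Q)) M"
    by (rule dg_hom_extend[OF qis_hom[OF g] D.N M])
  \<comment> \<open>\<open>d s\<close> and \<open>q z\<close> differ by the boundary of
    \<open>w\<close>; subtracting \<open>w\<close> from \<open>s\<close> gives an image for the new
    generator with boundary exactly \<open>q z\<close>.\<close>
  define y where "y = s \<ominus>\<^bsub>M\<^esub> w"
  have y: "y \<in> gr M n" "ract M y e = y" "diff M y = g (diff Q' t)"
    using D.s(1,3) w(1,3,4) D.M.gr_minus D.E dsz qz D.M.diff_closed[OF w(4)]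
    by (simp_all add: y_def D.M.minus_eq D.M.act_add_left D.M.act_inv_left D.M.diff_add D.M.diff_inv dt gj z(4) D.M.a_assoc D.M.r_neg)
  have yc: "y \<in> carrier M" using D.M.gr_closed[OF y(1)] .
  let ?q = "C.ext g M y"
  have h: "?q \<in> dg_hom A Q' M" using C.ext_dg_hom[OF gh y] dg_restrict_carrier[OF Q'] by simp
  have eq: "?q x = g x" if "x \<in> j ` carrier Q" for x
    using C.ext_N[OF that yc M] dg_homD(3)[OF gh, of x] that by simp
  have "qis A ?q Q' M"
  proof (rule cell_qis[OF c' c h])
    show "?q x \<in> N" if "x \<in> j ` carrier Q" for x
      using eq[OF that] dg_homD(3)[OF qis_hom[OF g], of x] that by simp
    show "\<ominus>\<^bsub>M\<^esub> w \<in> N" using D.S(5) w by simp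
    show "?q t = s \<oplus>\<^bsub>M\<^esub> \<ominus>\<^bsub>M\<^esub> w"
      using C.ext_s[OF M dg_hom_rmod[OF gh] yc y(2)] by (simp add: y_def D.M.minus_eq)
    show "qis A ?q (dg_restrict Q' (j ` carrier Q)) (dg_restrict M N)"
      by (rule qis_cong[OF g]) (use eq in simp)
  qed
  moreover have "?q (j x) = q x" if "x \<in> carrier Q" for x using eq[of "j x"] gj that by simp
  ultimately show ?thesis using that[OF j c' dt _ _ z(4) w(2) dsz] by blast
qed

text \<open>The degree of the new cell goes in front of the list, whether or not the list stays
  sorted; restoring the order is the work of \<open>insert_cell\<close>.\<close>

lemma core_attach:
  fixes Q :: "('a, 'm) dgmod" and M :: "('a, 'x) dgmod"
  assumes Q: "cellular A Q ns" and q: "qis A q Q (dg_restrict M N)"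
    and c: "cell A M N s e n N'" and M: "dg_module A M"
  obtains Q' :: "('a, 'm) dgmod" and q' where "cellular A Q' (n # ns)" "qis A q' Q' (dg_restrict M N')"
proof -
  have N': "dg_submodule A M N'" and sub: "N \<subseteq> N'" using c by (auto simp: cell_def)
  have c': "cell A (dg_restrict M N') N s e n (carrier (dg_restrict M N'))"
    using cell_restrict[OF N' order_refl] c by simp
  have q': "qis A q Q (dg_restrict (dg_restrict M N') N)" using q sub by (simp add: dg_restrict_restrict)
  obtain Q' :: "('a, 'm) dgmod" and j t p where
    j: "j \<in> dg_hom A Q Q'" "inj_on j (carrier Q)" "cell A Q' (j ` carrier Q) t e n (carrier Q')"
    "qis A p Q' (dg_restrict M N')"
    using attach_qis[OF q' c' dg_submoduleD(10)[OF M N']] by metis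
  have "chain A Q' (j ` {\<zero>\<^bsub>Q\<^esub>}) ns (j ` carrier Q)"
    by (rule chain_image[OF _ j(1,2)]) (use Q in \<open>simp add: cellular_def\<close>)
  then have "chain A Q' {\<zero>\<^bsub>Q'\<^esub>} (n # ns) (carrier Q')" using dg_hom_zero[OF j(1)] chain_cons[OF _ j(3)] by simp
  then have "cellular A Q' (n # ns)" using dg_homD(2)[OF j(1)] by (simp add: cellular_def)
  then show ?thesis using that j(4) by blast
qed

section \<open>Sorted models: cancellation and exchange of cells\<close>

lemma model_qis: "model A U X ns \<Longrightarrow> qis A f X Y \<Longrightarrow> model A U Y ns"
  unfolding model_def using qis_comp by blast

lemma model_zero:
  assumes "dg_module A X" "carrier X = {\<zero>\<^bsub>X\<^esub>}"
  shows "model A U X []"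
proof -
  have "carrier X \<lesssim> (UNIV :: 'm set)"
    using assms(2) infinite_universe by (simp add: finite_lepoll_infinite)
  then obtain Q :: "('a, 'm) dgmod" and \<phi> where \<phi>: "\<phi> \<in> dg_isos A Q X"
    using copy_exists[OF assms(1)] by blast
  note h = dg_isosD[OF \<phi>]
  have Q: "dg_module A Q" using dg_homD(1)[OF h(1)] .
  interpret Q: dg_module A Q by fact
  have "carrier Q = {\<zero>\<^bsub>Q\<^esub>}"
  proof -
    have "x = \<zero>\<^bsub>Q\<^esub>" if x: "x \<in> carrier Q" for x
    proof (rule inj_onD[OF bij_betw_imp_inj_on[OF h(2)] _ x Q.zero_closed])
      show "\<phi> x = \<phi> \<zero>\<^bsub>Q\<^esub>" using bij_betwE[OF h(2)] x Q.zero_closed assms(2) by (metis singletonD)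
    qed
    then show ?thesis using Q.zero_closed by blast
  qed
  then have "cellular A Q []" using Q dg_submodule_zero[OF Q] chain_nil by (simp add: cellular_def)
  then show ?thesis using qis_if_isos[OF \<phi>] by (auto simp: model_def)
qed

text \<open>The chain sits in a module on an arbitrary type; rebuilding it cell by cell yields a
  cellular module on \<open>'m\<close> with the same list of degrees.\<close>

lemma chain_model:
  fixes M :: "('a, 'x) dgmod"
  assumes "chain A M {\<zero>\<^bsub>M\<^esub>} ns N" and M: "dg_module A M" and "sorted_wrt (\<ge>) ns"
  shows "model A U (dg_restrict M N) ns"
  using assms(1,3)
proof (induction rule: chain.induct)
  case chain_nil
  show ?case by (rule model_zero) (use dg_submoduleD(10)[OF M dg_submodule_zero[OF M]] in simp_all)
next
  case (chain_cons ns N s e n N')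
  then obtain Q :: "('a, 'm) dgmod" and q where Q: "cellular A Q ns" "qis A q Q (dg_restrict M N)"
    by (auto simp: model_def)
  obtain Q' :: "('a, 'm) dgmod" and q' where "cellular A Q' (n # ns)" "qis A q' Q' (dg_restrict M N')"
    using core_attach[OF Q chain_cons.hyps(2) M] .
  then show ?case using chain_cons.prems by (auto simp: model_def)
qed

text \<open>By Schur's lemma \<open>c\<close> is invertible, so that \<open>N'\<close> modulo
  \<open>N0\<close> is the cone of an isomorphism between shifted copies of eA and e'A, hence
  acyclic. Without forming the quotient: every element of \<open>N'\<close> with boundary in
  \<open>N0\<close> can be moved into \<open>N0\<close> by a boundary.\<close>

lemma cancel_qis:
  fixes M :: "('a, 'x) dgmod"
  assumes t: "cell A M N0 t e' (n + 1) N" and s: "cell A M N s e n N'" and M: "dg_module A M"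
    and ds: "diff M s = x \<oplus>\<^bsub>M\<^esub> ract M t c" "x \<in> N0" "c \<in> peirce A e'" "c \<in> agr A 0" "c \<otimes> e = c" "c \<noteq> \<zero>"
  shows "qis A (\<lambda>x. x) (dg_restrict M N0) (dg_restrict M N')"
proof -
  interpret D: dg_cell k A M N0 t e' "n + 1" N using dg_cellI[OF t M] .
  interpret C: dg_cell k A M N s e n N' using dg_cellI[OF s M] .
  obtain d where d: "d \<in> agr A 0" "d \<otimes> e' = d" "c \<otimes> d = e'" "d \<otimes> c = e"
    using prim_idem_schur[OF C.e D.e ds(4) _ ds(5,6)] D.P(4)[OF ds(3)] by metis
  have cds: "D.coef (diff M s) = c" using D.coef_eqI(1)[OF ds(2,3)] ds(1) by simp
  have dc: "d \<in> carrier A" "c \<in> carrier A" using d ds by simp_all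
  have dd: "adiff A (d \<otimes> a) = d \<otimes> adiff A a" if "a \<in> carrier A" for a
    using leibniz[OF d(1) that] that dc diff_agr0[OF d(1)] by (simp add: koszul_def)
  have ed: "e \<otimes> d = d"
  proof -
    have "e \<otimes> d = d \<otimes> (c \<otimes> d)" using d(4) dc by (simp flip: m_assoc)
    then show ?thesis using d by simp
  qed
  \<comment> \<open>This single claim serves both halves: for a cycle it gives surjectivity on
    cohomology, and for a chain whose boundary lies in \<open>N0\<close> it gives
    injectivity.\<close>
  have red: "\<exists>w\<in>gr M (i - 1). w \<in> N' \<and> y \<ominus>\<^bsub>M\<^esub> diff M w \<in> N0"
    if y: "y \<in> gr M i" "y \<in> N'" and dy: "diff M y \<in> N0" for y i
  proof -
    let ?b = "C.coef y" and ?a = "D.coef (C.base y)"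
    note cb = C.coef_base[OF y(2)]
    note ab = D.coef_base[OF cb(2)]
    have cc: "?b \<in> carrier A" "?a \<in> carrier A" using C.coef_closed[OF y(2)] D.coef_closed[OF cb(2)] .
    \<comment> \<open>The coefficient at \<open>t\<close> of the boundary of \<open>y\<close> has to
      vanish; it receives the differential of \<open>?a\<close> and, through \<open>d s\<close>, the
      term \<open>c \<otimes> ?b\<close>.\<close>
    have e1: "koszul A (n + 1) (adiff A ?a) \<oplus> c \<otimes> ?b = \<zero>"
    proof -
      have "diff M y \<in> N" using dy D.sub by blast
      then have "C.base (diff M y) = diff M y" using C.coef_N by simp
      then have "diff M (C.base y) \<oplus>\<^bsub>M\<^esub> ract M (diff M s) ?b \<in> N0" using dy C.coef_diff(2)[OF y(2)] by simp
      then have "D.coef (diff M (C.base y) \<oplus>\<^bsub>M\<^esub> ract M (diff M s) ?b) = \<zero>" using D.coef_N by blast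
      moreover have "diff M (C.base y) \<in> N" "ract M (diff M s) ?b \<in> N" "diff M s \<in> N"
        using cb C.S(7,8) C.s(4) cc by auto
      ultimately show ?thesis using cb cc by (simp add: D.coef_add D.coef_diff D.coef_act cds)
    qed
    \<comment> \<open>Chosen so that the boundary of \<open>ract M s ?b'\<close> has coefficient c d
      a = a at \<open>t\<close>, where d is the inverse of c and a is \<open>?a\<close>.\<close>
    let ?b' = "d \<otimes> ?a"
    have b'P: "?b' \<in> peirce A e" using ed dc cc C.E(2) by (simp add: peirce_def flip: m_assoc)
    have b'c: "?b' \<in> carrier A" using dc cc by simp
    let ?w = "ract M s ?b'"
    have wN': "?w \<in> N'" using C.ract_s_mem b'c by simp
    have cw: "C.coef ?w = ?b'" "C.base ?w = \<zero>\<^bsub>M\<^esub>" using C.coef_eqI[OF C.S(2) b'P] b'c by simp_all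
    have "?a \<in> agr A (i - (n + 1))" using D.coef_gr(1)[OF cb(2) C.coef_gr(2)[OF y(2,1)]] .
    then have "?b' \<in> agr A (i - n - 1)" using mult_gr[OF d(1)] by (simp add: algebra_simps)
    then have wg: "?w \<in> gr M (i - 1)" using D.M.act_gr[OF C.s(1)] by (metis add.commute diff_add_cancel diff_diff_eq2 diff_add_eq)
    have yw: "y \<ominus>\<^bsub>M\<^esub> diff M ?w \<in> N'" using y C.S'(6,8) wN' by blast
    have dw: "diff M ?w \<in> N'" using C.S'(8) wN' .
    \<comment> \<open>Multiplying \<open>e1\<close> by the inverse of \<open>c\<close> shows that
      the coefficient at \<open>s\<close> is removed at the same time, so no second choice is
      needed.\<close>
    have bb: "koszul A n (adiff A ?b') = ?b"
    proof -
      have "\<zero> = d \<otimes> (koszul A (n + 1) (adiff A ?a) \<oplus> c \<otimes> ?b)" using e1 dc by simp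
      also have "\<dots> = koszul A (n + 1) (d \<otimes> adiff A ?a) \<oplus> e \<otimes> ?b"
        using dc cc d(4) by (simp add: r_distr koszul_def r_minus flip: m_assoc)
      also have "\<dots> = \<ominus> koszul A n (adiff A ?b') \<oplus> ?b"
        using dc cc C.P(4)[OF cb(1)] dd by (simp add: koszul_plus_one)
      finally have "\<ominus> koszul A n (adiff A ?b') \<oplus> ?b = \<zero>" by simp
      moreover have "koszul A n (adiff A ?b') \<in> carrier A" using b'c by simp
      ultimately show ?thesis using cc by (metis a_inv_closed minus_equality minus_minus a_comm)
    qed
    have "C.coef (y \<ominus>\<^bsub>M\<^esub> diff M ?w) = \<zero>"
      using y(2) dw wN' C.S'(5) cw bb cc by (simp add: a_minus_def C.coef_add C.coef_inv C.coef_diff r_neg)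
    then have inN: "y \<ominus>\<^bsub>M\<^esub> diff M ?w \<in> N" using C.mem_N_iff[OF yw] by simp
    have "C.base (y \<ominus>\<^bsub>M\<^esub> diff M ?w) = y \<ominus>\<^bsub>M\<^esub> diff M ?w" using C.coef_N inN by simp
    moreover have "C.base (y \<ominus>\<^bsub>M\<^esub> diff M ?w) = C.base y \<ominus>\<^bsub>M\<^esub> C.base (diff M ?w)"
    proof -
      have "C.base (\<ominus>\<^bsub>M\<^esub> v) = \<ominus>\<^bsub>M\<^esub> C.base v" if v: "v \<in> N'" for v
      proof -
        have "\<zero>\<^bsub>M\<^esub> = C.base v \<oplus>\<^bsub>M\<^esub> C.base (\<ominus>\<^bsub>M\<^esub> v)"
          using C.coef_add(2)[OF v C.S'(5)[OF v]] C.S'(3)[OF v] C.coef_N(2)[OF C.S(2)] by (simp add: D.M.r_neg)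
        moreover have "C.base v \<in> carrier M" "C.base (\<ominus>\<^bsub>M\<^esub> v) \<in> carrier M"
          using C.coef_base(2) C.S(3) C.S'(5) v by blast+
        ultimately show ?thesis by (metis D.M.minus_equality D.M.a_comm)
      qed
      then show ?thesis using y dw C.S'(5) by (simp add: a_minus_def C.coef_add)
    qed
    moreover have "C.base (diff M ?w) = ract M (diff M s) ?b'"
      using C.coef_diff(2)[OF wN'] cw D.M.act_closed[of "diff M s" ?b'] b'c by simp
    ultimately have eq: "y \<ominus>\<^bsub>M\<^esub> diff M ?w = C.base y \<ominus>\<^bsub>M\<^esub> ract M (diff M s) ?b'" by simp
    have dsN: "diff M s \<in> N" "ract M (diff M s) ?b' \<in> N" "\<ominus>\<^bsub>M\<^esub> ract M (diff M s) ?b' \<in> N"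
      using C.s(4) C.S(5,7) b'c by auto
    have "c \<otimes> ?b' = ?a" using d(3) dc cc D.P(4)[OF ab(1)] by (simp flip: m_assoc)
    then have "D.coef (y \<ominus>\<^bsub>M\<^esub> diff M ?w) = \<zero>"
      unfolding eq using cb(2) dsN b'c cc cds
      by (simp add: a_minus_def D.coef_add D.coef_inv D.coef_act r_neg)
    then have "y \<ominus>\<^bsub>M\<^esub> diff M ?w \<in> N0" using D.mem_N_iff[OF inN] by simp
    then show ?thesis using wg wN' by blast
  qed
  have N0': "dg_submodule A M N0" "N0 \<subseteq> N'" using D.N D.sub C.sub by auto
  show ?thesis
  proof (rule qisI[OF inclusion_dg_hom'[OF M N0'(1) C.N' N0'(2)]])
    fix i z assume z: "z \<in> gr (dg_restrict M N') i" "diff (dg_restrict M N') z = \<zero>\<^bsub>(dg_restrict M N')\<^esub>"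
    then have z': "z \<in> gr M i" "z \<in> N'" "diff M z = \<zero>\<^bsub>M\<^esub>" "z \<in> carrier M" using C.S'(3) by auto
    then obtain w where w: "w \<in> gr M (i - 1)" "w \<in> N'" "z \<ominus>\<^bsub>M\<^esub> diff M w \<in> N0"
      using red[OF z'(1,2)] D.S(2) by auto
    have wc: "w \<in> carrier M" using C.S'(3) w by blast
    have "z \<ominus>\<^bsub>M\<^esub> diff M w \<in> gr M i" using z' w D.M.gr_minus D.M.diff_gr' by simp
    moreover have "diff M (z \<ominus>\<^bsub>M\<^esub> diff M w) = \<zero>\<^bsub>M\<^esub>"
      using z' wc by (simp add: D.M.minus_eq D.M.diff_add D.M.diff_inv D.M.diff_diff)
    moreover have "z = (z \<ominus>\<^bsub>M\<^esub> diff M w) \<oplus>\<^bsub>M\<^esub> diff M w" using z'(4) D.M.diff_closed[OF wc] by algebra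
    ultimately show "\<exists>x\<in>gr (dg_restrict M N0) i. diff (dg_restrict M N0) x = \<zero>\<^bsub>(dg_restrict M N0)\<^esub> \<and>
      (\<exists>w\<in>gr (dg_restrict M N') (i - 1). z = x \<oplus>\<^bsub>(dg_restrict M N')\<^esub> diff (dg_restrict M N') w)"
      using w by (intro bexI[of _ "z \<ominus>\<^bsub>M\<^esub> diff M w"] bexI[of _ w] conjI) auto
  next
    fix i x v assume x: "x \<in> gr (dg_restrict M N0) i" and v: "v \<in> gr (dg_restrict M N') (i - 1)" "x = diff (dg_restrict M N') v"
    then have x': "x \<in> gr M i" "x \<in> N0" "v \<in> gr M (i - 1)" "v \<in> N'" "x = diff M v" by auto
    then obtain w where w: "w \<in> gr M (i - 1 - 1)" "w \<in> N'" "v \<ominus>\<^bsub>M\<^esub> diff M w \<in> N0"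
      using red[OF x'(3,4)] by auto
    have c: "w \<in> carrier M" "v \<in> carrier M" using C.S'(3) w x' by blast+
    have "v \<ominus>\<^bsub>M\<^esub> diff M w \<in> gr M (i - 1)" using x' w D.M.gr_minus D.M.diff_gr' by simp
    moreover have "x = diff M (v \<ominus>\<^bsub>M\<^esub> diff M w)"
      using x' c by (simp add: D.M.minus_eq D.M.diff_add D.M.diff_inv D.M.diff_diff)
    ultimately show "\<exists>u\<in>gr (dg_restrict M N0) (i - 1). x = diff (dg_restrict M N0) u"
      using w by (intro bexI[of _ "v \<ominus>\<^bsub>M\<^esub> diff M w"]) auto
  qed
qed

text \<open>The last clause is what the induction on direct summands feeds on. A cell strictly below
  all others sinks through the chain until it cancels or reaches the bottom; there its boundary
  would be zero. A nonzero boundary therefore forces a cancellation: one cell is added, two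
  disappear.\<close>

lemma insert_cell:
  fixes M :: "('a, 'x) dgmod"
  assumes "chain A M {\<zero>\<^bsub>M\<^esub>} ns N" and M: "dg_module A M"
    and "sorted_wrt (\<ge>) ns" "cell A M N s e n N'"
  shows "\<exists>ns'. model A U (dg_restrict M N') ns' \<and> set ns' \<subseteq> insert n (set ns) \<and>
    (diff M s \<noteq> \<zero>\<^bsub>M\<^esub> \<and> (\<forall>m\<in>set ns. n < m) \<longrightarrow> length ns' < length ns)"
  using assms(1,3,4)
proof (induction arbitrary: s e n N' rule: chain.induct)
  case chain_nil
  have "chain A M {\<zero>\<^bsub>M\<^esub>} [n] N'" using chain.chain_cons[OF chain.chain_nil[OF chain_nil.hyps] chain_nil.prems(2)] .
  then have "model A U (dg_restrict M N') [n]" using chain_model[OF _ M] by simp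
  moreover have "diff M s = \<zero>\<^bsub>M\<^esub>" using chain_nil by (simp add: cell_def)
  ultimately show ?case by (intro exI[of _ "[n]"]) simp
next
  case (chain_cons ns N0 t e' m N)
  have ch: "chain A M {\<zero>\<^bsub>M\<^esub>} (m # ns) N" using chain.chain_cons[OF chain_cons.hyps] .
  show ?case
  proof (cases "m \<le> n")
    case True
    have "chain A M {\<zero>\<^bsub>M\<^esub>} (n # m # ns) N'" using chain.chain_cons[OF ch chain_cons.prems(2)] .
    then have "model A U (dg_restrict M N') (n # m # ns)"
      by (rule chain_model[OF _ M]) (use True chain_cons.prems(1) in auto)
    then show ?thesis using True by (intro exI[of _ "n # m # ns"]) auto
  next
    case False
    interpret C: dg_cell k A M N s e n N' using dg_cellI[OF chain_cons.prems(2) M] .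
    interpret D: dg_cell k A M N0 t e' m N using dg_cellI[OF chain_cons.hyps(2) M] .
    let ?c = "D.coef (diff M s)"
    note ds = C.s(4)
    note cb = D.coef_base[OF ds] and cc = D.coef_closed[OF ds]
    have cg: "?c \<in> agr A (n + 1 - m)" using D.coef_gr(1)[OF ds C.M.diff_gr[OF C.s(1)]] .
    show ?thesis
    proof (cases "?c = \<zero>")
      case True
      then have ds0: "diff M s \<in> N0" using D.mem_N_iff[OF ds] by simp
      \<comment> \<open>\<open>d s\<close> does not involve \<open>t\<close>, so \<open>s\<close>
        can be attached directly to \<open>N0\<close>, below \<open>t\<close>.\<close>
      define M1 where "M1 = {x \<oplus>\<^bsub>M\<^esub> ract M s b |x b. x \<in> N0 \<and> b \<in> peirce A e}"
      have M1: "cell A M N0 s e n M1" unfolding M1_def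
        by (rule cell_sum[OF M D.N C.e C.s(1,3) ds0]) (use C.free D.sub in blast)
      interpret E: dg_cell k A M N0 s e n M1 using dg_cellI[OF M1 M] .
      have M1N': "M1 \<subseteq> N'"
      proof
        fix y assume "y \<in> M1"
        then obtain x b where y: "y = x \<oplus>\<^bsub>M\<^esub> ract M s b" "x \<in> N0" "b \<in> peirce A e" using M1_def by blast
        have "x \<in> N'" using y D.sub C.sub by blast
        then show "y \<in> N'" unfolding y(1) using C.S'(4) C.ract_s_mem[OF C.P(3)[OF y(3)]] by blast
      qed
      \<comment> \<open>Now \<open>t\<close> goes on top of \<open>M1\<close>: the new generator and
        the old one have changed places, and \<open>N'\<close> is unchanged.\<close>
      have c2: "cell A M M1 t e' m N'"
        unfolding cell_def
      proof (intro conjI ballI impI)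
        show "t \<in> N'" using D.s(2) C.sub by blast
        show "diff M t \<in> M1" using D.s(4) E.sub by blast
        fix y assume y: "y \<in> N'"
        note cy = C.coef_base[OF y]
        note dy = D.coef_base[OF cy(2)]
        have b: "D.base (C.base y) \<in> carrier M" "D.coef (C.base y) \<in> carrier A" "C.coef y \<in> carrier A"
          using D.S(3)[OF dy(2)] D.P(3)[OF dy(1)] C.P(3)[OF cy(1)] .
        have "y = C.base y \<oplus>\<^bsub>M\<^esub> ract M s (C.coef y)" by (rule cy(3))
        also have "\<dots> = (D.base (C.base y) \<oplus>\<^bsub>M\<^esub> ract M t (D.coef (C.base y))) \<oplus>\<^bsub>M\<^esub> ract M s (C.coef y)"
          by (rule arg_cong[OF dy(3)])
        also have "\<dots> = (D.base (C.base y) \<oplus>\<^bsub>M\<^esub> ract M s (C.coef y)) \<oplus>\<^bsub>M\<^esub> ract M t (D.coef (C.base y))"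
          using b by (simp add: C.M.a_ac)
        finally have "y = \<dots>" .
        moreover have "D.base (C.base y) \<oplus>\<^bsub>M\<^esub> ract M s (C.coef y) \<in> M1" using M1_def dy cy by blast
        ultimately show "\<exists>x\<in>M1. \<exists>b\<in>peirce A e'. y = x \<oplus>\<^bsub>M\<^esub> ract M t b" using dy(1) by blast
      next
        fix b assume b: "b \<in> peirce A e'" "ract M t b \<in> M1"
        have tN: "ract M t b \<in> N" using D.ract_s_mem D.P(3) b by blast
        obtain x b' where x: "ract M t b = x \<oplus>\<^bsub>M\<^esub> ract M s b'" "x \<in> N0" "b' \<in> peirce A e"
          using b(2) M1_def by blast
        have "x \<in> N" using x D.sub by blast
        then have "C.coef (ract M t b) = b'" using C.coef_eqI(1) x by simp
        then have "b' = \<zero>" using C.coef_N(1)[OF tN] by simp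
        then have "ract M t b \<in> N0" using x D.S(3) by simp
        then show "b = \<zero>" using D.free b by blast
      qed (use E.N' C.N' M1N' D.e D.s in auto)
      obtain ns1 where ns1: "model A U (dg_restrict M M1) ns1" "set ns1 \<subseteq> insert n (set ns)"
        "diff M s \<noteq> \<zero>\<^bsub>M\<^esub> \<and> (\<forall>m\<in>set ns. n < m) \<longrightarrow> length ns1 < length ns"
        using chain_cons.IH[OF _ M1] chain_cons.prems(1) by auto
      then obtain Q :: "('a, 'm) dgmod" and q where Q: "cellular A Q ns1" "qis A q Q (dg_restrict M M1)" "sorted_wrt (\<ge>) ns1"
        by (auto simp: model_def)
      obtain Q' :: "('a, 'm) dgmod" and q' where "cellular A Q' (m # ns1)" "qis A q' Q' (dg_restrict M N')"
        using core_attach[OF Q(1,2) c2 M] .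
      \<comment> \<open>The degrees in \<open>ns1\<close> are \<open>n\<close>, which is below
        \<open>m\<close>, or come from \<open>ns\<close>, which \<open>m\<close> already
        dominated.\<close>
      moreover have "sorted_wrt (\<ge>) (m # ns1)"
        using Q(3) ns1(2) chain_cons.prems(1) False by auto
      ultimately have "model A U (dg_restrict M N') (m # ns1)" by (auto simp: model_def)
      then show ?thesis using ns1 by (intro exI[of _ "m # ns1"]) auto
    next
      case nz: False
      \<comment> \<open>The coefficient has degree n + 1 - m, at most 0 since n < m; being nonzero
        it has degree at least 0 by positivity, which leaves m = n + 1.\<close>
      then have m: "m = n + 1" using agr_neg[OF cg] False by fastforce
      have "?c \<otimes> e = ?c"
      proof -
        have "ract M (diff M s) e = diff M s"
          using ract_peirce_diff[OF M C.s(1) C.E(2)] C.s diff_agr0[OF C.E(1)] C.E by simp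
        then show ?thesis using D.coef_act(1)[OF ds C.E(2)] by simp
      qed
      then have q: "qis A (\<lambda>x. x) (dg_restrict M N0) (dg_restrict M N')"
        using cancel_qis[OF chain_cons.hyps(2)[unfolded m] chain_cons.prems(2) M cb(3,2,1) _ _ nz] cg m by simp
      have "model A U (dg_restrict M N0) ns" using chain_model[OF chain_cons.hyps(1) M] chain_cons.prems(1) by simp
      then have "model A U (dg_restrict M N') ns" using model_qis q by blast
      then show ?thesis by (intro exI[of _ ns]) auto
    qed
  qed
qed

text \<open>On type \<open>'m\<close> this is the closure of dgFilt under isomorphism in the derived
  category, and the common description of dgPrae and dgPer.\<close>

definition filtered :: "('a, 'x) dgmod \<Rightarrow> bool" where
  "filtered X \<longleftrightarrow> (\<exists>ns. model A U X ns)"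

lemma filtered_qis: "filtered X \<Longrightarrow> qis A f X Y \<Longrightarrow> filtered Y"
  using model_qis unfolding filtered_def by blast

lemma filtered_module: "filtered X \<Longrightarrow> dg_module A X"
  by (auto simp: filtered_def model_def dest!: qis_hom dg_homD(2))

text \<open>The cell is transferred to a model of \<open>N\<close>, whose list is then sorted except
  possibly for its head; this is precisely the input of \<open>insert_cell\<close>.\<close>

lemma filtered_cell:
  fixes M :: "('a, 'x) dgmod"
  assumes f: "filtered (dg_restrict M N)" and c: "cell A M N s e n N'" and M: "dg_module A M"
  shows "filtered (dg_restrict M N')"
proof -
  obtain ns and Q :: "('a, 'm) dgmod" and q where Q: "cellular A Q ns" "qis A q Q (dg_restrict M N)" "sorted_wrt (\<ge>) ns"
    using f by (auto simp: model_def filtered_def)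
  obtain Q' :: "('a, 'm) dgmod" and q' where Q': "cellular A Q' (n # ns)" "qis A q' Q' (dg_restrict M N')"
    using core_attach[OF Q(1,2) c M] .
  then have m: "dg_module A Q'" "chain A Q' {\<zero>\<^bsub>Q'\<^esub>} (n # ns) (carrier Q')" by (auto simp: cellular_def)
  from m(2) obtain N1 t e1 where "chain A Q' {\<zero>\<^bsub>Q'\<^esub>} ns N1" "cell A Q' N1 t e1 n (carrier Q')"
    by (cases rule: chain.cases) auto
  then obtain ns' where "model A U (dg_restrict Q' (carrier Q')) ns'"
    using insert_cell[OF _ m(1) Q(3)] by metis
  then show ?thesis using model_qis[OF _ Q'(2)] dg_restrict_carrier[OF m(1)] by (auto simp: filtered_def)
qed

lemma filtered_chain:
  assumes "chain A M N0 ns N" and M: "dg_module A M" and f: "filtered (dg_restrict M N0)"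
  shows "filtered (dg_restrict M N)"
  using assms(1) by (induction rule: chain.induct) (use f filtered_cell[OF _ _ M] in blast)+

end

section \<open>Closure under shifts, cones and direct summands\<close>

context dg_algebra begin

lemma dg_hom_shift: "f \<in> dg_hom A M N \<Longrightarrow> f \<in> dg_hom A (dg_shift n M) (dg_shift n N)"
proof -
  assume f: "f \<in> dg_hom A M N"
  interpret M: dg_module A M using dg_homD(1)[OF f] .
  show ?thesis
    by (rule dg_homI) (use shift_dg_module dg_homD(1,2)[OF f] in \<open>auto simp: dg_homD(3-7)[OF f] dg_hom_koszul[OF f]\<close>)
qed

lemma qis_shift:
  assumes q: "qis A f M N" shows "qis A f (dg_shift n M) (dg_shift n N)"
proof -
  note f = qis_hom[OF q]
  interpret M: dg_module A M using dg_homD(1)[OF f] .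
  interpret N: dg_module A N using dg_homD(2)[OF f] .
  show ?thesis
  proof (rule qisI[OF dg_hom_shift[OF f]])
    fix i z assume z: "z \<in> gr (dg_shift n N) i" "diff (dg_shift n N) z = \<zero>\<^bsub>(dg_shift n N)\<^esub>"
    then have "z \<in> gr N (i + n)" "diff N z = \<zero>\<^bsub>N\<^esub>" using N.gr_closed by auto
    then obtain x w where x: "x \<in> gr M (i + n)" "diff M x = \<zero>\<^bsub>M\<^esub>" "w \<in> gr N (i + n - 1)" "z = f x \<oplus>\<^bsub>N\<^esub> diff N w"
      by (rule qis_surjE[OF q])
    have "w \<in> carrier N" using N.gr_closed[OF x(3)] .
    then have "diff N w = diff (dg_shift n N) (koszul N n w)" by (simp add: N.diff_koszul N.koszul_koszul) (simp add: koszul_def)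
    moreover have "koszul N n w \<in> gr (dg_shift n N) (i - 1)" using N.gr_koszul[OF x(3)] by (simp add: algebra_simps)
    ultimately show "\<exists>x\<in>gr (dg_shift n M) i. diff (dg_shift n M) x = \<zero>\<^bsub>(dg_shift n M)\<^esub> \<and>
        (\<exists>w\<in>gr (dg_shift n N) (i - 1). z = f x \<oplus>\<^bsub>(dg_shift n N)\<^esub> diff (dg_shift n N) w)"
      using x by (intro bexI[of _ x] conjI bexI[of _ "koszul N n w"]) simp_all
  next
    fix i x w assume x: "x \<in> gr (dg_shift n M) i" "diff (dg_shift n M) x = \<zero>\<^bsub>(dg_shift n M)\<^esub>"
      "w \<in> gr (dg_shift n N) (i - 1)" "f x = diff (dg_shift n N) w"
    have x': "x \<in> gr M (i + n)" "diff M x = \<zero>\<^bsub>M\<^esub>" using x M.gr_closed by auto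
    have w: "w \<in> gr N (i + n - 1)" using x(3) by (simp add: algebra_simps)
    have "f x = diff N (koszul N n w)" using x(4) N.gr_closed[OF w] by (simp add: N.diff_koszul)
    then obtain v where v: "v \<in> gr M (i + n - 1)" "x = diff M v" using qis_injE[OF q x' N.gr_koszul[OF w]] by metis
    have "v \<in> carrier M" using M.gr_closed[OF v(1)] .
    then have "x = diff (dg_shift n M) (koszul M n v)" using v by (simp add: M.diff_koszul M.koszul_koszul) (simp add: koszul_def)
    moreover have "koszul M n v \<in> gr (dg_shift n M) (i - 1)" using M.gr_koszul[OF v(1)] by (simp add: algebra_simps)
    ultimately show "\<exists>v\<in>gr (dg_shift n M) (i - 1). x = diff (dg_shift n M) v" by blast
  qed
qed

lemma shift_pr:
  assumes M: "dg_module A M" and x: "x \<in> carrier M"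
  shows "dg_module.pr (dg_shift n M) i x = dg_module.pr M (i + n) x"
proof -
  interpret M: dg_module A M by fact
  interpret S: dg_module A "dg_shift n M" by (rule shift_dg_module[OF M])
  have "x \<in> carrier (dg_shift n M)" using x by simp
  then show ?thesis
  proof (induction rule: S.gr_induct)
    case (gr j y)
    then show ?case using S.pr_pure[of y j i] by (simp add: M.pr_pure)
  next
    case (add y z)
    then show ?case using S.pr_add[of y z i] by (simp add: M.pr_add)
  qed
qed

lemma shift_submodule:
  assumes M: "dg_module A M" and N: "dg_submodule A M N"
  shows "dg_submodule A (dg_shift n M) N"
  by (rule dg_submoduleI[OF shift_dg_module[OF M]])
    (use dg_submoduleD(1,2)[OF M N] in \<open>simp_all add: dg_submoduleD(3-9,12)[OF M N] shift_pr[OF M]\<close>)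

lemma cell_shift:
  assumes M: "dg_module A M" and c: "cell A M N s e m N'"
  shows "cell A (dg_shift n M) N s e (m - n) N'"
proof -
  have N: "dg_submodule A M N" using c by (simp add: cell_def)
  show ?thesis using c shift_submodule[OF M] dg_submoduleD(12)[OF M N] by (auto simp: cell_def)
qed

lemma chain_shift:
  assumes M: "dg_module A M" and "chain A M N0 ns N"
  shows "chain A (dg_shift n M) N0 (map (\<lambda>i. i - n) ns) N"
  using assms(2)
  by (induction rule: chain.induct) (auto intro: chain.intros shift_submodule[OF M] cell_shift[OF M])

lemma shift_shift_iso:
  assumes M: "dg_module A M" shows "(\<lambda>x. x) \<in> dg_isos A (dg_shift (- n) (dg_shift n M)) M"
proof -
  interpret M: dg_module A M by fact
  have "(\<lambda>x. x) \<in> dg_hom A (dg_shift (- n) (dg_shift n M)) M"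
    by (rule dg_homI) (use shift_dg_module M in \<open>auto simp: M.koszul_koszul koszul_def M.minus_minus\<close>)
  then show ?thesis by (simp add: dg_isos_def bij_betw_def)
qed

end

context dg_universe begin

lemma filtered_shift:
  assumes "filtered X" shows "filtered (dg_shift n X)"
proof -
  obtain ns and Q :: "('a, 'm) dgmod" and q where Q: "sorted_wrt (\<ge>) ns" "cellular A Q ns" "qis A q Q X"
    using assms by (auto simp: filtered_def model_def)
  have "cellular A (dg_shift n Q) (map (\<lambda>i. i - n) ns)"
    using Q(2) chain_shift[of Q "{\<zero>\<^bsub>Q\<^esub>}" ns "carrier Q" n] shift_dg_module[of Q n] by (simp add: cellular_def)
  moreover have "sorted_wrt (\<ge>) (map (\<lambda>i. i - n) ns)" using Q(1) by (simp add: sorted_wrt_map)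
  ultimately show ?thesis using qis_shift[OF Q(3)] by (auto simp: filtered_def model_def)
qed

lemma filtered_iso: "filtered X \<Longrightarrow> dg_iso A X Y \<Longrightarrow> filtered Y"
  unfolding dg_iso_def using filtered_qis[OF _ qis_if_isos] by blast

lemma filtered_image:
  "filtered Y \<Longrightarrow> j \<in> dg_hom A Y M \<Longrightarrow> inj_on j (carrier Y) \<Longrightarrow> filtered (dg_restrict M (j ` carrier Y))"
  using filtered_qis[OF _ qis_if_isos[OF dg_isos_image]] .

lemma cellular_lift:
  assumes P: "cellular A P ns" and s: "qis A s M T" and f: "f \<in> dg_hom A P T"
  shows "\<exists>g h. g \<in> dg_hom A P M \<and> h \<in> rmod_hom A P T \<and> (\<forall>i. \<forall>x\<in>gr P i. h x \<in> gr T (i - 1)) \<and>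
    (\<forall>x\<in>carrier P. s (g x) = f x \<oplus>\<^bsub>T\<^esub> (diff T (h x) \<oplus>\<^bsub>T\<^esub> h (diff P x)))"
proof -
  have P: "dg_module A P" "chain A P {\<zero>\<^bsub>P\<^esub>} ns (carrier P)" using P by (auto simp: cellular_def)
  interpret P: dg_module A P by fact
  have r: "dg_restrict P (carrier P) = P" using dg_restrict_carrier[OF P(1)] .
  have i: "gr P i \<inter> carrier P = gr P i" for i using P.gr_closed by blast
  show ?thesis using chain_lift[OF P(1) s P(2), of f] f unfolding r i by blast
qed

text \<open>The lift agrees with \<open>f\<close> on cohomology after applying \<open>s\<close>,
  since the homotopy contributes only boundaries on cycles; two out of three does the rest.\<close>

lemma cellular_qis_lift:
  assumes P: "cellular A P ns" and s: "qis A s M T" and f: "qis A f P T"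
  obtains g where "qis A g P M"
proof -
  obtain g h where g: "g \<in> dg_hom A P M" "h \<in> rmod_hom A P T" "\<And>i x. x \<in> gr P i \<Longrightarrow> h x \<in> gr T (i - 1)"
    "\<And>x. x \<in> carrier P \<Longrightarrow> s (g x) = f x \<oplus>\<^bsub>T\<^esub> (diff T (h x) \<oplus>\<^bsub>T\<^esub> h (diff P x))"
    using cellular_lift[OF P s qis_hom[OF f]] by metis
  have P: "dg_module A P" and T: "dg_module A T" using dg_homD(1,2)[OF qis_hom[OF f]] .
  interpret P: dg_module A P by fact
  interpret T: dg_module A T by fact
  have "qis A g P M"
  proof (rule qis_lift[OF f s g(1)])
    fix i x assume x: "x \<in> gr P i" "diff P x = \<zero>\<^bsub>P\<^esub>"
    then have "s (g x) = f x \<oplus>\<^bsub>T\<^esub> diff T (h x)"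
      using g(4)[OF P.gr_closed[OF x(1)]] rmod_hom_zero[OF g(2) P T] T.gr_closed[OF g(3)[OF x(1)]] by simp
    then show "\<exists>w\<in>gr T (i - 1). s (g x) = f x \<oplus>\<^bsub>T\<^esub> diff T w" using g(3)[OF x(1)] by blast
  qed
  then show ?thesis by (rule that)
qed

text \<open>Models move forward by composition; to move one backward, its structure map is lifted
  through \<open>f\<close>.\<close>

lemma filtered_qis': "filtered Y \<Longrightarrow> qis A f X Y \<Longrightarrow> filtered X"
  unfolding filtered_def model_def by (metis cellular_qis_lift)

section \<open>Mapping cones of filtered modules\<close>

lemma cone_pr:
  assumes f: "f \<in> dg_hom A X Y" and z: "z \<in> carrier (dg_cone X f Y)"
  shows "dg_module.pr (dg_cone X f Y) i z = (dg_module.pr Y i (fst z), dg_module.pr X (i + 1) (snd z))"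
proof -
  interpret X: dg_module A X using dg_homD(1)[OF f] .
  interpret Y: dg_module A Y using dg_homD(2)[OF f] .
  interpret C: dg_module A "dg_cone X f Y" by (rule cone_dg_module[OF f])
  show ?thesis using z
  proof (induction rule: C.gr_induct)
    case (gr j y)
    then show ?case using C.pr_pure[OF gr, of i] by (cases y) (auto simp: X.pr_pure Y.pr_pure)
  next
    case (add y z)
    then show ?case using C.pr_add[OF add(1,2)] by (cases y; cases z) (auto simp: X.pr_add Y.pr_add)
  qed
qed

lemma cone_inv:
  assumes f: "f \<in> dg_hom A X Y" and "y \<in> carrier Y" "x \<in> carrier X"
  shows "\<ominus>\<^bsub>(dg_cone X f Y)\<^esub> (y, x) = (\<ominus>\<^bsub>Y\<^esub> y, \<ominus>\<^bsub>X\<^esub> x)"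
proof -
  interpret X: dg_module A X using dg_homD(1)[OF f] .
  interpret Y: dg_module A Y using dg_homD(2)[OF f] .
  interpret C: dg_module A "dg_cone X f Y" by (rule cone_dg_module[OF f])
  show ?thesis
    by (rule koszul_pair(1)[OF Y.abelian_group_axioms X.abelian_group_axioms C.abelian_group_axioms])
      (use assms in auto)
qed

lemma cone_submodule:
  assumes f: "f \<in> dg_hom A X Y" and N: "dg_submodule A X N"
  shows "dg_submodule A (dg_cone X f Y) (carrier Y \<times> N)"
proof -
  interpret X: dg_module A X using dg_homD(1)[OF f] .
  interpret Y: dg_module A Y using dg_homD(2)[OF f] .
  note S = dg_submoduleD[OF X.dg_module_axioms N]
  show ?thesis
    by (rule dg_submoduleI[OF cone_dg_module[OF f]])
      (use S(1,2) in \<open>auto simp: S(3-9) cone_pr[OF f] cone_inv[OF f] dg_homD(3)[OF f]\<close>)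
qed

text \<open>The cells of \<open>X\<close> become cells of the cone on top of \<open>Y\<close>, one
  degree lower because the cone contains the shift of \<open>X\<close> by 1; their boundary acquires
  the term \<open>f s\<close> in \<open>Y\<close>.\<close>

lemma cone_cell:
  assumes f: "f \<in> dg_hom A X Y" and c: "cell A X N s e n N'"
  shows "cell A (dg_cone X f Y) (carrier Y \<times> N) (\<zero>\<^bsub>Y\<^esub>, s) e (n - 1) (carrier Y \<times> N')"
proof -
  interpret Y: dg_module A Y using dg_homD(2)[OF f] .
  interpret C: dg_cell k A X N s e n N' using dg_cellI[OF c dg_homD(1)[OF f]] .
  show ?thesis unfolding cell_def
  proof (intro conjI ballI impI)
    fix y assume "y \<in> carrier Y \<times> N'"
    then obtain y1 y2 where y: "y = (y1, y2)" "y1 \<in> carrier Y" "y2 \<in> N'" by auto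
    note cb = C.coef_base[OF y(3)]
    have "y = (y1, C.base y2) \<oplus>\<^bsub>(dg_cone X f Y)\<^esub> ract (dg_cone X f Y) (\<zero>\<^bsub>Y\<^esub>, s) (C.coef y2)"
      using y cb(3) C.coef_closed[OF y(3)] by simp
    then show "\<exists>x\<in>carrier Y \<times> N. \<exists>b\<in>peirce A e. y = x \<oplus>\<^bsub>(dg_cone X f Y)\<^esub> ract (dg_cone X f Y) (\<zero>\<^bsub>Y\<^esub>, s) b"
      using y(2) cb by blast
  qed (use C.e C.s C.sub cone_submodule[OF f C.N] cone_submodule[OF f C.N'] C.S(5) C.E(2) C.free dg_homD(3)[OF f C.sc]
      in auto)
qed

lemma cone_chain:
  assumes f: "f \<in> dg_hom A X Y" and "chain A X N0 ns N"
  shows "chain A (dg_cone X f Y) (carrier Y \<times> N0) (map (\<lambda>i. i - 1) ns) (carrier Y \<times> N)"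
  using assms(2)
  by (induction rule: chain.induct) (auto intro: chain.intros cone_submodule[OF f] cone_cell[OF f])

lemma cone_inclusion:
  assumes f: "f \<in> dg_hom A X Y" shows "(\<lambda>y. (y, \<zero>\<^bsub>X\<^esub>)) \<in> dg_hom A Y (dg_cone X f Y)"
proof -
  interpret X: dg_module A X using dg_homD(1)[OF f] .
  interpret Y: dg_module A Y using dg_homD(2)[OF f] .
  show ?thesis
    by (rule dg_homI[OF Y.dg_module_axioms cone_dg_module[OF f]]) (auto simp: dg_hom_zero[OF f])
qed

text \<open>\<open>X\<close> may be replaced by a cellular model \<open>Q\<close>. The cone of the
  composite is then \<open>Y\<close> with finitely many cells attached, so it is filtered by
  \<open>filtered_chain\<close>, and it maps quasi-isomorphically to the original cone.\<close>

lemma filtered_cone: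
  fixes X :: "('a, 'x) dgmod" and Y :: "('a, 'y) dgmod"
  assumes f: "f \<in> dg_hom A X Y" and X: "filtered X" and Y: "filtered Y"
  shows "filtered (dg_cone X f Y)"
proof -
  obtain ns and Q :: "('a, 'm) dgmod" and p where Q: "cellular A Q ns" "qis A p Q X"
    using X by (auto simp: filtered_def model_def)
  note ph = qis_hom[OF Q(2)]
  have fp: "f \<circ> p \<in> dg_hom A Q Y" using dg_hom_comp[OF ph f] .
  interpret Q: dg_module A Q using dg_homD(1)[OF ph] .
  interpret X: dg_module A X using dg_homD(1)[OF f] .
  interpret Y: dg_module A Y using dg_homD(2)[OF f] .
  let ?C = "dg_cone Q (f \<circ> p) Y" and ?D = "dg_cone X f Y"
  have C: "dg_module A ?C" and D: "dg_module A ?D" using cone_dg_module fp f by auto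
  interpret C: dg_module A ?C by fact
  interpret D: dg_module A ?D by fact
  have im: "(\<lambda>y. (y, \<zero>\<^bsub>Q\<^esub>)) ` carrier Y = carrier Y \<times> {\<zero>\<^bsub>Q\<^esub>}" by auto
  have "filtered (dg_restrict ?C (carrier Y \<times> {\<zero>\<^bsub>Q\<^esub>}))"
    using filtered_image[OF Y cone_inclusion[OF fp]] unfolding im by (simp add: inj_on_def)
  then have "filtered (dg_restrict ?C (carrier ?C))"
    using filtered_chain[OF cone_chain[OF fp] C] Q(1) by (fastforce simp: cellular_def)
  then have fC: "filtered ?C" using dg_restrict_carrier[OF C] by simp
  define \<phi> where "\<phi> = (\<lambda>(y :: 'y, x). (y, p x))"
  have \<phi> [simp]: "\<phi> (y, x) = (y, p x)" for y x by (simp add: \<phi>_def)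
  note [simp] = dg_homD(3)[OF f] dg_homD(3)[OF ph] dg_hom_zero[OF ph]
  have h: "\<phi> \<in> dg_hom A ?C ?D"
    by (rule dg_homI[OF C D])
      (auto simp: dg_homD(4,5,6)[OF ph] dg_hom_inv[OF ph] dg_homD(7)[OF ph])
  have N: "dg_submodule A ?C (carrier Y \<times> {\<zero>\<^bsub>Q\<^esub>})" "dg_submodule A ?D (carrier Y \<times> {\<zero>\<^bsub>X\<^esub>})"
    using cone_submodule[OF fp dg_submodule_zero] cone_submodule[OF f dg_submodule_zero]
      Q.dg_module_axioms X.dg_module_axioms by auto
  \<comment> \<open>On the submodules \<open>Y\<close> the comparison is an isomorphism, and on the
    quotients it is the shifted map \<open>p\<close>; the five lemma applies.\<close>
  have "qis A \<phi> ?C ?D"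
  proof (rule qis_five[OF h N])
    show "\<phi> x \<in> carrier Y \<times> {\<zero>\<^bsub>X\<^esub>}" if "x \<in> carrier Y \<times> {\<zero>\<^bsub>Q\<^esub>}" for x using that by auto
    have "\<phi> \<in> dg_hom A (dg_restrict ?C (carrier Y \<times> {\<zero>\<^bsub>Q\<^esub>})) (dg_restrict ?D (carrier Y \<times> {\<zero>\<^bsub>X\<^esub>}))"
      by (rule dg_hom_codomain[OF dg_hom_restrict[OF h N(1)] N(2)]) auto
    moreover have "bij_betw \<phi> (carrier Y \<times> {\<zero>\<^bsub>Q\<^esub>}) (carrier Y \<times> {\<zero>\<^bsub>X\<^esub>})"
      by (rule bij_betw_byWitness[of _ "\<lambda>(y, x). (y, \<zero>\<^bsub>Q\<^esub>)"]) auto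
    ultimately show "qis A \<phi> (dg_restrict ?C (carrier Y \<times> {\<zero>\<^bsub>Q\<^esub>})) (dg_restrict ?D (carrier Y \<times> {\<zero>\<^bsub>X\<^esub>}))"
      by (intro qis_if_isos) (simp add: dg_isos_def)
  next
    fix i z assume z: "z \<in> gr ?D i" "diff ?D z \<in> carrier Y \<times> {\<zero>\<^bsub>X\<^esub>}"
    then obtain y x where z': "z = (y, x)" "y \<in> gr Y i" "x \<in> gr X (i + 1)" by auto
    have yx: "y \<in> carrier Y" "x \<in> carrier X" using z' X.gr_closed Y.gr_closed by auto
    have "\<ominus>\<^bsub>X\<^esub> diff X x = \<zero>\<^bsub>X\<^esub>" using z z' by simp
    then have dx: "diff X x = \<zero>\<^bsub>X\<^esub>" using yx by (metis X.diff_closed X.inv_zero X.minus_minus)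
    obtain x1 w where x1: "x1 \<in> gr Q (i + 1)" "diff Q x1 = \<zero>\<^bsub>Q\<^esub>" "w \<in> gr X (i + 1 - 1)" "x = p x1 \<oplus>\<^bsub>X\<^esub> diff X w"
      using qis_surjE[OF Q(2) z'(3) dx] .
    have c: "x1 \<in> carrier Q" "w \<in> carrier X" using Q.gr_closed[OF x1(1)] X.gr_closed[OF x1(3)] .
    have "(\<zero>\<^bsub>Y\<^esub>, x1) \<in> gr ?C i" "diff ?C (\<zero>\<^bsub>Y\<^esub>, x1) \<in> carrier Y \<times> {\<zero>\<^bsub>Q\<^esub>}" using x1 c by simp_all
    \<comment> \<open>The sign compensates the minus in the second component of the differential of
      the cone.\<close>
    moreover have "(\<zero>\<^bsub>Y\<^esub>, \<ominus>\<^bsub>X\<^esub> w) \<in> gr ?D (i - 1)" using x1 X.gr_inv by simp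
    moreover have "z \<ominus>\<^bsub>(?D)\<^esub> \<phi> (\<zero>\<^bsub>Y\<^esub>, x1) \<ominus>\<^bsub>(?D)\<^esub> diff ?D (\<zero>\<^bsub>Y\<^esub>, \<ominus>\<^bsub>X\<^esub> w) \<in> carrier Y \<times> {\<zero>\<^bsub>X\<^esub>}"
    proof -
      have "p x1 \<oplus>\<^bsub>X\<^esub> diff X w \<oplus>\<^bsub>X\<^esub> \<ominus>\<^bsub>X\<^esub> p x1 \<oplus>\<^bsub>X\<^esub> \<ominus>\<^bsub>X\<^esub> diff X w = \<zero>\<^bsub>X\<^esub>"
        using c X.diff_closed[OF c(2)] dg_homD(3)[OF ph c(1)] by algebra
      then show ?thesis
        using yx c z'(1) by (simp add: D.minus_eq cone_inv[OF f] X.diff_inv X.minus_minus x1(4))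
    qed
    ultimately show "\<exists>y\<in>gr ?C i. diff ?C y \<in> carrier Y \<times> {\<zero>\<^bsub>Q\<^esub>} \<and>
      (\<exists>w\<in>gr ?D (i - 1). z \<ominus>\<^bsub>(?D)\<^esub> \<phi> y \<ominus>\<^bsub>(?D)\<^esub> diff ?D w \<in> carrier Y \<times> {\<zero>\<^bsub>X\<^esub>})"
      by (intro bexI[of _ "(\<zero>\<^bsub>Y\<^esub>, x1)"] conjI bexI[of _ "(\<zero>\<^bsub>Y\<^esub>, \<ominus>\<^bsub>X\<^esub> w)"])
  next
    fix i z w' assume z: "z \<in> gr ?C i" "diff ?C z \<in> carrier Y \<times> {\<zero>\<^bsub>Q\<^esub>}" and w': "w' \<in> gr ?D (i - 1)"
      and b: "\<phi> z \<ominus>\<^bsub>(?D)\<^esub> diff ?D w' \<in> carrier Y \<times> {\<zero>\<^bsub>X\<^esub>}"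
    obtain y x where z': "z = (y, x)" "y \<in> gr Y i" "x \<in> gr Q (i + 1)" using z by auto
    obtain y' w where w: "w' = (y', w)" "y' \<in> gr Y (i - 1)" "w \<in> gr X (i - 1 + 1)" using w' by auto
    have c: "y \<in> carrier Y" "x \<in> carrier Q" "y' \<in> carrier Y" "w \<in> carrier X"
      using z' w X.gr_closed Y.gr_closed Q.gr_closed by auto
    have "\<ominus>\<^bsub>Q\<^esub> diff Q x = \<zero>\<^bsub>Q\<^esub>" using z z' by simp
    then have dx: "diff Q x = \<zero>\<^bsub>Q\<^esub>" using c by (metis Q.diff_closed Q.inv_zero Q.minus_minus)
    have "p x \<oplus>\<^bsub>X\<^esub> diff X w = \<zero>\<^bsub>X\<^esub>"
      using b c z'(1) w(1) by (simp add: D.minus_eq cone_inv[OF f] X.minus_minus)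
    then have "p x = diff X (\<ominus>\<^bsub>X\<^esub> w)" using c by (simp add: X.diff_inv X.eq_minusI)
    moreover have "\<ominus>\<^bsub>X\<^esub> w \<in> gr X (i + 1 - 1)" using X.gr_inv w by simp
    ultimately obtain v where v: "v \<in> gr Q (i + 1 - 1)" "x = diff Q v" using qis_injE[OF Q(2) z'(3) dx] by metis
    have vc: "v \<in> carrier Q" using Q.gr_closed[OF v(1)] .
    have "(\<zero>\<^bsub>Y\<^esub>, \<ominus>\<^bsub>Q\<^esub> v) \<in> gr ?C (i - 1)" using v Q.gr_inv by simp
    moreover have "z \<ominus>\<^bsub>(?C)\<^esub> diff ?C (\<zero>\<^bsub>Y\<^esub>, \<ominus>\<^bsub>Q\<^esub> v) \<in> carrier Y \<times> {\<zero>\<^bsub>Q\<^esub>}"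
      using c vc z'(1) by (simp add: C.minus_eq cone_inv[OF fp] Q.diff_inv Q.minus_minus v(2) Q.r_neg)
    ultimately show "\<exists>w\<in>gr ?C (i - 1). z \<ominus>\<^bsub>(?C)\<^esub> diff ?C w \<in> carrier Y \<times> {\<zero>\<^bsub>Q\<^esub>}" by (rule bexI[rotated])
  qed
  then show ?thesis using filtered_qis[OF fC] by blast
qed

section \<open>Removing the top cell of a filtered module\<close>

lemma cell_mod_cell:
  assumes e: "prim_idem A e"
  shows "cell A (cell_mod e n) {\<zero>} e e n (peirce A e)"
proof -
  note E = prim_idemD[OF e]
  note P = peirce_closed[OF E(1,3)]
  have K: "dg_module A (cell_mod e n)" using cell_mod_dg_module[OF E(1,3)] .
  have "dg_submodule A (cell_mod e n) {\<zero>}" "dg_submodule A (cell_mod e n) (peirce A e)"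
    using dg_submodule_zero[OF K] dg_submodule_carrier[OF K] by simp_all
  then show ?thesis unfolding cell_def
    using e E P(1-4) diff_agr0[OF E(1)] by (auto simp: cell_mod_diff[OF E(1,3)])
qed

lemma filtered_cell_mod:
  assumes e: "prim_idem A e" shows "filtered (cell_mod e n)"
proof -
  have K: "dg_module A (cell_mod e n)" using cell_mod_dg_module[OF prim_idemD(1,3)[OF e]] .
  have "chain A (cell_mod e n) {\<zero>\<^bsub>(cell_mod e n)\<^esub>} [n] (carrier (cell_mod e n))"
    using chain_cons[OF chain_nil cell_mod_cell[OF e]] dg_submodule_zero[OF K] by simp
  then have "model A U (dg_restrict (cell_mod e n) (carrier (cell_mod e n))) [n]"
    by (rule chain_model[OF _ K]) simp
  then show ?thesis unfolding filtered_def dg_restrict_carrier[OF K] by blast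
qed

text \<open>\<open>\<lbrace>1\<rbrace>N\<close> is quasi-isomorphic to the cone of the projection of \<open>M\<close> onto the top cell.\<close>

lemma filtered_fibre:
  assumes M: "filtered M" and c: "cell A M N s e n (carrier M)"
  shows "filtered (dg_restrict M N)"
proof -
  have Mm: "dg_module A M" by (rule filtered_module[OF M])
  interpret C: dg_cell k A M N s e n "carrier M" using dg_cellI[OF c Mm] .
  let ?K = "cell_mod e n"
  have K: "dg_module A ?K" using cell_mod_dg_module[OF C.E(1,3)] .
  interpret K: dg_module A ?K by fact
  \<comment> \<open>The coordinate at the top cell is the chain map from \<open>M\<close> onto its
    last subquotient, with kernel \<open>N\<close>.\<close>
  have \<pi>: "C.coef \<in> dg_hom A M ?K"
    by (rule dg_homI[OF Mm K])
      (auto simp: C.coef_base C.coef_add C.coef_act C.coef_diff cell_mod_diff[OF C.E(1,3)] C.coef_gr C.M.gr_closed)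
  let ?D = "dg_cone M C.coef ?K" and ?Z = "dg_shift 1 (dg_restrict M N)"
  have D: "filtered ?D" by (rule filtered_cone[OF \<pi> M filtered_cell_mod[OF C.e]])
  have Zm: "dg_module A ?Z" using shift_dg_module[OF C.S(10)] .
  have sb: "C.coef (diff M (ract M s b)) = diff ?K b" "ract M s b \<in> carrier M" "C.coef (ract M s b) = b"
    if b: "b \<in> peirce A e" for b
  proof -
    show sb: "ract M s b \<in> carrier M" using C.P(3)[OF b] by simp
    show cb: "C.coef (ract M s b) = b" using C.coef_eqI(1)[OF C.S(2) b] sb by simp
    show "C.coef (diff M (ract M s b)) = diff ?K b" using C.coef_diff(1)[OF sb] cb b by (simp add: cell_mod_diff[OF C.E(1,3)])
  qed
  \<comment> \<open>The kernel, shifted by 1, sits in the source part of the cone; surjectivity of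
    the projection makes this inclusion a quasi-isomorphism.\<close>
  have "(\<lambda>x. (\<zero>, x)) \<in> dg_hom A ?Z ?D"
    by (rule dg_homI[OF Zm cone_dg_module[OF \<pi>]])
      (auto simp: C.S(3) C.coef_N C.P(1) cell_mod_diff[OF C.E(1,3)] koszul_def C.S(8,11))
  then have "qis A (\<lambda>x. (\<zero>, x)) ?Z ?D"
  proof (rule qisI)
    fix i z assume z: "z \<in> gr ?D i" "diff ?D z = \<zero>\<^bsub>(?D)\<^esub>"
    then obtain b x where z': "z = (b, x)" "b \<in> agr A (i - n)" "b \<in> peirce A e" "x \<in> gr M (i + 1)" by auto
    have x: "x \<in> carrier M" using C.M.gr_closed[OF z'(4)] .
    have e1: "diff ?K b \<oplus> C.coef x = \<zero>" and "\<ominus>\<^bsub>M\<^esub> diff M x = \<zero>\<^bsub>M\<^esub>" using z z' by auto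
    then have dx: "diff M x = \<zero>\<^bsub>M\<^esub>" using x by (metis C.M.diff_closed C.M.inv_zero C.M.minus_minus)
    let ?w = "ract M s b"
    note w = sb[OF z'(3)]
    have wg: "?w \<in> gr M i" using C.M.act_gr[OF C.s(1) z'(2)] by simp
    \<comment> \<open>The boundary of (0, s b) in the cone is (b, - d (s b)): it removes the first
      component \<open>b\<close> and at the same time moves the second one into
      \<open>N\<close>.\<close>
    let ?x = "x \<oplus>\<^bsub>M\<^esub> diff M ?w"
    have xc: "?x \<in> carrier M" using x w by simp
    have bc: "diff ?K b \<in> carrier A" using K.diff_closed[of b] z'(3) C.P(3) by simp
    have "C.coef ?x = C.coef x \<oplus> diff ?K b" using x w by (simp add: C.coef_add)
    also have "\<dots> = \<zero>" using e1 bc C.coef_closed[OF x] by (simp add: a_comm)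
    finally have "?x \<in> N" using C.mem_N_iff[OF xc] by simp
    moreover have "?x \<in> gr M (i + 1)" using z'(4) wg C.M.diff_gr C.M.gr_add by simp
    moreover have "diff M ?x = \<zero>\<^bsub>M\<^esub>" using x w dx by (simp add: C.M.diff_add C.M.diff_diff)
    moreover have "z = (\<zero>, ?x) \<oplus>\<^bsub>(?D)\<^esub> diff ?D (\<zero>, ?w)"
      using z'(1,3) x w C.P(1,3) C.M.diff_closed[OF w(2)]
      by (simp add: cell_mod_diff[OF C.E(1,3)] C.M.a_assoc C.M.r_neg)
    moreover have "(\<zero>, ?w) \<in> gr ?D (i - 1)" using wg C.P(1) by simp
    ultimately show "\<exists>x\<in>gr ?Z i. diff ?Z x = \<zero>\<^bsub>(?Z)\<^esub> \<and> (\<exists>w\<in>gr ?D (i - 1). z = (\<zero>, x) \<oplus>\<^bsub>(?D)\<^esub> diff ?D w)"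
      using C.S(11)[of "\<zero>\<^bsub>M\<^esub>"] C.S(2) by (intro bexI[of _ ?x] conjI bexI[of _ "(\<zero>, ?w)"]) (simp_all add: koszul_def)
  next
    fix i x w assume x: "x \<in> gr ?Z i" "diff ?Z x = \<zero>\<^bsub>(?Z)\<^esub>" and w: "w \<in> gr ?D (i - 1)" "(\<zero>, x) = diff ?D w"
    obtain b v where w': "w = (b, v)" "b \<in> agr A (i - 1 - n)" "b \<in> peirce A e" "v \<in> gr M i" using w by auto
    have v: "v \<in> carrier M" using C.M.gr_closed[OF w'(4)] .
    have e1: "diff ?K b \<oplus> C.coef v = \<zero>" and xv: "x = \<ominus>\<^bsub>M\<^esub> diff M v" using w(2) w'(1) by auto
    let ?u = "ract M s b"
    note u = sb[OF w'(3)]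
    have ug: "?u \<in> gr M (i - 1)" using C.M.act_gr[OF C.s(1) w'(2)] by simp
    let ?v = "v \<oplus>\<^bsub>M\<^esub> diff M ?u"
    have vc: "?v \<in> carrier M" using v u by simp
    have bc: "diff ?K b \<in> carrier A" using K.diff_closed[of b] w'(3) C.P(3) by simp
    have "C.coef ?v = C.coef v \<oplus> diff ?K b" using v u by (simp add: C.coef_add)
    also have "\<dots> = \<zero>" using e1 bc C.coef_closed[OF v] by (simp add: a_comm)
    finally have vN: "?v \<in> N" using C.mem_N_iff[OF vc] by simp
    have "?v \<in> gr M i" using w'(4) ug C.M.diff_gr' C.M.gr_add by simp
    moreover have "x = \<ominus>\<^bsub>M\<^esub> diff M ?v" using v u xv by (simp add: C.M.diff_add C.M.diff_diff)
    ultimately show "\<exists>v\<in>gr ?Z (i - 1). x = diff ?Z v"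
      using vN C.S(8)[OF vN] by (intro bexI[of _ ?v]) (simp_all add: koszul_def C.S(11))
  qed
  then have "filtered ?Z" using filtered_qis'[OF D] by blast
  then have "filtered (dg_shift (- 1) ?Z)" by (rule filtered_shift)
  then show ?thesis using filtered_qis[OF _ qis_if_isos[OF shift_shift_iso[OF C.S(10)]]] by blast
qed

section \<open>Direct summands of filtered modules\<close>

lemma sum_cell:
  assumes c: "cell A X N s e n (carrier X)" and X: "dg_module A X" and Y: "dg_module A Y"
  shows "cell A (dg_sum X Y) (N \<times> carrier Y) (s, \<zero>\<^bsub>Y\<^esub>) e n (carrier (dg_sum X Y))"
proof -
  interpret C: dg_cell k A X N s e n "carrier X" using dg_cellI[OF c X] .
  interpret Y: dg_module A Y by fact
  have S: "dg_module A (dg_sum X Y)" by (rule sum_dg_module[OF X Y])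
  interpret S: dg_module A "dg_sum X Y" by fact
  have pr: "S.pr i z = (C.M.pr i (fst z), Y.pr i (snd z))" if "z \<in> carrier (dg_sum X Y)" for i z
    using that
  proof (induction rule: S.gr_induct)
    case (gr j y)
    then show ?case using S.pr_pure[OF gr, of i] by (cases y) (auto simp: C.M.pr_pure Y.pr_pure)
  next
    case (add y z)
    then show ?case using S.pr_add[OF add(1,2)] by (cases y; cases z) (auto simp: C.M.pr_add Y.pr_add)
  qed
  have inv: "\<ominus>\<^bsub>(dg_sum X Y)\<^esub> (x, y) = (\<ominus>\<^bsub>X\<^esub> x, \<ominus>\<^bsub>Y\<^esub> y)" if "x \<in> carrier X" "y \<in> carrier Y" for x y
    by (rule koszul_pair(1)[OF C.M.abelian_group_axioms Y.abelian_group_axioms S.abelian_group_axioms])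
      (use that in auto)
  have N: "dg_submodule A (dg_sum X Y) (N \<times> carrier Y)"
    by (rule dg_submoduleI[OF S]) (use C.S(1,2) in \<open>auto simp: C.S(3-9) pr inv\<close>)
  show ?thesis unfolding cell_def
  proof (intro conjI ballI impI)
    fix y assume "y \<in> carrier (dg_sum X Y)"
    then obtain y1 y2 where y: "y = (y1, y2)" "y1 \<in> carrier X" "y2 \<in> carrier Y" by auto
    note cb = C.coef_base[OF y(2)]
    have "y = (C.base y1, y2) \<oplus>\<^bsub>(dg_sum X Y)\<^esub> ract (dg_sum X Y) (s, \<zero>\<^bsub>Y\<^esub>) (C.coef y1)"
      using y cb(3) C.coef_closed[OF y(2)] by simp
    then show "\<exists>x\<in>N \<times> carrier Y. \<exists>b\<in>peirce A e. y = x \<oplus>\<^bsub>(dg_sum X Y)\<^esub> ract (dg_sum X Y) (s, \<zero>\<^bsub>Y\<^esub>) b"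
      using y(3) cb by blast
  qed (use N dg_submodule_carrier[OF S] C.e C.s C.S(1) C.E(2) C.free in auto)
qed

lemma chain_bottom:
  assumes "chain A M N0 ns N" "ns \<noteq> []"
  shows "\<exists>s e N1. cell A M N0 s e (last ns) N1 \<and> N1 \<subseteq> N"
  using assms
proof (induction rule: chain.induct)
  case (chain_cons ns N s e n N')
  then have sub: "N \<subseteq> N'" by (simp add: cell_def)
  show ?case
  proof (cases "ns = []")
    case True
    then have "N = N0" using chain_cons.hyps(1) by (auto elim: chain.cases)
    then show ?thesis using chain_cons.hyps(2) True by auto
  next
    case False
    then show ?thesis using chain_cons.IH sub by fastforce
  qed
qed simp

text \<open>By positivity a cell of degree n contributes nothing below degree n. In particular a
  bottom cell cannot be the boundary of anything.\<close>

lemma chain_gr_low: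
  assumes "chain A M {\<zero>\<^bsub>M\<^esub>} ns N" and M: "dg_module A M" and "\<forall>m\<in>set ns. p \<le> m" "i < p" "y \<in> gr M i" "y \<in> N"
  shows "y = \<zero>\<^bsub>M\<^esub>"
  using assms(1,3,5,6)
proof (induction arbitrary: y rule: chain.induct)
  case (chain_cons ns N s e n N')
  interpret C: dg_cell k A M N s e n N' using dg_cellI[OF chain_cons.hyps(2) M] .
  note y = chain_cons.prems(3)
  have "C.coef y = \<zero>" using C.coef_gr(1)[OF y chain_cons.prems(2)] agr_neg assms(4) chain_cons.prems(1) by force
  then have "y \<in> N" using C.mem_N_iff[OF y] by simp
  then show ?case using chain_cons by auto
qed simp

lemma sum_swap_iso:
  assumes "dg_module A X" "dg_module A Y"
  shows "(\<lambda>(x, y). (y, x)) \<in> dg_isos A (dg_sum X Y) (dg_sum Y X)"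
proof -
  have "(\<lambda>(x, y). (y, x)) \<in> dg_hom A (dg_sum X Y) (dg_sum Y X)"
    by (rule dg_homI) (use sum_dg_module assms in auto)
  moreover have "bij_betw (\<lambda>(x, y). (y, x)) (carrier (dg_sum X Y)) (carrier (dg_sum Y X))"
    by (rule bij_betw_byWitness[of _ "\<lambda>(x, y). (y, x)"]) auto
  ultimately show ?thesis by (simp add: dg_isos_def)
qed

text \<open>The induction step for direct summands: killing a bottom class of \<open>X\<close> shortens the
  minimal model of the sum.\<close>

lemma kill_class:
  fixes Q X Y :: "('a, 'm) dgmod"
  assumes Q: "cellular A Q ns" "sorted_wrt (\<ge>) ns" "\<forall>m\<in>set ns. p \<le> m" and q: "qis A q Q (dg_sum X Y)"
    and X: "dg_module A X" and Y: "dg_module A Y" and e: "prim_idem A e"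
    and x: "x \<in> gr X p" "diff X x = \<zero>\<^bsub>X\<^esub>" "ract X x e = x" "x \<notin> boundaries X p"
  obtains X' :: "('a, 'm) dgmod" and ns' and Q' :: "('a, 'm) dgmod" and q' where
    "filtered X' \<Longrightarrow> filtered X" "length ns' < length ns" "sorted_wrt (\<ge>) ns'" "cellular A Q' ns'"
    "qis A q' Q' (dg_sum X' Y)" "dg_module A X'"
proof -
  interpret X: dg_module A X by fact
  interpret Y: dg_module A Y by fact
  \<comment> \<open>A class of degree p is killed by a cell of degree p - 1, strictly below all
    cells of \<open>Q\<close>, as the length clause of \<open>insert_cell\<close> requires.\<close>
  have x': "x \<in> gr X (p - 1 + 1)" using x by simp
  obtain X' :: "('a, 'm) dgmod" and i s where i: "i \<in> dg_hom A X X'" "inj_on i (carrier X)"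
    and c: "cell A X' (i ` carrier X) s e (p - 1) (carrier X')" and ds: "diff X' s = i x"
    using attach[OF X e x' x(2,3)] .
  have X': "dg_module A X'" using dg_homD(2)[OF i(1)] .
  interpret X': dg_module A X' by fact
  let ?M = "dg_sum X' Y" and ?N = "i ` carrier X \<times> carrier Y"
  have cM: "cell A ?M ?N (s, \<zero>\<^bsub>Y\<^esub>) e (p - 1) (carrier ?M)" by (rule sum_cell[OF c X' Y])
  have M: "dg_module A ?M" by (rule sum_dg_module[OF X' Y])
  have N: "dg_submodule A ?M ?N" using cM by (simp add: cell_def)
  define \<iota> where "\<iota> = (\<lambda>(x, y). (i x, y :: 'm))"
  have \<iota>: "\<iota> \<in> dg_hom A (dg_sum X Y) ?M"
    by (rule dg_homI[OF sum_dg_module[OF X Y] M]) (auto simp: \<iota>_def dg_homD(3-7)[OF i(1)])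
  have "inj_on \<iota> (carrier (dg_sum X Y))" using i(2) by (auto simp: \<iota>_def inj_on_def)
  moreover have "\<iota> ` carrier (dg_sum X Y) = ?N" by (auto simp: \<iota>_def image_iff)
  ultimately have "qis A \<iota> (dg_sum X Y) (dg_restrict ?M ?N)" using qis_if_isos[OF dg_isos_image[OF \<iota>]] by simp
  then have "qis A (\<iota> \<circ> q) Q (dg_restrict ?M ?N)" using qis_comp[OF q] by blast
  then obtain Q1 :: "('a, 'm) dgmod" and j t q1 z w where j: "j \<in> dg_hom A Q Q1" "inj_on j (carrier Q)"
    and cQ: "cell A Q1 (j ` carrier Q) t e (p - 1) (carrier Q1)" "diff Q1 t = j z"
    and q1: "qis A q1 Q1 ?M" and z: "z \<in> carrier Q" "w \<in> ?N" "diff ?M (s, \<zero>\<^bsub>Y\<^esub>) = (\<iota> \<circ> q) z \<oplus>\<^bsub>(?M)\<^esub> diff ?M w"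
    using attach_qis[OF _ cM M] by metis
  have Qm: "dg_module A Q" and Q1m: "dg_module A Q1" using dg_homD(1,2)[OF j(1)] .
  interpret Q: dg_module A Q by fact
  interpret Q1: dg_module A Q1 by fact
  \<comment> \<open>If the model received a cell with zero boundary, then \<open>x\<close> would
    already have been a boundary in \<open>X\<close>.\<close>
  have "z \<noteq> \<zero>\<^bsub>Q\<^esub>"
  proof
    assume "z = \<zero>\<^bsub>Q\<^esub>"
    then have "(\<iota> \<circ> q) z = \<zero>\<^bsub>(?M)\<^esub>" using dg_hom_zero[OF dg_hom_comp[OF qis_hom[OF q] \<iota>]] by simp
    then have "diff ?M w = (i x, \<zero>\<^bsub>Y\<^esub>)"
      using z(2,3) ds X'.diff_closed Y.diff_closed dg_submoduleD(3)[OF M N z(2)] by (cases w) (auto simp: X'.l_zero Y.l_zero)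
    then obtain v y where v: "w = (i v, y)" "v \<in> carrier X" "diff X' (i v) = i x" using z(2) by auto
    have xc: "x \<in> carrier X" using X.gr_closed[OF x(1)] .
    have "i (diff X v) = i x" using v dg_homD(7)[OF i(1) v(2)] by simp
    then have dv: "diff X v = x" using inj_onD[OF i(2)] X.diff_closed[OF v(2)] xc by blast
    \<comment> \<open>The chain bounding \<open>x\<close> need not be homogeneous; its component in
      degree p - 1 bounds \<open>x\<close> as well.\<close>
    have "diff X (X.pr (p - 1) v) = X.pr p x" using X.pr_diff[OF v(2), of "p - 1"] dv by simp
    then have "x = diff X (X.pr (p - 1) v)" using x(1) by (simp add: X.pr_pure)
    then have "x \<in> boundaries X p" by (rule boundariesI[OF X.pr_gr[OF v(2)]])
    then show False using x(4) by simp
  qed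
  then have "diff Q1 t \<noteq> \<zero>\<^bsub>Q1\<^esub>"
    using cQ(2) inj_onD[OF j(2), of z "\<zero>\<^bsub>Q\<^esub>"] z(1) dg_hom_zero[OF j(1)] Q.zero_closed by auto
  moreover have "\<forall>m\<in>set ns. p - 1 < m" using Q(3) by auto
  moreover have "chain A Q1 {\<zero>\<^bsub>Q1\<^esub>} ns (j ` carrier Q)"
    using chain_image[OF _ j, of "{\<zero>\<^bsub>Q\<^esub>}" ns "carrier Q"] Q(1) dg_hom_zero[OF j(1)] by (simp add: cellular_def)
  ultimately obtain ns' where ns': "model A U (dg_restrict Q1 (carrier Q1)) ns'" "length ns' < length ns"
    using insert_cell[OF _ Q1m Q(2) cQ(1)] by blast
  then obtain Q' :: "('a, 'm) dgmod" and r where Q': "sorted_wrt (\<ge>) ns'" "cellular A Q' ns'" "qis A r Q' Q1"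
    using dg_restrict_carrier[OF Q1m] by (auto simp: model_def)
  \<comment> \<open>\<open>X\<close> is recovered as the submodule below the newly attached top cell
    of \<open>X'\<close>.\<close>
  have "filtered X" if "filtered X'"
    using filtered_qis[OF filtered_fibre[OF that c] qis_if_isos[OF dg_isos_inv[OF dg_isos_image[OF i]]]] .
  then show ?thesis using that[OF _ ns'(2) Q'(1,2) qis_comp[OF Q'(3) q1] X'] by blast
qed

text \<open>A zero model makes the sum acyclic, hence \<open>X\<close> too, so the zero map from the
  model is already a quasi-isomorphism to \<open>X\<close>.\<close>

lemma zero_qis:
  assumes q: "qis A q Q (dg_sum X Y)" and Q: "carrier Q = {\<zero>\<^bsub>Q\<^esub>}" and X: "dg_module A X" and Y: "dg_module A Y"
  shows "filtered X"
proof -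
  interpret X: dg_module A X by fact
  interpret Y: dg_module A Y by fact
  have Qm: "dg_module A Q" using dg_homD(1)[OF qis_hom[OF q]] .
  interpret Q: dg_module A Q by fact
  have h: "(\<lambda>x. \<zero>\<^bsub>X\<^esub>) \<in> dg_hom A Q X" by (rule dg_homI[OF Qm X]) auto
  have "qis A (\<lambda>x. \<zero>\<^bsub>X\<^esub>) Q X"
  proof (rule qisI[OF h])
    fix i z assume z: "z \<in> gr X i" "diff X z = \<zero>\<^bsub>X\<^esub>"
    then have "(z, \<zero>\<^bsub>Y\<^esub>) \<in> gr (dg_sum X Y) i" "diff (dg_sum X Y) (z, \<zero>\<^bsub>Y\<^esub>) = \<zero>\<^bsub>(dg_sum X Y)\<^esub>" by simp_all
    then obtain x w where x: "x \<in> gr Q i" "diff Q x = \<zero>\<^bsub>Q\<^esub>" "w \<in> gr (dg_sum X Y) (i - 1)"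
      "(z, \<zero>\<^bsub>Y\<^esub>) = q x \<oplus>\<^bsub>(dg_sum X Y)\<^esub> diff (dg_sum X Y) w" by (rule qis_surjE[OF q])
    have "x = \<zero>\<^bsub>Q\<^esub>" using Q.gr_closed[OF x(1)] Q by simp
    then have "q x = (\<zero>\<^bsub>X\<^esub>, \<zero>\<^bsub>Y\<^esub>)" using dg_hom_zero[OF qis_hom[OF q]] by simp
    moreover obtain w1 w2 where w: "w = (w1, w2)" "w1 \<in> gr X (i - 1)" "w2 \<in> gr Y (i - 1)" using x(3) by auto
    ultimately have "z = \<zero>\<^bsub>X\<^esub> \<oplus>\<^bsub>X\<^esub> diff X w1" using x(4) by simp
    then show "\<exists>x\<in>gr Q i. diff Q x = \<zero>\<^bsub>Q\<^esub> \<and> (\<exists>w\<in>gr X (i - 1). z = \<zero>\<^bsub>X\<^esub> \<oplus>\<^bsub>X\<^esub> diff X w)" using w x(1,2) by blast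
  next
    fix i x w assume "x \<in> gr Q i"
    then have "x = \<zero>\<^bsub>Q\<^esub>" using Q.gr_closed Q by blast
    then show "\<exists>v\<in>gr Q (i - 1). x = diff Q v" by (intro bexI[of _ "\<zero>\<^bsub>Q\<^esub>"]) simp_all
  qed
  moreover have "filtered Q" using model_zero[OF Qm Q] by (auto simp: filtered_def)
  ultimately show ?thesis using filtered_qis by blast
qed

text \<open>Both summands are treated at once: the bottom class may survive in only one of them, and
  the induction hypothesis for the altered summand has to return the untouched one as well.\<close>

lemma filtered_summands:
  fixes Q X Y :: "('a, 'm) dgmod"
  assumes "cellular A Q ns" "sorted_wrt (\<ge>) ns" "qis A q Q (dg_sum X Y)" "dg_module A X" "dg_module A Y"
  shows "filtered X \<and> filtered Y"
  using assms
proof (induction "length ns" arbitrary: ns Q q X Y rule: less_induct)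
  case less
  note Q = less.prems(1,2) and q = less.prems(3) and X = less.prems(4) and Y = less.prems(5)
  interpret X: dg_module A X by fact
  interpret Y: dg_module A Y by fact
  have Qm: "dg_module A Q" and ch: "chain A Q {\<zero>\<^bsub>Q\<^esub>} ns (carrier Q)" using Q(1) by (auto simp: cellular_def)
  interpret Q: dg_module A Q by fact
  have q': "qis A ((\<lambda>(x, y). (y, x)) \<circ> q) Q (dg_sum Y X)"
    by (rule qis_comp[OF q qis_if_isos[OF sum_swap_iso[OF X Y]]])
  note qh = qis_hom[OF q]
  show ?case
  proof (cases "ns = []")
    case True
    then have "carrier Q = {\<zero>\<^bsub>Q\<^esub>}" using ch by (auto elim: chain.cases)
    then show ?thesis using zero_qis[OF q _ X Y] zero_qis[OF q' _ Y X] by blast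
  next
    case False
    define p where "p = last ns"
    have low: "\<forall>m\<in>set ns. p \<le> m"
    proof
      fix m assume "m \<in> set ns"
      then show "p \<le> m" using Q(2) append_butlast_last_id[OF False] sorted_wrt_append[of "(\<ge>)" "butlast ns" "[last ns]"]
        by (metis p_def Un_iff list.set_intros(1) order_refl set_append set_ConsD empty_iff list.set(1))
    qed
    obtain t e N1 where c: "cell A Q {\<zero>\<^bsub>Q\<^esub>} t e p N1" using chain_bottom[OF ch False] p_def by blast
    interpret C: dg_cell k A Q "{\<zero>\<^bsub>Q\<^esub>}" t e p N1 using dg_cellI[OF c Qm] .
    have t: "t \<in> gr Q p" "diff Q t = \<zero>\<^bsub>Q\<^esub>" "ract Q t e = t" "t \<in> carrier Q" using C.s by auto
    have "t \<noteq> \<zero>\<^bsub>Q\<^esub>" using C.free[OF C.P(2)] t C.E(4) by auto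
    obtain a b where ab: "q t = (a, b)" "a \<in> gr X p" "b \<in> gr Y p" using dg_homD(6)[OF qh t(1)] by auto
    have "diff (dg_sum X Y) (q t) = (\<zero>\<^bsub>X\<^esub>, \<zero>\<^bsub>Y\<^esub>)" using dg_homD(7)[OF qh t(4)] t(2) dg_hom_zero[OF qh] by simp
    then have d: "diff X a = \<zero>\<^bsub>X\<^esub>" "diff Y b = \<zero>\<^bsub>Y\<^esub>" using ab by simp_all
    have "ract (dg_sum X Y) (q t) e = q t" using dg_homD(5)[OF qh t(4) C.E(2)] t(3) by simp
    then have abe: "ract X a e = a" "ract Y b e = b" using ab by simp_all
    \<comment> \<open>Otherwise \<open>q t\<close> would be a boundary, so \<open>t\<close> would
      bound an element of degree p - 1 in \<open>Q\<close>, where \<open>Q\<close> is zero.\<close>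
    have "a \<notin> boundaries X p \<or> b \<notin> boundaries Y p"
    proof (rule ccontr)
      assume "\<not> ?thesis"
      then obtain x y where "x \<in> gr X (p - 1)" "a = diff X x" "y \<in> gr Y (p - 1)" "b = diff Y y"
        by (auto elim!: boundariesE)
      then have "(x, y) \<in> gr (dg_sum X Y) (p - 1)" "q t = diff (dg_sum X Y) (x, y)" using ab by simp_all
      then obtain v where v: "v \<in> gr Q (p - 1)" "t = diff Q v" using qis_injE[OF q t(1,2)] by metis
      have "v = \<zero>\<^bsub>Q\<^esub>" by (rule chain_gr_low[OF ch Qm low _ v(1) Q.gr_closed[OF v(1)]]) simp
      then show False using v \<open>t \<noteq> \<zero>\<^bsub>Q\<^esub>\<close> by simp
    qed
    then show ?thesis
    proof
      assume nb: "a \<notin> boundaries X p"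
      show ?thesis
      proof (rule kill_class[OF Q low q X Y C.e ab(2) d(1) abe(1) nb])
        fix X' :: "('a, 'm) dgmod" and ns' and Q' :: "('a, 'm) dgmod" and r
        assume "filtered X' \<Longrightarrow> filtered X" "length ns' < length ns" "sorted_wrt (\<ge>) ns'" "cellular A Q' ns'"
          "qis A r Q' (dg_sum X' Y)" "dg_module A X'"
        then show ?thesis using less.hyps[of ns' Q' r X' Y] Y by blast
      qed
    next
      assume nb: "b \<notin> boundaries Y p"
      show ?thesis
      proof (rule kill_class[OF Q low q' Y X C.e ab(3) d(2) abe(2) nb])
        fix X' :: "('a, 'm) dgmod" and ns' and Q' :: "('a, 'm) dgmod" and r
        assume "filtered X' \<Longrightarrow> filtered Y" "length ns' < length ns" "sorted_wrt (\<ge>) ns'" "cellular A Q' ns'"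
          "qis A r Q' (dg_sum X' X)" "dg_module A X'"
        then show ?thesis using less.hyps[of ns' Q' r X' X] X by blast
      qed
    qed
  qed
qed

end

section \<open>Zigzags and cohomology\<close>

text \<open>Equality of cohomology classes as a relation between cycles, so that the arguments about
  zigzags run on representatives instead of cosets.\<close>

definition cohomologous :: "('a, 'm) dgmod \<Rightarrow> int \<Rightarrow> 'm \<Rightarrow> 'm \<Rightarrow> bool" where
  "cohomologous M i x y \<longleftrightarrow> x \<in> cycles M i \<and> y \<in> cycles M i \<and> (\<exists>w\<in>gr M (i - 1). x = y \<oplus>\<^bsub>M\<^esub> diff M w)"

context dg_algebra begin

lemma cohomologous_refl: "dg_module A M \<Longrightarrow> x \<in> cycles M i \<Longrightarrow> cohomologous M i x x"
proof -
  assume "dg_module A M" and x: "x \<in> cycles M i"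
  then interpret M: dg_module A M by blast
  show ?thesis unfolding cohomologous_def using x M.gr_closed[of x i]
    by (auto simp: cycles_iff intro!: bexI[of _ "\<zero>\<^bsub>M\<^esub>"])
qed

lemma cohomologous_sym:
  assumes "dg_module A M" "cohomologous M i x y" shows "cohomologous M i y x"
proof -
  interpret M: dg_module A M by fact
  obtain w where w: "x \<in> gr M i" "y \<in> gr M i" "w \<in> gr M (i - 1)" "x = y \<oplus>\<^bsub>M\<^esub> diff M w"
    using assms(2) by (auto simp: cohomologous_def cycles_iff)
  have c: "y \<in> carrier M" "w \<in> carrier M" using w M.gr_closed by auto
  have "y = x \<oplus>\<^bsub>M\<^esub> diff M (\<ominus>\<^bsub>M\<^esub> w)" using c by (simp add: w(4) M.diff_inv M.a_assoc M.r_neg)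
  moreover have "\<ominus>\<^bsub>M\<^esub> w \<in> gr M (i - 1)" using M.gr_inv w by simp
  ultimately show ?thesis using assms(2) unfolding cohomologous_def by blast
qed

lemma cohomologous_trans:
  assumes "dg_module A M" "cohomologous M i x y" "cohomologous M i y z" shows "cohomologous M i x z"
proof -
  interpret M: dg_module A M by fact
  obtain w v where w: "z \<in> gr M i" "w \<in> gr M (i - 1)" "v \<in> gr M (i - 1)" "x = y \<oplus>\<^bsub>M\<^esub> diff M w" "y = z \<oplus>\<^bsub>M\<^esub> diff M v"
    using assms(2,3) by (auto simp: cohomologous_def cycles_iff)
  have c: "z \<in> carrier M" "w \<in> carrier M" "v \<in> carrier M" using w M.gr_closed by auto
  have "x = z \<oplus>\<^bsub>M\<^esub> diff M (v \<oplus>\<^bsub>M\<^esub> w)" using c by (simp add: w M.diff_add M.a_assoc)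
  moreover have "v \<oplus>\<^bsub>M\<^esub> w \<in> gr M (i - 1)" using M.gr_add w by simp
  ultimately show ?thesis using assms(2,3) unfolding cohomologous_def by blast
qed

lemma cycles_map: "f \<in> dg_hom A M N \<Longrightarrow> x \<in> cycles M i \<Longrightarrow> f x \<in> cycles N i"
proof -
  assume f: "f \<in> dg_hom A M N" and x: "x \<in> cycles M i"
  interpret M: dg_module A M using dg_homD(1)[OF f] .
  show ?thesis using x dg_homD(6)[OF f] dg_homD(7)[OF f, of x] dg_hom_zero[OF f] M.gr_closed
    by (auto simp: cycles_iff)
qed

lemma cohomologous_map:
  assumes f: "f \<in> dg_hom A M N" and xy: "cohomologous M i x y" shows "cohomologous N i (f x) (f y)"
proof -
  interpret M: dg_module A M using dg_homD(1)[OF f] .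
  obtain w where w: "x \<in> cycles M i" "y \<in> cycles M i" "w \<in> gr M (i - 1)" "x = y \<oplus>\<^bsub>M\<^esub> diff M w"
    using xy by (auto simp: cohomologous_def)
  have c: "y \<in> carrier M" "w \<in> carrier M" using w M.gr_closed by (auto simp: cycles_iff)
  have "f x = f y \<oplus>\<^bsub>N\<^esub> diff N (f w)" using c by (simp add: w(4) dg_homD(4,7)[OF f])
  then show ?thesis unfolding cohomologous_def using cycles_map[OF f] w dg_homD(6)[OF f] by blast
qed

lemma qis_cohomologous:
  assumes q: "qis A f M N" and xy: "x \<in> cycles M i" "y \<in> cycles M i" "cohomologous N i (f x) (f y)"
  shows "cohomologous M i x y"
proof -
  note f = qis_hom[OF q]
  interpret M: dg_module A M using dg_homD(1)[OF f] .
  interpret N: dg_module A N using dg_homD(2)[OF f] .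
  obtain w where w: "w \<in> gr N (i - 1)" "f x = f y \<oplus>\<^bsub>N\<^esub> diff N w"
    using xy(3) by (auto simp: cohomologous_def)
  have g: "x \<in> gr M i" "y \<in> gr M i" "diff M x = \<zero>\<^bsub>M\<^esub>" "diff M y = \<zero>\<^bsub>M\<^esub>" using xy by (auto simp: cycles_iff)
  have c: "x \<in> carrier M" "y \<in> carrier M" "w \<in> carrier N" "f y \<in> carrier N" "diff N w \<in> carrier N"
    using g w M.gr_closed N.gr_closed dg_homD(3)[OF f] by auto
  have "f (x \<ominus>\<^bsub>M\<^esub> y) = f y \<oplus>\<^bsub>N\<^esub> diff N w \<ominus>\<^bsub>N\<^esub> f y" using c by (simp add: dg_hom_minus[OF f] w(2))
  also have "\<dots> = diff N w" using c by algebra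
  finally have "f (x \<ominus>\<^bsub>M\<^esub> y) = diff N w" .
  moreover have "diff M (x \<ominus>\<^bsub>M\<^esub> y) = \<zero>\<^bsub>M\<^esub>" using g c by (simp add: M.minus_eq M.diff_add M.diff_inv)
  ultimately obtain v where v: "v \<in> gr M (i - 1)" "x \<ominus>\<^bsub>M\<^esub> y = diff M v"
    using qis_injE[OF q M.gr_minus[OF g(1,2)] _ w(1)] by metis
  have "x = y \<oplus>\<^bsub>M\<^esub> (x \<ominus>\<^bsub>M\<^esub> y)" using c by algebra
  then show ?thesis using v xy unfolding cohomologous_def by metis
qed

lemma qis_cohomologous_ex:
  assumes q: "qis A f M N" and z: "z \<in> cycles N i"
  shows "\<exists>x\<in>cycles M i. cohomologous N i z (f x)"
proof -
  have "z \<in> gr N i" "diff N z = \<zero>\<^bsub>N\<^esub>" using z by (auto simp: cycles_iff)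
  then obtain x w where x: "x \<in> gr M i" "diff M x = \<zero>\<^bsub>M\<^esub>" "w \<in> gr N (i - 1)" "z = f x \<oplus>\<^bsub>N\<^esub> diff N w"
    by (rule qis_surjE[OF q])
  then have xc: "x \<in> cycles M i" by (simp add: cycles_iff)
  then show ?thesis using cycles_map[OF qis_hom[OF q] xc] z x(3,4) unfolding cohomologous_def by blast
qed

lemma coset_eq_iff:
  assumes M: "dg_module A M" and "x \<in> cycles M i" "y \<in> cycles M i"
  shows "boundaries M i +>\<^bsub>M\<^esub> x = boundaries M i +>\<^bsub>M\<^esub> y \<longleftrightarrow> cohomologous M i x y"
proof -
  interpret M: dg_module A M by fact
  have g: "x \<in> gr M i" "y \<in> gr M i" using assms by (auto simp: cycles_iff)
  have c: "x \<in> carrier M" "y \<in> carrier M" using g M.gr_closed by auto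
  have mem: "z \<in> boundaries M i +>\<^bsub>M\<^esub> x \<longleftrightarrow> (\<exists>w\<in>gr M (i - 1). z = diff M w \<oplus>\<^bsub>M\<^esub> x)" for z x
    by (auto simp: a_r_coset_def' boundaries_def)
  show ?thesis
  proof
    assume eq: "boundaries M i +>\<^bsub>M\<^esub> x = boundaries M i +>\<^bsub>M\<^esub> y"
    have "x = diff M \<zero>\<^bsub>M\<^esub> \<oplus>\<^bsub>M\<^esub> x" using c by simp
    then have "x \<in> boundaries M i +>\<^bsub>M\<^esub> x" unfolding mem using M.gr_zero by blast
    then obtain w where w: "w \<in> gr M (i - 1)" "x = diff M w \<oplus>\<^bsub>M\<^esub> y" unfolding eq mem by blast
    then have "x = y \<oplus>\<^bsub>M\<^esub> diff M w" using c M.diff_closed[OF M.gr_closed[OF w(1)]] by (simp add: M.a_comm)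
    then show "cohomologous M i x y" using assms(2,3) w(1) unfolding cohomologous_def by blast
  next
    assume co: "cohomologous M i x y"
    have half: "boundaries M i +>\<^bsub>M\<^esub> x \<subseteq> boundaries M i +>\<^bsub>M\<^esub> y" if co': "cohomologous M i x y" for x y
    proof
      fix z assume "z \<in> boundaries M i +>\<^bsub>M\<^esub> x"
      then obtain w where w: "w \<in> gr M (i - 1)" "z = diff M w \<oplus>\<^bsub>M\<^esub> x" unfolding mem by blast
      obtain v where v: "y \<in> gr M i" "v \<in> gr M (i - 1)" "x = y \<oplus>\<^bsub>M\<^esub> diff M v"
        using co' by (auto simp: cohomologous_def cycles_iff)
      have c: "w \<in> carrier M" "v \<in> carrier M" "y \<in> carrier M" using w v M.gr_closed by auto
      have "z = diff M (w \<oplus>\<^bsub>M\<^esub> v) \<oplus>\<^bsub>M\<^esub> y" using c by (simp add: w(2) v(3) M.diff_add M.a_ac)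
      then show "z \<in> boundaries M i +>\<^bsub>M\<^esub> y" unfolding mem using M.gr_add[OF w(1) v(2)] by blast
    qed
    show "boundaries M i +>\<^bsub>M\<^esub> x = boundaries M i +>\<^bsub>M\<^esub> y"
      using half[OF co] half[OF cohomologous_sym[OF M co]] by blast
  qed
qed

lemma cohomology_map_coset:
  assumes f: "f \<in> dg_hom A M N" and x: "x \<in> cycles M i"
  shows "cohomology_map N i f (boundaries M i +>\<^bsub>M\<^esub> x) = boundaries N i +>\<^bsub>N\<^esub> f x"
proof -
  interpret M: dg_module A M using dg_homD(1)[OF f] .
  interpret N: dg_module A N using dg_homD(2)[OF f] .
  have xc: "x \<in> carrier M" "f x \<in> carrier N" using x M.gr_closed dg_homD(3)[OF f] by (auto simp: cycles_iff)
  show ?thesis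
  proof (intro equalityI subsetI)
    fix z assume "z \<in> cohomology_map N i f (boundaries M i +>\<^bsub>M\<^esub> x)"
    then obtain v w where v: "v \<in> gr N (i - 1)" "w \<in> gr M (i - 1)" "z = diff N v \<oplus>\<^bsub>N\<^esub> f (diff M w \<oplus>\<^bsub>M\<^esub> x)"
      by (auto simp: cohomology_map_def set_add_def' a_r_coset_def' boundaries_def)
    have c: "v \<in> carrier N" "w \<in> carrier M" using v M.gr_closed N.gr_closed by auto
    have "z = diff N (v \<oplus>\<^bsub>N\<^esub> f w) \<oplus>\<^bsub>N\<^esub> f x"
      using c xc dg_homD(3)[OF f] by (simp add: v(3) N.diff_add dg_homD(4,7)[OF f] N.a_assoc)
    moreover have "v \<oplus>\<^bsub>N\<^esub> f w \<in> gr N (i - 1)" using v dg_homD(6)[OF f] N.gr_add by simp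
    ultimately show "z \<in> boundaries N i +>\<^bsub>N\<^esub> f x" by (auto simp: a_r_coset_def' boundaries_def)
  next
    fix z assume "z \<in> boundaries N i +>\<^bsub>N\<^esub> f x"
    then obtain v where v: "v \<in> gr N (i - 1)" "z = diff N v \<oplus>\<^bsub>N\<^esub> f x" by (auto simp: a_r_coset_def' boundaries_def)
    have "x \<in> boundaries M i +>\<^bsub>M\<^esub> x" using xc M.diff_zero M.gr_zero[of "i - 1"]
      by (force simp: a_r_coset_def' boundaries_def intro!: bexI[of _ "\<zero>\<^bsub>M\<^esub>"])
    then show "z \<in> cohomology_map N i f (boundaries M i +>\<^bsub>M\<^esub> x)"
      using v by (auto simp: cohomology_map_def set_add_def' boundaries_def)
  qed
qed

text \<open>Translates the coset definition once and for all; from here on only representatives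
  occur.\<close>

lemma quasi_isos_iff: "f \<in> quasi_isos A M N \<longleftrightarrow> qis A f M N"
proof
  assume q: "f \<in> quasi_isos A M N"
  then have f: "f \<in> dg_hom A M N" and b: "\<And>i. bij_betw (cohomology_map N i f) (cohomology M i) (cohomology N i)"
    by (auto simp: quasi_isos_def)
  have M: "dg_module A M" and N: "dg_module A N" using dg_homD(1,2)[OF f] .
  interpret M: dg_module A M by fact
  interpret N: dg_module A N by fact
  show "qis A f M N"
  proof (rule qisI[OF f])
    fix i z assume z: "z \<in> gr N i" "diff N z = \<zero>\<^bsub>N\<^esub>"
    then have zc: "z \<in> cycles N i" by (simp add: cycles_iff)
    then have "boundaries N i +>\<^bsub>N\<^esub> z \<in> cohomology_map N i f ` cohomology M i"
      using b[of i] by (auto simp: bij_betw_def cohomology_def)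
    then obtain x where x: "x \<in> cycles M i" "boundaries N i +>\<^bsub>N\<^esub> z = boundaries N i +>\<^bsub>N\<^esub> f x"
      using cohomology_map_coset[OF f] by (auto simp: cohomology_def)
    then have "cohomologous N i z (f x)" using coset_eq_iff[OF N zc cycles_map[OF f]] by simp
    then show "\<exists>x\<in>gr M i. diff M x = \<zero>\<^bsub>M\<^esub> \<and> (\<exists>w\<in>gr N (i - 1). z = f x \<oplus>\<^bsub>N\<^esub> diff N w)"
      using x(1) unfolding cohomologous_def cycles_iff by blast
  next
    fix i x w assume x: "x \<in> gr M i" "diff M x = \<zero>\<^bsub>M\<^esub>" and w: "w \<in> gr N (i - 1)" "f x = diff N w"
    have xc: "x \<in> cycles M i" "\<zero>\<^bsub>M\<^esub> \<in> cycles M i" using x by (simp_all add: cycles_iff)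
    have "f x = f \<zero>\<^bsub>M\<^esub> \<oplus>\<^bsub>N\<^esub> diff N w" using w N.gr_closed dg_hom_zero[OF f] by simp
    then have "cohomologous N i (f x) (f \<zero>\<^bsub>M\<^esub>)" unfolding cohomologous_def using cycles_map[OF f] xc w(1) by blast
    then have "cohomology_map N i f (boundaries M i +>\<^bsub>M\<^esub> x) = cohomology_map N i f (boundaries M i +>\<^bsub>M\<^esub> \<zero>\<^bsub>M\<^esub>)"
      using coset_eq_iff[OF N cycles_map[OF f] cycles_map[OF f]] xc by (simp add: cohomology_map_coset[OF f])
    then have "boundaries M i +>\<^bsub>M\<^esub> x = boundaries M i +>\<^bsub>M\<^esub> \<zero>\<^bsub>M\<^esub>"
      by (rule inj_onD[OF bij_betw_imp_inj_on[OF b]]) (use xc in \<open>auto simp: cohomology_def\<close>)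
    then have "cohomologous M i x \<zero>\<^bsub>M\<^esub>" using coset_eq_iff[OF M] xc by simp
    then obtain v where "v \<in> gr M (i - 1)" "x = \<zero>\<^bsub>M\<^esub> \<oplus>\<^bsub>M\<^esub> diff M v" by (auto simp: cohomologous_def)
    then show "\<exists>v\<in>gr M (i - 1). x = diff M v" using M.gr_closed by auto
  qed
next
  assume q: "qis A f M N"
  note f = qis_hom[OF q]
  have M: "dg_module A M" and N: "dg_module A N" using dg_homD(1,2)[OF f] .
  have "bij_betw (cohomology_map N i f) (cohomology M i) (cohomology N i)" for i
  proof (rule bij_betw_imageI)
    show "inj_on (cohomology_map N i f) (cohomology M i)"
    proof (rule inj_onI)
      fix X Y assume "X \<in> cohomology M i" "Y \<in> cohomology M i"
        and eq: "cohomology_map N i f X = cohomology_map N i f Y"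
      then obtain x y where x: "x \<in> cycles M i" "X = boundaries M i +>\<^bsub>M\<^esub> x"
        and y: "y \<in> cycles M i" "Y = boundaries M i +>\<^bsub>M\<^esub> y" by (auto simp: cohomology_def)
      have "cohomologous N i (f x) (f y)"
        using eq x y coset_eq_iff[OF N cycles_map[OF f x(1)] cycles_map[OF f y(1)]] by (simp add: cohomology_map_coset[OF f])
      then show "X = Y" using qis_cohomologous[OF q x(1) y(1)] coset_eq_iff[OF M x(1) y(1)] x y by simp
    qed
    show "cohomology_map N i f ` cohomology M i = cohomology N i"
    proof (intro equalityI subsetI)
      fix Z assume "Z \<in> cohomology_map N i f ` cohomology M i"
      then show "Z \<in> cohomology N i" using cohomology_map_coset[OF f] cycles_map[OF f] by (auto simp: cohomology_def)
    next
      fix Z assume "Z \<in> cohomology N i"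
      then obtain z where z: "z \<in> cycles N i" "Z = boundaries N i +>\<^bsub>N\<^esub> z" by (auto simp: cohomology_def)
      obtain x where x: "x \<in> cycles M i" "cohomologous N i z (f x)" using qis_cohomologous_ex[OF q z(1)] by blast
      then have "Z = cohomology_map N i f (boundaries M i +>\<^bsub>M\<^esub> x)"
        using z coset_eq_iff[OF N z(1) cycles_map[OF f x(1)]] by (simp add: cohomology_map_coset[OF f])
      then show "Z \<in> cohomology_map N i f ` cohomology M i" using x(1) by (auto simp: cohomology_def)
    qed
  qed
  then show "f \<in> quasi_isos A M N" using f by (simp add: quasi_isos_def)
qed

end

text \<open>The effect of a zigzag on cohomology, kept as a relation between cycles: a formal
  inverse is read as the converse relation, so no inverse map has to be chosen.\<close>

fun zz_rel :: "('a, 'm) dgmod \<Rightarrow> ('a, 'm) zigzag \<Rightarrow> int \<Rightarrow> 'm \<Rightarrow> 'm \<Rightarrow> bool" where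
  "zz_rel X [] i x y \<longleftrightarrow> cohomologous X i x y"
| "zz_rel X (Fwd M f N # p) i x y \<longleftrightarrow> x \<in> cycles M i \<and> zz_rel N p i (f x) y"
| "zz_rel X (Bwd N s M # p) i x y \<longleftrightarrow> (\<exists>x'\<in>cycles M i. cohomologous N i x (s x') \<and> zz_rel M p i x' y)"

section \<open>Invariance of the action of zigzags on cohomology\<close>

context dg_algebra begin

lemma zigzag_modules: "zigzag A X p Y \<Longrightarrow> dg_module A X \<and> dg_module A Y"
proof (induction p arbitrary: X)
  case (Cons st p)
  show ?case
  proof (cases st)
    case (Fwd M f N) then show ?thesis using Cons dg_homD(1) by auto
  next
    case (Bwd N s M)
    then have "s \<in> dg_hom A M N" "X = N" "zigzag A M p Y" using Cons.prems by (auto simp: quasi_isos_def)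
    then show ?thesis using Cons.IH dg_homD(2) by auto
  qed
qed auto

lemma zigzag_append: "zigzag A X (p @ q) Z \<longleftrightarrow> (\<exists>Y. zigzag A X p Y \<and> zigzag A Y q Z)"
proof (induction p arbitrary: X)
  case Nil
  then show ?case using zigzag_modules by auto
next
  case (Cons st p)
  then show ?case by (cases st) auto
qed

lemma zz_equiv_zigzag: "zz_equiv A X Y p q \<Longrightarrow> zigzag A X p Y \<and> zigzag A X q Y"
proof (induction rule: zz_equiv.induct)
  case (zz_cong X p M N q q' r Y)
  then show ?case by (auto simp: zigzag_append)
next
  case (zz_homotopy f M N g)
  then show ?case using dg_homD(2) by auto
next
  case (zz_ident M)
  then show ?case using dg_hom_id by auto
next
  case (zz_comp f M N g P)
  then show ?case using dg_homD(2) dg_hom_comp by auto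
next
  case (zz_inv_right s M N)
  then have "s \<in> dg_hom A M N" by (simp add: quasi_isos_def)
  then show ?case using zz_inv_right dg_homD(1,2) by auto
next
  case (zz_inv_left s M N)
  then have "s \<in> dg_hom A M N" by (simp add: quasi_isos_def)
  then show ?case using zz_inv_left dg_homD(1,2) by auto
qed auto

lemma zz_rel_cycles: "zigzag A X p Y \<Longrightarrow> zz_rel X p i x y \<Longrightarrow> x \<in> cycles X i \<and> y \<in> cycles Y i"
proof (induction p arbitrary: X x)
  case Nil then show ?case by (auto simp: cohomologous_def)
next
  case (Cons st p)
  show ?case
  proof (cases st)
    case (Fwd M f N) then show ?thesis using Cons.prems Cons.IH[of N "f x"] by auto
  next
    case (Bwd N s M)
    then obtain x' where "cohomologous N i x (s x')" "zz_rel M p i x' y" "X = N" "zigzag A M p Y" using Cons.prems by auto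
    then show ?thesis using Cons.IH by (auto simp: cohomologous_def)
  qed
qed

lemma zz_rel_left:
  "zigzag A X p Y \<Longrightarrow> cohomologous X i x x' \<Longrightarrow> zz_rel X p i x' y \<Longrightarrow> zz_rel X p i x y"
proof (induction p arbitrary: X x x')
  case Nil then show ?case using cohomologous_trans by (metis zigzag.simps(1) zz_rel.simps(1))
next
  case (Cons st p)
  show ?case
  proof (cases st)
    case (Fwd M f N)
    then have h: "X = M" "f \<in> dg_hom A M N" "zigzag A N p Y" "zz_rel N p i (f x') y" using Cons.prems by auto
    have "zz_rel N p i (f x) y" by (rule Cons.IH[OF h(3) cohomologous_map[OF h(2)] h(4)]) (use Cons.prems(2) h in simp)
    then show ?thesis using Fwd Cons.prems(2) h(1) by (simp add: cohomologous_def)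
  next
    case (Bwd N s M)
    then have h: "X = N" "zigzag A M p Y" using Cons.prems by auto
    obtain u where u: "u \<in> cycles M i" "cohomologous N i x' (s u)" "zz_rel M p i u y" using Cons.prems(3) Bwd by auto
    have "dg_module A N" using zigzag_modules[OF Cons.prems(1)] h by simp
    then have "cohomologous N i x (s u)" using cohomologous_trans[OF _ _ u(2)] Cons.prems(2) h(1) by simp
    then show ?thesis using u Bwd by auto
  qed
qed

lemma zz_rel_append:
  assumes "zigzag A X p M" "zigzag A M q Y"
  shows "zz_rel X (p @ q) i x y \<longleftrightarrow> (\<exists>u. zz_rel X p i x u \<and> zz_rel M q i u y)"
  using assms(1)
proof (induction p arbitrary: X x)
  case Nil
  then have X: "X = M" "dg_module A M" by auto
  have "zz_rel M q i x y \<longleftrightarrow> (\<exists>u. cohomologous M i x u \<and> zz_rel M q i u y)"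
    using zz_rel_left[OF assms(2)] cohomologous_refl[OF X(2)] zz_rel_cycles[OF assms(2)] by metis
  then show ?case using X by simp
next
  case (Cons st p)
  show ?case
  proof (cases st)
    case (Fwd M' f N) then show ?thesis using Cons by auto
  next
    case (Bwd N s M')
    then show ?thesis using Cons by auto
  qed
qed

text \<open>Cohomology identifies homotopic maps and inverts quasi-isomorphisms, so it factors
  through the localization; each generator of the congruence is checked in turn.\<close>

lemma zz_rel_equiv: "zz_equiv A X Y p q \<Longrightarrow> zz_rel X p i x y \<longleftrightarrow> zz_rel X q i x y"
proof (induction arbitrary: x y rule: zz_equiv.induct)
  case (zz_cong X p M N q q' r Y)
  have z: "zigzag A M q N" "zigzag A M q' N" using zz_equiv_zigzag[OF zz_cong.hyps(2)] by auto
  have z': "zigzag A M (q @ r) Y" "zigzag A M (q' @ r) Y" using z zz_cong.hyps(3) by (auto simp: zigzag_append)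
  show ?case
    by (simp add: zz_rel_append[OF zz_cong.hyps(1) z'(1)] zz_rel_append[OF zz_cong.hyps(1) z'(2)]
        zz_rel_append[OF z(1) zz_cong.hyps(3)] zz_rel_append[OF z(2) zz_cong.hyps(3)] zz_cong.IH)
next
  case (zz_homotopy f M N g)
  note f = zz_homotopy.hyps(1) and g = zz_homotopy.hyps(2)
  interpret M: dg_module A M using dg_homD(1)[OF f] .
  interpret N: dg_module A N using dg_homD(2)[OF f] .
  obtain h where h: "h \<in> rmod_hom A M N" "\<And>i x. x \<in> gr M i \<Longrightarrow> h x \<in> gr N (i - 1)"
    "\<And>x. x \<in> carrier M \<Longrightarrow> f x = g x \<oplus>\<^bsub>N\<^esub> (diff N (h x) \<oplus>\<^bsub>N\<^esub> h (diff M x))"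
    using zz_homotopy.hyps(3) by (auto simp: homotopic_def)
  \<comment> \<open>On a cycle the summand \<open>h (diff M x)\<close> vanishes, and homotopic maps
    differ by a boundary.\<close>
  have "cohomologous N i (f x) (g x)" if x: "x \<in> cycles M i" for x
  proof -
    have xg: "x \<in> gr M i" "diff M x = \<zero>\<^bsub>M\<^esub>" "x \<in> carrier M" using x M.gr_closed by (auto simp: cycles_iff)
    have "f x = g x \<oplus>\<^bsub>N\<^esub> diff N (h x)"
      using h(3)[OF xg(3)] xg(2) rmod_hom_zero[OF h(1) M.dg_module_axioms N.dg_module_axioms] N.gr_closed[OF h(2)[OF xg(1)]] by simp
    then show ?thesis using cycles_map[OF f x] cycles_map[OF g x] h(2)[OF xg(1)] unfolding cohomologous_def by blast
  qed
  then have "cohomologous N i (f x) y \<longleftrightarrow> cohomologous N i (g x) y" if "x \<in> cycles M i"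
    using that cohomologous_trans[OF N.dg_module_axioms] cohomologous_sym[OF N.dg_module_axioms] by metis
  then show ?case by auto
next
  case (zz_ident M)
  then show ?case by (auto simp: cohomologous_def)
next
  case (zz_comp f M N g P)
  then show ?case using cycles_map by auto
next
  case (zz_inv_right s M N)
  then have q: "qis A s M N" by (simp add: quasi_isos_iff)
  note h = qis_hom[OF q]
  have M: "dg_module A M" and N: "dg_module A N" using dg_homD(1,2)[OF h] .
  show ?case (is "?l = ?r")
  proof
    assume ?l
    then obtain x' where x: "x \<in> cycles M i" "x' \<in> cycles M i" "cohomologous N i (s x) (s x')" "cohomologous M i x' y" by auto
    then show ?r using qis_cohomologous[OF q x(1-3)] cohomologous_trans[OF M] by auto
  next
    assume ?r
    then have xy: "x \<in> cycles M i" "cohomologous M i x y" by (auto simp: cohomologous_def)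
    then show ?l using cohomologous_refl[OF N cycles_map[OF h xy(1)]] by auto
  qed
next
  case (zz_inv_left s M N)
  then have q: "qis A s M N" by (simp add: quasi_isos_iff)
  note h = qis_hom[OF q]
  have M: "dg_module A M" and N: "dg_module A N" using dg_homD(1,2)[OF h] .
  show ?case (is "?l = ?r")
  proof
    assume ?l then show ?r using cohomologous_trans[OF N] by auto
  next
    assume ?r
    then have xy: "x \<in> cycles N i" "cohomologous N i x y" by (auto simp: cohomologous_def)
    obtain u where u: "u \<in> cycles M i" "cohomologous N i x (s u)" using qis_cohomologous_ex[OF q xy(1)] by blast
    then have "cohomologous N i (s u) y" using cohomologous_sym[OF N u(2)] cohomologous_trans[OF N _ xy(2)] by blast
    then show ?l using u by auto
  qed
qed auto

lemma zero_cycle: "dg_module A M \<Longrightarrow> \<zero>\<^bsub>M\<^esub> \<in> cycles M i"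
proof -
  assume "dg_module A M"
  then interpret M: dg_module A M .
  show ?thesis by (simp add: cycles_iff)
qed

lemma zz_rel_zero: "zigzag A X p Y \<Longrightarrow> zz_rel X p i \<zero>\<^bsub>X\<^esub> \<zero>\<^bsub>Y\<^esub>"
proof (induction p arbitrary: X)
  case Nil then show ?case by (auto intro: cohomologous_refl zero_cycle)
next
  case (Cons st p)
  show ?case
  proof (cases st)
    case (Fwd M f N)
    then have h: "f \<in> dg_hom A M N" "X = M" "zigzag A N p Y" using Cons.prems by auto
    then show ?thesis using Cons.IH[OF h(3)] Fwd dg_hom_zero[OF h(1)] zero_cycle[OF dg_homD(1)[OF h(1)]] by simp
  next
    case (Bwd N s M)
    then have h: "s \<in> dg_hom A M N" "X = N" "zigzag A M p Y" using Cons.prems by (auto simp: quasi_isos_def)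
    have M: "dg_module A M" and N: "dg_module A N" using dg_homD(1,2)[OF h(1)] .
    have "cohomologous N i \<zero>\<^bsub>N\<^esub> (s \<zero>\<^bsub>M\<^esub>)" using cohomologous_refl[OF N zero_cycle[OF N]] dg_hom_zero[OF h(1)] by simp
    then show ?thesis using Cons.IH[OF h(3)] Bwd h(2) zero_cycle[OF M] by auto
  qed
qed

text \<open>The action on cohomology sees the formal inverse: the relation for \<open>q\<close>
  followed by \<open>f\<close> gives surjectivity, and if \<open>f x\<close> is a boundary then
  \<open>f\<close> followed by \<open>q\<close> relates \<open>x\<close> to zero as well as to
  itself, up to boundaries.\<close>

lemma qis_if_inverse:
  assumes f: "f \<in> dg_hom A X Y" and q: "zigzag A Y q X"
    and l: "zz_equiv A X X (Fwd X f Y # q) []" and r: "zz_equiv A Y Y (q @ [Fwd X f Y]) []"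
  shows "qis A f X Y"
proof (rule qisI[OF f])
  have X: "dg_module A X" and Y: "dg_module A Y" using dg_homD(1,2)[OF f] .
  interpret X: dg_module A X by fact
  interpret Y: dg_module A Y by fact
  have F: "zigzag A X [Fwd X f Y] Y" using f Y by simp
  {
    fix i z assume z: "z \<in> gr Y i" "diff Y z = \<zero>\<^bsub>Y\<^esub>"
    then have zc: "z \<in> cycles Y i" by (simp add: cycles_iff)
    then have "zz_rel Y (q @ [Fwd X f Y]) i z z" using zz_rel_equiv[OF r] cohomologous_refl[OF Y] by simp
    then obtain u where "u \<in> cycles X i" "cohomologous Y i (f u) z" using zz_rel_append[OF q F] by auto
    then show "\<exists>x\<in>gr X i. diff X x = \<zero>\<^bsub>X\<^esub> \<and> (\<exists>w\<in>gr Y (i - 1). z = f x \<oplus>\<^bsub>Y\<^esub> diff Y w)"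
      using cohomologous_sym[OF Y] unfolding cohomologous_def cycles_iff by blast
  next
    fix i x w assume x: "x \<in> gr X i" "diff X x = \<zero>\<^bsub>X\<^esub>" and w: "w \<in> gr Y (i - 1)" "f x = diff Y w"
    have xc: "x \<in> cycles X i" using x by (simp add: cycles_iff)
    have "f x = \<zero>\<^bsub>Y\<^esub> \<oplus>\<^bsub>Y\<^esub> diff Y w" using w Y.gr_closed by simp
    then have "cohomologous Y i (f x) \<zero>\<^bsub>Y\<^esub>"
      using cycles_map[OF f xc] zero_cycle[OF Y] w(1) unfolding cohomologous_def by blast
    then have "zz_rel X (Fwd X f Y # q) i x \<zero>\<^bsub>X\<^esub>" using zz_rel_left[OF q _ zz_rel_zero[OF q]] xc by simp
    then have "cohomologous X i x \<zero>\<^bsub>X\<^esub>" using zz_rel_equiv[OF l] by simp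
    then obtain v where "v \<in> gr X (i - 1)" "x = \<zero>\<^bsub>X\<^esub> \<oplus>\<^bsub>X\<^esub> diff X v" by (auto simp: cohomologous_def)
    then show "\<exists>v\<in>gr X (i - 1). x = diff X v" using X.gr_closed by auto
  }
qed

section \<open>The derived category\<close>

lemma zz_class_eq_iff:
  assumes "zigzag A X p Y" "zigzag A X q Y"
  shows "zz_class A X p Y = zz_class A X q Y \<longleftrightarrow> zz_equiv A X Y p q"
proof
  assume "zz_class A X p Y = zz_class A X q Y"
  then have "{r. zz_equiv A X Y p r} = {r. zz_equiv A X Y q r}" by (simp add: zz_class_def)
  then show "zz_equiv A X Y p q" using zz_refl[OF assms(2)] by blast
next
  assume "zz_equiv A X Y p q"
  then have "{r. zz_equiv A X Y p r} = {r. zz_equiv A X Y q r}" using zz_sym zz_trans by blast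
  then show "zz_class A X p Y = zz_class A X q Y" by (simp add: zz_class_def)
qed

lemma zz_equiv_append:
  assumes "zz_equiv A X Y p p'" "zz_equiv A Y Z q q'"
  shows "zz_equiv A X Z (p @ q) (p' @ q')"
proof -
  have z: "zigzag A X p Y" "zigzag A X p' Y" "zigzag A Y q Z" "zigzag A Y q' Z"
    using zz_equiv_zigzag assms by blast+
  have "zz_equiv A X Z ([] @ p @ q) ([] @ p' @ q)"
    by (rule zz_cong[OF _ assms(1) z(3)]) (use zigzag_modules z in auto)
  moreover have "zz_equiv A X Z (p' @ q @ []) (p' @ q' @ [])"
    by (rule zz_cong[OF z(2) assms(2)]) (use zigzag_modules z in auto)
  ultimately show ?thesis using zz_trans by fastforce
qed

lemma dgDer_sel [simp]:
  "Ob (dgDer A) = {M. dg_module A M}" "Hom (dgDer A) X Y = {zz_class A X p Y |p. zigzag A X p Y}"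
  "Id (dgDer A) X = zz_class A X [] X"
  by (simp_all add: dgDer_def)

text \<open>Composition is defined through all representatives; by the congruence rules it is
  concatenation of any chosen ones.\<close>

lemma dgDer_Comp:
  assumes p: "zigzag A X p Y" and q: "zigzag A Y q Z"
  shows "Comp (dgDer A) (zz_class A Y q Z) (zz_class A X p Y) = zz_class A X (p @ q) Z"
proof -
  have "(\<exists>p'\<in>{r. zz_equiv A X Y p r}. \<exists>q'\<in>{r. zz_equiv A Y Z q r}. zz_equiv A X Z (p' @ q') r)
    \<longleftrightarrow> zz_equiv A X Z (p @ q) r" for r
    using zz_equiv_append zz_trans zz_refl[OF p] zz_refl[OF q] by blast
  then show ?thesis by (simp add: dgDer_def zz_class_def)
qed

lemma dgDer_category: "category (dgDer A)"
proof
  fix X Y Z V f g h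
  show "X \<in> Ob (dgDer A) \<Longrightarrow> Id (dgDer A) X \<in> Hom (dgDer A) X X" by auto
  assume X: "X \<in> Ob (dgDer A)" and Y: "Y \<in> Ob (dgDer A)" and "f \<in> Hom (dgDer A) X Y"
  then obtain p where p: "f = zz_class A X p Y" "zigzag A X p Y" by auto
  have nil: "zigzag A X [] X" "zigzag A Y [] Y" using X Y by auto
  show "Comp (dgDer A) (Id (dgDer A) Y) f = f" "Comp (dgDer A) f (Id (dgDer A) X) = f"
    using dgDer_Comp[OF p(2) nil(2)] dgDer_Comp[OF nil(1) p(2)] p(1) by simp_all
  assume "g \<in> Hom (dgDer A) Y Z"
  then obtain q where q: "g = zz_class A Y q Z" "zigzag A Y q Z" by auto
  have pq: "zigzag A X (p @ q) Z" using p q by (auto simp: zigzag_append)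
  show "Comp (dgDer A) g f \<in> Hom (dgDer A) X Z" using dgDer_Comp[OF p(2) q(2)] p q pq by auto
  assume "h \<in> Hom (dgDer A) Z V"
  then obtain r where r: "h = zz_class A Z r V" "zigzag A Z r V" by auto
  have qr: "zigzag A Y (q @ r) V" using r q by (auto simp: zigzag_append)
  show "Comp (dgDer A) h (Comp (dgDer A) g f) = Comp (dgDer A) (Comp (dgDer A) h g) f"
    by (simp add: p q r dgDer_Comp[OF p(2) q(2)] dgDer_Comp[OF q(2) r(2)] dgDer_Comp[OF pq r(2)] dgDer_Comp[OF p(2) qr])
qed

text \<open>Removes classes from the notion of isomorphism, so that later arguments only manipulate
  zigzags and their congruence.\<close>

lemma isomorphic_iff:
  "isomorphic_in (dgDer A) X Y \<longleftrightarrow> (\<exists>p q. zigzag A X p Y \<and> zigzag A Y q X \<and>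
     zz_equiv A X X (p @ q) [] \<and> zz_equiv A Y Y (q @ p) [])"
proof -
  have "iso_in (dgDer A) X Y (zz_class A X p Y) \<longleftrightarrow> (\<exists>q. zigzag A Y q X \<and>
     zz_equiv A X X (p @ q) [] \<and> zz_equiv A Y Y (q @ p) [])" if p: "zigzag A X p Y" for p
  proof -
    have nil: "zigzag A X [] X" "zigzag A Y [] Y" using zigzag_modules[OF p] by auto
    have pq: "zigzag A X (p @ q) X" "zigzag A Y (q @ p) Y" if "zigzag A Y q X" for q
      using p that by (auto simp: zigzag_append)
    have c: "Comp (dgDer A) (zz_class A Y q X) (zz_class A X p Y) = Id (dgDer A) X \<longleftrightarrow> zz_equiv A X X (p @ q) []"
      "Comp (dgDer A) (zz_class A X p Y) (zz_class A Y q X) = Id (dgDer A) Y \<longleftrightarrow> zz_equiv A Y Y (q @ p) []"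
      if "zigzag A Y q X" for q
      using zz_class_eq_iff[OF pq(1)[OF that] nil(1)] zz_class_eq_iff[OF pq(2)[OF that] nil(2)] dgDer_Comp[OF p that]
        dgDer_Comp[OF that p] by simp_all
    show ?thesis unfolding iso_in_def
    proof (intro iffI conjI)
      assume "zz_class A X p Y \<in> Hom (dgDer A) X Y \<and> (\<exists>g\<in>Hom (dgDer A) Y X.
        Comp (dgDer A) g (zz_class A X p Y) = Id (dgDer A) X \<and> Comp (dgDer A) (zz_class A X p Y) g = Id (dgDer A) Y)"
      then obtain g where g: "g \<in> Hom (dgDer A) Y X" "Comp (dgDer A) g (zz_class A X p Y) = Id (dgDer A) X"
        "Comp (dgDer A) (zz_class A X p Y) g = Id (dgDer A) Y" by blast
      then obtain q where q: "g = zz_class A Y q X" "zigzag A Y q X" unfolding dgDer_sel by blast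
      then show "\<exists>q. zigzag A Y q X \<and> zz_equiv A X X (p @ q) [] \<and> zz_equiv A Y Y (q @ p) []"
        using g(2,3) c by blast
    next
      show "zz_class A X p Y \<in> Hom (dgDer A) X Y" using p unfolding dgDer_sel by blast
      assume "\<exists>q. zigzag A Y q X \<and> zz_equiv A X X (p @ q) [] \<and> zz_equiv A Y Y (q @ p) []"
      then obtain q where q: "zigzag A Y q X" "zz_equiv A X X (p @ q) []" "zz_equiv A Y Y (q @ p) []" by blast
      then have "zz_class A Y q X \<in> Hom (dgDer A) Y X" unfolding dgDer_sel by blast
      then show "\<exists>g\<in>Hom (dgDer A) Y X. Comp (dgDer A) g (zz_class A X p Y) = Id (dgDer A) X \<and>
        Comp (dgDer A) (zz_class A X p Y) g = Id (dgDer A) Y" using c q by blast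
    qed
  qed
  note * = this
  show ?thesis
  proof
    assume "isomorphic_in (dgDer A) X Y"
    then obtain f where f: "iso_in (dgDer A) X Y f" unfolding isomorphic_in_def by blast
    then obtain p where "f = zz_class A X p Y" "zigzag A X p Y" unfolding iso_in_def dgDer_sel by blast
    then show "\<exists>p q. zigzag A X p Y \<and> zigzag A Y q X \<and> zz_equiv A X X (p @ q) [] \<and> zz_equiv A Y Y (q @ p) []"
      using * f by blast
  next
    assume "\<exists>p q. zigzag A X p Y \<and> zigzag A Y q X \<and> zz_equiv A X X (p @ q) [] \<and> zz_equiv A Y Y (q @ p) []"
    then obtain p where p: "zigzag A X p Y" "iso_in (dgDer A) X Y (zz_class A X p Y)" using * by blast
    then show "isomorphic_in (dgDer A) X Y"
      unfolding isomorphic_in_def dgDer_sel using zigzag_modules by blast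
  qed
qed

lemma isomorphicI:
  "dg_module A X \<Longrightarrow> dg_module A Y \<Longrightarrow> iso_in (dgDer A) X Y f \<Longrightarrow> isomorphic_in (dgDer A) X Y"
  unfolding isomorphic_in_def dgDer_sel by blast

lemma isomorphic_sym: "isomorphic_in (dgDer A) X Y \<Longrightarrow> isomorphic_in (dgDer A) Y X"
  unfolding isomorphic_iff by blast

lemma isomorphic_trans:
  assumes "isomorphic_in (dgDer A) X Y" "isomorphic_in (dgDer A) Y Z"
  shows "isomorphic_in (dgDer A) X Z"
proof -
  obtain p q where p: "zigzag A X p Y" "zigzag A Y q X" "zz_equiv A X X (p @ q) []" "zz_equiv A Y Y (q @ p) []"
    using assms(1) isomorphic_iff by blast
  obtain p' q' where p': "zigzag A Y p' Z" "zigzag A Z q' Y" "zz_equiv A Y Y (p' @ q') []" "zz_equiv A Z Z (q' @ p') []"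
    using assms(2) isomorphic_iff by blast
  have "zz_equiv A X X (p @ (p' @ q') @ q) (p @ [] @ q)" by (rule zz_cong[OF p(1) p'(3) p(2)])
  then have 1: "zz_equiv A X X ((p @ p') @ (q' @ q)) []" using p(3) zz_trans by fastforce
  have "zz_equiv A Z Z (q' @ (q @ p) @ p') (q' @ [] @ p')" by (rule zz_cong[OF p'(2) p(4) p'(1)])
  then have 2: "zz_equiv A Z Z ((q' @ q) @ (p @ p')) []" using p'(4) zz_trans by fastforce
  have "zigzag A X (p @ p') Z" "zigzag A Z (q' @ q) X" using p p' by (auto simp: zigzag_append)
  then show ?thesis using 1 2 isomorphic_iff by blast
qed

lemma qis_isomorphic:
  assumes "qis A s M N" shows "isomorphic_in (dgDer A) M N"
proof -
  have q: "s \<in> quasi_isos A M N" using assms quasi_isos_iff by blast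
  then have "s \<in> dg_hom A M N" "dg_module A M" "dg_module A N" using dg_homD(1,2) by (auto simp: quasi_isos_def)
  then have "zigzag A M [Fwd M s N] N" "zigzag A N [Bwd N s M] M" using q by auto
  then show ?thesis unfolding isomorphic_iff using zz_inv_right[OF q] zz_inv_left[OF q]
    by (intro exI[of _ "[Fwd M s N]"] exI[of _ "[Bwd N s M]"]) simp
qed

lemma dg_iso_isomorphic: "dg_iso A M N \<Longrightarrow> isomorphic_in (dgDer A) M N"
  unfolding dg_iso_def using qis_isomorphic[OF qis_if_isos] by blast

lemma isomorphic_refl: "dg_module A X \<Longrightarrow> isomorphic_in (dgDer A) X X"
  using qis_isomorphic[OF qis_id] .

lemma iso_Id: "dg_module A X \<Longrightarrow> iso_in (dgDer A) X X (zz_class A X [] X)"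
  unfolding iso_in_def
proof (intro conjI bexI)
  assume X: "dg_module A X"
  then have nil: "zigzag A X [] X" by simp
  show "zz_class A X [] X \<in> Hom (dgDer A) X X" "zz_class A X [] X \<in> Hom (dgDer A) X X" using nil unfolding dgDer_sel by blast+
  show "Comp (dgDer A) (zz_class A X [] X) (zz_class A X [] X) = Id (dgDer A) X"
    "Comp (dgDer A) (zz_class A X [] X) (zz_class A X [] X) = Id (dgDer A) X"
    using dgDer_Comp[OF nil nil] by simp_all
qed

section \<open>Shift of zigzags, standard triangles and complements\<close>

lemma zigzag_shift: "zigzag A X p Y \<Longrightarrow> zigzag A (dg_shift 1 X) (map step_shift p) (dg_shift 1 Y)"
proof (induction p arbitrary: X)
  case Nil then show ?case using shift_dg_module by auto
next
  case (Cons st p)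
  then show ?case using dg_hom_shift qis_shift by (cases st) (auto simp: quasi_isos_iff)
qed

lemma zz_equiv_shift:
  "zz_equiv A X Y p q \<Longrightarrow> zz_equiv A (dg_shift 1 X) (dg_shift 1 Y) (map step_shift p) (map step_shift q)"
proof (induction rule: zz_equiv.induct)
  case (zz_refl X p Y) then show ?case using zigzag_shift zz_equiv.zz_refl by blast
next
  case (zz_sym X Y p q) then show ?case using zz_equiv.zz_sym by blast
next
  case (zz_trans X Y p q r) then show ?case using zz_equiv.zz_trans by blast
next
  case (zz_cong X p M N q q' r Y)
  show ?case using zz_equiv.zz_cong[OF zigzag_shift[OF zz_cong.hyps(1)] zz_cong.IH zigzag_shift[OF zz_cong.hyps(3)]]
    by simp
next
  case (zz_homotopy f M N g)
  interpret M: dg_module A M using dg_homD(1)[OF zz_homotopy.hyps(1)] .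
  interpret N: dg_module A N using dg_homD(2)[OF zz_homotopy.hyps(1)] .
  obtain h where h: "h \<in> rmod_hom A M N" "\<And>i x. x \<in> gr M i \<Longrightarrow> h x \<in> gr N (i - 1)"
    "\<And>x. x \<in> carrier M \<Longrightarrow> f x = g x \<oplus>\<^bsub>N\<^esub> (diff N (h x) \<oplus>\<^bsub>N\<^esub> h (diff M x))"
    using zz_homotopy.hyps(3) by (auto simp: homotopic_def)
  note hd = rmod_homD[OF h(1)] and hi = rmod_hom_inv[OF h(1) M.dg_module_axioms N.dg_module_axioms]
  \<comment> \<open>The shift negates both differentials, hence the homotopy is negated too.\<close>
  have "homotopic A (dg_shift 1 M) (dg_shift 1 N) f g"
    unfolding homotopic_def
  proof (intro bexI[of _ "\<lambda>x. \<ominus>\<^bsub>N\<^esub> h x"] conjI allI ballI)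
    show "(\<lambda>x. \<ominus>\<^bsub>N\<^esub> h x) \<in> rmod_hom A (dg_shift 1 M) (dg_shift 1 N)"
      by (auto simp: rmod_hom_def hd N.minus_add N.act_inv_left)
    show "\<ominus>\<^bsub>N\<^esub> h x \<in> gr (dg_shift 1 N) (i - 1)" if "x \<in> gr (dg_shift 1 M) i" for i x
      using h(2)[of x "i + 1"] that N.gr_inv by simp
    show "f x = g x \<oplus>\<^bsub>(dg_shift 1 N)\<^esub> (diff (dg_shift 1 N) (\<ominus>\<^bsub>N\<^esub> h x) \<oplus>\<^bsub>(dg_shift 1 N)\<^esub> \<ominus>\<^bsub>N\<^esub> h (diff (dg_shift 1 M) x))"
      if "x \<in> carrier (dg_shift 1 M)" for x
      using that h(3)[of x] hd(1) by (simp add: koszul_def N.diff_inv hi N.minus_minus)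
  qed
  from zz_equiv.zz_homotopy[OF dg_hom_shift[OF zz_homotopy.hyps(1)] dg_hom_shift[OF zz_homotopy.hyps(2)] this]
  show ?case by simp
next
  case (zz_ident M) then show ?case using zz_equiv.zz_ident[OF shift_dg_module, of M 1] by simp
next
  case (zz_comp f M N g P)
  show ?case by simp (rule zz_equiv.zz_comp[OF dg_hom_shift[OF zz_comp.hyps(1)] dg_hom_shift[OF zz_comp.hyps(2)]])
next
  case (zz_inv_right s M N)
  then have "s \<in> quasi_isos A (dg_shift 1 M) (dg_shift 1 N)" unfolding quasi_isos_iff by (rule qis_shift)
  from zz_equiv.zz_inv_right[OF this] show ?case by simp
next
  case (zz_inv_left s M N)
  then have "s \<in> quasi_isos A (dg_shift 1 M) (dg_shift 1 N)" unfolding quasi_isos_iff by (rule qis_shift)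
  from zz_equiv.zz_inv_left[OF this] show ?case by simp
qed

lemma der_shift_Id:
  assumes "dg_module A X"
  shows "der_shift A (zz_class A X [] X) = zz_class A (dg_shift 1 X) [] (dg_shift 1 X)"
proof -
  have "(\<exists>p\<in>{r. zz_equiv A X X [] r}. zz_equiv A (dg_shift 1 X) (dg_shift 1 X) (map step_shift p) r)
     \<longleftrightarrow> zz_equiv A (dg_shift 1 X) (dg_shift 1 X) [] r" for r
  proof
    assume "\<exists>p\<in>{r. zz_equiv A X X [] r}. zz_equiv A (dg_shift 1 X) (dg_shift 1 X) (map step_shift p) r"
    then obtain p where p: "zz_equiv A X X [] p" "zz_equiv A (dg_shift 1 X) (dg_shift 1 X) (map step_shift p) r" by blast
    show "zz_equiv A (dg_shift 1 X) (dg_shift 1 X) [] r"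
      using zz_trans[OF zz_equiv_shift[OF p(1)] p(2)] by simp
  next
    assume "zz_equiv A (dg_shift 1 X) (dg_shift 1 X) [] r"
    moreover have "zz_equiv A X X [] []" using assms by (intro zz_refl) simp
    ultimately show "\<exists>p\<in>{r. zz_equiv A X X [] r}. zz_equiv A (dg_shift 1 X) (dg_shift 1 X) (map step_shift p) r"
      by (intro bexI[of _ "[]"]) simp_all
  qed
  then show ?thesis by (simp add: zz_class_def)
qed

text \<open>The standard triangle is compared with itself by identity morphisms. It is the device by
  which a triangulated subcategory absorbs a mapping cone.\<close>

lemma distinguished_cone:
  assumes f: "f \<in> dg_hom A X Y" and \<phi>: "\<phi> \<in> dg_isos A C (dg_cone X f Y)"
  shows "\<exists>u v w. distinguished A X Y C u v w"
proof -
  have X: "dg_module A X" and Y: "dg_module A Y" using dg_homD(1,2)[OF f] .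
  interpret X: dg_module A X by fact
  interpret Y: dg_module A Y by fact
  have C: "dg_module A C" using dg_homD(1)[OF dg_isosD(1)[OF \<phi>]] .
  have D: "dg_module A (dg_cone X f Y)" by (rule cone_dg_module[OF f])
  let ?i = "\<lambda>y. inv_into (carrier C) \<phi> (y, \<zero>\<^bsub>X\<^esub>)" and ?s = "\<lambda>z. snd (\<phi> z)"
  have "(\<lambda>y. (y, \<zero>\<^bsub>X\<^esub>)) \<in> dg_hom A Y (dg_cone X f Y)"
    by (rule dg_homI[OF Y D]) (auto simp: dg_hom_zero[OF f])
  from dg_hom_comp[OF this dg_isosD(1)[OF dg_isos_inv[OF \<phi>]]]
  have i: "?i \<in> dg_hom A Y C" by (simp add: comp_def)
  have "snd \<in> dg_hom A (dg_cone X f Y) (dg_shift 1 X)"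
    by (rule dg_homI[OF D shift_dg_module[OF X]]) (auto simp: koszul_def)
  from dg_hom_comp[OF dg_isosD(1)[OF \<phi>] this]
  have s: "?s \<in> dg_hom A C (dg_shift 1 X)" by (simp add: comp_def)
  have X1: "dg_module A (dg_shift 1 X)" by (rule shift_dg_module[OF X])
  let ?u = "der_of A X f Y" and ?v = "der_of A Y ?i C" and ?w = "der_of A C ?s (dg_shift 1 X)"
  have z: "zigzag A X [Fwd X f Y] Y" "zigzag A Y [Fwd Y ?i C] C" "zigzag A C [Fwd C ?s (dg_shift 1 X)] (dg_shift 1 X)"
    using f i s Y C X1 by simp_all
  have nil: "zigzag A X [] X" "zigzag A Y [] Y" "zigzag A C [] C" "zigzag A (dg_shift 1 X) [] (dg_shift 1 X)"
    using X Y C X1 by simp_all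
  have h: "?u \<in> Hom (dgDer A) X Y" "?v \<in> Hom (dgDer A) Y C" "?w \<in> Hom (dgDer A) C (dg_shift 1 X)"
    unfolding der_of_def using z by auto
  have "distinguished A X Y C ?u ?v ?w"
    unfolding distinguished_def
  proof (intro conjI exI)
    show "f \<in> dg_hom A X Y" "\<phi> \<in> dg_isos A C (dg_cone X f Y)" by fact+
    show "iso_in (dgDer A) X X (zz_class A X [] X)" "iso_in (dgDer A) Y Y (zz_class A Y [] Y)"
      "iso_in (dgDer A) C C (zz_class A C [] C)" using iso_Id X Y C by auto
    show "Comp (dgDer A) (zz_class A Y [] Y) ?u = Comp (dgDer A) ?u (zz_class A X [] X)"
      "Comp (dgDer A) (zz_class A C [] C) ?v = Comp (dgDer A) ?v (zz_class A Y [] Y)"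
      "Comp (dgDer A) (der_shift A (zz_class A X [] X)) ?w = Comp (dgDer A) ?w (zz_class A C [] C)"
      unfolding der_of_def der_shift_Id[OF X] using z nil by (simp_all only: dgDer_Comp append_Nil append_Nil2)
  qed (use h in auto)
  then show ?thesis by blast
qed

text \<open>\<open>direct_summand\<close> does not require the complement to be a dg module. It is
  one automatically: it corresponds to the graded submodule of the sum on which the first component
  vanishes.\<close>

lemma sum_dg_moduleD:
  assumes S: "dg_module A (dg_sum X Y)" and X: "dg_module A X"
  shows "dg_module A Y"
proof -
  interpret S: dg_module A "dg_sum X Y" by fact
  interpret X: dg_module A X by fact
  let ?N = "{\<zero>\<^bsub>X\<^esub>} \<times> carrier Y"
  have z: "\<zero>\<^bsub>Y\<^esub> \<in> carrier Y" using S.zero_closed by simp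
  have fst_add: "fst (u \<oplus>\<^bsub>(dg_sum X Y)\<^esub> v) = fst u \<oplus>\<^bsub>X\<^esub> fst v" for u v by (cases u; cases v) simp
  have fst_c: "fst u \<in> carrier X" if "u \<in> carrier (dg_sum X Y)" for u using that by auto
  have fst_pr: "X.pr i (fst u) = fst (S.pr i u)" if "u \<in> carrier (dg_sum X Y)" for i u
    using that
  proof (induction rule: S.gr_induct)
    case (gr j y)
    then show ?case using S.pr_pure[OF gr, of i] by (auto simp: X.pr_pure)
  next
    case (add y z)
    then show ?case by (simp add: S.pr_add fst_add X.pr_add fst_c)
  qed
  have N: "dg_submodule A (dg_sum X Y) ?N"
  proof (rule dg_submoduleI[OF S])
    fix u assume u: "u \<in> ?N"
    have uc: "u \<in> carrier (dg_sum X Y)" "fst u = \<zero>\<^bsub>X\<^esub>" using u by auto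
    have *: "v \<in> ?N" if "v \<in> carrier (dg_sum X Y)" "fst v = \<zero>\<^bsub>X\<^esub>" for v using that by auto
    show "u \<oplus>\<^bsub>(dg_sum X Y)\<^esub> v \<in> ?N" if "v \<in> ?N" for v
    proof (rule *)
      have "v \<in> carrier (dg_sum X Y)" using that by auto
      then show "u \<oplus>\<^bsub>(dg_sum X Y)\<^esub> v \<in> carrier (dg_sum X Y)" by (rule S.a_closed[OF uc(1)])
      show "fst (u \<oplus>\<^bsub>(dg_sum X Y)\<^esub> v) = \<zero>\<^bsub>X\<^esub>" using uc that by (auto simp: fst_add)
    qed
    have "fst (\<ominus>\<^bsub>(dg_sum X Y)\<^esub> u) = \<zero>\<^bsub>X\<^esub>"
      using fst_add[of "\<ominus>\<^bsub>(dg_sum X Y)\<^esub> u" u] S.l_neg[OF uc(1)] uc(2) fst_c[OF S.a_inv_closed[OF uc(1)]] by simp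
    then show "\<ominus>\<^bsub>(dg_sum X Y)\<^esub> u \<in> ?N" using * S.a_inv_closed[OF uc(1)] by blast
    show "ract (dg_sum X Y) u a \<in> ?N" if a: "a \<in> carrier A" for a
      by (rule *[OF S.act_closed[OF uc(1) a]]) (use u a in auto)
    show "diff (dg_sum X Y) u \<in> ?N"
      by (rule *[OF S.diff_closed[OF uc(1)]]) (use u in auto)
    show "S.pr i u \<in> ?N" for i
      by (rule *[OF S.pr_closed[OF uc(1)]]) (use fst_pr[OF uc(1)] uc(2) in simp)
  qed (use z in auto)
  note R = dg_submoduleD[OF S N]
  have "(\<lambda>y. (\<zero>\<^bsub>X\<^esub>, y)) \<in> dg_isos A Y (dg_restrict (dg_sum X Y) ?N)"
  proof (rule transport_dg_module[OF R(10)])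
    show "bij_betw (\<lambda>y. (\<zero>\<^bsub>X\<^esub>, y)) (carrier Y) (carrier (dg_restrict (dg_sum X Y) ?N))"
      by (auto simp: bij_betw_def inj_on_def)
    show "y \<in> gr Y i \<longleftrightarrow> y \<in> carrier Y \<and> (\<zero>\<^bsub>X\<^esub>, y) \<in> gr (dg_restrict (dg_sum X Y) ?N) i" for i y
      using S.gr_closed[of "(\<zero>\<^bsub>X\<^esub>, y)" i] by auto
    show "x \<oplus>\<^bsub>Y\<^esub> y \<in> carrier Y" if "x \<in> carrier Y" "y \<in> carrier Y" for x y
      using R(4)[of "(\<zero>\<^bsub>X\<^esub>, x)" "(\<zero>\<^bsub>X\<^esub>, y)"] that by simp
    show "ract Y x a \<in> carrier Y" if "x \<in> carrier Y" "a \<in> carrier A" for x a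
      using R(7)[of "(\<zero>\<^bsub>X\<^esub>, x)" a] that by simp
    show "diff Y x \<in> carrier Y" if "x \<in> carrier Y" for x
      using R(8)[of "(\<zero>\<^bsub>X\<^esub>, x)"] that by simp
  qed (use z in auto)
  then show ?thesis using dg_homD(1)[OF dg_isosD(1)] by blast
qed

end

section \<open>Morphisms out of cellular modules; closure properties of filtered modules\<close>

context dg_universe begin

text \<open>Cellular modules behave as K-projectives: forward steps are composed, and a backward
  step along \<open>s\<close> is replaced by a lift through \<open>s\<close>, which is a strict
  inverse up to homotopy.\<close>

lemma zigzag_lift:
  assumes P: "cellular A P ns" and "f \<in> dg_hom A P X" "zigzag A X p Y"
  shows "\<exists>g\<in>dg_hom A P Y. zz_equiv A P Y (Fwd P f X # p) [Fwd P g Y]"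
  using assms(2,3)
proof (induction p arbitrary: X f)
  case Nil
  then show ?case using zz_refl[of A P "[Fwd P f Y]" Y] by auto
next
  case (Cons st p)
  note f = Cons.prems(1)
  have Pm: "dg_module A P" using P by (simp add: cellular_def)
  then have nil: "zigzag A P [] P" by simp
  show ?case
  proof (cases st)
    case (Fwd M g N)
    then have h: "X = M" "g \<in> dg_hom A M N" "zigzag A N p Y" using Cons.prems by auto
    have "zz_equiv A P Y ([Fwd P f M, Fwd M g N] @ p) ([Fwd P (g \<circ> f) N] @ p)"
      using zz_equiv_append[OF zz_comp zz_refl[OF h(3)]] f h by blast
    moreover obtain g' where "g' \<in> dg_hom A P Y" "zz_equiv A P Y (Fwd P (g \<circ> f) N # p) [Fwd P g' Y]"
      using Cons.IH[OF dg_hom_comp h(3)] f h by blast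
    ultimately show ?thesis using zz_trans Fwd h(1) by fastforce
  next
    case (Bwd N s M)
    then have h: "X = N" "s \<in> quasi_isos A M N" "zigzag A M p Y" using Cons.prems by auto
    have q: "qis A s M N" using h(2) quasi_isos_iff by blast
    obtain g k where g: "g \<in> dg_hom A P M" "k \<in> rmod_hom A P N" "\<forall>i. \<forall>x\<in>gr P i. k x \<in> gr N (i - 1)"
      "\<forall>x\<in>carrier P. s (g x) = f x \<oplus>\<^bsub>N\<^esub> (diff N (k x) \<oplus>\<^bsub>N\<^esub> k (diff P x))"
      using cellular_lift[OF P q] f h(1) by blast
    have sg: "s \<circ> g \<in> dg_hom A P N" using dg_hom_comp[OF g(1) qis_hom[OF q]] .
    \<comment> \<open>Up to homotopy \<open>f\<close> factors through \<open>s\<close>, so the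
      formal inverse of \<open>s\<close> cancels against \<open>s\<close>.\<close>
    have "homotopic A P N (s \<circ> g) f" unfolding homotopic_def using g(2-4) by auto
    then have 1: "zz_equiv A P N [Fwd P f N] [Fwd P (s \<circ> g) N]" using zz_homotopy sg f h(1) zz_sym by blast
    have 2: "zz_equiv A P N [Fwd P (s \<circ> g) N] [Fwd P g M, Fwd M s N]" using zz_comp[OF g(1) qis_hom[OF q]] zz_sym by blast
    have B: "zigzag A N [Bwd N s M] M" using h(2) dg_homD(1)[OF qis_hom[OF q]] by simp
    have G: "zigzag A P [Fwd P g M] M" using g(1) dg_homD(2)[OF g(1)] by simp
    have "zz_equiv A P M ([Fwd P f N] @ [Bwd N s M]) ([Fwd P g M, Fwd M s N] @ [Bwd N s M])"
      using zz_equiv_append[OF zz_trans[OF 1 2] zz_refl[OF B]] .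
    moreover have "zz_equiv A P M ([Fwd P g M] @ [Fwd M s N, Bwd N s M]) ([Fwd P g M] @ [])"
      using zz_equiv_append[OF zz_refl[OF G] zz_inv_right[OF h(2)]] .
    ultimately have "zz_equiv A P M [Fwd P f N, Bwd N s M] [Fwd P g M]" using zz_trans by fastforce
    from zz_equiv_append[OF this zz_refl[OF h(3)]]
    have "zz_equiv A P Y (Fwd P f N # Bwd N s M # p) (Fwd P g M # p)" by simp
    moreover obtain g' where "g' \<in> dg_hom A P Y" "zz_equiv A P Y (Fwd P g M # p) [Fwd P g' Y]"
      using Cons.IH[OF g(1) h(3)] by blast
    ultimately show ?thesis using zz_trans Bwd h(1) by blast
  qed
qed

text \<open>The isomorphism is represented by a single map by lifting; an invertible map is a
  quasi-isomorphism because cohomology detects it.\<close>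

lemma cellular_isomorphic_qis:
  assumes P: "cellular A P ns" and iso: "isomorphic_in (dgDer A) P Y"
  shows "\<exists>f. qis A f P Y"
proof -
  obtain p q where p: "zigzag A P p Y" "zigzag A Y q P" "zz_equiv A P P (p @ q) []" "zz_equiv A Y Y (q @ p) []"
    using iso isomorphic_iff by blast
  have Pm: "dg_module A P" using P by (simp add: cellular_def)
  \<comment> \<open>The zigzag is prefixed with the identity of \<open>P\<close>, since the lifting
    statement starts from a map out of \<open>P\<close>.\<close>
  obtain f where f: "f \<in> dg_hom A P Y" "zz_equiv A P Y (Fwd P (\<lambda>x. x) P # p) [Fwd P f Y]"
    using zigzag_lift[OF P dg_hom_id[OF Pm] p(1)] by blast
  have "zz_equiv A P Y ([Fwd P (\<lambda>x. x) P] @ p) ([] @ p)"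
    using zz_equiv_append[OF zz_ident[OF Pm] zz_refl[OF p(1)]] .
  then have pf: "zz_equiv A P Y [Fwd P f Y] p" using f(2) zz_sym zz_trans by fastforce
  have "zz_equiv A P P ([Fwd P f Y] @ q) []" using zz_trans[OF zz_equiv_append[OF pf zz_refl[OF p(2)]] p(3)] .
  moreover have "zz_equiv A Y Y (q @ [Fwd P f Y]) []" using zz_trans[OF zz_equiv_append[OF zz_refl[OF p(2)] pf] p(4)] .
  ultimately show ?thesis using qis_if_inverse[OF f(1) p(2)] by auto
qed

lemma filtered_isomorphic:
  fixes X Y :: "('a, 'm) dgmod"
  assumes "filtered X" "isomorphic_in (dgDer A) X Y" shows "filtered Y"
proof -
  obtain ns and Q :: "('a, 'm) dgmod" and q where Q: "sorted_wrt (\<ge>) ns" "cellular A Q ns" "qis A q Q X"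
    using assms(1) by (auto simp: filtered_def model_def)
  have "isomorphic_in (dgDer A) Q Y" using isomorphic_trans[OF qis_isomorphic[OF Q(3)] assms(2)] .
  then obtain f where "qis A f Q Y" using cellular_isomorphic_qis[OF Q(2)] by blast
  then show ?thesis using Q by (auto simp: filtered_def model_def)
qed

text \<open>A distinguished triangle is isomorphic to a standard one, so its third object is
  isomorphic to the cone of a morphism between filtered modules.\<close>

lemma filtered_strict_triangulated: "strict_triangulated A {X :: ('a, 'm) dgmod. filtered X}"
  unfolding strict_triangulated_def
proof (intro conjI allI impI ballI)
  show "{X :: ('a, 'm) dgmod. filtered X} \<subseteq> Ob (dgDer A)" using filtered_module by auto
  show "X \<in> {X. filtered X}" if "X \<in> Ob (dgDer A)" "carrier X = {\<zero>\<^bsub>X\<^esub>}" for X :: "('a, 'm) dgmod"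
    using model_zero[of X] that by (auto simp: filtered_def)
  show "Y \<in> {X. filtered X}" if "X \<in> {X. filtered X}" "isomorphic_in (dgDer A) X Y" for X Y :: "('a, 'm) dgmod"
    using filtered_isomorphic that by simp
  show "dg_shift n X \<in> {X. filtered X}" if "X \<in> {X. filtered X}" for X :: "('a, 'm) dgmod" and n
    using filtered_shift that by simp
  show "Z \<in> {X. filtered X}" if d: "distinguished A X Y Z u v w" and "X \<in> {X. filtered X}" "Y \<in> {X. filtered X}"
    for X Y Z :: "('a, 'm) dgmod" and u v w
  proof -
    from d obtain X' Y' C :: "('a, 'm) dgmod" and f \<phi> a b c where
      f: "f \<in> dg_hom A X' Y'" "\<phi> \<in> dg_isos A C (dg_cone X' f Y')"
      and iso: "iso_in (dgDer A) X X' a" "iso_in (dgDer A) Y Y' b" "iso_in (dgDer A) Z C c"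
      and Z: "v \<in> Hom (dgDer A) Y Z"
      unfolding distinguished_def by blast
    have X: "filtered X" "filtered Y" using that by auto
    have mods: "dg_module A X'" "dg_module A Y'" "dg_module A C" "dg_module A Z"
      using dg_homD(1,2)[OF f(1)] dg_homD(1)[OF dg_isosD(1)[OF f(2)]] Z zigzag_modules by auto
    have "filtered X'" "filtered Y'"
      using filtered_isomorphic[OF X(1) isomorphicI[OF filtered_module[OF X(1)] mods(1) iso(1)]]
        filtered_isomorphic[OF X(2) isomorphicI[OF filtered_module[OF X(2)] mods(2) iso(2)]] .
    then have "filtered (dg_cone X' f Y')" by (rule filtered_cone[OF f(1)])
    then have "filtered C" using filtered_qis[OF _ qis_if_isos[OF dg_isos_inv[OF f(2)]]] by blast
    moreover have "isomorphic_in (dgDer A) C Z" using isomorphic_sym[OF isomorphicI[OF mods(4,3) iso(3)]] .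
    ultimately show ?thesis using filtered_isomorphic by simp
  qed
qed

lemma filtered_summand_closed: "summand_closed A {X :: ('a, 'm) dgmod. filtered X}"
  unfolding summand_closed_def
proof (intro ballI impI)
  fix M X :: "('a, 'm) dgmod" assume M: "M \<in> {X. filtered X}" and X: "X \<in> Ob (dgDer A)" and s: "direct_summand A X M"
  obtain Y D :: "('a, 'm) dgmod" where D: "dg_iso A D (dg_sum X Y)" "isomorphic_in (dgDer A) M D"
    using s unfolding direct_summand_def by blast
  have X: "dg_module A X" using X by simp
  obtain \<phi> where \<phi>: "\<phi> \<in> dg_isos A D (dg_sum X Y)" using D(1) by (auto simp: dg_iso_def)
  have Y: "dg_module A Y" using sum_dg_moduleD[OF dg_homD(2)[OF dg_isosD(1)[OF \<phi>]] X] .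
  have "filtered M" using M by simp
  then obtain ns and Q :: "('a, 'm) dgmod" and q where Q: "sorted_wrt (\<ge>) ns" "cellular A Q ns" "qis A q Q M"
    by (auto simp: filtered_def model_def)
  \<comment> \<open>The summand is given only up to isomorphism in the derived category; cellularity
    of \<open>Q\<close> turns this into a quasi-isomorphism onto the honest direct sum.\<close>
  have "isomorphic_in (dgDer A) Q D" using isomorphic_trans[OF qis_isomorphic[OF Q(3)] D(2)] .
  then obtain f where "qis A f Q D" using cellular_isomorphic_qis[OF Q(2)] by blast
  then have "qis A (\<phi> \<circ> f) Q (dg_sum X Y)" using qis_comp qis_if_isos[OF \<phi>] by blast
  then show "X \<in> {X. filtered X}" using filtered_summands[OF Q(2,1) _ X Y] by simp
qed

end

section \<open>Simple modules and primitive idempotents\<close>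

text \<open>The cyclic submodule generated by a nonzero element is nonzero, hence
  everything.\<close>

lemma simple_rmoduleD:
  assumes "simple_rmodule R M" and x: "x \<in> carrier M" "x \<noteq> \<zero>\<^bsub>M\<^esub>" and y: "y \<in> carrier M"
  shows "\<exists>a\<in>carrier R. y = ract M x a"
proof -
  have M: "right_module R M" using assms(1) by (simp add: simple_rmodule_def)
  interpret R: ring R by (rule right_module.ring[OF M])
  interpret M: abelian_group M by (rule right_module.abelian_group[OF M])
  note act = right_module.act_closed[OF M] right_module.act_add_left[OF M] right_module.act_add_right[OF M]
    right_module.act_assoc[OF M] right_module.act_one[OF M]
  define N where "N = {ract M x a |a. a \<in> carrier R}"
  have sub: "N \<subseteq> carrier M" using x act(1) by (auto simp: N_def)
  have zero: "ract M x \<zero>\<^bsub>R\<^esub> = \<zero>\<^bsub>M\<^esub>"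
    by (rule R.hom_zero[of "ract M x"]) (use x act M.abelian_group_axioms in auto)
  have N0: "\<zero>\<^bsub>M\<^esub> \<in> N" using zero by (force simp: N_def)
  have add: "u \<oplus>\<^bsub>M\<^esub> v \<in> N" if "u \<in> N" "v \<in> N" for u v
  proof -
    obtain a b where ab: "u = ract M x a" "v = ract M x b" "a \<in> carrier R" "b \<in> carrier R" using \<open>u \<in> N\<close> \<open>v \<in> N\<close> by (auto simp: N_def)
    then have "u \<oplus>\<^bsub>M\<^esub> v = ract M x (a \<oplus>\<^bsub>R\<^esub> b)" using act(3) x by simp
    then show ?thesis using ab by (auto simp: N_def)
  qed
  have inv: "\<exists>v\<in>N. v \<oplus>\<^bsub>M\<^esub> u = \<zero>\<^bsub>M\<^esub>" if "u \<in> N" for u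
  proof -
    obtain a where a: "u = ract M x a" "a \<in> carrier R" using \<open>u \<in> N\<close> by (auto simp: N_def)
    then have "ract M x (\<ominus>\<^bsub>R\<^esub> a) \<oplus>\<^bsub>M\<^esub> u = \<zero>\<^bsub>M\<^esub>" using act(3)[of x "\<ominus>\<^bsub>R\<^esub> a" a] x zero by (simp add: R.l_neg)
    then show ?thesis using a by (intro bexI[of _ "ract M x (\<ominus>\<^bsub>R\<^esub> a)"]) (auto simp: N_def)
  qed
  have ab: "abelian_group (M\<lparr>carrier := N\<rparr>)"
    by (rule abelian_groupI) (use N0 add inv sub in \<open>auto simp: M.a_ac subset_eq\<close>)
  have ac: "ract M u b \<in> N" if "u \<in> N" "b \<in> carrier R" for u b
  proof -
    obtain a where a: "u = ract M x a" "a \<in> carrier R" using \<open>u \<in> N\<close> by (auto simp: N_def)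
    then have "ract M u b = ract M x (a \<otimes>\<^bsub>R\<^esub> b)" using act(4) x that by simp
    then show ?thesis using a that by (auto simp: N_def)
  qed
  have "right_module R (M\<lparr>carrier := N\<rparr>)"
    by (rule right_module.intro[OF R.ring_axioms ab]) (use act ac sub in \<open>auto simp: subset_eq\<close>)
  then have "rsubmodule R M N" using sub by (simp add: rsubmodule_def)
  moreover have "x \<in> N" using act(5)[OF x(1)] by (force simp: N_def)
  ultimately have "N = carrier M" using assms(1) x(2) by (auto simp: simple_rmodule_def)
  then show ?thesis using y by (auto simp: N_def)
qed

lemma simple_rmoduleI:
  assumes M: "right_module R M" and x: "x \<in> carrier M" "x \<noteq> \<zero>\<^bsub>M\<^esub>"
    and gen: "\<And>x y. x \<in> carrier M \<Longrightarrow> x \<noteq> \<zero>\<^bsub>M\<^esub> \<Longrightarrow> y \<in> carrier M \<Longrightarrow> \<exists>a\<in>carrier R. y = ract M x a"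
  shows "simple_rmodule R M"
  unfolding simple_rmodule_def
proof (intro conjI allI impI)
  show "carrier M \<noteq> {\<zero>\<^bsub>M\<^esub>}" using x by auto
  fix N assume "rsubmodule R M N"
  then have N: "N \<subseteq> carrier M" "right_module R (M\<lparr>carrier := N\<rparr>)" by (auto simp: rsubmodule_def)
  interpret N: abelian_group "M\<lparr>carrier := N\<rparr>" by (rule right_module.abelian_group[OF N(2)])
  have z: "\<zero>\<^bsub>M\<^esub> \<in> N" using N.zero_closed by simp
  show "N = {\<zero>\<^bsub>M\<^esub>} \<or> N = carrier M"
  proof (cases "N = {\<zero>\<^bsub>M\<^esub>}")
    case False
    then obtain u where u: "u \<in> N" "u \<noteq> \<zero>\<^bsub>M\<^esub>" using z by blast
    have "carrier M \<subseteq> N"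
    proof
      fix y assume "y \<in> carrier M"
      then obtain a where "a \<in> carrier R" "y = ract M u a" using gen[of u y] u N(1) by blast
      then show "y \<in> N" using right_module.act_closed[OF N(2), of u a] u by simp
    qed
    then show ?thesis using N(1) by blast
  qed simp
qed (fact M)

lemma degree_zero_sel [simp]:
  "carrier (degree_zero_ring A) = agr A 0" "x \<otimes>\<^bsub>(degree_zero_ring A)\<^esub> y = x \<otimes>\<^bsub>A\<^esub> y"
  "\<one>\<^bsub>(degree_zero_ring A)\<^esub> = \<one>\<^bsub>A\<^esub>" "\<zero>\<^bsub>(degree_zero_ring A)\<^esub> = \<zero>\<^bsub>A\<^esub>"
  "x \<oplus>\<^bsub>(degree_zero_ring A)\<^esub> y = x \<oplus>\<^bsub>A\<^esub> y"
  by (simp_all add: degree_zero_ring_def)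

lemma regular_rmod_sel [simp]:
  "carrier (regular_rmod R) = carrier R" "\<zero>\<^bsub>(regular_rmod R)\<^esub> = \<zero>\<^bsub>R\<^esub>"
  "x \<oplus>\<^bsub>(regular_rmod R)\<^esub> y = x \<oplus>\<^bsub>R\<^esub> y" "ract (regular_rmod R) x a = x \<otimes>\<^bsub>R\<^esub> a"
  by (simp_all add: regular_rmod_def)

text \<open>\<open>l0\<close> corresponds to \<open>e\<close> under an isomorphism of \<open>L\<close> with \<open>e A\<^sup>0\<close>.\<close>

definition idem_generator :: "('k, 'a, 'f) dga_scheme \<Rightarrow> ('a, 'l) rmod \<Rightarrow> 'a \<Rightarrow> 'l \<Rightarrow> bool" where
  "idem_generator A L e l0 \<longleftrightarrow> l0 \<in> carrier L \<and> ract L l0 e = l0 \<and>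
     (\<forall>l\<in>carrier L. \<exists>a\<in>agr A 0. e \<otimes>\<^bsub>A\<^esub> a = a \<and> l = ract L l0 a) \<and>
     (\<forall>a\<in>agr A 0. e \<otimes>\<^bsub>A\<^esub> a = a \<longrightarrow> ract L l0 a = \<zero>\<^bsub>L\<^esub> \<longrightarrow> a = \<zero>\<^bsub>A\<^esub>)"

section \<open>Primitive idempotents of the semisimple ring in degree zero\<close>

context pos_dga begin

lemma agr0_add: "a \<in> agr A 0 \<Longrightarrow> b \<in> agr A 0 \<Longrightarrow> a \<oplus> b \<in> agr A 0"
  by (rule pj_F_add[OF apr])

lemma agr0_inv: "a \<in> agr A 0 \<Longrightarrow> \<ominus> a \<in> agr A 0"
  by (rule pj_F_inv[OF apr])

text \<open>The components of the unit in the decomposition of A^0 into simple right ideals. Only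
  finitely many are nonzero, although the decomposition is not assumed finite.\<close>

lemma complete_idempotents:
  assumes ss: "semisimple_ring (degree_zero_ring A)"
  shows "\<exists>(T :: 'a set set) \<epsilon>. finite T \<and> (\<forall>N\<in>T. prim_idem A (\<epsilon> N)) \<and>
    (\<forall>N\<in>T. \<forall>N'\<in>T. N \<noteq> N' \<longrightarrow> \<epsilon> N \<otimes> \<epsilon> N' = \<zero>) \<and> finsum A \<epsilon> T = \<one>"
proof -
  let ?R = "degree_zero_ring A" and ?B = "regular_rmod (degree_zero_ring A)"
  obtain S where B: "right_module ?R ?B" and S: "\<And>N. N \<in> S \<Longrightarrow> rsubmodule ?R ?B N"
    "\<And>N. N \<in> S \<Longrightarrow> simple_rmodule ?R (?B\<lparr>carrier := N\<rparr>)" and ds: "internal_direct_sum ?B S (\<lambda>N. N)"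
    using ss by (auto simp: semisimple_ring_def semisimple_rmodule_def)
  interpret B: abelian_group ?B by (rule right_module.abelian_group[OF B])
  have N: "N \<subseteq> agr A 0" "\<zero> \<in> N" "x \<in> N \<Longrightarrow> a \<in> agr A 0 \<Longrightarrow> x \<otimes> a \<in> N" if "N \<in> S" for N x a
  proof -
    have r: "right_module ?R (?B\<lparr>carrier := N\<rparr>)" and sub: "N \<subseteq> agr A 0"
      using S(1)[OF that] by (auto simp: rsubmodule_def)
    interpret N: abelian_group "?B\<lparr>carrier := N\<rparr>" by (rule right_module.abelian_group[OF r])
    show "N \<subseteq> agr A 0" "\<zero> \<in> N" using sub N.zero_closed by simp_all
    show "x \<in> N \<Longrightarrow> a \<in> agr A 0 \<Longrightarrow> x \<otimes> a \<in> N" using right_module.act_closed[OF r, of x a] by simp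
  qed
  \<comment> \<open>The regular module is a separate record with the same addition, so finite sums
    in it are identified with sums in A.\<close>
  have fs: "finsum ?B g T = finsum A g T" if "finite T" "\<And>i. i \<in> T \<Longrightarrow> g i \<in> agr A 0" for g :: "'a set \<Rightarrow> 'a" and T
    using that
  proof (induction T)
    case empty then show ?case by simp
  next
    case (insert i T)
    then have "g \<in> T \<rightarrow> carrier ?B" "g i \<in> carrier ?B" "g \<in> T \<rightarrow> carrier A" "g i \<in> carrier A" by auto
    then show ?case using insert by simp
  qed
  define D where "D x g \<longleftrightarrow> g \<in> (\<Pi>\<^sub>E N\<in>S. N) \<and> finite {N\<in>S. g N \<noteq> \<zero>} \<and> x = finsum A g {N\<in>S. g N \<noteq> \<zero>}" for x g
  have DI: "D x (restrict g S)" if g: "\<And>N. N \<in> S \<Longrightarrow> g N \<in> N" and T: "finite T" "T \<subseteq> S" "\<And>N. N \<in> S \<Longrightarrow> g N \<noteq> \<zero> \<Longrightarrow> N \<in> T"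
    and x: "x = finsum A g T" for x g T
  proof -
    have supp: "{N\<in>S. restrict g S N \<noteq> \<zero>} \<subseteq> T" using T by auto
    have "finsum A (restrict g S) {N\<in>S. restrict g S N \<noteq> \<zero>} = finsum A g T"
      by (rule add.finprod_mono_neutral_cong_left[OF T(1) supp]) (use T(2) g N(1) in \<open>auto simp: subset_eq\<close>)
    then show ?thesis unfolding D_def using g finite_subset[OF supp T(1)] x by auto
  qed
  have uniq: "\<exists>!g. D x g" if "x \<in> agr A 0" for x
  proof -
    have "\<exists>!g. g \<in> (\<Pi>\<^sub>E N\<in>S. N) \<and> finite {N\<in>S. g N \<noteq> \<zero>} \<and> x = finsum ?B g {N\<in>S. g N \<noteq> \<zero>}"
      using ds that by (simp add: internal_direct_sum_def)
    moreover have "(g \<in> (\<Pi>\<^sub>E N\<in>S. N) \<and> finite {N\<in>S. g N \<noteq> \<zero>} \<and> x = finsum ?B g {N\<in>S. g N \<noteq> \<zero>}) \<longleftrightarrow> D x g" for g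
    proof (cases "g \<in> (\<Pi>\<^sub>E N\<in>S. N) \<and> finite {N\<in>S. g N \<noteq> \<zero>}")
      case True
      then have "g N \<in> agr A 0" if "N \<in> S" for N using that N(1)[OF that] by auto
      then show ?thesis using fs[of "{N\<in>S. g N \<noteq> \<zero>}" g] True by (auto simp: D_def)
    qed (auto simp: D_def)
    ultimately show ?thesis by simp
  qed
  obtain \<epsilon> where \<epsilon>: "D \<one> \<epsilon>" using uniq[OF one_gr] by blast
  define T where "T = {N\<in>S. \<epsilon> N \<noteq> \<zero>}"
  have T: "finite T" "T \<subseteq> S" "finsum A \<epsilon> T = \<one>" using \<epsilon> by (auto simp: D_def T_def)
  have \<epsilon>N: "\<epsilon> N \<in> N" "\<epsilon> N \<in> agr A 0" if "N \<in> S" for N using \<epsilon> that N(1)[OF that] by (auto simp: D_def)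
  \<comment> \<open>Writing a = 1 a decomposes \<open>a\<close> with terms \<epsilon> N a, but
    \<open>a\<close> already lies in the single summand \<open>N0\<close>. Uniqueness gives
    idempotence for N = N0 and orthogonality otherwise.\<close>
  have key: "\<epsilon> N \<otimes> a = (if N = N0 then a else \<zero>)" if N0: "N0 \<in> S" "a \<in> N0" and NS: "N \<in> S" for N0 a N
  proof -
    have a: "a \<in> agr A 0" using N0 N(1) by blast
    have "D a (restrict (\<lambda>N. \<epsilon> N \<otimes> a) S)"
    proof (rule DI[OF _ T(1,2)])
      show "\<epsilon> N \<otimes> a \<in> N" if "N \<in> S" for N using N(3)[OF that] \<epsilon>N[OF that] a by blast
      show "N \<in> T" if "N \<in> S" "\<epsilon> N \<otimes> a \<noteq> \<zero>" for N using that a by (auto simp: T_def)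
      have "a = finsum A \<epsilon> T \<otimes> a" using T(3) a by simp
      also have "\<dots> = (\<Oplus>N\<in>T. \<epsilon> N \<otimes> a)" by (rule finsum_ldistr[OF T(1)]) (use a T(2) \<epsilon>N(2) in auto)
      finally show "a = (\<Oplus>N\<in>T. \<epsilon> N \<otimes> a)" .
    qed
    moreover have "D a (restrict (\<lambda>N. if N = N0 then a else \<zero>) S)"
      by (rule DI[of _ "{N0}"]) (use N0 N(2) a in \<open>auto split: if_splits\<close>)
    ultimately have "restrict (\<lambda>N. \<epsilon> N \<otimes> a) S = restrict (\<lambda>N. if N = N0 then a else \<zero>) S" using uniq[OF a] by blast
    from fun_cong[OF this, of N] show ?thesis using NS by simp
  qed
  have "prim_idem A (\<epsilon> N)" if "N \<in> T" for N
  proof -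
    have NS: "N \<in> S" using that T(2) by blast
    show ?thesis unfolding prim_idem_def
    proof (intro conjI ballI impI)
      show "\<epsilon> N \<in> agr A 0" "\<epsilon> N \<otimes> \<epsilon> N = \<epsilon> N" "\<epsilon> N \<noteq> \<zero>" using \<epsilon>N[OF NS] key[OF NS \<epsilon>N(1)[OF NS] NS] that by (auto simp: T_def)
      fix x assume x: "x \<in> agr A 0" "\<epsilon> N \<otimes> x = x" "x \<noteq> \<zero>"
      then have "x \<in> N" using N(3)[OF NS \<epsilon>N(1)[OF NS] x(1)] by simp
      \<comment> \<open>The ideal \<open>N\<close> is simple and contains both \<open>x\<close> and
        \<epsilon> N, so \<open>x\<close> generates the latter.\<close>
      then show "\<exists>c\<in>agr A 0. x \<otimes> c = \<epsilon> N"
        using simple_rmoduleD[OF S(2)[OF NS], of x "\<epsilon> N"] x(3) \<epsilon>N(1)[OF NS] by auto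
    qed
  qed
  moreover have "\<epsilon> N \<otimes> \<epsilon> N' = \<zero>" if "N \<in> T" "N' \<in> T" "N \<noteq> N'" for N N'
    using key[of N' "\<epsilon> N'" N] \<epsilon>N that T(2) by auto
  ultimately show ?thesis using T(1,3) by blast
qed

text \<open>Any nonzero \<open>l\<close> is the sum of the elements l \<epsilon> N, so one of these
  is nonzero; sending e = \<epsilon> N to it is a nonzero map between the simple modules e A^0 and
  \<open>L\<close>, hence an isomorphism.\<close>

lemma simple_generator:
  assumes ss: "semisimple_ring (degree_zero_ring A)" and L: "simple_rmodule (degree_zero_ring A) L"
  obtains e l0 where "prim_idem A e" "idem_generator A L e l0"
proof -
  let ?R = "degree_zero_ring A"
  have LM: "right_module ?R L" and ne: "carrier L \<noteq> {\<zero>\<^bsub>L\<^esub>}" using L by (auto simp: simple_rmodule_def)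
  interpret L: abelian_group L by (rule right_module.abelian_group[OF LM])
  note act = right_module.act_closed[OF LM, simplified] right_module.act_add_right[OF LM, simplified]
    right_module.act_assoc[OF LM, simplified] right_module.act_one[OF LM, simplified]
  from complete_idempotents[OF ss] obtain T :: "'a set set" and \<epsilon> where
    "finite T \<and> (\<forall>N\<in>T. prim_idem A (\<epsilon> N)) \<and> (\<forall>N\<in>T. \<forall>N'\<in>T. N \<noteq> N' \<longrightarrow> \<epsilon> N \<otimes> \<epsilon> N' = \<zero>) \<and> finsum A \<epsilon> T = \<one>"
    by (elim exE)
  then have T: "finite T" "\<And>N. N \<in> T \<Longrightarrow> prim_idem A (\<epsilon> N)" "finsum A \<epsilon> T = \<one>" by simp_all
  have \<epsilon>c: "\<epsilon> N \<in> agr A 0" if "N \<in> T" for N using prim_idemD(1)[OF T(2)[OF that]] .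
  obtain l where l: "l \<in> carrier L" "l \<noteq> \<zero>\<^bsub>L\<^esub>" using ne L.zero_closed by blast
  have z: "ract L l \<zero> = \<zero>\<^bsub>L\<^esub>"
  proof -
    have "ract L l \<zero> \<oplus>\<^bsub>L\<^esub> ract L l \<zero> = ract L l \<zero>" using act(2)[OF l(1), of \<zero> \<zero>] by simp
    then show ?thesis using L.add.l_cancel_one' act(1)[OF l(1) agr_zero] by metis
  qed
  have "\<exists>N\<in>T. ract L l (\<epsilon> N) \<noteq> \<zero>\<^bsub>L\<^esub>"
  proof (rule ccontr)
    assume "\<not> ?thesis"
    then have *: "ract L l (\<epsilon> N) = \<zero>\<^bsub>L\<^esub>" if "N \<in> T" for N using that by blast
    have "F \<subseteq> T \<Longrightarrow> finsum A \<epsilon> F \<in> agr A 0 \<and> ract L l (finsum A \<epsilon> F) = \<zero>\<^bsub>L\<^esub>" if "finite F" for F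
      using that
    proof (induction F)
      case empty then show ?case using z by simp
    next
      case (insert N F)
      have "\<epsilon> \<in> F \<rightarrow> carrier A" "\<epsilon> N \<in> carrier A" using insert.prems \<epsilon>c by (auto simp: subset_eq)
      then show ?case using insert * \<epsilon>c agr0_add act(2)[OF l(1)] by simp
    qed
    then have "ract L l \<one> = \<zero>\<^bsub>L\<^esub>" using T(1,3) by force
    then show False using act(4) l by simp
  qed
  then obtain N where N: "N \<in> T" "ract L l (\<epsilon> N) \<noteq> \<zero>\<^bsub>L\<^esub>" by blast
  let ?e = "\<epsilon> N" and ?l = "ract L l (\<epsilon> N)"
  note e = T(2)[OF N(1)] and E = prim_idemD[OF T(2)[OF N(1)]]
  have lc: "?l \<in> carrier L" using act(1) l E by blast
  have le: "ract L ?l ?e = ?l" using act(3)[OF l(1) E(1) E(1)] E(3) by simp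
  have "idem_generator A L ?e ?l"
    unfolding idem_generator_def
  proof (intro conjI ballI impI lc le)
    fix y assume "y \<in> carrier L"
    then obtain a where a: "a \<in> agr A 0" "y = ract L ?l a" using simple_rmoduleD[OF L lc N(2)] by auto
    have "ract L ?l (?e \<otimes> a) = y" using act(3)[OF lc E(1) a(1)] le a by simp
    moreover have "?e \<otimes> (?e \<otimes> a) = ?e \<otimes> a" using E a by (simp flip: m_assoc)
    ultimately show "\<exists>a\<in>agr A 0. ?e \<otimes> a = a \<and> y = ract L ?l a" using agr0_mult[OF E(1) a(1)] by metis
  next
    fix a assume a: "a \<in> agr A 0" "?e \<otimes> a = a" "ract L ?l a = \<zero>\<^bsub>L\<^esub>"
    show "a = \<zero>"
    \<comment> \<open>A nonzero \<open>a\<close> would satisfy a c = e for some \<open>c\<close>,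
      and the generator, being fixed by \<open>e\<close>, would be annihilated.\<close>
    proof (rule ccontr)
      assume "a \<noteq> \<zero>"
      then obtain c where c: "c \<in> agr A 0" "a \<otimes> c = ?e" using e a unfolding prim_idem_def by blast
      have "ract L \<zero>\<^bsub>L\<^esub> c = \<zero>\<^bsub>L\<^esub>"
      proof -
        have "ract L \<zero>\<^bsub>L\<^esub> c \<oplus>\<^bsub>L\<^esub> ract L \<zero>\<^bsub>L\<^esub> c = ract L \<zero>\<^bsub>L\<^esub> c"
          using right_module.act_add_left[OF LM, of "\<zero>\<^bsub>L\<^esub>" "\<zero>\<^bsub>L\<^esub>" c] c by simp
        then show ?thesis using L.add.l_cancel_one' act(1)[OF L.zero_closed c(1)] by metis
      qed
      moreover have "ract L ?l (a \<otimes> c) = ract L \<zero>\<^bsub>L\<^esub> c" using act(3)[OF lc a(1) c(1)] a(3) by simp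
      ultimately show False using c(2) le N(2) by simp
    qed
  qed
  then show ?thesis using that e by blast
qed

text \<open>Completeness of the representatives speaks only about modules on \<open>'m\<close>. The
  simple module e A^0 lives on the type of A and is therefore first copied along an injection
  \<kappa> of A into \<open>'m\<close>.\<close>

lemma idem_generator_ex:
  fixes L :: "'x \<Rightarrow> ('a, 'm) rmod"
  assumes emb: "carrier A \<lesssim> (UNIV :: 'm set)" and ring: "ring (degree_zero_ring A)"
    and L: "simple_representatives (degree_zero_ring A) W L" and e: "prim_idem A e"
  obtains x l0 where "x \<in> W" "idem_generator A (L x) e l0"
proof -
  let ?R = "degree_zero_ring A"
  note E = prim_idemD[OF e]
  obtain \<kappa> :: "'a \<Rightarrow> 'm" where \<kappa>: "inj_on \<kappa> (carrier A)" using emb by (auto simp: lepoll_def)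
  define \<delta> where "\<delta> = inv_into (carrier A) \<kappa>"
  have \<delta> [simp]: "\<delta> (\<kappa> a) = a" if "a \<in> carrier A" for a using \<kappa> that by (simp add: \<delta>_def)
  define P where "P = {a \<in> agr A 0. e \<otimes> a = a}"
  have P: "a \<in> agr A 0" "a \<in> carrier A" "e \<otimes> a = a" if "a \<in> P" for a using that by (auto simp: P_def)
  have Pc: "\<zero> \<in> P" "e \<in> P" "\<And>a b. a \<in> P \<Longrightarrow> b \<in> P \<Longrightarrow> a \<oplus> b \<in> P" "\<And>a. a \<in> P \<Longrightarrow> \<ominus> a \<in> P"
    "\<And>a b. a \<in> P \<Longrightarrow> b \<in> agr A 0 \<Longrightarrow> a \<otimes> b \<in> P"
    using E agr0_add agr0_inv agr0_mult by (auto simp: P_def r_distr r_minus m_assoc[symmetric])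
  define M :: "('a, 'm) rmod" where "M = \<lparr>carrier = \<kappa> ` P, monoid.mult = undefined, monoid.one = undefined,
    ring.zero = \<kappa> \<zero>, ring.add = (\<lambda>x y. \<kappa> (\<delta> x \<oplus> \<delta> y)), ract = (\<lambda>x a. \<kappa> (\<delta> x \<otimes> a))\<rparr>"
  have M [simp]: "carrier M = \<kappa> ` P" "\<zero>\<^bsub>M\<^esub> = \<kappa> \<zero>" "x \<oplus>\<^bsub>M\<^esub> y = \<kappa> (\<delta> x \<oplus> \<delta> y)" "ract M x a = \<kappa> (\<delta> x \<otimes> a)" for x y a
    by (simp_all add: M_def)
  have "abelian_group M"
  proof (rule abelian_groupI)
    fix x assume "x \<in> carrier M"
    then obtain a where a: "x = \<kappa> a" "a \<in> P" by auto
    then show "\<exists>y\<in>carrier M. y \<oplus>\<^bsub>M\<^esub> x = \<zero>\<^bsub>M\<^esub>" using P Pc(4)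
      by (intro bexI[of _ "\<kappa> (\<ominus> a)"]) (simp_all add: l_neg)
  qed (use P Pc in \<open>auto simp: a_ac\<close>)
  then have rM: "right_module ?R M"
    by (rule right_module.intro[OF ring]) (use P Pc(1,2,3,5) in \<open>auto simp: l_distr r_distr m_assoc agr0_mult agr0_add\<close>)
  have inj: "\<kappa> a = \<kappa> b \<longleftrightarrow> a = b" if "a \<in> carrier A" "b \<in> carrier A" for a b
    using \<kappa> that by (auto dest: inj_onD)
  have "simple_rmodule ?R M"
  proof (rule simple_rmoduleI[OF rM, of "\<kappa> e"])
    show "\<kappa> e \<in> carrier M" "\<kappa> e \<noteq> \<zero>\<^bsub>M\<^esub>" using Pc(2) E inj by simp_all
    fix x y assume x: "x \<in> carrier M" "x \<noteq> \<zero>\<^bsub>M\<^esub>" and y: "y \<in> carrier M"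
    obtain a b where ab: "x = \<kappa> a" "y = \<kappa> b" "a \<in> P" "b \<in> P" using x y by auto
    then have "a \<noteq> \<zero>" using x by auto
    then obtain c where c: "c \<in> agr A 0" "a \<otimes> c = e" using e P[OF ab(3)] unfolding prim_idem_def by blast
    have "a \<otimes> (c \<otimes> b) = b" using P[OF ab(3)] P[OF ab(4)] c by (simp flip: m_assoc)
    then have "y = ract M x (c \<otimes> b)" using ab P by simp
    then show "\<exists>a\<in>carrier ?R. y = ract M x a" using agr0_mult[OF c(1) P(1)[OF ab(4)]] by auto
  qed
  then obtain x where x: "x \<in> W" "rmod_iso ?R M (L x)" using L unfolding simple_representatives_def by blast
  then obtain f where f: "f \<in> rmod_hom ?R M (L x)" "bij_betw f (carrier M) (carrier (L x))" by (auto simp: rmod_iso_def)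
  have LM: "right_module ?R (L x)" using L x(1) by (auto simp: simple_representatives_def simple_rmodule_def)
  have fa: "f (\<kappa> (b \<otimes> a)) = ract (L x) (f (\<kappa> b)) a" if "b \<in> P" "a \<in> agr A 0" for a b
    using f(1) that P by (auto simp: rmod_hom_def)
  have f0: "f (\<kappa> \<zero>) = \<zero>\<^bsub>(L x)\<^esub>"
    using abelian_group.hom_zero[OF right_module.abelian_group[OF rM], of f "L x"] right_module.abelian_group[OF LM] f(1)
    by (auto simp: rmod_hom_def)
  have "idem_generator A (L x) e (f (\<kappa> e))"
    unfolding idem_generator_def
  proof (intro conjI ballI impI)
    show "f (\<kappa> e) \<in> carrier (L x)" using bij_betwE[OF f(2)] Pc(2) by auto
    show "ract (L x) (f (\<kappa> e)) e = f (\<kappa> e)" using fa[OF Pc(2) E(1)] E(3) by simp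
    fix l assume "l \<in> carrier (L x)"
    then obtain a where a: "a \<in> P" "l = f (\<kappa> a)" using f(2) by (auto simp: bij_betw_def)
    then show "\<exists>a\<in>agr A 0. e \<otimes> a = a \<and> l = ract (L x) (f (\<kappa> e)) a" using fa[OF Pc(2), of a] P by auto
  next
    fix a assume a: "a \<in> agr A 0" "e \<otimes> a = a" "ract (L x) (f (\<kappa> e)) a = \<zero>\<^bsub>(L x)\<^esub>"
    then have aP: "a \<in> P" by (simp add: P_def)
    have "f (\<kappa> a) = f (\<kappa> \<zero>)" using fa[OF Pc(2) a(1)] a f0 by simp
    then have "\<kappa> a = \<kappa> \<zero>"
      by (rule inj_onD[OF bij_betw_imp_inj_on[OF f(2)]]) (simp_all add: aP Pc(1))
    then show "a = \<zero>" using inj P(2)[OF aP] by simp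
  qed
  then show ?thesis using that x(1) by blast
qed

section \<open>Induced modules\<close>

lemma dg_shift_0 [simp]: "dg_shift 0 M = M"
  by (simp add: dg_shift_def koszul_def)

lemma shift_cell_mod: "dg_shift l (cell_mod e 0) = cell_mod e (- l)"
  by (simp add: cell_mod_def)

lemma dg_iso_shift: "dg_iso A M N \<Longrightarrow> dg_iso A (dg_shift n M) (dg_shift n N)"
  unfolding dg_iso_def dg_isos_def using dg_hom_shift by fastforce

context
  fixes L :: "('a, 'l) rmod" and e l0
  assumes LM: "right_module (degree_zero_ring A) L" and e: "prim_idem A e" and l0: "idem_generator A L e l0"
begin

interpretation L: abelian_group L
  by (rule right_module.abelian_group[OF LM])

private abbreviation (input) "F \<equiv> tensor_free A L"
private abbreviation (input) "H \<equiv> tensor_rel A L"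

text \<open>The inverse of the isomorphism from e A^0 to \<open>L\<close> given by a \<mapsto> l0
  a.\<close>

private definition "\<iota> l = (SOME a. a \<in> agr A 0 \<and> e \<otimes> a = a \<and> l = ract L l0 a)"

private lemma E: "e \<in> agr A 0" "e \<in> carrier A" "e \<otimes> e = e" "e \<noteq> \<zero>"
  using prim_idemD[OF e] by auto

private lemma Lact: "l \<in> carrier L \<Longrightarrow> a \<in> agr A 0 \<Longrightarrow> ract L l a \<in> carrier L"
  "l \<in> carrier L \<Longrightarrow> a \<in> agr A 0 \<Longrightarrow> b \<in> agr A 0 \<Longrightarrow> ract L l (a \<otimes> b) = ract L (ract L l a) b"
  "l \<in> carrier L \<Longrightarrow> a \<in> agr A 0 \<Longrightarrow> b \<in> agr A 0 \<Longrightarrow> ract L l (a \<oplus> b) = ract L l a \<oplus>\<^bsub>L\<^esub> ract L l b"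
  using right_module.act_closed[OF LM] right_module.act_assoc[OF LM] right_module.act_add_right[OF LM] by simp_all

private lemma l0c: "l0 \<in> carrier L" "ract L l0 e = l0"
  using l0 by (auto simp: idem_generator_def)

private lemma \<iota>: "l \<in> carrier L \<Longrightarrow> \<iota> l \<in> agr A 0" "l \<in> carrier L \<Longrightarrow> e \<otimes> \<iota> l = \<iota> l" "l \<in> carrier L \<Longrightarrow> l = ract L l0 (\<iota> l)"
proof -
  assume "l \<in> carrier L"
  then have "\<exists>a. a \<in> agr A 0 \<and> e \<otimes> a = a \<and> l = ract L l0 a" using l0 by (auto simp: idem_generator_def)
  from someI_ex[OF this] show "\<iota> l \<in> agr A 0" "e \<otimes> \<iota> l = \<iota> l" "l = ract L l0 (\<iota> l)" by (auto simp: \<iota>_def)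
qed

private lemma \<iota>c: "l \<in> carrier L \<Longrightarrow> \<iota> l \<in> carrier A"
  using \<iota>(1) by simp

private lemma \<iota>_eqI: assumes a: "a \<in> agr A 0" "e \<otimes> a = a" shows "\<iota> (ract L l0 a) = a"
proof -
  let ?l = "ract L l0 a"
  have l: "?l \<in> carrier L" using Lact l0c a by blast
  note i = \<iota>[OF l]
  let ?d = "\<iota> ?l \<oplus> \<ominus> a"
  have d: "?d \<in> agr A 0" "e \<otimes> ?d = ?d" using i a E by (auto simp: agr0_add agr0_inv r_distr r_minus)
  have "ract L l0 (\<ominus> a) = \<ominus>\<^bsub>L\<^esub> ?l"
  proof -
    have z: "ract L l0 \<zero> = \<zero>\<^bsub>L\<^esub>"
    proof -
      have "ract L l0 \<zero> \<oplus>\<^bsub>L\<^esub> ract L l0 \<zero> = ract L l0 \<zero>" using Lact(3)[OF l0c(1), of \<zero> \<zero>] by simp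
      then show ?thesis using L.add.l_cancel_one' Lact(1)[OF l0c(1) agr_zero] by metis
    qed
    have "ract L l0 (\<ominus> a) \<oplus>\<^bsub>L\<^esub> ?l = \<zero>\<^bsub>L\<^esub>" using Lact(3)[OF l0c(1) agr0_inv[OF a(1)] a(1)] a z by (simp add: l_neg)
    then show ?thesis using L.minus_equality[OF _ l Lact(1)[OF l0c(1) agr0_inv[OF a(1)]]] by simp
  qed
  then have "ract L l0 ?d = \<zero>\<^bsub>L\<^esub>" using Lact(3)[OF l0c(1) i(1) agr0_inv[OF a(1)]] i(3) l by (simp add: L.r_neg)
  then have "?d = \<zero>" using l0 d by (auto simp: idem_generator_def)
  then show ?thesis using i a diff_eq_zero[of "\<iota> ?l" a] by (simp add: a_minus_def)
qed

private lemma \<iota>_add: "l \<in> carrier L \<Longrightarrow> l' \<in> carrier L \<Longrightarrow> \<iota> (l \<oplus>\<^bsub>L\<^esub> l') = \<iota> l \<oplus> \<iota> l'"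
proof -
  assume l: "l \<in> carrier L" "l' \<in> carrier L"
  have "l \<oplus>\<^bsub>L\<^esub> l' = ract L l0 (\<iota> l \<oplus> \<iota> l')" using Lact(3)[OF l0c(1) \<iota>(1)[OF l(1)] \<iota>(1)[OF l(2)]] \<iota>(3) l by metis
  moreover have "e \<otimes> (\<iota> l \<oplus> \<iota> l') = \<iota> l \<oplus> \<iota> l'" using \<iota> \<iota>c l E by (simp add: r_distr)
  ultimately show ?thesis using \<iota>_eqI agr0_add \<iota>(1) l by metis
qed

private lemma \<iota>_act: "l \<in> carrier L \<Longrightarrow> r \<in> agr A 0 \<Longrightarrow> \<iota> (ract L l r) = \<iota> l \<otimes> r"
proof -
  assume l: "l \<in> carrier L" "r \<in> agr A 0"
  have "ract L l r = ract L l0 (\<iota> l \<otimes> r)" using Lact(2)[OF l0c(1) \<iota>(1)[OF l(1)] l(2)] \<iota>(3)[OF l(1)] by simp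
  moreover have "e \<otimes> (\<iota> l \<otimes> r) = \<iota> l \<otimes> r" using \<iota> \<iota>c l E by (simp flip: m_assoc)
  ultimately show ?thesis using \<iota>_eqI agr0_mult \<iota>(1) l by metis
qed

private lemma \<iota>_l0: "\<iota> l0 = e"
  using \<iota>_eqI[OF E(1,3)] l0c by simp

text \<open>The map from the free group underlying the tensor product to eA that sends the pair (l,
  a) to \<iota> l times a. It is characterised on generators by the universal property of free
  abelian groups.\<close>

private definition "ev = (SOME h. h \<in> hom F (add_monoid A) \<and> (\<forall>x\<in>carrier L \<times> carrier A. h (frag_of x) = \<iota> (fst x) \<otimes> snd x))"

private lemma ev: "ev \<in> hom F (add_monoid A)" "l \<in> carrier L \<Longrightarrow> a \<in> carrier A \<Longrightarrow> ev (frag_of (l, a)) = \<iota> l \<otimes> a"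
proof -
  have cg: "comm_group (add_monoid A)" using a_comm_group .
  have "(\<lambda>x. \<iota> (fst x) \<otimes> snd x) ` (carrier L \<times> carrier A) \<subseteq> carrier (add_monoid A)" using \<iota>c by auto
  from comm_group.free_Abelian_group_universal[OF cg this]
  have "\<exists>h. h \<in> hom F (add_monoid A) \<and> (\<forall>x\<in>carrier L \<times> carrier A. h (frag_of x) = \<iota> (fst x) \<otimes> snd x)"
    unfolding tensor_free_def by metis
  from someI_ex[OF this] show "ev \<in> hom F (add_monoid A)" "l \<in> carrier L \<Longrightarrow> a \<in> carrier A \<Longrightarrow> ev (frag_of (l, a)) = \<iota> l \<otimes> a"
    unfolding ev_def by auto
qed

private lemma Fc: "t \<in> carrier F \<longleftrightarrow> Poly_Mapping.keys t \<subseteq> carrier L \<times> carrier A"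
  by (simp add: tensor_free_def)

private lemma Fop [simp]: "s \<otimes>\<^bsub>F\<^esub> t = s + t" "\<one>\<^bsub>F\<^esub> = 0"
  by (simp_all add: tensor_free_def)

private lemma Finv: "t \<in> carrier F \<Longrightarrow> inv\<^bsub>F\<^esub> t = - t"
  by (simp add: tensor_free_def)

private lemma Fcl: "0 \<in> carrier F" "s \<in> carrier F \<Longrightarrow> t \<in> carrier F \<Longrightarrow> s + t \<in> carrier F"
  "s \<in> carrier F \<Longrightarrow> - s \<in> carrier F" "s \<in> carrier F \<Longrightarrow> t \<in> carrier F \<Longrightarrow> s - t \<in> carrier F"
  "l \<in> carrier L \<Longrightarrow> a \<in> carrier A \<Longrightarrow> frag_of (l, a) \<in> carrier F"
  using keys_add[of s t] keys_diff[of s t] unfolding Fc by auto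

private lemma Fgrp: "comm_group F"
  unfolding tensor_free_def by (rule abelian_free_Abelian_group)

private lemma ev_closed: "t \<in> carrier F \<Longrightarrow> ev t \<in> carrier A"
  using ev(1) by (auto simp: hom_def)

private lemma ev_add: "s \<in> carrier F \<Longrightarrow> t \<in> carrier F \<Longrightarrow> ev (s + t) = ev s \<oplus> ev t"
  using ev(1) by (auto simp: hom_def)

private lemma ev_zero: "ev 0 = \<zero>"
  using ev_add[OF Fcl(1) Fcl(1)] ev_closed[OF Fcl(1)] by (metis add.l_cancel_one' add_0)

private lemma ev_minus: "t \<in> carrier F \<Longrightarrow> ev (- t) = \<ominus> ev t"
  using ev_add[of "- t" t] Fcl(3)[of t] ev_closed ev_zero by (metis add.left_inverse minus_equality)

private lemma ev_diff: "s \<in> carrier F \<Longrightarrow> t \<in> carrier F \<Longrightarrow> ev (s - t) = ev s \<ominus> ev t"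
  using ev_add[of s "- t"] Fcl(3) ev_minus by (simp add: a_minus_def)

private lemma F_induct [consumes 1, case_names zero one diff]:
  assumes "t \<in> carrier F" "P 0" "\<And>l a. l \<in> carrier L \<Longrightarrow> a \<in> carrier A \<Longrightarrow> P (frag_of (l, a))"
    "\<And>s t. s \<in> carrier F \<Longrightarrow> t \<in> carrier F \<Longrightarrow> P s \<Longrightarrow> P t \<Longrightarrow> P (s - t)"
  shows "P t"
proof -
  have "t \<in> carrier F \<and> P t"
  proof (rule frag_induction[of t "carrier L \<times> carrier A" "\<lambda>t. t \<in> carrier F \<and> P t"])
    show "Poly_Mapping.keys t \<subseteq> carrier L \<times> carrier A" using assms(1) Fc by blast
  qed (use assms Fcl in auto)
  then show ?thesis by blast
qed

private lemma ev_P: "t \<in> carrier F \<Longrightarrow> e \<otimes> ev t = ev t"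
proof (induction rule: F_induct)
  case zero then show ?case using E by (simp add: ev_zero)
next
  case (one l a) then show ?case using ev(2) \<iota> \<iota>c E by (simp flip: m_assoc)
next
  case (diff s t)
  then show ?case using ev_closed E by (simp add: ev_diff a_minus_def r_distr r_minus)
qed

private definition "gens =
  {frag_of (l \<oplus>\<^bsub>L\<^esub> l', a) - frag_of (l, a) - frag_of (l', a) |l l' a.
     l \<in> carrier L \<and> l' \<in> carrier L \<and> a \<in> carrier A} \<union>
  {frag_of (l, a \<oplus> a') - frag_of (l, a) - frag_of (l, a') |l a a'.
     l \<in> carrier L \<and> a \<in> carrier A \<and> a' \<in> carrier A} \<union>
  {frag_of (ract L l r, a) - frag_of (l, r \<otimes> a) |l r a.
     l \<in> carrier L \<and> r \<in> agr A 0 \<and> a \<in> carrier A}"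

private lemma Hgen: "H = generate F gens"
  by (simp add: tensor_rel_def gens_def)

private lemma gensF: "gens \<subseteq> carrier F"
  unfolding gens_def using Fcl(4,5) Lact(1) by auto

private lemma Hsub: "subgroup H F"
  unfolding Hgen by (rule group.generate_is_subgroup[OF comm_group.axioms(2)[OF Fgrp] gensF])

private lemma H: "0 \<in> H" "s \<in> H \<Longrightarrow> t \<in> H \<Longrightarrow> s + t \<in> H" "s \<in> H \<Longrightarrow> - s \<in> H" "s \<in> H \<Longrightarrow> s \<in> carrier F"
proof -
  show F: "s \<in> H \<Longrightarrow> s \<in> carrier F" for s using subgroup.mem_carrier[OF Hsub] .
  show "0 \<in> H" "s \<in> H \<Longrightarrow> t \<in> H \<Longrightarrow> s + t \<in> H" using subgroup.one_closed[OF Hsub] subgroup.m_closed[OF Hsub] by auto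
  show "s \<in> H \<Longrightarrow> - s \<in> H" using subgroup.m_inv_closed[OF Hsub, of s] Finv F by simp
qed

private lemma gens_ev: assumes "g \<in> gens" shows "ev g = \<zero>"
proof -
  have "x \<oplus> y \<ominus> x \<ominus> y = \<zero>" if "x \<in> carrier A" "y \<in> carrier A" for x y using that by algebra
  then show ?thesis using assms unfolding gens_def
    by (auto simp: ev_diff Fcl ev(2) Lact(1) \<iota>_add \<iota>_act \<iota>c l_distr r_distr m_assoc a_minus_def r_neg)
qed

private lemma H_ev: "t \<in> H \<Longrightarrow> ev t = \<zero>"
proof -
  assume "t \<in> H"
  then have "t \<in> generate F gens" by (simp add: Hgen)
  then show ?thesis
  proof (induction rule: generate.induct)
    case one then show ?case by (simp add: ev_zero)
  next
    case (incl h) then show ?case by (rule gens_ev)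
  next
    case (inv h) then show ?case using gens_ev gensF by (auto simp: Finv ev_minus subset_eq)
  next
    case (eng h1 h2)
    then have "h1 \<in> carrier F" "h2 \<in> carrier F" using H(4) Hgen by auto
    then show ?case using eng by (simp add: ev_add)
  qed
qed

private lemma gens_H: "g \<in> gens \<Longrightarrow> g \<in> H"
  unfolding Hgen by (rule generate.incl)

text \<open>Since l = l0 \<iota>(l), a pure tensor of \<open>l\<close> and \<open>a\<close> equals
  that of \<open>l0\<close> and \<iota>(l) a; additivity in the second factor then collects all
  terms into a single one.\<close>

private lemma normal_form: "t \<in> carrier F \<Longrightarrow> t - frag_of (l0, ev t) \<in> H"
proof (induction rule: F_induct)
  case zero
  \<comment> \<open>The additivity relation for 0 + 0 = 0 reduces to minus the generator (l0, 0),
    which is therefore a relation.\<close>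
  have "frag_of (l0, \<zero> \<oplus> \<zero>) - frag_of (l0, \<zero>) - frag_of (l0, \<zero>) \<in> gens" unfolding gens_def using l0c by blast
  then have "- frag_of (l0, \<zero>) \<in> H" using gens_H by fastforce
  then show ?case by (simp add: ev_zero)
next
  case (one l a)
  have "frag_of (ract L l0 (\<iota> l), a) - frag_of (l0, \<iota> l \<otimes> a) \<in> gens" unfolding gens_def using l0c \<iota>(1)[OF one(1)] one(2) by blast
  then show ?case using gens_H \<iota>(3)[OF one(1)] ev(2)[OF one] by simp
next
  case (diff s t)
  let ?a = "ev s \<ominus> ev t" and ?b = "ev t"
  have ab: "?a \<in> carrier A" "?b \<in> carrier A" "?a \<oplus> ?b = ev s"
    using ev_closed[OF diff(1)] ev_closed[OF diff(2)] by (simp_all add: a_minus_def a_assoc l_neg)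
  then have "frag_of (l0, ?a \<oplus> ?b) - frag_of (l0, ?a) - frag_of (l0, ?b) \<in> gens" unfolding gens_def using l0c by blast
  then have g: "frag_of (l0, ev s) - frag_of (l0, ?a) - frag_of (l0, ?b) \<in> H" using gens_H ab(3) by simp
  have "s - t - frag_of (l0, ?a) = (s - frag_of (l0, ev s)) + - (t - frag_of (l0, ev t)) + (frag_of (l0, ev s) - frag_of (l0, ?a) - frag_of (l0, ?b))"
    by simp
  then show ?case using H(2,3) diff(3,4) g by (simp only: ev_diff[OF diff(1,2)])
qed

text \<open>The relations are exactly the kernel of \<open>ev\<close>: the normal form of an element
  in the kernel is the generator (l0, 0), itself a relation. Afterwards the generated subgroup need
  not be opened again.\<close>

private lemma H_iff: "t \<in> carrier F \<Longrightarrow> t \<in> H \<longleftrightarrow> ev t = \<zero>"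
proof
  assume t: "t \<in> carrier F" "ev t = \<zero>"
  have "0 - frag_of (l0, \<zero>) \<in> H" using normal_form[OF Fcl(1)] by (simp add: ev_zero)
  then have "frag_of (l0, \<zero>) \<in> H" using H(3) by fastforce
  then have "(t - frag_of (l0, \<zero>)) + frag_of (l0, \<zero>) \<in> H" using H(2)[OF normal_form[OF t(1)]] unfolding t(2) by blast
  then show "t \<in> H" by simp
qed (rule H_ev)

private definition "cs t = H #>\<^bsub>F\<^esub> t"

private lemma cs_mem: "u \<in> cs t \<longleftrightarrow> (\<exists>h\<in>H. u = h + t)"
  by (auto simp: cs_def r_coset_def)

private lemma cs_mem': "t \<in> carrier F \<Longrightarrow> u \<in> cs t \<longleftrightarrow> u \<in> carrier F \<and> ev u = ev t"
proof -
  assume t: "t \<in> carrier F"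
  have "u \<in> carrier F \<and> ev u = ev t" if "h \<in> H" "u = h + t" for h
    using that H(4) H_ev t Fcl(2) ev_add ev_closed by simp
  moreover have "u - t \<in> H" if "u \<in> carrier F" "ev u = ev t"
    using that t ev_closed Fcl(4) by (simp add: H_iff ev_diff a_minus_def r_neg)
  ultimately show ?thesis unfolding cs_mem by (metis diff_add_cancel)
qed

text \<open>The map induced by \<open>ev\<close> on cosets; any element of the coset gives the same
  value.\<close>

private definition "rep X = ev (SOME u. u \<in> X)"

private lemma rep_cs: "t \<in> carrier F \<Longrightarrow> rep (cs t) = ev t"
proof -
  assume t: "t \<in> carrier F"
  have "t \<in> cs t" using cs_mem' t by simp
  then have "(SOME u. u \<in> cs t) \<in> cs t" by (rule someI)
  then show ?thesis using cs_mem' t by (simp add: rep_def)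
qed

private lemma cs_eq: "s \<in> carrier F \<Longrightarrow> t \<in> carrier F \<Longrightarrow> ev s = ev t \<Longrightarrow> cs s = cs t"
  by (rule Set.set_eqI) (simp add: cs_mem')

text \<open>The record describes action and differential as an operator on a whole coset followed by
  adding the relations. If the operator preserves the kernel of \<open>ev\<close>, the result is the
  coset of the transformed representative.\<close>

private lemma cs_operator:
  assumes t: "t \<in> carrier F" and T: "\<And>s. s \<in> carrier F \<Longrightarrow> T s \<in> carrier F"
    "\<And>s u. s \<in> carrier F \<Longrightarrow> u \<in> carrier F \<Longrightarrow> T (s + u) = T s + T u"
    and z: "\<And>s. s \<in> carrier F \<Longrightarrow> ev s = \<zero> \<Longrightarrow> ev (T s) = \<zero>"
  shows "H <#>\<^bsub>F\<^esub> T ` cs t = cs (T t)"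
proof (intro equalityI subsetI)
  fix u assume "u \<in> H <#>\<^bsub>F\<^esub> T ` cs t"
  then obtain h h' where h: "h \<in> H" "h' \<in> H" "u = h + T (h' + t)" by (auto simp: set_mult_def cs_mem)
  have "T h' \<in> H" using H_iff[OF T(1)[OF H(4)[OF h(2)]]] z[OF H(4)[OF h(2)] H_ev[OF h(2)]] by simp
  moreover have "u = (h + T h') + T t" using h T(2)[OF H(4)[OF h(2)] t] by (simp add: add.assoc)
  ultimately show "u \<in> cs (T t)" unfolding cs_mem using H(2)[OF h(1)] by blast
next
  fix u assume "u \<in> cs (T t)"
  then obtain h where "h \<in> H" "u = h + T t" unfolding cs_mem by blast
  moreover have "t \<in> cs t" using cs_mem'[OF t] t by simp
  ultimately show "u \<in> H <#>\<^bsub>F\<^esub> T ` cs t" by (auto simp: set_mult_def)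
qed

private lemma act_op:
  assumes b: "b \<in> carrier A" and t: "t \<in> carrier F"
  defines "T \<equiv> frag_extend (\<lambda>(l, a). frag_of (l, a \<otimes> b))"
  shows "T t \<in> carrier F \<and> ev (T t) = ev t \<otimes> b"
  using t
proof (induction rule: F_induct)
  case zero then show ?case using b by (simp add: T_def Fcl ev_zero)
next
  case (one l a) then show ?case using b \<iota>c by (simp add: T_def Fcl ev(2) m_assoc)
next
  case (diff s t)
  then show ?case using b ev_closed by (simp add: T_def frag_extend_diff Fcl(4) ev_diff a_minus_def l_distr l_minus)
qed

private lemma diff_op:
  assumes t: "t \<in> carrier F"
  defines "T \<equiv> frag_extend (\<lambda>(l, a). frag_of (l, adiff A a))"
  shows "T t \<in> carrier F \<and> ev (T t) = adiff A (ev t)"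
  using t
proof (induction rule: F_induct)
  case zero then show ?case by (simp add: T_def Fcl ev_zero)
next
  case (one l a)
  then show ?case using \<iota>c leibniz[OF \<iota>(1)[OF one(1)] one(2)] diff_agr0[OF \<iota>(1)[OF one(1)]]
    by (simp add: T_def Fcl ev(2) koszul_def)
next
  case (diff s t)
  then show ?case using ev_closed regular.diff_inv[of "ev t"]
    by (simp add: T_def frag_extend_diff Fcl(4) ev_diff a_minus_def diff_add)
qed

text \<open>Inducing e A^0 up to A gives eA: \<open>ev\<close> is surjective onto eA with the
  relations as its kernel, and its inverse sends \<open>b\<close> to the tensor of \<open>l0\<close>
  and \<open>b\<close>.\<close>

lemma induced_iso: "dg_iso A (induced_dgmod A L) (cell_mod e 0)"
proof -
  let ?I = "induced_dgmod A L" and ?K = "cell_mod e 0"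
  note P = peirce_closed[OF E(1,3)]
  have car: "carrier ?I = cs ` carrier F"
    by (auto simp: induced_dgmod_def mk_dgmod_def Let_def RCOSETS_def cs_def)
  have I: "\<zero>\<^bsub>(?I)\<^esub> = H" "X \<oplus>\<^bsub>(?I)\<^esub> Y = X <#>\<^bsub>F\<^esub> Y"
    "ract ?I X b = H <#>\<^bsub>F\<^esub> frag_extend (\<lambda>(l, a). frag_of (l, a \<otimes> b)) ` X"
    "diff ?I X = H <#>\<^bsub>F\<^esub> frag_extend (\<lambda>(l, a). frag_of (l, adiff A a)) ` X"
    "gr ?I n = {cs t |t. t \<in> carrier (free_Abelian_group (carrier L \<times> agr A n))}" for X Y b n
    by (simp_all add: induced_dgmod_def mk_dgmod_def Let_def cs_def)
  have H0: "H = cs 0" using cs_mem by auto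
  have cs_add: "cs s <#>\<^bsub>F\<^esub> cs t = cs (s + t)" if "s \<in> carrier F" "t \<in> carrier F" for s t
  proof (intro equalityI subsetI)
    fix u assume "u \<in> cs s <#>\<^bsub>F\<^esub> cs t"
    then obtain h h' where h: "h \<in> H" "h' \<in> H" "u = (h + s) + (h' + t)" by (auto simp: set_mult_def cs_mem)
    then have "u = (h + h') + (s + t)" by (simp add: ac_simps)
    then show "u \<in> cs (s + t)" unfolding cs_mem using H(2)[OF h(1,2)] by blast
  next
    fix u assume "u \<in> cs (s + t)"
    then obtain h where h: "h \<in> H" "u = h + (s + t)" unfolding cs_mem by blast
    have "h + s \<in> cs s" unfolding cs_mem using h(1) by blast
    moreover have "t \<in> cs t" "u = (h + s) + t" using cs_mem'[OF that(2)] that(2) h(2) by (simp_all add: add.assoc)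
    ultimately have "h + s \<in> cs s" "t \<in> cs t" "u = (h + s) + t" .
    then show "u \<in> cs s <#>\<^bsub>F\<^esub> cs t" by (auto simp: set_mult_def)
  qed
  have act: "ract ?I (cs t) b = cs (frag_extend (\<lambda>(l, a). frag_of (l, a \<otimes> b)) t)" if "t \<in> carrier F" "b \<in> carrier A" for t b
    unfolding I by (rule cs_operator[OF that(1)]) (use act_op[OF that(2)] that(2) in \<open>auto simp: frag_extend_add\<close>)
  have dif: "diff ?I (cs t) = cs (frag_extend (\<lambda>(l, a). frag_of (l, adiff A a)) t)" if "t \<in> carrier F" for t
    unfolding I by (rule cs_operator[OF that(1)]) (use diff_op in \<open>auto simp: frag_extend_add\<close>)
  have evP: "ev t \<in> peirce A e" if "t \<in> carrier F" for t using ev_P[OF that] ev_closed[OF that] by (simp add: peirce_def)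
  have frag: "frag_of (l0, b) \<in> carrier F" "ev (frag_of (l0, b)) = b" if "b \<in> peirce A e" for b
    using P(3,4)[OF that] Fcl(5) l0c(1) ev(2) \<iota>_l0 by simp_all
  have "rep \<in> dg_isos A ?I ?K"
  proof (rule transport_dg_module[OF cell_mod_dg_module[OF E(1,3)]])
    show "bij_betw rep (carrier ?I) (carrier ?K)"
      unfolding car
    proof (rule bij_betw_imageI)
      show "inj_on rep (cs ` carrier F)"
      proof (rule inj_onI)
        fix X Y assume XY: "X \<in> cs ` carrier F" "Y \<in> cs ` carrier F" "rep X = rep Y"
        then obtain s t where st: "s \<in> carrier F" "t \<in> carrier F" "X = cs s" "Y = cs t" by blast
        then have "ev s = ev t" using XY(3) by (simp add: rep_cs)
        then show "X = Y" using cs_eq[OF st(1,2)] st(3,4) by simp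
      qed
      show "rep ` cs ` carrier F = carrier ?K"
      proof (intro equalityI subsetI)
        fix b assume "b \<in> rep ` cs ` carrier F"
        then obtain t where "t \<in> carrier F" "b = rep (cs t)" by blast
        then show "b \<in> carrier ?K" using evP[of t] by (simp add: rep_cs)
      next
        fix b assume "b \<in> carrier ?K"
        then have b: "b \<in> peirce A e" by simp
        then have "b = rep (cs (frag_of (l0, b)))" using frag by (simp add: rep_cs)
        then show "b \<in> rep ` cs ` carrier F" using frag(1)[OF b] by blast
      qed
    qed
    show "\<zero>\<^bsub>(?I)\<^esub> \<in> carrier ?I" "rep \<zero>\<^bsub>(?I)\<^esub> = \<zero>\<^bsub>(?K)\<^esub>" using Fcl(1) unfolding I car H0 by (auto simp: rep_cs ev_zero)
    fix X assume "X \<in> carrier ?I"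
    then obtain s where s: "s \<in> carrier F" "X = cs s" by (auto simp: car)
    show "X \<oplus>\<^bsub>(?I)\<^esub> Y \<in> carrier ?I" "rep (X \<oplus>\<^bsub>(?I)\<^esub> Y) = rep X \<oplus>\<^bsub>(?K)\<^esub> rep Y" if Y: "Y \<in> carrier ?I" for Y
    proof -
      obtain t where t: "t \<in> carrier F" "Y = cs t" using Y by (auto simp: car)
      show "X \<oplus>\<^bsub>(?I)\<^esub> Y \<in> carrier ?I" "rep (X \<oplus>\<^bsub>(?I)\<^esub> Y) = rep X \<oplus>\<^bsub>(?K)\<^esub> rep Y"
        unfolding I(2) car using s t by (simp_all add: cs_add rep_cs ev_add Fcl(2))
    qed
    show "ract ?I X a \<in> carrier ?I" "rep (ract ?I X a) = ract ?K (rep X) a" if a: "a \<in> carrier A" for a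
      using act[OF s(1) a] act_op[OF a s(1)] s by (simp_all add: car rep_cs)
    show "diff ?I X \<in> carrier ?I" "rep (diff ?I X) = diff ?K (rep X)"
      using dif[OF s(1)] diff_op[OF s(1)] s evP[OF s(1)] by (simp_all add: car rep_cs cell_mod_diff[OF E(1,3)] koszul_def)
  next
    fix i X
    show "X \<in> gr ?I i \<longleftrightarrow> X \<in> carrier ?I \<and> rep X \<in> gr ?K i"
    proof
      assume "X \<in> gr ?I i"
      then obtain t where t: "X = cs t" "Poly_Mapping.keys t \<subseteq> carrier L \<times> agr A i" by (auto simp: I(5))
      have "t \<in> carrier F \<and> ev t \<in> agr A i"
      proof (rule frag_induction[OF t(2), of "\<lambda>t. t \<in> carrier F \<and> ev t \<in> agr A i"])
        show "0 \<in> carrier F \<and> ev 0 \<in> agr A i" by (simp add: Fcl ev_zero)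
        show "frag_of x \<in> carrier F \<and> ev (frag_of x) \<in> agr A i" if x: "x \<in> carrier L \<times> agr A i" for x
        proof -
          obtain l a where x: "x = (l, a)" "l \<in> carrier L" "a \<in> agr A i" using x by auto
          then show ?thesis using mult_gr[OF \<iota>(1)[OF x(2)] x(3)] agr_closed[OF x(3)] by (simp add: Fcl ev(2))
        qed
        show "s - t \<in> carrier F \<and> ev (s - t) \<in> agr A i"
          if "s \<in> carrier F \<and> ev s \<in> agr A i" "t \<in> carrier F \<and> ev t \<in> agr A i" for s t
          using that pj_F_add[OF apr] pj_F_inv[OF apr] by (simp add: Fcl(4) ev_diff a_minus_def)
      qed
      then show "X \<in> carrier ?I \<and> rep X \<in> gr ?K i" using t(1) evP by (simp add: car rep_cs)
    next
      assume X: "X \<in> carrier ?I \<and> rep X \<in> gr ?K i"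
      then obtain t where t: "t \<in> carrier F" "X = cs t" by (auto simp: car)
      then have "ev t \<in> agr A i" "ev t \<in> peirce A e" using X by (auto simp: rep_cs)
      \<comment> \<open>A coset is homogeneous as soon as its value is: the representative (l0, ev
        t) has its second entry in degree i.\<close>
      then have "X = cs (frag_of (l0, ev t))" "frag_of (l0, ev t) \<in> carrier (free_Abelian_group (carrier L \<times> agr A i))"
        using cs_eq[OF t(1) frag(1)] frag(2) t(2) l0c(1) by auto
      then show "X \<in> gr ?I i" unfolding I(5) by blast
    qed
  qed
  then show ?thesis unfolding dg_iso_def by blast
qed

end

end

section \<open>Filtrations and chains of cells\<close>

context pos_dga begin

context
  fixes R :: "('a, 'm) dgmod" and N
  assumes R: "dg_module A R" and N: "dg_submodule A R N"
begin

interpretation R: dg_module A R by (rule R)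

private lemmas S = dg_submoduleD[OF R N]

private lemma coset_mem: "u \<in> N +>\<^bsub>R\<^esub> x \<longleftrightarrow> (\<exists>n\<in>N. u = n \<oplus>\<^bsub>R\<^esub> x)"
  by (auto simp: a_r_coset_def')

private lemma coset_eq: "x \<in> carrier R \<Longrightarrow> y \<in> carrier R \<Longrightarrow> N +>\<^bsub>R\<^esub> x = N +>\<^bsub>R\<^esub> y \<longleftrightarrow> x \<ominus>\<^bsub>R\<^esub> y \<in> N"
proof
  assume xy: "x \<in> carrier R" "y \<in> carrier R" and eq: "N +>\<^bsub>R\<^esub> x = N +>\<^bsub>R\<^esub> y"
  have "x \<in> N +>\<^bsub>R\<^esub> x" unfolding coset_mem using S(2) xy by (intro bexI[of _ "\<zero>\<^bsub>R\<^esub>"]) simp_all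
  then obtain n where n: "n \<in> N" "x = n \<oplus>\<^bsub>R\<^esub> y" unfolding eq coset_mem by blast
  then have "x \<ominus>\<^bsub>R\<^esub> y = n" using S(3)[OF n(1)] xy by (simp add: R.minus_eq R.a_assoc R.r_neg)
  then show "x \<ominus>\<^bsub>R\<^esub> y \<in> N" using n by simp
next
  assume xy: "x \<in> carrier R" "y \<in> carrier R" and d: "x \<ominus>\<^bsub>R\<^esub> y \<in> N"
  have half: "N +>\<^bsub>R\<^esub> x \<subseteq> N +>\<^bsub>R\<^esub> y" if xy: "x \<in> carrier R" "y \<in> carrier R" and d: "x \<ominus>\<^bsub>R\<^esub> y \<in> N" for x y
  proof
    fix u assume "u \<in> N +>\<^bsub>R\<^esub> x"
    then obtain n where n: "n \<in> N" "u = n \<oplus>\<^bsub>R\<^esub> x" unfolding coset_mem by blast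
    have "n \<oplus>\<^bsub>R\<^esub> x = (n \<oplus>\<^bsub>R\<^esub> (x \<ominus>\<^bsub>R\<^esub> y)) \<oplus>\<^bsub>R\<^esub> y" using S(3)[OF n(1)] xy by algebra
    then show "u \<in> N +>\<^bsub>R\<^esub> y" unfolding coset_mem using S(4)[OF n(1) d] n(2) by blast
  qed
  have "y \<ominus>\<^bsub>R\<^esub> x = \<ominus>\<^bsub>R\<^esub> (x \<ominus>\<^bsub>R\<^esub> y)" using xy by algebra
  then have "y \<ominus>\<^bsub>R\<^esub> x \<in> N" using S(5)[OF d] by simp
  then show "N +>\<^bsub>R\<^esub> x = N +>\<^bsub>R\<^esub> y" using half xy d by blast
qed

private lemma coset_add:
  assumes xy: "x \<in> carrier R" "y \<in> carrier R"
  shows "(N +>\<^bsub>R\<^esub> x) <+>\<^bsub>R\<^esub> (N +>\<^bsub>R\<^esub> y) = N +>\<^bsub>R\<^esub> (x \<oplus>\<^bsub>R\<^esub> y)"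
proof (intro equalityI subsetI)
  fix u assume "u \<in> (N +>\<^bsub>R\<^esub> x) <+>\<^bsub>R\<^esub> (N +>\<^bsub>R\<^esub> y)"
  then obtain n m where n: "n \<in> N" "m \<in> N" "u = (n \<oplus>\<^bsub>R\<^esub> x) \<oplus>\<^bsub>R\<^esub> (m \<oplus>\<^bsub>R\<^esub> y)" by (auto simp: set_add_def' coset_mem)
  have "u = (n \<oplus>\<^bsub>R\<^esub> m) \<oplus>\<^bsub>R\<^esub> (x \<oplus>\<^bsub>R\<^esub> y)" unfolding n(3) using S(3)[OF n(1)] S(3)[OF n(2)] xy by algebra
  then show "u \<in> N +>\<^bsub>R\<^esub> (x \<oplus>\<^bsub>R\<^esub> y)" unfolding coset_mem using S(4)[OF n(1,2)] by blast
next
  fix u assume "u \<in> N +>\<^bsub>R\<^esub> (x \<oplus>\<^bsub>R\<^esub> y)"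
  then obtain n where n: "n \<in> N" "u = n \<oplus>\<^bsub>R\<^esub> (x \<oplus>\<^bsub>R\<^esub> y)" unfolding coset_mem by blast
  have "u = (n \<oplus>\<^bsub>R\<^esub> x) \<oplus>\<^bsub>R\<^esub> (\<zero>\<^bsub>R\<^esub> \<oplus>\<^bsub>R\<^esub> y)" unfolding n(2) using S(3)[OF n(1)] xy by algebra
  moreover have "n \<oplus>\<^bsub>R\<^esub> x \<in> N +>\<^bsub>R\<^esub> x" "\<zero>\<^bsub>R\<^esub> \<oplus>\<^bsub>R\<^esub> y \<in> N +>\<^bsub>R\<^esub> y" unfolding coset_mem using n(1) S(2) by blast+
  ultimately show "u \<in> (N +>\<^bsub>R\<^esub> x) <+>\<^bsub>R\<^esub> (N +>\<^bsub>R\<^esub> y)" by (auto simp: set_add_def')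
qed

text \<open>The quotient record applies an operator to a full coset and adds \<open>N\<close> again;
  for an additive operator that preserves \<open>N\<close> this is the coset of the image.\<close>

private lemma coset_operator:
  assumes x: "x \<in> carrier R" and T: "\<And>u v. u \<in> carrier R \<Longrightarrow> v \<in> carrier R \<Longrightarrow> T (u \<oplus>\<^bsub>R\<^esub> v) = T u \<oplus>\<^bsub>R\<^esub> T v"
    "\<And>u. u \<in> carrier R \<Longrightarrow> T u \<in> carrier R" "\<And>u. u \<in> N \<Longrightarrow> T u \<in> N"
  shows "N <+>\<^bsub>R\<^esub> T ` (N +>\<^bsub>R\<^esub> x) = N +>\<^bsub>R\<^esub> T x"
proof (intro equalityI subsetI)
  fix u assume "u \<in> N <+>\<^bsub>R\<^esub> T ` (N +>\<^bsub>R\<^esub> x)"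
  then obtain n m where n: "n \<in> N" "m \<in> N" "u = n \<oplus>\<^bsub>R\<^esub> T (m \<oplus>\<^bsub>R\<^esub> x)" by (auto simp: set_add_def' coset_mem)
  have "u = (n \<oplus>\<^bsub>R\<^esub> T m) \<oplus>\<^bsub>R\<^esub> T x" unfolding n(3) using S(3)[OF n(1)] S(3)[OF n(2)] x T(1,2) by (simp add: R.a_assoc)
  then show "u \<in> N +>\<^bsub>R\<^esub> T x" unfolding coset_mem using S(4)[OF n(1) T(3)[OF n(2)]] by blast
next
  fix u assume "u \<in> N +>\<^bsub>R\<^esub> T x"
  then obtain n where "n \<in> N" "u = n \<oplus>\<^bsub>R\<^esub> T x" unfolding coset_mem by blast
  moreover have "x \<in> N +>\<^bsub>R\<^esub> x" unfolding coset_mem using S(2) x by (intro bexI[of _ "\<zero>\<^bsub>R\<^esub>"]) simp_all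
  ultimately show "u \<in> N <+>\<^bsub>R\<^esub> T ` (N +>\<^bsub>R\<^esub> x)" by (auto simp: set_add_def')
qed

private lemma quotient_sel:
  "carrier (dg_quotient R N) = (\<lambda>x. N +>\<^bsub>R\<^esub> x) ` carrier R" "\<zero>\<^bsub>(dg_quotient R N)\<^esub> = N"
  "X \<oplus>\<^bsub>(dg_quotient R N)\<^esub> Y = X <+>\<^bsub>R\<^esub> Y"
  "gr (dg_quotient R N) i = (\<lambda>x. N +>\<^bsub>R\<^esub> x) ` gr R i"
  by (auto simp: dg_quotient_def mk_dgmod_def A_RCOSETS_def')

private lemma quotient_act:
  "x \<in> carrier R \<Longrightarrow> a \<in> carrier A \<Longrightarrow> ract (dg_quotient R N) (N +>\<^bsub>R\<^esub> x) a = N +>\<^bsub>R\<^esub> ract R x a"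
  using coset_operator[of x "\<lambda>x. ract R x a"] by (simp add: dg_quotient_def mk_dgmod_def R.act_add_left S(7))

private lemma quotient_diff:
  "x \<in> carrier R \<Longrightarrow> diff (dg_quotient R N) (N +>\<^bsub>R\<^esub> x) = N +>\<^bsub>R\<^esub> diff R x"
  using coset_operator[of x "diff R"] by (simp add: dg_quotient_def mk_dgmod_def R.diff_add S(8))

private lemma coset_zero: "N +>\<^bsub>R\<^esub> \<zero>\<^bsub>R\<^esub> = N"
  using S(3) by (auto simp: coset_mem)

text \<open>\<open>coef\<close> vanishes on \<open>N\<close>, so it descends to the quotient, where
  freeness makes it an isomorphism onto the shifted eA.\<close>

lemma cell_quotient:
  assumes c: "cell A R N s e n (carrier R)"
  shows "dg_iso A (dg_quotient R N) (cell_mod e n)"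
proof -
  interpret C: dg_cell k A R N s e n "carrier R" using dg_cellI[OF c R] .
  let ?Q = "dg_quotient R N" and ?K = "cell_mod e n"
  define rep where "rep X = C.coef (SOME x. x \<in> X)" for X
  have rep: "rep (N +>\<^bsub>R\<^esub> x) = C.coef x" if x: "x \<in> carrier R" for x
  proof -
    have "x \<in> N +>\<^bsub>R\<^esub> x" unfolding coset_mem using S(2) x by (intro bexI[of _ "\<zero>\<^bsub>R\<^esub>"]) simp_all
    then have "(SOME u. u \<in> N +>\<^bsub>R\<^esub> x) \<in> N +>\<^bsub>R\<^esub> x" by (rule someI)
    then obtain m where m: "m \<in> N" "(SOME u. u \<in> N +>\<^bsub>R\<^esub> x) = m \<oplus>\<^bsub>R\<^esub> x" unfolding coset_mem by blast
    then have "rep (N +>\<^bsub>R\<^esub> x) = C.coef m \<oplus> C.coef x" using S(3)[OF m(1)] x by (simp add: rep_def C.coef_add)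
    then show ?thesis using C.coef_N[OF m(1)] C.coef_closed[OF x] by simp
  qed
  have "rep \<in> dg_isos A ?Q ?K"
  proof (rule transport_dg_module[OF cell_mod_dg_module[OF C.E(1,3)]])
    show "bij_betw rep (carrier ?Q) (carrier ?K)"
    proof (rule bij_betw_imageI)
      show "inj_on rep (carrier ?Q)"
      proof (rule inj_onI)
        fix X Y assume XY: "X \<in> carrier ?Q" "Y \<in> carrier ?Q" "rep X = rep Y"
        then obtain x y where x: "x \<in> carrier R" "X = N +>\<^bsub>R\<^esub> x" and y: "y \<in> carrier R" "Y = N +>\<^bsub>R\<^esub> y"
          by (auto simp: quotient_sel)
        then have eq: "C.coef x = C.coef y" using XY(3) by (simp add: rep)
        then have "C.coef (x \<ominus>\<^bsub>R\<^esub> y) = \<zero>" using x y C.coef_closed[OF y(1)] by (simp add: a_minus_def C.coef_add C.coef_inv r_neg)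
        then have "x \<ominus>\<^bsub>R\<^esub> y \<in> N" using C.mem_N_iff[of "x \<ominus>\<^bsub>R\<^esub> y"] x y by simp
        then show "X = Y" using coset_eq[OF x(1) y(1)] x y by simp
      qed
      show "rep ` carrier ?Q = carrier ?K"
      proof (intro equalityI subsetI)
        fix b assume "b \<in> rep ` carrier ?Q"
        then show "b \<in> carrier ?K" using C.coef_base(1) by (auto simp: quotient_sel rep)
      next
        fix b assume "b \<in> carrier ?K"
        then have b: "b \<in> peirce A e" by simp
        have sb: "ract R s b \<in> carrier R" using C.P(3)[OF b] by simp
        have "rep (N +>\<^bsub>R\<^esub> ract R s b) = b" using rep[OF sb] C.coef_eqI(1)[OF C.S(2) b] sb by simp
        then show "b \<in> rep ` carrier ?Q" using sb unfolding quotient_sel by (metis imageI)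
      qed
    qed
    show "\<zero>\<^bsub>(?Q)\<^esub> \<in> carrier ?Q" "rep \<zero>\<^bsub>(?Q)\<^esub> = \<zero>\<^bsub>(?K)\<^esub>"
      using rep[OF R.zero_closed] C.coef_N(1)[OF S(2)] R.zero_closed unfolding quotient_sel coset_zero
      by (auto intro!: image_eqI[of _ _ "\<zero>\<^bsub>R\<^esub>"] simp: coset_zero)
    fix X assume "X \<in> carrier ?Q"
    then obtain x where x: "x \<in> carrier R" "X = N +>\<^bsub>R\<^esub> x" by (auto simp: quotient_sel)
    show "X \<oplus>\<^bsub>(?Q)\<^esub> Y \<in> carrier ?Q" "rep (X \<oplus>\<^bsub>(?Q)\<^esub> Y) = rep X \<oplus>\<^bsub>(?K)\<^esub> rep Y" if Y: "Y \<in> carrier ?Q" for Y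
    proof -
      obtain y where y: "y \<in> carrier R" "Y = N +>\<^bsub>R\<^esub> y" using Y by (auto simp: quotient_sel)
      show "X \<oplus>\<^bsub>(?Q)\<^esub> Y \<in> carrier ?Q" "rep (X \<oplus>\<^bsub>(?Q)\<^esub> Y) = rep X \<oplus>\<^bsub>(?K)\<^esub> rep Y"
        using x y by (simp_all add: quotient_sel coset_add rep C.coef_add)
    qed
    show "ract ?Q X a \<in> carrier ?Q" "rep (ract ?Q X a) = ract ?K (rep X) a" if a: "a \<in> carrier A" for a
      using x a by (simp_all add: quotient_act quotient_sel(1) rep C.coef_act)
    show "diff ?Q X \<in> carrier ?Q" "rep (diff ?Q X) = diff ?K (rep X)"
      using x C.coef_base(1)[OF x(1)]
      by (simp_all add: quotient_diff quotient_sel(1) rep C.coef_diff cell_mod_diff[OF C.E(1,3)])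
  next
    fix i X
    show "X \<in> gr ?Q i \<longleftrightarrow> X \<in> carrier ?Q \<and> rep X \<in> gr ?K i"
    proof
      assume "X \<in> gr ?Q i"
      then obtain x where x: "x \<in> gr R i" "X = N +>\<^bsub>R\<^esub> x" by (auto simp: quotient_sel)
      have xc: "x \<in> carrier R" using R.gr_closed[OF x(1)] .
      show "X \<in> carrier ?Q \<and> rep X \<in> gr ?K i"
        using x xc C.coef_gr(1)[OF xc x(1)] C.coef_base(1)[OF xc] by (auto simp: quotient_sel rep)
    next
      assume X: "X \<in> carrier ?Q \<and> rep X \<in> gr ?K i"
      then obtain x where x: "x \<in> carrier R" "X = N +>\<^bsub>R\<^esub> x" by (auto simp: quotient_sel)
      note cb = C.coef_base[OF x(1)]
      have g: "C.coef x \<in> agr A (i - n)" using X x by (simp add: rep)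
      have sb: "ract R s (C.coef x) \<in> gr R i" using R.act_gr[OF C.s(1) g] by simp
      have "x \<ominus>\<^bsub>R\<^esub> ract R s (C.coef x) = C.base x" by (simp add: C.base_def)
      then have "X = N +>\<^bsub>R\<^esub> ract R s (C.coef x)" using coset_eq[OF x(1) R.gr_closed[OF sb]] cb(2) x(2) by simp
      then show "X \<in> gr ?Q i" using sb by (auto simp: quotient_sel)
    qed
  qed
  then show ?thesis unfolding dg_iso_def by blast
qed

text \<open>The quotient is generated by the class of \<open>e\<close>; a homogeneous lift of this
  class is the generator of the cell.\<close>

lemma quotient_cell:
  assumes e: "prim_idem A e" and iso: "dg_iso A (dg_quotient R N) (cell_mod e n)"
  shows "\<exists>s. cell A R N s e n (carrier R)"
proof -
  note E = prim_idemD[OF e] and P = peirce_closed[OF prim_idemD(1,3)[OF e]]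
  let ?Q = "dg_quotient R N" and ?K = "cell_mod e n"
  obtain \<psi> where \<psi>: "\<psi> \<in> dg_isos A ?K ?Q" using dg_iso_sym[OF iso] by (auto simp: dg_iso_def)
  note h = dg_isosD(1)[OF \<psi>] and bij = dg_isosD(2)[OF \<psi>]
  have "e \<in> gr ?K n" using E P by simp
  then have "\<psi> e \<in> gr ?Q n" by (rule dg_homD(6)[OF h])
  then obtain x where x: "x \<in> gr R n" "\<psi> e = N +>\<^bsub>R\<^esub> x" by (auto simp: quotient_sel)
  have xc: "x \<in> carrier R" using R.gr_closed[OF x(1)] .
  \<comment> \<open>Multiplication by \<open>e\<close> forces \<open>s e = s\<close> and does not
    change the class, which already satisfies this equation.\<close>
  define s where "s = ract R x e"
  have s: "s \<in> gr R n" "s \<in> carrier R" "ract R s e = s"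
    using R.act_gr[OF x(1) E(1)] xc E by (simp_all add: s_def R.act_assoc)
  have \<psi>b: "\<psi> b = N +>\<^bsub>R\<^esub> ract R s b" if b: "b \<in> peirce A e" for b
  proof -
    have "\<psi> b = \<psi> (ract ?K e b)" using P(4)[OF b] by simp
    also have "\<dots> = ract ?Q (\<psi> e) b" using dg_homD(5)[OF h, of e b] P(2,3) b by simp
    also have "\<dots> = N +>\<^bsub>R\<^esub> ract R x b" using quotient_act[OF xc P(3)[OF b]] x by simp
    also have "ract R x b = ract R s b" using P(3,4)[OF b] xc E by (simp add: s_def R.act_assoc)
    finally show ?thesis .
  qed
  have \<psi>0: "\<psi> \<zero> = N" using dg_hom_zero[OF h] by (simp add: quotient_sel)
  have mem: "y \<in> N \<longleftrightarrow> N +>\<^bsub>R\<^esub> y = N" if "y \<in> carrier R" for y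
    using coset_eq[OF that R.zero_closed] that unfolding coset_zero by (simp add: R.minus_eq)
  have "cell A R N s e n (carrier R)"
    unfolding cell_def
  proof (intro conjI ballI impI)
    have "\<psi> (diff ?K e) = diff ?Q (\<psi> e)" using dg_homD(7)[OF h, of e] P(2) by simp
    moreover have "diff ?K e = \<zero>" using cell_mod_diff[OF E(1,3) P(2)] diff_agr0[OF E(1)] by simp
    moreover have "\<psi> e = N +>\<^bsub>R\<^esub> s" using \<psi>b[OF P(2)] s(3) by simp
    ultimately have "N +>\<^bsub>R\<^esub> diff R s = N" using \<psi>0 quotient_diff[OF s(2)] by simp
    then show "diff R s \<in> N" using mem s(2) by simp
    fix y assume y: "y \<in> carrier R"
    then have "N +>\<^bsub>R\<^esub> y \<in> carrier ?Q" by (simp add: quotient_sel)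
    then obtain b where b: "b \<in> peirce A e" "N +>\<^bsub>R\<^esub> y = \<psi> b" using bij by (auto simp: bij_betw_def)
    have sb: "ract R s b \<in> carrier R" using P(3)[OF b(1)] s by simp
    have d: "y \<ominus>\<^bsub>R\<^esub> ract R s b \<in> N" using coset_eq[OF y sb] b(2) \<psi>b[OF b(1)] by simp
    have "y = (y \<ominus>\<^bsub>R\<^esub> ract R s b) \<oplus>\<^bsub>R\<^esub> ract R s b" using y sb by algebra
    then show "\<exists>x\<in>N. \<exists>b\<in>peirce A e. y = x \<oplus>\<^bsub>R\<^esub> ract R s b" using d b(1) by blast
  next
    fix b assume b: "b \<in> peirce A e" "ract R s b \<in> N"
    have "ract R s b \<in> carrier R" using P(3)[OF b(1)] s by simp
    then have "\<psi> b = \<psi> \<zero>" using mem[of "ract R s b"] b \<psi>b[OF b(1)] \<psi>0 by simp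
    then show "b = \<zero>" using inj_onD[OF bij_betw_imp_inj_on[OF bij], of b \<zero>] b(1) P(1) by simp
  qed (use N dg_submodule_carrier[OF R] S(1) e s in auto)
  then show ?thesis by blast
qed

end

text \<open>The dictionary between the subquotients in the definition of dgFilt and attached
  cells.\<close>

lemma cell_quotient_iff:
  assumes M: "dg_module A M" and N: "dg_submodule A M N" "dg_submodule A M N'" "N \<subseteq> N'" and e: "prim_idem A e"
  shows "dg_iso A (dg_quotient (dg_restrict M N') N) (cell_mod e n) \<longleftrightarrow> (\<exists>s. cell A M N s e n N')"
proof -
  note S = dg_submoduleD[OF M N(2)]
  have N0: "dg_submodule A (dg_restrict M N') N" using dg_submodule_restrict[OF N(3) S(1)] N(1) by simp
  have "cell A (dg_restrict M N') N s e n (carrier (dg_restrict M N')) \<longleftrightarrow> cell A M N s e n N'" for s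
    using cell_restrict[OF N(2) order_refl] by simp
  then show ?thesis using cell_quotient[OF S(10) N0] quotient_cell[OF S(10) N0 e] by blast
qed

end

section \<open>Equivalences from full subcategories\<close>

lemma full_subcat_sel [simp]:
  "Ob (full_subcat C S) = S" "Hom (full_subcat C S) = Hom C" "Id (full_subcat C S) = Id C"
  "Comp (full_subcat C S) = Comp C"
  by (simp_all add: full_subcat_def)

lemma full_subcat_category:
  assumes C: "category C" and S: "S \<subseteq> Ob C" shows "category (full_subcat C S)"
proof -
  interpret C: category C by fact
  have o: "X \<in> Ob C" if "X \<in> S" for X using S that by blast
  show ?thesis
  proof (rule category.intro, unfold full_subcat_sel)
    fix X Y Z V f g h
    show "X \<in> S \<Longrightarrow> Id C X \<in> Hom C X X" by (rule C.Id_in[OF o])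
    assume X: "X \<in> S" and Y: "Y \<in> S"
    show "f \<in> Hom C X Y \<Longrightarrow> Comp C (Id C Y) f = f" "f \<in> Hom C X Y \<Longrightarrow> Comp C f (Id C X) = f"
      using C.Comp_Id_left[OF o[OF X] o[OF Y]] C.Comp_Id_right[OF o[OF X] o[OF Y]] by auto
    assume Z: "Z \<in> S"
    show "f \<in> Hom C X Y \<Longrightarrow> g \<in> Hom C Y Z \<Longrightarrow> Comp C g f \<in> Hom C X Z"
      by (rule C.Comp_in[OF o[OF X] o[OF Y] o[OF Z]])
    assume V: "V \<in> S"
    show "f \<in> Hom C X Y \<Longrightarrow> g \<in> Hom C Y Z \<Longrightarrow> h \<in> Hom C Z V \<Longrightarrow> Comp C h (Comp C g f) = Comp C (Comp C h g) f"
      by (rule C.Comp_assoc[OF o[OF X] o[OF Y] o[OF Z] o[OF V]])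
  qed
qed

lemma iso_in_full_subcat [simp]: "iso_in (full_subcat C S) = iso_in C"
  by (simp add: iso_in_def fun_eq_iff)

text \<open>The functions \<open>src\<close> and \<open>tgt\<close> are needed because a quasi-inverse acts on bare morphisms.\<close>

lemma full_subcat_equivalence:
  assumes C: "category C" and ST: "S \<subseteq> T" "T \<subseteq> Ob C"
    and ess: "\<And>Y. Y \<in> T \<Longrightarrow> \<exists>X\<in>S. isomorphic_in C X Y"
    and ends: "\<And>X Y f. X \<in> T \<Longrightarrow> Y \<in> T \<Longrightarrow> f \<in> Hom C X Y \<Longrightarrow> src f = X \<and> tgt f = Y"
  shows "equivalence_functor (full_subcat C S) (full_subcat C T) (\<lambda>M. M) (\<lambda>f. f)"
proof -
  interpret C: category C by fact
  let ?S = "full_subcat C S" and ?T = "full_subcat C T"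
  have cS: "category ?S" and cT: "category ?T" using full_subcat_category[OF C] ST by auto
  have "\<exists>X a b. X \<in> S \<and> a \<in> Hom C X Y \<and> b \<in> Hom C Y X \<and> Comp C b a = Id C X \<and> Comp C a b = Id C Y"
    if Y: "Y \<in> T" for Y
    using ess[OF Y] by (auto simp: isomorphic_in_def iso_in_def)
  then obtain G a b where G: "\<And>Y. Y \<in> T \<Longrightarrow> G Y \<in> S \<and> a Y \<in> Hom C (G Y) Y \<and> b Y \<in> Hom C Y (G Y) \<and>
      Comp C (b Y) (a Y) = Id C (G Y) \<and> Comp C (a Y) (b Y) = Id C Y" by metis
  have TO: "X \<in> Ob C" if "X \<in> T" for X using that ST by blast
  have GO: "G X \<in> Ob C" if "X \<in> T" for X using G[OF that] ST by blast
  \<comment> \<open>Conjugation by the chosen isomorphisms at source and target, the only way to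
    make \<open>a\<close> and \<open>b\<close> natural.\<close>
  define Gm where "Gm f = Comp C (b (tgt f)) (Comp C f (a (src f)))" for f
  have Gm: "Gm f = Comp C (b Y) (Comp C f (a X))" "Gm f \<in> Hom C (G X) (G Y)" if "X \<in> T" "Y \<in> T" "f \<in> Hom C X Y" for X Y f
  proof -
    show e: "Gm f = Comp C (b Y) (Comp C f (a X))" using ends[OF that] by (simp add: Gm_def)
    show "Gm f \<in> Hom C (G X) (G Y)" unfolding e
      using C.Comp_in TO GO G that by meson
  qed
  have fa: "Comp C f (a X) \<in> Hom C (G X) Y" if "X \<in> T" "Y \<in> T" "f \<in> Hom C X Y" for X Y f
    using C.Comp_in[OF GO[OF that(1)] TO[OF that(1)] TO[OF that(2)]] G that by blast
  have nat1: "Comp C (b Y) f = Comp C (Gm f) (b X)" if xy: "X \<in> T" "Y \<in> T" "f \<in> Hom C X Y" for X Y f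
  proof -
    note o = TO[OF xy(1)] TO[OF xy(2)] GO[OF xy(1)] GO[OF xy(2)] and gx = G[OF xy(1)] and gy = G[OF xy(2)]
    have "Comp C (Gm f) (b X) = Comp C (b Y) (Comp C (Comp C f (a X)) (b X))"
      unfolding Gm(1)[OF xy] using C.Comp_assoc[OF o(1,3,2,4)] gx gy fa[OF xy] by metis
    also have "Comp C (Comp C f (a X)) (b X) = Comp C f (Comp C (a X) (b X))"
      using C.Comp_assoc[OF o(1,3,1,2)] gx xy(3) by metis
    also have "\<dots> = f" using gx C.Comp_Id_right[OF o(1,2) xy(3)] by simp
    finally show ?thesis by simp
  qed
  have nat2: "Comp C (a Y) (Gm f) = Comp C f (a X)" if xy: "X \<in> T" "Y \<in> T" "f \<in> Hom C X Y" for X Y f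
  proof -
    note o = TO[OF xy(1)] TO[OF xy(2)] GO[OF xy(1)] GO[OF xy(2)] and gx = G[OF xy(1)] and gy = G[OF xy(2)]
    have "Comp C (a Y) (Gm f) = Comp C (Comp C (a Y) (b Y)) (Comp C f (a X))"
      unfolding Gm(1)[OF xy] using C.Comp_assoc[OF o(3,2,4,2)] gx gy fa[OF xy] by metis
    also have "\<dots> = Comp C f (a X)" using gy C.Comp_Id_left[OF o(3,2) fa[OF xy]] by simp
    finally show ?thesis .
  qed
  have isoab: "iso_in C (G X) X (a X)" "iso_in C X (G X) (b X)" if "X \<in> T" for X
    unfolding iso_in_def using G[OF that] by blast+
  have F: "cat_functor ?S ?T (\<lambda>M. M) (\<lambda>f. f)"
    using ST by (intro cat_functor.intro cS cT cat_functor_axioms.intro) (auto simp: subset_eq)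
  have Gf: "cat_functor ?T ?S G Gm"
  proof (intro cat_functor.intro cS cT cat_functor_axioms.intro)
    show "G X \<in> Ob ?S" if "X \<in> Ob ?T" for X using G that by simp
    show "Gm f \<in> Hom ?S (G X) (G Y)" if "X \<in> Ob ?T" "Y \<in> Ob ?T" "f \<in> Hom ?T X Y" for X Y f using Gm(2) that by simp
    show "Gm (Id ?T X) = Id ?S (G X)" if "X \<in> Ob ?T" for X
    proof -
      have X: "X \<in> T" using that by simp
      show ?thesis using Gm(1)[OF X X C.Id_in[OF TO[OF X]]] G[OF X] C.Comp_Id_left[OF GO[OF X] TO[OF X]] by simp
    qed
    fix X Y Z f g assume "X \<in> Ob ?T" "Y \<in> Ob ?T" "Z \<in> Ob ?T" "f \<in> Hom ?T X Y" "g \<in> Hom ?T Y Z"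
    then have h: "X \<in> T" "Y \<in> T" "Z \<in> T" "f \<in> Hom C X Y" "g \<in> Hom C Y Z" by simp_all
    note o = TO[OF h(1)] TO[OF h(2)] TO[OF h(3)] GO[OF h(1)] GO[OF h(2)] GO[OF h(3)]
    note gx = G[OF h(1)] and gy = G[OF h(2)] and gz = G[OF h(3)]
    have gf: "Comp C g f \<in> Hom C X Z" using C.Comp_in[OF o(1-3) h(4,5)] .
    have "Comp C (Gm g) (Gm f) = Comp C (b Z) (Comp C (Comp C g (a Y)) (Gm f))"
      unfolding Gm(1)[OF h(2,3,5)]
      using C.Comp_assoc[OF o(4,5,3,6) Gm(2)[OF h(1,2,4)] fa[OF h(2,3,5)]] gz by simp
    also have "Comp C (Comp C g (a Y)) (Gm f) = Comp C g (Comp C (a Y) (Gm f))"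
      using C.Comp_assoc[OF o(4,5,2,3) Gm(2)[OF h(1,2,4)] _ h(5)] gy by simp
    also have "\<dots> = Comp C (Comp C g f) (a X)"
      unfolding nat2[OF h(1,2,4)] using C.Comp_assoc[OF o(4,1,2,3) _ h(4,5)] gx by simp
    finally have "Comp C (Gm g) (Gm f) = Gm (Comp C g f)" using Gm(1)[OF h(1,3) gf] by simp
    then show "Gm (Comp ?T g f) = Comp ?S (Gm g) (Gm f)" by simp
  qed
  have "nat_iso ?S ?S (\<lambda>X. X) (\<lambda>f. f) (G \<circ> (\<lambda>M. M)) (Gm \<circ> (\<lambda>f. f)) b"
    unfolding nat_iso_def using isoab(2) nat1 subsetD[OF ST(1)] by simp
  moreover have "nat_iso ?T ?T ((\<lambda>M. M) \<circ> G) ((\<lambda>f. f) \<circ> Gm) (\<lambda>X. X) (\<lambda>f. f) a"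
    unfolding nat_iso_def using isoab(1) nat2 by simp
  ultimately show ?thesis unfolding equivalence_functor_def using F Gf by blast
qed

section \<open>The three subcategories\<close>

locale dg_semisimple = dg_universe k A U
  for k :: "('k, 'e) ring_scheme" and A :: "('k, 'a, 'f) dga_scheme" (structure) and U :: "'m itself" +
  fixes W :: "'x set" and L :: "'x \<Rightarrow> ('a, 'm) rmod"
  assumes semisimple: "semisimple_ring (degree_zero_ring A)"
    and representatives: "simple_representatives (degree_zero_ring A) W L"
begin

section \<open>Objects of dgFilt as sorted cellular modules\<close>

lemma induced_cell_mod:
  assumes "x \<in> W"
  obtains e where "prim_idem A e" "dg_iso A (induced_dgmod A (L x)) (cell_mod e 0)"
proof -
  have Lx: "simple_rmodule (degree_zero_ring A) (L x)" using representatives assms by (simp add: simple_representatives_def)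
  then have LM: "right_module (degree_zero_ring A) (L x)" by (simp add: simple_rmodule_def)
  obtain e l0 where e: "prim_idem A e" "idem_generator A (L x) e l0" using simple_generator[OF semisimple Lx] .
  from induced_iso[OF LM e] show ?thesis by (rule that[OF e(1)])
qed

lemma cell_mod_induced:
  assumes e: "prim_idem A e"
  obtains x where "x \<in> W" "dg_iso A (induced_dgmod A (L x)) (cell_mod e 0)"
proof -
  have ring: "ring (degree_zero_ring A)" using semisimple by (simp add: semisimple_ring_def)
  obtain x l0 where x: "x \<in> W" "idem_generator A (L x) e l0"
    using idem_generator_ex[OF algebra_lepoll ring representatives e] .
  have "right_module (degree_zero_ring A) (L x)"
    using representatives x(1) by (simp add: simple_representatives_def simple_rmodule_def)
  from induced_iso[OF this e x(2)] show ?thesis by (rule that[OF x(1)])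
qed

text \<open>A cell of degree n is a subquotient shifted by l = - n, so ascending degrees of cells
  are descending integers l, as dgFilt demands.\<close>

lemma dgFilt_if_cellular:
  assumes Q: "cellular A M ns" "sorted_wrt (\<ge>) ns" shows "M \<in> dgFilt A W L"
proof -
  have M: "dg_module A M" and ch: "chain A M {\<zero>\<^bsub>M\<^esub>} ns (carrier M)" using Q by (auto simp: cellular_def)
  \<comment> \<open>The extra clause \<open>- l i \<in> set ns\<close> ties the shifts to the
    recorded degrees; without it the induction could not compare a new top cell with all earlier
    ones.\<close>
  define P where "P ns N F l x \<longleftrightarrow> F 0 = {\<zero>\<^bsub>M\<^esub>} \<and> F (length ns) = N \<and> (\<forall>i\<le>length ns. dg_submodule A M (F i)) \<and>
     (\<forall>i\<in>{1..length ns}. F (i - 1) \<subseteq> F i \<and> x i \<in> W \<and> - l i \<in> set ns \<and>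
        dg_iso A (dg_quotient (dg_restrict M (F i)) (F (i - 1))) (dg_shift (l i) (induced_dgmod A (L (x i))))) \<and>
     (\<forall>i\<in>{1..length ns}. \<forall>j\<in>{1..length ns}. i \<le> j \<longrightarrow> l j \<le> l i)" for ns N F and l :: "nat \<Rightarrow> int" and x
  have "\<exists>F l x. P ns N F l x" if "chain A M {\<zero>\<^bsub>M\<^esub>} ns N" "sorted_wrt (\<ge>) ns" for ns N
    using that
  proof (induction rule: chain.induct)
    case chain_nil
    have "P [] {\<zero>\<^bsub>M\<^esub>} (\<lambda>i. {\<zero>\<^bsub>M\<^esub>}) (\<lambda>i. 0) (\<lambda>i. undefined)" using chain_nil by (simp add: P_def)
    then show ?case by blast
  next
    case (chain_cons ns N s e n N')
    then obtain F l x where F: "P ns N F l x" by auto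
    have c: "prim_idem A e" "dg_submodule A M N" "dg_submodule A M N'" "N \<subseteq> N'" using chain_cons.hyps(2) by (auto simp: cell_def)
    obtain y where y: "y \<in> W" "dg_iso A (induced_dgmod A (L y)) (cell_mod e 0)" using cell_mod_induced[OF c(1)] .
    have "dg_iso A (dg_shift (- n) (induced_dgmod A (L y))) (cell_mod e n)"
      using dg_iso_shift[OF y(2), of "- n"] by (simp add: shift_cell_mod)
    then have iso: "dg_iso A (dg_quotient (dg_restrict M N') N) (dg_shift (- n) (induced_dgmod A (L y)))"
      using cell_quotient_iff[OF M c(2-4,1)] chain_cons.hyps(2) dg_iso_sym dg_iso_trans by blast
    let ?m = "Suc (length ns)"
    have cases: "i \<le> length ns \<or> i = ?m" if "i \<le> ?m" for i using that by auto
    have "P (n # ns) N' (F(?m := N')) (l(?m := - n)) (x(?m := y))"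
      unfolding P_def
    proof (intro conjI ballI allI impI)
      show "(F(?m := N')) 0 = {\<zero>\<^bsub>M\<^esub>}" using F by (simp add: P_def)
      show "(F(?m := N')) (length (n # ns)) = N'" by simp
      show "dg_submodule A M ((F(?m := N')) i)" if "i \<le> length (n # ns)" for i
        using that F c(3) cases[of i] by (auto simp: P_def)
      fix i assume i: "i \<in> {1..length (n # ns)}"
      consider "i \<in> {1..length ns}" | "i = ?m" using i by fastforce
      then have "(F(?m := N')) (i - 1) \<subseteq> (F(?m := N')) i \<and> (x(?m := y)) i \<in> W \<and> - (l(?m := - n)) i \<in> set (n # ns) \<and>
        dg_iso A (dg_quotient (dg_restrict M ((F(?m := N')) i)) ((F(?m := N')) (i - 1)))
          (dg_shift ((l(?m := - n)) i) (induced_dgmod A (L ((x(?m := y)) i))))"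
      proof cases
        case 1
        then have "i \<noteq> ?m" "i - 1 \<noteq> ?m" by auto
        then show ?thesis using F 1 unfolding P_def by auto
      next
        case 2
        moreover have "F (length ns) = N" using F by (simp add: P_def)
        ultimately show ?thesis using iso y(1) c(4) by simp
      qed
      then show "(F(?m := N')) (i - 1) \<subseteq> (F(?m := N')) i" "(x(?m := y)) i \<in> W" "- (l(?m := - n)) i \<in> set (n # ns)"
        "dg_iso A (dg_quotient (dg_restrict M ((F(?m := N')) i)) ((F(?m := N')) (i - 1)))
          (dg_shift ((l(?m := - n)) i) (induced_dgmod A (L ((x(?m := y)) i))))" by blast+
      fix j assume j: "j \<in> {1..length (n # ns)}" "i \<le> j"
      consider "j \<in> {1..length ns}" "i \<in> {1..length ns}" | "j = ?m" "i \<in> {1..length ns}" | "j = ?m" "i = ?m"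
        using i j by fastforce
      then show "(l(?m := - n)) j \<le> (l(?m := - n)) i"
      proof cases
        case 1
        then have "i \<noteq> ?m" "j \<noteq> ?m" by auto
        then show ?thesis using F 1 j(2) unfolding P_def by simp
      next
        case 2
        then have "- l i \<in> set ns" using F unfolding P_def by blast
        then have "- l i \<le> n" using chain_cons.prems by simp
        moreover have "i \<noteq> ?m" using 2(2) by auto
        ultimately show ?thesis using 2(1) by simp
      next
        case 3 then show ?thesis by simp
      qed
    qed
    then show ?case by blast
  qed
  then obtain F l x where F: "P ns (carrier M) F l x" using ch Q(2) by blast
  show ?thesis unfolding dgFilt_def
    using M F unfolding P_def by (auto intro!: exI[of _ "length ns"] exI[of _ F] exI[of _ l] exI[of _ x])
qed

lemma cellular_if_dgFilt:
  assumes "M \<in> dgFilt A W L" obtains ns where "cellular A M ns" "sorted_wrt (\<ge>) ns"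
proof -
  have M: "dg_module A M" using assms by (simp add: dgFilt_def)
  obtain n and F :: "nat \<Rightarrow> 'm set" and l and x :: "nat \<Rightarrow> 'x" where *: "F 0 = {\<zero>\<^bsub>M\<^esub>} \<and> F n = carrier M \<and>
      (\<forall>i\<le>n. dg_submodule A M (F i)) \<and>
      (\<forall>i\<in>{1..n}. F (i - 1) \<subseteq> F i \<and> x i \<in> W \<and>
         dg_iso A (dg_quotient (dg_restrict M (F i)) (F (i - 1))) (dg_shift (l i) (induced_dgmod A (L (x i))))) \<and>
      (\<forall>i\<in>{1..n}. \<forall>j\<in>{1..n}. i \<le> j \<longrightarrow> l j \<le> l i)"
    using assms unfolding dgFilt_def mem_Collect_eq by (elim conjE exE) (rule that, intro conjI)
  then have F: "F 0 = {\<zero>\<^bsub>M\<^esub>}" "F n = carrier M" "\<And>i. i \<le> n \<Longrightarrow> dg_submodule A M (F i)" by simp_all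
  have F4: "F (i - 1) \<subseteq> F i \<and> x i \<in> W \<and>
       dg_iso A (dg_quotient (dg_restrict M (F i)) (F (i - 1))) (dg_shift (l i) (induced_dgmod A (L (x i))))"
    if "i \<in> {1..n}" for i using * that by blast
  have F5: "l j \<le> l i" if "i \<in> {1..n}" "j \<in> {1..n}" "i \<le> j" for i j using * that by blast
  \<comment> \<open>The last clause again relates degrees to shifts, here to obtain that the next
    degree dominates the list built so far.\<close>
  have "m \<le> n \<Longrightarrow> \<exists>ns. chain A M {\<zero>\<^bsub>M\<^esub>} ns (F m) \<and> sorted_wrt (\<ge>) ns \<and> (\<forall>p\<in>set ns. \<exists>i\<in>{1..m}. p = - l i)" for m
  proof (induction m)
    case 0
    show ?case using chain_nil[OF dg_submodule_zero[OF M]] F(1) by (intro exI[of _ "[]"]) simp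
  next
    case (Suc m)
    then obtain ns where ns: "chain A M {\<zero>\<^bsub>M\<^esub>} ns (F m)" "sorted_wrt (\<ge>) ns" "\<forall>p\<in>set ns. \<exists>i\<in>{1..m}. p = - l i" by auto
    have i: "Suc m \<in> {1..n}" using Suc.prems by simp
    have f: "F m \<subseteq> F (Suc m)" "x (Suc m) \<in> W"
      "dg_iso A (dg_quotient (dg_restrict M (F (Suc m))) (F m)) (dg_shift (l (Suc m)) (induced_dgmod A (L (x (Suc m)))))"
      using F4[OF i] by simp_all
    obtain e where e: "prim_idem A e" "dg_iso A (induced_dgmod A (L (x (Suc m)))) (cell_mod e 0)" using induced_cell_mod[OF f(2)] .
    have "dg_iso A (dg_quotient (dg_restrict M (F (Suc m))) (F m)) (cell_mod e (- l (Suc m)))"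
      using dg_iso_trans[OF f(3) dg_iso_shift[OF e(2)]] by (simp add: shift_cell_mod)
    then obtain s where "cell A M (F m) s e (- l (Suc m)) (F (Suc m))"
      using cell_quotient_iff[OF M F(3) F(3) f(1) e(1)] Suc.prems by auto
    then have "chain A M {\<zero>\<^bsub>M\<^esub>} (- l (Suc m) # ns) (F (Suc m))" using chain_cons[OF ns(1)] by blast
    moreover have "sorted_wrt (\<ge>) (- l (Suc m) # ns)"
    proof -
      have "p \<le> - l (Suc m)" if p: "p \<in> set ns" for p
      proof -
        obtain i where i': "i \<in> {1..m}" "p = - l i" using ns(3) p by blast
        then have "i \<in> {1..n}" "i \<le> Suc m" using Suc.prems by auto
        then show ?thesis using F5[OF _ i] i'(2) by simp
      qed
      then show ?thesis using ns(2) by simp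
    qed
    moreover have "\<forall>p\<in>set (- l (Suc m) # ns). \<exists>i\<in>{1..Suc m}. p = - l i" using ns(3) by fastforce
    ultimately show ?case by blast
  qed
  from this[of n] show ?thesis using that M F(2) unfolding cellular_def by auto
qed

lemma dgFilt_filtered: "M \<in> dgFilt A W L \<Longrightarrow> filtered M"
  using cellular_if_dgFilt qis_id unfolding filtered_def model_def cellular_def by metis

lemma filtered_dgFilt: "filtered X \<Longrightarrow> \<exists>M\<in>dgFilt A W L. isomorphic_in (dgDer A) M (X :: ('a, 'm) dgmod)"
  using dgFilt_if_cellular qis_isomorphic unfolding filtered_def model_def by blast

section \<open>Identification of dgPrae with the filtered modules\<close>

lemma universe_copy:
  assumes e: "e \<in> agr A 0" "e \<otimes> e = e"
  obtains C :: "('a, 'm) dgmod" where "dg_iso A C (cell_mod e n)"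
proof -
  have "carrier (cell_mod e n) \<subseteq> carrier A" by (auto simp: peirce_def)
  then have "carrier (cell_mod e n) \<lesssim> (UNIV :: 'm set)"
    using subset_imp_lepoll lepoll_trans algebra_lepoll by blast
  then show ?thesis using copy_exists[OF cell_mod_dg_module[OF e]] that by (metis dg_iso_def empty_iff)
qed

text \<open>Attaching a cell along d s is taking the cone of a map from a shifted eA, which is a
  shift of an induced module. A triangulated subcategory containing the induced modules therefore
  follows any chain of cells.\<close>

lemma filtered_in_triangulated:
  fixes S :: "('a, 'm) dgmod set"
  assumes S: "strict_triangulated A S" and ind: "\<And>x M. x \<in> W \<Longrightarrow> dg_iso A M (induced_dgmod A (L x)) \<Longrightarrow> M \<in> S"
    and X: "filtered X"
  shows "X \<in> S"
proof -
  have Sz: "\<And>X. X \<in> Ob (dgDer A) \<Longrightarrow> carrier X = {\<zero>\<^bsub>X\<^esub>} \<Longrightarrow> X \<in> S"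
    and Si: "\<And>X Y. X \<in> S \<Longrightarrow> isomorphic_in (dgDer A) X Y \<Longrightarrow> Y \<in> S"
    and Ss: "\<And>X n. X \<in> S \<Longrightarrow> dg_shift n X \<in> S"
    and Sd: "\<And>X Y Z u v w. distinguished A X Y Z u v w \<Longrightarrow> X \<in> S \<Longrightarrow> Y \<in> S \<Longrightarrow> Z \<in> S"
    using S unfolding strict_triangulated_def by blast+
  \<comment> \<open>Every copy of a shifted eA belongs to the subcategory: the simple module e A^0
    has a representative in \<open>W\<close>, and the shift by - n places the generator in degree
    n.\<close>
  have cm: "C \<in> S" if e: "prim_idem A e" and C: "dg_iso A C (cell_mod e n)" for e n and C :: "('a, 'm) dgmod"
  proof -
    note E = prim_idemD[OF e]
    obtain x where x: "x \<in> W" "dg_iso A (induced_dgmod A (L x)) (cell_mod e 0)" using cell_mod_induced[OF e] .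
    obtain D :: "('a, 'm) dgmod" where D: "dg_iso A D (cell_mod e 0)" using universe_copy[OF E(1,3)] .
    have "D \<in> S" using ind[OF x(1)] dg_iso_trans[OF D dg_iso_sym[OF x(2)]] by blast
    then have "dg_shift (- n) D \<in> S" by (rule Ss)
    moreover have "dg_iso A (dg_shift (- n) D) (cell_mod e n)" using dg_iso_shift[OF D, of "- n"] by (simp add: shift_cell_mod)
    then have "dg_iso A (dg_shift (- n) D) C" using dg_iso_trans dg_iso_sym[OF C] by blast
    ultimately show ?thesis using Si dg_iso_isomorphic by blast
  qed
  have step: "dg_restrict Q N' \<in> S" if c: "cell A Q N s e n N'" and Q: "dg_module A Q" and N: "dg_restrict Q N \<in> S"
    for Q :: "('a, 'm) dgmod" and N s e n N'
  proof -
    interpret C: dg_cell k A Q N s e n N' using dg_cellI[OF c Q] .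
    \<comment> \<open>Degree n + 1, because the cone lowers it to the degree \<open>n\<close> of the
      cell.\<close>
    obtain X' :: "('a, 'm) dgmod" where X': "dg_iso A X' (cell_mod e (n + 1))" using universe_copy[OF C.E(1,3)] .
    obtain \<phi> where \<phi>: "\<phi> \<in> dg_isos A X' (cell_mod e (n + 1))" using X' by (auto simp: dg_iso_def)
    note \<phi>h = dg_isosD(1)[OF \<phi>] and \<phi>b = dg_isosD(2)[OF \<phi>]
    have \<phi>P: "\<phi> b \<in> peirce A e" if "b \<in> carrier X'" for b using dg_homD(3)[OF \<phi>h that] by simp
    let ?N = "dg_restrict Q N" and ?N' = "dg_restrict Q N'"
    have ds: "diff Q s \<in> gr ?N (n + 1)" "diff ?N (diff Q s) = \<zero>\<^bsub>(?N)\<^esub>"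
      using C.s C.M.diff_gr C.M.diff_diff by simp_all
    define f where "f = (\<lambda>b. ract ?N (diff Q s) b) \<circ> \<phi>"
    have f: "f \<in> dg_hom A X' ?N"
      unfolding f_def by (rule dg_hom_comp[OF \<phi>h cell_mod_hom[OF C.E(1,3) C.S(10) ds]])
    let ?D = "dg_cone X' f ?N"
    have X'm: "dg_module A X'" using dg_homD(1)[OF \<phi>h] .
    interpret X': dg_module A X' by fact
    \<comment> \<open>The isomorphism from the cone to \<open>N'\<close>: the first component is
      kept, the second becomes the coefficient of \<open>s\<close>.\<close>
    define \<theta> where "\<theta> = (\<lambda>(y, b). y \<oplus>\<^bsub>Q\<^esub> ract Q s (\<phi> b))"
    have \<theta>: "\<theta> (y, b) = y \<oplus>\<^bsub>Q\<^esub> ract Q s (\<phi> b)" for y b by (simp add: \<theta>_def)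
    have cf: "C.coef (\<theta> (y, b)) = \<phi> b" "C.base (\<theta> (y, b)) = y" if "y \<in> N" "b \<in> carrier X'" for y b
      unfolding \<theta> using C.coef_eqI[OF that(1) \<phi>P[OF that(2)]] by simp_all
    have c1: "y \<in> carrier Q" "\<phi> b \<in> carrier A" "ract Q s (\<phi> b) \<in> carrier Q" "ract Q s (\<phi> b) \<in> N'" "y \<in> N'"
      if "y \<in> N" "b \<in> carrier X'" for y b
      using C.S(3) that C.P(3)[OF \<phi>P[OF that(2)]] C.ract_s_mem C.sub by auto
    have \<theta>h: "\<theta> \<in> dg_hom A ?D ?N'"
    proof (rule dg_homI[OF cone_dg_module[OF f] C.S'(10)])
      fix z assume "z \<in> carrier ?D"
      then obtain y b where z: "z = (y, b)" "y \<in> N" "b \<in> carrier X'" by auto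
      note c = c1[OF z(2,3)]
      show "\<theta> z \<in> carrier ?N'" using C.S'(4)[OF c(5,4)] z(1) by (simp add: \<theta>)
      show "\<theta> (z \<oplus>\<^bsub>(?D)\<^esub> z') = \<theta> z \<oplus>\<^bsub>(?N')\<^esub> \<theta> z'" if z': "z' \<in> carrier ?D" for z'
      proof -
        obtain y' b' where z': "z' = (y', b')" "y' \<in> N" "b' \<in> carrier X'" using z' by auto
        show ?thesis using c c1[OF z'(2,3)] dg_homD(4)[OF \<phi>h z(3) z'(3)]
          by (simp add: z(1) z'(1) \<theta> C.M.act_add_right C.M.a_ac)
      qed
      show "\<theta> (ract ?D z a) = ract ?N' (\<theta> z) a" if "a \<in> carrier A" for a
        using c that dg_homD(5)[OF \<phi>h z(3) that] by (simp add: z(1) \<theta> C.M.act_add_left C.M.act_assoc)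
      show "\<theta> (diff ?D z) = diff ?N' (\<theta> z)"
      proof -
        \<comment> \<open>The minus sign of the cone turns the sign (-1)^(n+1) of the shifted eA
          into the (-1)^n of the Leibniz rule at \<open>s\<close>.\<close>
        have "\<phi> (\<ominus>\<^bsub>X'\<^esub> diff X' b) = \<ominus> diff (cell_mod e (n + 1)) (\<phi> b)"
          using dg_hom_inv[OF \<phi>h X'.diff_closed[OF z(3)]] dg_homD(7)[OF \<phi>h z(3)]
            cell_mod_inv[OF C.E(1,3), of "diff (cell_mod e (n + 1)) (\<phi> b)" "n + 1"]
            dg_homD(3)[OF \<phi>h X'.diff_closed[OF z(3)]] by simp
        also have "\<dots> = koszul A n (adiff A (\<phi> b))"
          using cell_mod_diff[OF C.E(1,3) \<phi>P[OF z(3)]] c(2) koszul_plus_one[of "adiff A (\<phi> b)" n] by simp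
        finally have "\<theta> (diff ?D z) = diff Q y \<oplus>\<^bsub>Q\<^esub> ract Q (diff Q s) (\<phi> b) \<oplus>\<^bsub>Q\<^esub> ract Q s (koszul A n (adiff A (\<phi> b)))"
          by (simp add: z(1) \<theta> f_def)
        also have "\<dots> = diff Q (\<theta> z)" using c by (simp add: z(1) \<theta> C.M.diff_add ract_peirce_diff[OF Q C.s(1)] C.M.a_assoc)
        finally show ?thesis by simp
      qed
    next
      fix i z assume "z \<in> gr ?D i"
      then obtain y b where z: "z = (y, b)" "y \<in> gr Q i" "y \<in> N" "b \<in> gr X' (i + 1)" by auto
      have b: "b \<in> carrier X'" using X'.gr_closed[OF z(4)] .
      have "\<phi> b \<in> agr A (i - n)" using dg_homD(6)[OF \<phi>h z(4)] by simp
      then have "ract Q s (\<phi> b) \<in> gr Q i" using C.M.act_gr[OF C.s(1)] by fastforce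
      then show "\<theta> z \<in> gr ?N' i" using z(1,2) C.M.gr_add C.S'(4)[OF c1(5,4)[OF z(3) b]] by (simp add: \<theta>)
    qed
    have "bij_betw \<theta> (carrier ?D) (carrier ?N')"
    proof (rule bij_betw_imageI)
      show "inj_on \<theta> (carrier ?D)"
      proof (rule inj_onI)
        fix z z' assume zz: "z \<in> carrier ?D" "z' \<in> carrier ?D" "\<theta> z = \<theta> z'"
        obtain y b y' b' where z: "z = (y, b)" "z' = (y', b')" "y \<in> N" "b \<in> carrier X'" "y' \<in> N" "b' \<in> carrier X'"
          using zz(1,2) by auto
        have "\<phi> b = \<phi> b'" "y = y'" using cf[OF z(3,4)] cf[OF z(5,6)] zz(3) z(1,2) by simp_all
        then show "z = z'" using inj_onD[OF bij_betw_imp_inj_on[OF \<phi>b] _ z(4,6)] z(1,2) by simp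
      qed
      show "\<theta> ` carrier ?D = carrier ?N'"
      proof (intro equalityI subsetI)
        show "y \<in> carrier ?N'" if "y \<in> \<theta> ` carrier ?D" for y using that dg_homD(3)[OF \<theta>h] by blast
        fix y assume "y \<in> carrier ?N'"
        then have y: "y \<in> N'" by simp
        note cb = C.coef_base[OF y]
        have "C.coef y \<in> \<phi> ` carrier X'" using \<phi>b cb(1) by (simp add: bij_betw_def)
        then obtain b where b: "b \<in> carrier X'" "\<phi> b = C.coef y" by auto
        have "y = \<theta> (C.base y, b)" using cb(3) b(2) by (simp add: \<theta>)
        then show "y \<in> \<theta> ` carrier ?D" using b(1) cb(2) by simp
      qed
    qed
    then have "\<theta> \<in> dg_isos A ?D ?N'" using \<theta>h unfolding dg_isos_def by blast
    then have "inv_into (carrier ?D) \<theta> \<in> dg_isos A ?N' ?D" by (rule dg_isos_inv)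
    then show ?thesis using Sd distinguished_cone[OF f] cm[OF C.e X'] N by metis
  qed
  obtain ns and Q :: "('a, 'm) dgmod" and q where Q: "cellular A Q ns" "qis A q Q X"
    using X by (auto simp: filtered_def model_def)
  have Qm: "dg_module A Q" and ch: "chain A Q {\<zero>\<^bsub>Q\<^esub>} ns (carrier Q)" using Q(1) by (auto simp: cellular_def)
  have "dg_restrict Q N \<in> S" if "chain A Q {\<zero>\<^bsub>Q\<^esub>} ns N" for ns N
    using that
  proof (induction rule: chain.induct)
    case chain_nil
    show ?case by (rule Sz) (use dg_submoduleD(10)[OF Qm chain_nil] in auto)
  next
    case (chain_cons ns N s e n N')
    then show ?case using step Qm by blast
  qed
  then have "Q \<in> S" using ch dg_restrict_carrier[OF Qm] by metis
  then show ?thesis using Si qis_isomorphic[OF Q(2)] by blast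
qed

lemma filtered_induced:
  assumes "x \<in> W" "dg_iso A M (induced_dgmod A (L x))" shows "filtered M"
proof -
  obtain e where e: "prim_idem A e" "dg_iso A (induced_dgmod A (L x)) (cell_mod e 0)" using induced_cell_mod[OF assms(1)] .
  show ?thesis using filtered_iso[OF filtered_cell_mod[OF e(1)] dg_iso_sym[OF dg_iso_trans[OF assms(2) e(2)]]] .
qed

lemma dgPrae_eq: "dgPrae A W L = {X :: ('a, 'm) dgmod. filtered X}"
proof
  show "dgPrae A W L \<subseteq> {X :: ('a, 'm) dgmod. filtered X}"
    unfolding dgPrae_def using filtered_strict_triangulated filtered_induced by (intro Inter_lower) auto
  show "{X :: ('a, 'm) dgmod. filtered X} \<subseteq> dgPrae A W L"
    unfolding dgPrae_def using filtered_in_triangulated by blast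
qed

text \<open>A is exhausted by the right ideals fA, where f runs through partial sums of a complete
  set of orthogonal primitive idempotents; each further idempotent attaches one cell of degree 0
  with itself as generator.\<close>

lemma filtered_regular: "filtered (regular_dgmod A)"
proof -
  let ?R = "regular_dgmod A"
  from complete_idempotents[OF semisimple] obtain T :: "'a set set" and \<epsilon> where
    "finite T \<and> (\<forall>N\<in>T. prim_idem A (\<epsilon> N)) \<and> (\<forall>N\<in>T. \<forall>N'\<in>T. N \<noteq> N' \<longrightarrow> \<epsilon> N \<otimes> \<epsilon> N' = \<zero>) \<and> finsum A \<epsilon> T = \<one>"
    by (elim exE)
  then have T: "finite T" "\<And>N. N \<in> T \<Longrightarrow> prim_idem A (\<epsilon> N)" "finsum A \<epsilon> T = \<one>"
    "\<And>N N'. N \<in> T \<Longrightarrow> N' \<in> T \<Longrightarrow> N \<noteq> N' \<Longrightarrow> \<epsilon> N \<otimes> \<epsilon> N' = \<zero>" by simp_all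
  note \<epsilon> = prim_idemD[OF T(2)]
  \<comment> \<open>Partial sums stay idempotent only because they remain orthogonal, on both sides,
    to the idempotents still to come; this is carried through the induction.\<close>
  have "F \<subseteq> T \<Longrightarrow> finsum A \<epsilon> F \<in> agr A 0 \<and> finsum A \<epsilon> F \<otimes> finsum A \<epsilon> F = finsum A \<epsilon> F \<and>
      (\<forall>N\<in>T - F. finsum A \<epsilon> F \<otimes> \<epsilon> N = \<zero> \<and> \<epsilon> N \<otimes> finsum A \<epsilon> F = \<zero>) \<and> filtered (dg_restrict ?R (peirce A (finsum A \<epsilon> F)))"
    if "finite F" for F
    using that
  proof (induction F)
    case empty
    have p: "peirce A \<zero> = {\<zero>}" by (auto simp: peirce_def)
    have z: "dg_submodule A ?R {\<zero>}" using dg_submodule_zero[OF regular_dg_module] by simp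
    have "model A U (dg_restrict ?R {\<zero>}) []" by (rule model_zero) (use dg_submoduleD(10)[OF regular_dg_module z] in simp_all)
    then have "filtered (dg_restrict ?R {\<zero>})" by (auto simp: filtered_def)
    then show ?case using \<epsilon> by (simp add: p)
  next
    case (insert N F)
    let ?f = "finsum A \<epsilon> F" and ?e = "\<epsilon> N"
    have NT: "N \<in> T" "N \<in> T - F" using insert by auto
    have IH: "?f \<in> agr A 0" "?f \<otimes> ?f = ?f" "?f \<otimes> ?e = \<zero>" "?e \<otimes> ?f = \<zero>" "filtered (dg_restrict ?R (peirce A ?f))"
      "\<And>M. M \<in> T - F \<Longrightarrow> ?f \<otimes> \<epsilon> M = \<zero> \<and> \<epsilon> M \<otimes> ?f = \<zero>"
      using insert NT by auto
    note E = \<epsilon>[OF NT(1)]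
    have fc: "?f \<in> carrier A" using IH(1) by simp
    have "\<epsilon> \<in> F \<rightarrow> carrier A" "?e \<in> carrier A" using insert.prems \<epsilon>(2) by auto
    then have sum: "finsum A \<epsilon> (insert N F) = ?e \<oplus> ?f" using insert.hyps by simp
    let ?g = "?e \<oplus> ?f"
    have g: "?g \<in> agr A 0" "?g \<otimes> ?g = ?g" using E IH fc by (simp_all add: agr0_add l_distr r_distr)
    have orth: "?g \<otimes> \<epsilon> M = \<zero>" "\<epsilon> M \<otimes> ?g = \<zero>" if M: "M \<in> T - insert N F" for M
    proof -
      have "M \<in> T" "M \<noteq> N" "M \<in> T - F" using M by auto
      then have "?f \<otimes> \<epsilon> M = \<zero>" "\<epsilon> M \<otimes> ?f = \<zero>" "?e \<otimes> \<epsilon> M = \<zero>" "\<epsilon> M \<otimes> ?e = \<zero>" "\<epsilon> M \<in> carrier A"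
        using IH(6) T(4) NT \<epsilon>(2) by auto
      then show "?g \<otimes> \<epsilon> M = \<zero>" "\<epsilon> M \<otimes> ?g = \<zero>" using E fc by (simp_all add: l_distr r_distr)
    qed
    note Pf = peirce_closed[OF IH(1,2)] and Pg = peirce_closed[OF g] and Pe = peirce_closed[OF E(1,3)]
    have ef: "?e \<otimes> y = \<zero>" if "y \<in> peirce A ?f" for y
    proof -
      have "?e \<otimes> y = ?e \<otimes> (?f \<otimes> y)" using Pf(4)[OF that] by simp
      also have "\<dots> = ?e \<otimes> ?f \<otimes> y" using E fc Pf(3)[OF that] by (simp only: m_assoc)
      finally show ?thesis using IH(4) Pf(3)[OF that] by simp
    qed
    have fe: "?f \<otimes> y = \<zero>" if "y \<in> peirce A ?e" for y
    proof -
      have "?f \<otimes> y = ?f \<otimes> (?e \<otimes> y)" using Pe(4)[OF that] by simp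
      also have "\<dots> = ?f \<otimes> ?e \<otimes> y" using E fc Pe(3)[OF that] by (simp only: m_assoc)
      finally show ?thesis using IH(3) Pe(3)[OF that] by simp
    qed
    have "cell A ?R (peirce A ?f) ?e ?e 0 (peirce A ?g)"
      unfolding cell_def
    proof (intro conjI ballI impI)
      show "peirce A ?f \<subseteq> peirce A ?g"
      proof
        fix y assume y: "y \<in> peirce A ?f"
        then show "y \<in> peirce A ?g" using ef[OF y] Pf(3,4)[OF y] E fc by (simp add: peirce_def l_distr)
      qed
      show "?e \<in> peirce A ?g" using E IH fc by (simp add: peirce_def l_distr)
      show "diff ?R ?e \<in> peirce A ?f" using diff_agr0[OF E(1)] Pf(1) by simp
      show "\<exists>x\<in>peirce A ?f. \<exists>b\<in>peirce A ?e. y = x \<oplus>\<^bsub>(?R)\<^esub> ract ?R ?e b" if y: "y \<in> peirce A ?g" for y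
      proof -
        have yc: "y \<in> carrier A" using Pg(3)[OF y] .
        have "y = ?f \<otimes> y \<oplus> ?e \<otimes> y" using Pg(4)[OF y] yc E fc by (simp add: l_distr a_comm)
        also have "?e \<otimes> y = ?e \<otimes> (?e \<otimes> y)" using yc E by (simp flip: m_assoc)
        finally show ?thesis using Pf(5)[OF yc] Pe(5)[OF yc] by auto
      qed
      show "b = \<zero>" if b: "b \<in> peirce A ?e" "ract ?R ?e b \<in> peirce A ?f" for b
      proof -
        have "b \<in> peirce A ?f" using b Pe(4)[OF b(1)] by simp
        then show ?thesis using ef[of b] Pe(4)[OF b(1)] by simp
      qed
    qed (use T(2)[OF NT(1)] E peirce_submodule[OF IH(1,2)] peirce_submodule[OF g] in auto)
    then have "filtered (dg_restrict ?R (peirce A ?g))" using filtered_cell[OF IH(5)] regular_dg_module by blast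
    then show ?case unfolding sum using g orth by blast
  qed
  from this[OF T(1) order_refl] have "filtered (dg_restrict ?R (peirce A \<one>))" unfolding T(3) by blast
  moreover have "peirce A \<one> = carrier ?R" by (auto simp: peirce_def)
  ultimately show ?thesis using dg_restrict_carrier[OF regular_dg_module] by simp
qed

section \<open>Identification of dgPer and the equivalence with dgFilt\<close>

lemma dgPer_subset: "dgPer A \<subseteq> {X :: ('a, 'm) dgmod. filtered X}"
  unfolding dgPer_def
  by (intro Inter_lower CollectI conjI filtered_strict_triangulated filtered_summand_closed allI impI
      filtered_iso[OF filtered_regular dg_iso_sym])

text \<open>The Peirce decomposition of A for \<open>e\<close>. It is a decomposition of dg modules,
  since both \<open>e\<close> and 1 - e are cycles of degree 0.\<close>

lemma regular_decomposition:
  assumes e: "e \<in> agr A 0" "e \<otimes> e = e"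
  shows "dg_iso A (dg_sum (cell_mod e 0) (cell_mod (\<one> \<ominus> e) 0)) (regular_dgmod A)"
proof -
  let ?f = "\<one> \<ominus> e"
  have ec: "e \<in> carrier A" using e by simp
  have f: "?f \<in> agr A 0" "?f \<otimes> ?f = ?f" "?f \<in> carrier A"
    using e ec one_gr agr0_add agr0_inv by (simp_all add: a_minus_def l_distr r_distr l_minus r_minus r_neg)
  note Pe = peirce_closed[OF e] and Pf = peirce_closed[OF f(1,2)]
  let ?S = "dg_sum (cell_mod e 0) (cell_mod ?f 0)"
  define \<phi> where "\<phi> = (\<lambda>(a, b). a \<oplus> b)"
  have \<phi>: "\<phi> (a, b) = a \<oplus> b" for a b by (simp add: \<phi>_def)
  have fa: "?f \<otimes> a = a \<ominus> e \<otimes> a" if "a \<in> carrier A" for a using that ec by (simp add: a_minus_def l_distr l_minus)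
  have eb: "e \<otimes> b = \<zero>" if b: "b \<in> peirce A ?f" for b
  proof -
    have bc: "b \<in> carrier A" using Pf(3)[OF b] .
    have "b = b \<ominus> e \<otimes> b" using fa[OF bc] Pf(4)[OF b] by simp
    then have "e \<otimes> b = b \<ominus> b" using bc ec by (metis a_comm a_minus_def add.inv_closed l_neg m_closed minus_equality minus_minus r_neg add.inv_solve_right' local.minus_eq r_zero zero_closed)
    then show ?thesis using bc by (simp add: a_minus_def r_neg)
  qed
  have "\<phi> \<in> dg_hom A ?S (regular_dgmod A)"
  proof (rule dg_homI[OF sum_dg_module[OF cell_mod_dg_module[OF e] cell_mod_dg_module[OF f(1,2)]] regular_dg_module])
    fix z assume "z \<in> carrier ?S"
    then obtain a b where z: "z = (a, b)" "a \<in> peirce A e" "b \<in> peirce A ?f" by auto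
    note c = Pe(3)[OF z(2)] Pf(3)[OF z(3)]
    show "\<phi> z \<in> carrier (regular_dgmod A)" using z c by (simp add: \<phi>)
    show "\<phi> (z \<oplus>\<^bsub>(?S)\<^esub> z') = \<phi> z \<oplus>\<^bsub>(regular_dgmod A)\<^esub> \<phi> z'" if "z' \<in> carrier ?S" for z'
      using that z c Pe(3) Pf(3) by (auto simp: \<phi> a_ac)
    show "\<phi> (ract ?S z r) = ract (regular_dgmod A) (\<phi> z) r" if "r \<in> carrier A" for r
      using that z c by (simp add: \<phi> l_distr)
    show "\<phi> (diff ?S z) = diff (regular_dgmod A) (\<phi> z)"
      using z c by (simp add: \<phi> cell_mod_diff[OF e] cell_mod_diff[OF f(1,2)] koszul_def diff_add)
  next
    fix i z assume "z \<in> gr ?S i"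
    then show "\<phi> z \<in> gr (regular_dgmod A) i" using pj_F_add[OF apr] by (auto simp: \<phi>)
  qed
  moreover have "bij_betw \<phi> (carrier ?S) (carrier (regular_dgmod A))"
  proof (rule bij_betw_byWitness[of _ "\<lambda>x. (e \<otimes> x, ?f \<otimes> x)"])
    show "\<forall>z\<in>carrier ?S. (e \<otimes> \<phi> z, ?f \<otimes> \<phi> z) = z"
    proof
      fix z assume "z \<in> carrier ?S"
      then obtain a b where z: "z = (a, b)" "a \<in> peirce A e" "b \<in> peirce A ?f" by auto
      note c = Pe(3)[OF z(2)] Pf(3)[OF z(3)]
      have 1: "e \<otimes> (a \<oplus> b) = a" using c ec eb[OF z(3)] Pe(4)[OF z(2)] by (simp add: r_distr)
      have "?f \<otimes> (a \<oplus> b) = (a \<oplus> b) \<ominus> a" unfolding fa[OF a_closed[OF c]] 1 ..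
      also have "\<dots> = b" using c by algebra
      finally have "?f \<otimes> (a \<oplus> b) = b" .
      then show "(e \<otimes> \<phi> z, ?f \<otimes> \<phi> z) = z" using 1 z(1) by (simp add: \<phi>)
    qed
    show "\<forall>x\<in>carrier (regular_dgmod A). \<phi> (e \<otimes> x, ?f \<otimes> x) = x"
    proof
      fix x assume "x \<in> carrier (regular_dgmod A)"
      then have x: "x \<in> carrier A" "e \<otimes> x \<in> carrier A" using ec by simp_all
      show "\<phi> (e \<otimes> x, ?f \<otimes> x) = x" unfolding \<phi> fa[OF x(1)] using x by algebra
    qed
    show "\<phi> ` carrier ?S \<subseteq> carrier (regular_dgmod A)" using Pe(3) Pf(3) by (auto simp: \<phi>)
    show "(\<lambda>x. (e \<otimes> x, ?f \<otimes> x)) ` carrier (regular_dgmod A) \<subseteq> carrier ?S" using Pe(5) Pf(5) by auto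
  qed
  ultimately show ?thesis unfolding dg_iso_def dg_isos_def by blast
qed

lemma dg_iso_sum:
  assumes "dg_iso A X X'" "dg_iso A Y Y'" shows "dg_iso A (dg_sum X Y) (dg_sum X' Y')"
proof -
  obtain f g where f: "f \<in> dg_isos A X X'" and g: "g \<in> dg_isos A Y Y'" using assms by (auto simp: dg_iso_def)
  note fh = dg_isosD(1)[OF f] and gh = dg_isosD(1)[OF g]
  have "map_prod f g \<in> dg_hom A (dg_sum X Y) (dg_sum X' Y')"
    by (rule dg_homI[OF sum_dg_module[OF dg_homD(1)[OF fh] dg_homD(1)[OF gh]] sum_dg_module[OF dg_homD(2)[OF fh] dg_homD(2)[OF gh]]])
      (auto simp: dg_homD(3-7)[OF fh] dg_homD(3-7)[OF gh])
  moreover have "bij_betw (map_prod f g) (carrier (dg_sum X Y)) (carrier (dg_sum X' Y'))"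
    using dg_isosD(2)[OF f] dg_isosD(2)[OF g] by (simp add: bij_betw_map_prod)
  ultimately show ?thesis unfolding dg_iso_def dg_isos_def by blast
qed

text \<open>Up to isomorphism the induced module is eA, a direct summand of A with complement (1 -
  e)A. Copies of A and of the complement in the universe are chosen because
  \<open>direct_summand\<close> refers to modules on \<open>'m\<close>.\<close>

lemma induced_in_summand_closed:
  fixes M :: "('a, 'm) dgmod"
  assumes x: "x \<in> W" and M: "dg_iso A M (induced_dgmod A (L x))"
    and S: "summand_closed A S" and reg: "\<And>N :: ('a, 'm) dgmod. dg_iso A N (regular_dgmod A) \<Longrightarrow> N \<in> S"
  shows "M \<in> S"
proof -
  obtain e where e: "prim_idem A e" "dg_iso A (induced_dgmod A (L x)) (cell_mod e 0)" using induced_cell_mod[OF x] .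
  note E = prim_idemD[OF e(1)]
  have f: "\<one> \<ominus> e \<in> agr A 0" "(\<one> \<ominus> e) \<otimes> (\<one> \<ominus> e) = \<one> \<ominus> e"
    using E one_gr agr0_add agr0_inv by (simp_all add: a_minus_def l_distr r_distr l_minus r_minus r_neg)
  obtain Y :: "('a, 'm) dgmod" where Y: "dg_iso A Y (cell_mod (\<one> \<ominus> e) 0)" using universe_copy[OF f] .
  obtain R :: "('a, 'm) dgmod" where R: "dg_iso A R (regular_dgmod A)"
    using copy_exists[OF regular_dg_module] algebra_lepoll by (metis dg_iso_def empty_iff regular_sel(1))
  have "dg_iso A (dg_sum M Y) (regular_dgmod A)"
    using dg_iso_trans[OF dg_iso_sum[OF dg_iso_trans[OF M e(2)] Y] regular_decomposition[OF E(1,3)]] .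
  then have RM: "dg_iso A R (dg_sum M Y)" using dg_iso_trans[OF R dg_iso_sym] by blast
  then obtain \<phi> where \<phi>: "\<phi> \<in> dg_isos A R (dg_sum M Y)" by (auto simp: dg_iso_def)
  have Rm: "dg_module A R" using dg_homD(1)[OF dg_isosD(1)[OF \<phi>]] .
  obtain \<psi> where "\<psi> \<in> dg_isos A M (induced_dgmod A (L x))" using M by (auto simp: dg_iso_def)
  then have "dg_module A M" using dg_homD(1)[OF dg_isosD(1)] by blast
  then have Mo: "M \<in> Ob (dgDer A)" by simp
  have "direct_summand A M R" unfolding direct_summand_def using RM isomorphic_refl[OF Rm] by blast
  then show ?thesis using S Mo reg[OF R] unfolding summand_closed_def by blast
qed

lemma dgPer_eq: "dgPer A = {X :: ('a, 'm) dgmod. filtered X}"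
proof
  show "{X :: ('a, 'm) dgmod. filtered X} \<subseteq> dgPer A"
    unfolding dgPer_def using filtered_in_triangulated induced_in_summand_closed by blast
qed (rule dgPer_subset)

text \<open>Essential surjectivity is the existence of sorted models; a morphism is a triple that
  records its endpoints, which supplies source and target for the quasi-inverse.\<close>

lemma dgFilt_equivalence:
  "equivalence_functor (full_subcat (dgDer A) (dgFilt A W L))
     (full_subcat (dgDer A) (dgPer A :: ('a, 'm) dgmod set)) (\<lambda>M. M) (\<lambda>f. f)"
proof (rule full_subcat_equivalence[where src = fst and tgt = "\<lambda>f. fst (snd f)"])
  show "category (dgDer A :: (('a, 'm) dgmod, ('a, 'm) dmor) cat)" by (rule dgDer_category)
  show "dgFilt A W L \<subseteq> dgPer A" unfolding dgPer_eq using dgFilt_filtered by blast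
  show "(dgPer A :: ('a, 'm) dgmod set) \<subseteq> Ob (dgDer A)" unfolding dgPer_eq using filtered_module by auto
  show "\<exists>X\<in>dgFilt A W L. isomorphic_in (dgDer A) X Y" if "Y \<in> dgPer A" for Y
    using filtered_dgFilt that unfolding dgPer_eq by blast
  show "fst f = X \<and> fst (snd f) = Y" if "f \<in> Hom (dgDer A) X Y" for X Y :: "('a, 'm) dgmod" and f
    using that unfolding dgDer_sel zz_class_def by auto
qed

end

theorem theorem1:
  fixes k :: "('k, 'e) ring_scheme" and A :: "('k, 'a, 'f) dga_scheme"
    and W :: "'x set" and L :: "'x \<Rightarrow> ('a, 'm) rmod"
  assumes universe: "infinite (UNIV :: 'm set)" "carrier A \<lesssim> (UNIV :: 'm set)"
    and dga: "dg_algebra k A"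
    and P1: "\<And>i. i < 0 \<Longrightarrow> agr A i = {\<zero>\<^bsub>A\<^esub>}"
    and P2: "semisimple_ring (degree_zero_ring A)"
    and P3: "\<And>a. a \<in> agr A 0 \<Longrightarrow> adiff A a = \<zero>\<^bsub>A\<^esub>"
    and L: "simple_representatives (degree_zero_ring A) W L"
  shows "(summand_closed A (dgPrae A W L) \<and> dgPrae A W L = dgPer A) \<and>
    equivalence_functor
      (full_subcat (dgDer A) (dgFilt A W L))
      (full_subcat (dgDer A) (dgPer A :: ('a, 'm) dgmod set))
      (\<lambda>M. M) (\<lambda>f. f)"
proof -
  interpret dg_semisimple k A "TYPE('m)" W L
    using assms
    by (intro dg_semisimple.intro dg_universe.intro pos_dga.intro pos_dga_axioms.intro
        dg_universe_axioms.intro dg_semisimple_axioms.intro)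
  show ?thesis
    using filtered_summand_closed dgFilt_equivalence unfolding dgPrae_eq dgPer_eq by blast
qed

end
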